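(* (i) If $\Phi$ is a ray (starting at the origin) in $\mathcal{D}$, then the convolution equation has a unique solution in $L^1_{loc}(\Phi)$, namely $\mathbf{Y}_0=\mathcal{B}\tilde{\mathbf{y}}_0$. (ii) For any ray $\Phi$ in $\mathcal{W}_1$, the system consisting of the convolution equation (for $k=0$) and the convolution hierarchy (for $k\ge1$) has in $L^1_{loc}(\Phi)$ the general solution $C^k\mathbf{Y}_k=C^k\mathcal{B}\tilde{\mathbf{y}}_k$, $k\ge0$, with $C\in\mathbb{C}$ arbitrary.
   Context: Differential system. Consider, near $x=\infty$, $$\mathbf{y}'=\mathbf{f}_0(x)-\hat\Lambda\mathbf{y}-\tfrac1x\hat B\mathbf{y}+\mathbf{g}(x,\mathbf{y}),\qquad \mathbf{y}\in\mathbb{C}^n,$$ where $\xi\mapsto\mathbf{f}_0(\xi^{-1})$ and $(\xi,\mathbf{y})\mapsto\mathbf{g}(\xi^{-1},\mathbf{y})$ are analytic for small arguments, $\mathbf{f}_0(x)=O(x^{-2})$ and $\mathbf{g}(x,\mathbf{y})=O(|\mathbf{y}|^2,x^{-2}\mathbf{y})$. The constant matrices $\hat\Lambda=\mathrm{diag}(\lambda_1,\dots,\lambda_n)$ and $\hat B$ are diagonal, all $\lambda_j\ne0$, $\lambda_1=1$, $0=\arg\lambda_1<\arg\lambda_2<\dots<\arg\lambda_n<2\pi$, and $\beta:=\hat B_{1,1}$ satisfies $\Re\beta\in(0,1]$. Write $\mathbf{g}(\xi^{-1},\mathbf{y})=\sum_{m\ge0,|\mathbf{l}|\ge1}\mathbf{g}_{m,\mathbf{l}}\xi^m\mathbf{y}^{\mathbf{l}}$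 (multi-indices $\mathbf{l}$), with $\mathbf{g}_{0,\mathbf{l}}=\mathbf{g}_{1,\mathbf{l}}=0$ if $|\mathbf{l}|=1$, and $\mathbf{f}_0=\sum_{m\ge2}\mathbf{f}_{0,m}x^{-m}$. Trans-series. $\tilde{\mathbf{y}}_0=\sum_{m\ge2}\tilde{\mathbf{y}}_{0,m}x^{-m}$ is the unique formal power series solution; the formal solutions decaying in $\Re x>0$ are $\tilde{\mathbf{y}}_0+\sum_{k\ge1}C^ke^{-kx}\tilde{\mathbf{y}}_k$, with formal series $\tilde{\mathbf{y}}_k=x^{-k\beta}\sum_{m\ge0}\tilde{\mathbf{y}}_{k,m}x^{-m}$ obtained by substituting into the differential system and equating coefficients of $e^{-kx}$, and uniquely determined by requiring that the first component of the leading coefficient of $\tilde{\mathbf{y}}_1$ be $1$. $\mathcal{B}$ is the Borel transform (termwise inverse Laplace transform) $\mathcal{B}x^{-s}=p^{s-1}/\Gamma(s)$; the resulting series is identified with the analytic function it generates, continued along the ray. Convolution equation. $(f*g)(p)=\int_0^pf(s)g(p-s)\,ds$; $\mathbf{Y}^{*\mathbf{l}}=Y_1^{*l_1}*\cdots*Y_n^{*l_n}$; $\mathbf{F}_0(p)=\sum_{m\ge2}\mathbf{f}_{0,m}p^{m-1}/(m-1)!$; $\mathbf{G}_{\mathbf{l}}(p)=\sum_{m\ge1}\mathbf{g}_{m,\mathbf{l}}p^{m-1}/(m-1)!$; $$\mathcal{N}(\mathbf{Y})=\sum_{|\mathbf{l}|\ge1}\mathbf{G}_{\mathbf{l}}*\mathbf{Y}^{*\mathbf{l}}+\sum_{|\mathbf{l}|\ge2}\mathbf{g}_{0,\mathbf{l}}\mathbf{Y}^{*\mathbf{l}}.$$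 The convolution equation for $\mathbf{Y}=\mathbf{Y}_0$ is $$-p\mathbf{Y}(p)=\mathbf{F}_0(p)-\hat\Lambda\mathbf{Y}(p)-\hat B\int_0^p\mathbf{Y}(s)\,ds+\mathcal{N}(\mathbf{Y})(p).$$ Convolution hierarchy ($k\ge1$): $$(\hat\Lambda-p-k)\mathbf{Y}_k(p)+\hat B\int_0^p\mathbf{Y}_k(s)\,ds-\sum_{j=1}^n\int_0^p(\mathbf{Y}_k)_j(s)\mathbf{d}_j(p-s)\,ds=\sum_{|\mathbf{l}|>1}\mathbf{d}_{\mathbf{l}}*\sum_{\Sigma m=k}{}^{*}\!\prod_{i=1}^n{}^{*}\!\prod_{j=1}^{l_i}(\mathbf{Y}_{m_{i,j}})_i,$$ where ${}^*\!\prod$ is convolution product, the inner sum is over integers $m_{i,j}\ge1$ ($1\le i\le n$, $1\le j\le l_i$) with total sum $k$, and $\mathbf{d}_{\mathbf{m}}=\mathcal{L}^{-1}(\mathbf{g}^{(\mathbf{m})}(x,\mathbf{y}_0)/\mathbf{m}!)$, $\mathbf{d}_j=\mathcal{L}^{-1}(\partial\mathbf{g}(x,\mathbf{y}_0)/\partial y_j)$, i.e. $\mathbf{d}_{\mathbf{m}}=\sum_{\mathbf{l}\ge\mathbf{m}}\binom{\mathbf{l}}{\mathbf{m}}\big(\mathbf{G}_{\mathbf{l}}*\mathbf{Y}_0^{*(\mathbf{l}-\mathbf{m})}+\mathbf{g}_{0,\mathbf{l}}\mathbf{Y}_0^{*(\mathbf{l}-\mathbf{m})}\big)$ with $\mathbf{Y}_0^{*\mathbf{0}}$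 the convolution identity (Dirac delta at $0$), and $\mathbf{d}_j=\mathbf{d}_{\mathbf{e}_j}$, $\mathbf{e}_j$ the $j$-th unit multi-index. Domains. $\mathcal{D}:=\mathbb{C}\setminus\bigcup_{i=1}^n\{\alpha\lambda_i:\alpha\ge1\}$; with $\phi_+=\arg\lambda_2$, $\phi_-=2\pi-\arg\lambda_n$, $\mathcal{W}_1:=\{p:\ p\notin\mathbb{N}\cup\{0\},\ \arg p\in(-\phi_-,\phi_+)\}$ (no condition on $\arg p$ if $n=1$). A ray in $\mathcal{W}_1$ is one whose points other than the origin lie in $\mathcal{W}_1$.
   Formalization: In (ii) the ray is also assumed to contain no nonzero point λ_j − k (k ≥ 1); otherwise the claim can fail, e.g. n=1, f_0=g=0 on the negative axis, where the k=2 equation has the extra solution (t−1)^{β−1} for p=−t, t>1 (zero for t<1). *)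

theory Defs
  imports "HOL-Analysis.Analysis"
begin

text \<open>
  Components are indexed by a finite linearly ordered type \<open>'n\<close>; the index 1 is \<open>Min UNIV\<close>, the
  index \<open>n\<close> is \<open>Max UNIV\<close>. The diagonal matrices are given by their diagonals \<open>lam\<close>, \<open>b\<close>.
  A multi-index is a function \<open>'n \<Rightarrow> nat\<close>; \<open>\<le>\<close> on multi-indices is the pointwise order.
\<close>

type_synonym 'n cvec = "(complex, 'n) vec"

definition ix1 :: "'n::{finite,linorder}"
  where "ix1 = Min UNIV"

definition msize :: "('n::finite \<Rightarrow> nat) \<Rightarrow> nat"
  where "msize l = (\<Sum>i\<in>UNIV. l i)"

definition mbinom :: "('n::finite \<Rightarrow> nat) \<Rightarrow> ('n \<Rightarrow> nat) \<Rightarrow> nat"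
  where "mbinom l m = (\<Prod>i\<in>UNIV. l i choose m i)"

definition munit :: "'n \<Rightarrow> 'n \<Rightarrow> nat"
  where "munit j = (\<lambda>i. if i = j then 1 else 0)"


section \<open>The differential system\<close>

text \<open>
  \<open>fc m\<close> and \<open>gc m l\<close> are the Taylor coefficients at 0 of \<open>\<xi> \<mapsto> f0 (1/\<xi>)\<close> and
  \<open>(\<xi>, y) \<mapsto> g (1/\<xi>) y\<close>. Since \<open>inverse 0 = 0\<close>, the point \<open>\<xi> = 0\<close> is left out of the
  expansions: there the functions are meant to be extended analytically. The order conditions
  \<open>f0 = O(x^(-2))\<close> and \<open>g = O(|y|^2, x^(-2) y)\<close> are the vanishing conditions on the coefficients.
\<close>

definition normal_form ::
  "'n::{finite,linorder} cvec \<Rightarrow> 'n cvec \<Rightarrow>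
   (complex \<Rightarrow> 'n cvec) \<Rightarrow> (nat \<Rightarrow> 'n cvec) \<Rightarrow>
   (complex \<Rightarrow> 'n cvec \<Rightarrow> 'n cvec) \<Rightarrow> (nat \<Rightarrow> ('n \<Rightarrow> nat) \<Rightarrow> 'n cvec) \<Rightarrow> bool"
  where "normal_form lam b f0 fc g gc \<longleftrightarrow>
    (\<exists>r>0. \<forall>\<xi>. 0 < cmod \<xi> \<and> cmod \<xi> < r \<longrightarrow>
       ((\<lambda>m. \<xi>^m *s fc m) has_sum f0 (inverse \<xi>)) UNIV) \<and>
    (\<exists>r>0. \<forall>\<xi> y. 0 < cmod \<xi> \<and> cmod \<xi> < r \<and> norm y < r \<longrightarrow>
       ((\<lambda>(m, l). (\<xi>^m * (\<Prod>i\<in>UNIV. (y $ i)^(l i))) *s gc m l) has_sum g (inverse \<xi>) y) UNIV) \<and>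
    (\<forall>m<2. fc m = 0) \<and>
    (\<forall>m l. msize l = 0 \<longrightarrow> gc m l = 0) \<and>
    (\<forall>l. msize l = 1 \<longrightarrow> gc 0 l = 0 \<and> gc 1 l = 0) \<and>
    (\<forall>i. lam $ i \<noteq> 0) \<and> lam $ ix1 = 1 \<and>
    (\<forall>i j. i < j \<longrightarrow> Arg2pi (lam $ i) < Arg2pi (lam $ j)) \<and>
    0 < Re (b $ ix1) \<and> Re (b $ ix1) \<le> 1"


section \<open>The formal trans-series\<close>

text \<open>
  A trans-series \<open>\<Sum>k. exp (-k x) x^(-k \<beta>) (\<Sum>m. y_(k,m) x^(-m))\<close> is encoded, componentwise, as
  a formal power series in \<open>\<zeta> = exp (-x) x^(-\<beta>)\<close> (outer) over formal power series in \<open>\<xi> = 1/x\<close>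
  (inner), so \<open>y_(k,m)\<close> is \<open>fps_nth (fps_nth (y i) k) m\<close> in component \<open>i\<close>. Differentiation in \<open>x\<close>
  acts by \<open>\<xi>' = -\<xi>^2\<close> and \<open>\<zeta>' = -\<zeta> - \<beta> \<xi> \<zeta>\<close>.
\<close>

definition ts_deriv :: "complex \<Rightarrow> nat \<Rightarrow> complex fps \<Rightarrow> complex fps"
  where "ts_deriv \<beta> k w =
    - fps_const (of_nat k) * w - fps_const (of_nat k * \<beta>) * fps_X * w - fps_X^2 * fps_deriv w"

text \<open>
  The coefficient of \<open>\<zeta>^k\<close> in component \<open>i\<close> of \<open>g(x, y)\<close>. When \<open>y_(0,0) = y_(0,1) = 0\<close> only finitely
  many terms of each infinite sum are nonzero.
\<close>

definition ts_g ::
  "(nat \<Rightarrow> ('n::finite \<Rightarrow> nat) \<Rightarrow> 'n cvec) \<Rightarrow> ('n \<Rightarrow> complex fps fps) \<Rightarrow> nat \<Rightarrow> 'n \<Rightarrow> complex fps"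
  where "ts_g gc y k i = Abs_fps (\<lambda>N.
    \<Sum>\<^sub>\<infinity>(m, l)\<in>{(m, l). m \<le> N \<and> msize l \<ge> 1}.
      gc m l $ i * fps_nth (fps_nth (\<Prod>j\<in>UNIV. y j ^ l j) k) (N - m))"

definition transseries ::
  "'n::{finite,linorder} cvec \<Rightarrow> 'n cvec \<Rightarrow> (nat \<Rightarrow> 'n cvec) \<Rightarrow>
   (nat \<Rightarrow> ('n \<Rightarrow> nat) \<Rightarrow> 'n cvec) \<Rightarrow> ('n \<Rightarrow> complex fps fps) \<Rightarrow> bool"
  where "transseries lam b fc gc y \<longleftrightarrow>
    (\<forall>i. \<forall>m<2. fps_nth (fps_nth (y i) 0) m = 0) \<and>
    (\<forall>k i. ts_deriv (b $ ix1) k (fps_nth (y i) k) =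
       (if k = 0 then Abs_fps (\<lambda>m. fc m $ i) else 0)
       - fps_const (lam $ i) * fps_nth (y i) k
       - fps_const (b $ i) * fps_X * fps_nth (y i) k
       + ts_g gc y k i) \<and>
    fps_nth (fps_nth (y ix1) 1) 0 = 1"

definition ts_coeff :: "('n::finite \<Rightarrow> complex fps fps) \<Rightarrow> nat \<Rightarrow> nat \<Rightarrow> 'n cvec"
  where "ts_coeff y k m = (\<chi> i. fps_nth (fps_nth (y i) k) m)"


section \<open>Rays, local integrability, Borel transform\<close>

definition ray :: "real \<Rightarrow> complex set"
  where "ray \<theta> = {of_real t * cis \<theta> | t. t \<ge> 0}"

definition AE_ray :: "real \<Rightarrow> (complex \<Rightarrow> bool) \<Rightarrow> bool"
  where "AE_ray \<theta> P \<longleftrightarrow> (AE t in lebesgue. t \<ge> 0 \<longrightarrow> P (of_real t * cis \<theta>))"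

definition L1loc :: "real \<Rightarrow> (complex \<Rightarrow> 'n::finite cvec) \<Rightarrow> bool"
  where "L1loc \<theta> Y \<longleftrightarrow> (\<forall>T. set_integrable lebesgue {0..T} (\<lambda>t. Y (of_real t * cis \<theta>)))"

text \<open>The power \<open>p^s\<close> for \<open>p \<noteq> 0\<close> on \<open>ray \<theta>\<close>, with the determination \<open>arg p = \<theta>\<close>. Adding
  \<open>2 \<pi> j\<close> to \<open>\<theta>\<close> multiplies \<open>p^(k \<beta> - 1)\<close> by \<open>exp (2 \<pi> i j \<beta>)^k\<close>, so that the family of sequences
  \<open>C^k Y_k\<close>, \<open>C\<close> arbitrary, depends only on the ray.\<close>

definition ray_power :: "real \<Rightarrow> complex \<Rightarrow> complex \<Rightarrow> complex"
  where "ray_power \<theta> s p = exp (s * Complex (ln (cmod p)) \<theta>)"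

text \<open>
  \<open>Y\<close> is, on \<open>ray \<theta>\<close>, the Borel transform of \<open>x^(-s) (\<Sum>m. a m x^(-m))\<close>: termwise this is
  \<open>p^(s-1) (\<Sum>m. a m p^m / Gamma (s+m))\<close>, the power series being convergent near 0 with a sum \<open>A\<close>
  that continues analytically along the ray. For \<open>s = 0\<close> the series used below have
  \<open>a 0 = a 1 = 0\<close>, and \<open>p^(-1) A\<close> is analytic at 0.
\<close>

definition borel_along ::
  "real \<Rightarrow> complex \<Rightarrow> (nat \<Rightarrow> 'n::finite cvec) \<Rightarrow> (complex \<Rightarrow> 'n cvec) \<Rightarrow> bool"
  where "borel_along \<theta> s a Y \<longleftrightarrow>
    (\<exists>U A. open U \<and> ray \<theta> \<subseteq> U \<and> (\<forall>i. (\<lambda>p. A p $ i) holomorphic_on U) \<and>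
       (\<exists>\<epsilon>>0. \<forall>p i. cmod p < \<epsilon> \<longrightarrow>
          (\<lambda>m. a m $ i * p^m * rGamma (s + of_nat m)) sums (A p $ i)) \<and>
       (\<forall>p \<in> ray \<theta> - {0}. Y p = ray_power \<theta> (s - 1) p *s A p))"


section \<open>Convolution\<close>

text \<open>The integral over the segment from 0 to \<open>p\<close>.\<close>

definition seg_int :: "(complex \<Rightarrow> complex) \<Rightarrow> complex \<Rightarrow> complex"
  where "seg_int f p = p * (LINT u:{0..1}|lebesgue. f (of_real u * p))"

definition conv :: "(complex \<Rightarrow> complex) \<Rightarrow> (complex \<Rightarrow> complex) \<Rightarrow> complex \<Rightarrow> complex"
  where "conv f g p = seg_int (\<lambda>s. f s * g (p - s)) p"

text \<open>A pair \<open>(c, f)\<close> stands for \<open>c \<delta> + f\<close>, where \<open>\<delta>\<close> is the Dirac delta at 0.\<close>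

type_synonym dfun = "complex \<times> (complex \<Rightarrow> complex)"

definition dconv :: "dfun \<Rightarrow> dfun \<Rightarrow> dfun"
  where "dconv F G =
    (fst F * fst G, \<lambda>p. fst F * snd G p + fst G * snd F p + conv (snd F) (snd G) p)"

text \<open>The convolution product of the functions \<open>f i j\<close>, \<open>1 \<le> j \<le> l i\<close>; it is \<open>\<delta>\<close> if \<open>l = 0\<close>.\<close>

definition conv_prod ::
  "('n::{finite,linorder} \<Rightarrow> nat) \<Rightarrow> ('n \<Rightarrow> nat \<Rightarrow> complex \<Rightarrow> complex) \<Rightarrow> dfun"
  where "conv_prod l f =
    foldr dconv [(0, f i j). i \<leftarrow> sorted_list_of_set UNIV, j \<leftarrow> [1..<Suc (l i)]] (1, \<lambda>p. 0)"

definition conv_pow ::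
  "(complex \<Rightarrow> 'n cvec) \<Rightarrow> ('n::{finite,linorder} \<Rightarrow> nat) \<Rightarrow> dfun"
  where "conv_pow Y l = conv_prod l (\<lambda>i j p. Y p $ i)"


section \<open>The convolution equation and the convolution hierarchy\<close>

definition F0 :: "(nat \<Rightarrow> 'n::finite cvec) \<Rightarrow> complex \<Rightarrow> 'n \<Rightarrow> complex"
  where "F0 fc p i = (\<Sum>m. fc (m + 2) $ i * p^(m + 1) / fact (m + 1))"

definition Gl ::
  "(nat \<Rightarrow> ('n::finite \<Rightarrow> nat) \<Rightarrow> 'n cvec) \<Rightarrow> ('n \<Rightarrow> nat) \<Rightarrow> 'n \<Rightarrow> complex \<Rightarrow> complex"
  where "Gl gc l i p = (\<Sum>m. gc (m + 1) l $ i * p^m / fact m)"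

text \<open>
  For \<open>Y\<close> locally integrable on a ray the infinite sums here and in \<open>dcoef\<close> converge absolutely
  at almost every point of the ray.
\<close>

definition Nop ::
  "(nat \<Rightarrow> ('n::{finite,linorder} \<Rightarrow> nat) \<Rightarrow> 'n cvec) \<Rightarrow>
   (complex \<Rightarrow> 'n cvec) \<Rightarrow> complex \<Rightarrow> 'n \<Rightarrow> complex"
  where "Nop gc Y p i =
    (\<Sum>\<^sub>\<infinity>l\<in>{l. msize l \<ge> 1}. conv (Gl gc l i) (snd (conv_pow Y l)) p) +
    (\<Sum>\<^sub>\<infinity>l\<in>{l. msize l \<ge> 2}. gc 0 l $ i * snd (conv_pow Y l) p)"

definition solves_conv_eq ::
  "'n::{finite,linorder} cvec \<Rightarrow> 'n cvec \<Rightarrow> (nat \<Rightarrow> 'n cvec) \<Rightarrow>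
   (nat \<Rightarrow> ('n \<Rightarrow> nat) \<Rightarrow> 'n cvec) \<Rightarrow> real \<Rightarrow> (complex \<Rightarrow> 'n cvec) \<Rightarrow> bool"
  where "solves_conv_eq lam b fc gc \<theta> Y \<longleftrightarrow>
    AE_ray \<theta> (\<lambda>p. \<forall>i.
      - p * Y p $ i =
        F0 fc p i - lam $ i * Y p $ i - b $ i * seg_int (\<lambda>s. Y s $ i) p + Nop gc Y p i)"

text \<open>
  Component \<open>i\<close> of \<open>d_m\<close>. Its delta part is \<open>gc 0 m $ i\<close>, coming from the term \<open>l = m\<close>.
\<close>

definition dcoef ::
  "(nat \<Rightarrow> ('n::{finite,linorder} \<Rightarrow> nat) \<Rightarrow> 'n cvec) \<Rightarrow>
   (complex \<Rightarrow> 'n cvec) \<Rightarrow> ('n \<Rightarrow> nat) \<Rightarrow> 'n \<Rightarrow> dfun"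
  where "dcoef gc Y0 m i =
    (let term = (\<lambda>l. dconv (gc 0 l $ i, Gl gc l i) (conv_pow Y0 (\<lambda>j. l j - m j))) in
      (\<Sum>\<^sub>\<infinity>l\<in>{l. m \<le> l}. of_nat (mbinom l m) * fst (term l),
       \<lambda>p. \<Sum>\<^sub>\<infinity>l\<in>{l. m \<le> l}. of_nat (mbinom l m) * snd (term l) p))"

text \<open>
  The families of integers \<open>m i j \<ge> 1\<close>, \<open>1 \<le> j \<le> l i\<close>, of sum \<open>k\<close>, set to 0 at all other \<open>j\<close> so
  that each family is counted once.
\<close>

definition compositions :: "('n::finite \<Rightarrow> nat) \<Rightarrow> nat \<Rightarrow> ('n \<Rightarrow> nat \<Rightarrow> nat) set"
  where "compositions l k =
    {m. (\<forall>i. \<forall>j\<in>{1..l i}. m i j \<ge> 1) \<and> (\<forall>i. \<forall>j. j \<notin> {1..l i} \<longrightarrow> m i j = 0) \<and>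
        (\<Sum>i\<in>UNIV. \<Sum>j\<in>{1..l i}. m i j) = k}"

definition solves_hierarchy ::
  "'n::{finite,linorder} cvec \<Rightarrow> 'n cvec \<Rightarrow>
   (nat \<Rightarrow> ('n \<Rightarrow> nat) \<Rightarrow> 'n cvec) \<Rightarrow> real \<Rightarrow> (nat \<Rightarrow> complex \<Rightarrow> 'n cvec) \<Rightarrow> nat \<Rightarrow> bool"
  where "solves_hierarchy lam b gc \<theta> Y k \<longleftrightarrow>
    AE_ray \<theta> (\<lambda>p. \<forall>i.
      (lam $ i - p - of_nat k) * Y k p $ i
        + b $ i * seg_int (\<lambda>s. Y k s $ i) p
        - (\<Sum>j\<in>UNIV. conv (\<lambda>s. Y k s $ j) (snd (dcoef gc (Y 0) (munit j) i)) p) =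
      (\<Sum>\<^sub>\<infinity>l\<in>{l. msize l > 1}.
         snd (dconv (dcoef gc (Y 0) l i)
           (0, \<lambda>q. \<Sum>m\<in>compositions l k. snd (conv_prod l (\<lambda>i' j s. Y (m i' j) s $ i')) q)) p))"


section \<open>Domains\<close>

definition domD :: "'n::finite cvec \<Rightarrow> complex set"
  where "domD lam = UNIV - (\<Union>i. {of_real \<alpha> * lam $ i | \<alpha>. \<alpha> \<ge> 1})"

text \<open>\<open>Min (UNIV - {ix1})\<close> is the second index; \<open>phi_plus\<close> is only used for \<open>n \<ge> 2\<close>.\<close>

definition phi_plus :: "'n::{finite,linorder} cvec \<Rightarrow> real"
  where "phi_plus lam = Arg2pi (lam $ Min (UNIV - {ix1}))"

definition phi_minus :: "'n::{finite,linorder} cvec \<Rightarrow> real"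
  where "phi_minus lam = 2 * pi - Arg2pi (lam $ Max UNIV)"

definition domW1 :: "'n::{finite,linorder} cvec \<Rightarrow> complex set"
  where "domW1 lam = {p. p \<notin> \<nat> \<and>
    (CARD('n) = 1 \<or> (\<exists>a. - phi_minus lam < a \<and> a < phi_plus lam \<and> p = of_real (cmod p) * cis a))}"

text \<open>
  On the ray the factor \<open>\<Lambda> - p - k\<close> in front of \<open>Y_k\<close> is invertible, for all \<open>k \<ge> 1\<close>, except at
  \<open>p = 0\<close> for \<open>k = 1\<close>. If \<open>n \<ge> 2\<close>, \<open>phi_minus \<le> \<pi>\<close> and \<open>phi_plus \<le> \<pi>\<close>, every ray in \<open>domW1\<close> has this
  property; if \<open>n = 1\<close>, it excludes only the negative real axis. At a zero \<open>lam $ j - k\<close> on the ray, uniqueness in \<open>L1loc\<close> can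
  fail: for \<open>n = 1\<close>, \<open>f0 = 0\<close>, \<open>g = 0\<close> on the negative axis, the equation for \<open>k = 2\<close> is solved by
  the function equal to \<open>(t - 1)^(\<beta> - 1)\<close> at \<open>p = -t\<close>, \<open>t > 1\<close>, and to 0 for \<open>t < 1\<close>.
\<close>

definition nonresonant_ray :: "'n::finite cvec \<Rightarrow> real \<Rightarrow> bool"
  where "nonresonant_ray lam \<theta> \<longleftrightarrow> (\<forall>k\<ge>1. \<forall>j. lam $ j - of_nat k \<notin> ray \<theta> - {0})"

end

theory Submission imports Defs "HOL-Complex_Analysis.Complex_Analysis" begin

text \<open>
 Borel transforms of formal series are followed as analytic functions on open sets that are
 star-shaped about 0. There the convolution equation and, level by level, the linear equations of
 the hierarchy are solved by contraction in sup norms weighted by \<open>exp (- \<nu> |p|)\<close>: the factor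
 \<open>lam - p - k\<close> has no zero except at \<open>p = 0\<close> for \<open>k = 1\<close>, where the kernels vanish and \<open>p\<close> can be
 divided out. The Taylor coefficients at 0 of these solutions obey the recurrences of the
 trans-series, so the solutions are its Borel transforms.

 Uniqueness in \<open>L1loc\<close> is the same contraction in weighted \<open>L1\<close> norms on \<open>[0, T]\<close>, in which every
 function becomes small as \<open>\<nu>\<close> grows. Only for \<open>k = 1\<close> does the homogeneous equation have nonzero
 solutions \<open>f\<close>; then \<open>t^(-\<beta>) \<integral> f\<close> has a limit at 0, which vanishes only for \<open>f = 0\<close>. So level 1 is
 spanned by \<open>Y_1\<close>; this fixes \<open>C\<close>, and homogeneity propagates \<open>C^k\<close> to level \<open>k\<close>.
\<close>

text \<open>The fractional powers are kept out of the existence proof. Objects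
  \<open>c \<delta> + f\<close> with \<open>f\<close> analytic on a star-shaped domain form a ring
  under convolution, in correspondence with series in \<open>1/x\<close>. Level k is solved there
  for the series without its prefactor \<open>x^(-k \<beta>)\<close>; the prefactor is restored at
  the end by convolving with \<open>p^(k \<beta> - 1) / Gamma (k \<beta>)\<close>. Removing it
  shifts the diagonal entries of the system to \<open>lam - k\<close> and
  \<open>b - k \<beta>\<close>. In the first component at level 1 both vanish together, and this
  makes division by p possible. The hierarchy for the functions is then not solved again: both of
  its sides are Borel transforms of equal series, hence equal by analytic continuation. The given
  trans-series is also a tool, since its existence supplies the compatibility conditions at p = 0.
  Weights are chosen for each compact set separately, because the domains come arbitrarily close to
  the points \<open>lam - k\<close>. The nonlinear estimates are needed for two norms and are proved
  once, from a list of axioms.\<close>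

no_notation fps_nth (infixl \<open>$\<close> 75)

section \<open>Borel transforms and convolution\<close>

text \<open>Differentiation under the integral sign with hypotheses on \<open>h\<close> only:
  Cauchy's inequality on discs of half the radius turns the local majorant \<open>w\<close> into the
  majorant \<open>2 * w / r\<close> of the difference quotients, and dominated convergence along
  sequences gives the derivative.\<close>

lemma holomorphic_LINT: fixes h :: "complex \<Rightarrow> 'a \<Rightarrow> complex" assumes U: "open U"
  and hol: "\<And>u. (\<lambda>p. h p u) holomorphic_on U"
  and meas: "\<And>p. p \<in> U \<Longrightarrow> h p \<in> borel_measurable M"
  and bound: "\<And>K. compact K \<Longrightarrow> K \<subseteq> U \<Longrightarrow> \<exists>w. integrable M w \<and> (\<forall>p\<in>K. \<forall>u. norm (h p u) \<le> (w u :: real))"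
 shows "(\<lambda>p. LINT u|M. h p u) holomorphic_on U"
proof -
 have "\<exists>D. ((\<lambda>p. LINT u|M. h p u) has_field_derivative D) (at p0)" if p0: "p0 \<in> U" for p0
 proof -
  obtain r where r: "r > 0" "cball p0 r \<subseteq> U" using U p0 open_contains_cball by blast
  obtain w where w: "integrable M w" "\<And>p u. p \<in> cball p0 r \<Longrightarrow> norm (h p u) \<le> w u"
   using bound[of "cball p0 r"] r by auto
  have int: "integrable M (h p)" if "p \<in> cball p0 r" for p using w(1) by (rule Bochner_Integration.integrable_bound)
    (use meas that r w(2)[OF that] in \<open>auto intro!: AE_I2 intro: order_trans[OF _ abs_ge_self]\<close>)
  have dbound: "norm (deriv (\<lambda>p. h p u) p) \<le> 2 * w u / r" if "p \<in> ball p0 (r/2)" for p u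
  proof -
   have sub: "cball p (r/2) \<subseteq> cball p0 r"
   proof
    fix x assume "x \<in> cball p (r/2)"
    then show "x \<in> cball p0 r" using that dist_triangle[of p0 x p] by (auto simp: dist_commute)
   qed
   have "norm ((deriv ^^ 1) (\<lambda>p. h p u) p) \<le> fact 1 * w u / (r/2) ^ 1"
   proof (rule Cauchy_inequality)
    show "(\<lambda>p. h p u) holomorphic_on ball p (r/2)"
     using hol sub r by (meson ball_subset_cball holomorphic_on_subset order_trans)
    show "continuous_on (cball p (r/2)) (\<lambda>p. h p u)"
     using hol sub r by (meson continuous_on_subset holomorphic_on_imp_continuous_on order_trans)
    fix x assume "norm (p - x) = r/2"
    then show "norm (h x u) \<le> w u" by (intro w(2) subsetD[OF sub]) (simp add: dist_norm)
   qed (use r in auto)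
   then show ?thesis by (simp add: field_simps)
  qed
  have lip: "norm (h p u - h p0 u) \<le> 2 * w u / r * norm (p - p0)" if "p \<in> ball p0 (r/2)" for p u
  proof (rule field_differentiable_bound[of "ball p0 (r/2)" "\<lambda>p. h p u" "deriv (\<lambda>p. h p u)"])
   fix z assume z: "z \<in> ball p0 (r/2)"
   then have "z \<in> U" using r by auto
   then show "((\<lambda>p. h p u) has_field_derivative deriv (\<lambda>p. h p u) z) (at z within ball p0 (r/2))"
    using hol U by (meson at_within_open holomorphic_derivI has_field_derivative_at_within)
   show "norm (deriv (\<lambda>p. h p u) z) \<le> 2 * w u / r" using dbound z by blast
  qed (use that r in auto)
  have "((\<lambda>x. ((LINT u|M. h x u) - (LINT u|M. h p0 u)) / (x - p0)) \<longlongrightarrow>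
      (LINT u|M. deriv (\<lambda>p. h p u) p0)) (at p0)" unfolding tendsto_at_iff_sequentially
  proof (intro allI impI)
   fix X :: "nat \<Rightarrow> complex"
   assume X: "\<forall>i. X i \<in> UNIV - {p0}" "X \<longlonglongrightarrow> p0"
   have "eventually (\<lambda>i. X i \<in> ball p0 (r/2)) sequentially" using X(2) r by (intro topological_tendstoD) auto
   then obtain N where N: "\<And>i. i \<ge> N \<Longrightarrow> X i \<in> ball p0 (r/2)" by (auto simp: eventually_sequentially)
   define Y where "Y i = X (i + N)" for i
   have Y: "Y i \<in> ball p0 (r/2)" "Y i \<noteq> p0" for i using N X by (auto simp: Y_def)
   have Ylim: "Y \<longlonglongrightarrow> p0" using X(2) unfolding Y_def by (rule LIMSEQ_ignore_initial_segment)
   have Yc: "Y i \<in> cball p0 r" for i using Y(1)[of i] r by auto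
   have p0c: "p0 \<in> cball p0 r" using r by auto
   define q where "q i u = (h (Y i) u - h p0 u) / (Y i - p0)" for i u
   have qlim: "(\<lambda>i. q i u) \<longlonglongrightarrow> deriv (\<lambda>p. h p u) p0" for u
   proof -
    have "((\<lambda>p. h p u) has_field_derivative deriv (\<lambda>p. h p u) p0) (at p0)"
     using hol U p0 holomorphic_derivI by blast
    then have "((\<lambda>x. (h x u - h p0 u) / (x - p0)) \<longlongrightarrow> deriv (\<lambda>p. h p u) p0) (at p0)"
     by (simp add: has_field_derivative_iff)
    then show ?thesis unfolding tendsto_at_iff_sequentially using Y(2) Ylim by (auto simp: q_def comp_def)
   qed
   have qm: "q i \<in> borel_measurable M" for i unfolding q_def using meas[OF subsetD[OF r(2) Yc]] meas[OF subsetD[OF r(2) p0c]]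
    by (intro borel_measurable_divide borel_measurable_diff) auto
   have "(\<lambda>i. LINT u|M. q i u) \<longlonglongrightarrow> (LINT u|M. deriv (\<lambda>p. h p u) p0)"
   proof (rule integral_dominated_convergence[where w = "\<lambda>u. 2 * w u / r"])
    show "(\<lambda>u. deriv (\<lambda>p. h p u) p0) \<in> borel_measurable M"
     by (rule borel_measurable_LIMSEQ_metric[OF qm qlim])
    show "integrable M (\<lambda>u. 2 * w u / r)" using w by auto
    show "AE x in M. norm (q i x) \<le> 2 * w x / r" for i
    proof (intro AE_I2)
     fix x
     show "norm (q i x) \<le> 2 * w x / r" using lip[OF Y(1), of i x] Y(2)[of i] by (simp add: q_def norm_divide divide_le_eq)
    qed
    show "q i \<in> borel_measurable M" for i by (rule qm)
    show "AE x in M. (\<lambda>i. q i x) \<longlonglongrightarrow> deriv (\<lambda>p. h p x) p0" by (intro AE_I2 qlim)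
   qed
   moreover have "(LINT u|M. q i u) = ((LINT u|M. h (Y i) u) - (LINT u|M. h p0 u)) / (Y i - p0)" for i
    unfolding q_def using int[OF Yc] int[OF p0c] by simp
   ultimately have "(\<lambda>i. ((LINT u|M. h (X (i+N)) u) - (LINT u|M. h p0 u)) / (X (i+N) - p0))
     \<longlonglongrightarrow> (LINT u|M. deriv (\<lambda>p. h p u) p0)" by (simp add: Y_def)
   from LIMSEQ_offset[OF this]
   show "((\<lambda>x. ((LINT u|M. h x u) - (LINT u|M. h p0 u)) / (x - p0)) \<circ> X)
     \<longlonglongrightarrow> (LINT u|M. deriv (\<lambda>p. h p u) p0)" by (simp add: comp_def)
  qed
  then show ?thesis by (auto simp: has_field_derivative_iff)
 qed
 then show ?thesis using U by (simp add: holomorphic_on_open)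
qed

text \<open>The integrand of Euler's Beta integral. It remains when the powers
  \<open>p^(s-1)\<close> and \<open>p^(s'-1)\<close> of two convolved functions are scaled out of
  the integral over the segment.\<close>

definition beta_kernel :: "complex \<Rightarrow> complex \<Rightarrow> real \<Rightarrow> complex"
 where "beta_kernel s s' u = of_real u powr (s - 1) * of_real (1 - u) powr (s' - 1)"

lemma norm_beta_kernel:
 "u \<in> {0..1} \<Longrightarrow> norm (beta_kernel s s' u) = u powr (Re s - 1) * (1 - u) powr (Re s' - 1)"
 by (simp add: beta_kernel_def norm_mult norm_powr_real_powr del: of_real_diff)

lemma beta_kernel_measurable [measurable]: "beta_kernel s s' \<in> borel_measurable borel" unfolding beta_kernel_def by measurable

lemma set_integrable_beta_real: assumes "a > 0" "b > (0::real)"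
 shows "set_integrable lebesgue {0..1} (\<lambda>u. u powr (a - 1) * (1 - u) powr (b - 1))"
 using integrable_Beta[OF assms] unfolding set_integrable_def by (rule iffD2[OF integrable_completion, rotated]) auto

lemma borel_imp_lebesgue_measurable: "f \<in> borel_measurable borel \<Longrightarrow> f \<in> borel_measurable lebesgue"
 by (simp add: measurable_completion)

lemma set_integrable_beta_kernel: assumes "Re s > 0" "Re s' > 0" shows "set_integrable lebesgue {0..1} (beta_kernel s s')"
 unfolding set_integrable_def
proof (rule Bochner_Integration.integrable_bound[OF set_integrable_beta_real[OF assms, unfolded set_integrable_def]])
 show "(\<lambda>x. indicat_real {0..1} x *\<^sub>R beta_kernel s s' x) \<in> borel_measurable lebesgue"
  by (intro borel_imp_lebesgue_measurable) auto
qed (auto simp: indicator_def norm_beta_kernel)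

lemma powr_bound_unit: assumes "u \<in> {0..1::real}" "c \<le> a" shows "u powr (a - 1) \<le> u powr (c - 1)"
 using assms by (cases "u = 0") (auto intro: powr_mono')

text \<open>On \<open>[0, 1]\<close> the kernel grows as \<open>Re s\<close> decreases, so on a
  compact set of exponents the one of smallest real part gives the majorant.\<close>

lemma beta_kernel_integral_holomorphic: assumes "Re s' > 0"
 shows "(\<lambda>s. LINT u:{0..1}|lebesgue. beta_kernel s s' u) holomorphic_on {s. Re s > 0}" unfolding set_lebesgue_integral_def
proof (rule holomorphic_LINT)
 show "open {s. Re s > 0}" by (simp add: open_halfspace_Re_gt)
 show "(\<lambda>p. indicat_real {0..1} u *\<^sub>R beta_kernel p s' u) holomorphic_on {s. Re s > 0}" for u
  unfolding beta_kernel_def scaleR_conv_of_real by (cases "u = 0") (auto intro!: holomorphic_intros)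
 show "(\<lambda>u. indicat_real {0..1} u *\<^sub>R beta_kernel p s' u) \<in> borel_measurable lebesgue" for p
  by (intro borel_imp_lebesgue_measurable) auto
 fix K :: "complex set" assume K: "compact K" "K \<subseteq> {s. Re s > 0}"
 show "\<exists>w. integrable lebesgue w \<and> (\<forall>p\<in>K. \<forall>u. norm (indicat_real {0..1} u *\<^sub>R beta_kernel p s' u) \<le> (w u :: real))"
 proof (cases "K = {}")
  case True then show ?thesis by (intro exI[of _ "\<lambda>_. 0"]) auto
 next
  case False
  have "continuous_on K Re" by (intro continuous_intros)
  then obtain z where z: "z \<in> K" "\<And>x. x \<in> K \<Longrightarrow> Re z \<le> Re x"
   using continuous_attains_inf[OF K(1) False] by blast
  have "Re z > 0" using z K by auto
  show ?thesis
  proof (intro exI conjI ballI allI)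
   show "integrable lebesgue (\<lambda>u. indicat_real {0..1} u *\<^sub>R (u powr (Re z - 1) * (1 - u) powr (Re s' - 1)))"
    using set_integrable_beta_real[OF \<open>Re z > 0\<close> assms] by (simp add: set_integrable_def)
   fix p u assume "p \<in> K"
   then show "norm (indicat_real {0..1} u *\<^sub>R beta_kernel p s' u)
    \<le> indicat_real {0..1} u *\<^sub>R (u powr (Re z - 1) * (1 - u) powr (Re s' - 1))"
    using z(2)[of p] by (auto simp: indicator_def norm_beta_kernel intro!: mult_right_mono powr_bound_unit)
  qed
 qed
qed

lemma beta_kernel_commute_integral:
 "(LINT u:{0..1}|lebesgue. beta_kernel s s' u) = (LINT u:{0..1}|lebesgue. beta_kernel s' s u)"
proof -
 have "(LINT u:{0..1}|lebesgue. beta_kernel s s' u)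
   = (LINT u|lebesgue. indicat_real {0..1} (1 + (-1) * u) *\<^sub>R beta_kernel s s' (1 + (-1) * u))"
  unfolding set_lebesgue_integral_def by (subst lebesgue_integral_real_affine[of "-1" _ 1]) auto
 also have "\<dots> = (LINT u:{0..1}|lebesgue. beta_kernel s' s u)" unfolding set_lebesgue_integral_def
  by (intro Bochner_Integration.integral_cong) (auto simp: indicator_def beta_kernel_def)
 finally show ?thesis .
qed

lemma beta_kernel_integral_real: assumes "a > 0" "b > 0"
 shows "(LINT u:{0..1}|lebesgue. beta_kernel (of_real a) (of_real b) u) = Beta (of_real a) (of_real b)"
proof -
 have "beta_kernel (of_real a) (of_real b) u = of_real (u powr (a - 1) * (1 - u) powr (b - 1))" if "u \<in> {0..1}" for u
  using that by (auto simp: beta_kernel_def powr_of_real[symmetric])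
 then have "(LINT u:{0..1}|lebesgue. beta_kernel (of_real a) (of_real b) u)
   = (LINT u:{0..1}|lebesgue. of_real (u powr (a - 1) * (1 - u) powr (b - 1)))" by (intro set_lebesgue_integral_cong) auto
 also have "\<dots> = of_real (LINT u:{0..1}|lebesgue. u powr (a - 1) * (1 - u) powr (b - 1))"
  by (simp only: set_integral_complex_of_real)
 also have "(LINT u:{0..1}|lebesgue. u powr (a - 1) * (1 - u) powr (b - 1)) = Beta a b"
  using set_lebesgue_integral_eq_integral(2)[OF set_integrable_beta_real[OF assms]]
   has_integral_Beta_real[OF assms] by (simp add: integral_unique)
 finally show ?thesis by (simp add: Beta_complex_of_real)
qed

text \<open>Identity theorem: the positive reals accumulate at 1, inside the half-plane.\<close>

lemma halfplane_eq_from_reals: assumes "f holomorphic_on {s. Re s > 0}" "g holomorphic_on {s. Re s > 0}"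
  and "\<And>a::real. a > 0 \<Longrightarrow> f (of_real a) = g (of_real a)" and "Re s > 0" shows "f s = (g s :: complex)"
proof (rule analytic_continuation[where f = "\<lambda>s. f s - g s" and S = "{s. Re s > 0}" and U = "of_real ` {0<..}" and \<xi> = 1, THEN eq_iff_diff_eq_0[THEN iffD2]])
 have "(1::complex) islimpt of_real ` {0<..}" unfolding islimpt_sequential
 proof (intro exI conjI allI)
  show "complex_of_real (1 + 1 / real (Suc n)) \<in> of_real ` {0<..} - {1}" for n
  proof -
   have "1 + 1 / real (Suc n) \<in> {0<..}" "1 + 1 / real (Suc n) \<noteq> 1" by (simp_all add: add_pos_pos)
   then show ?thesis by (auto simp del: of_real_add of_nat_Suc)
  qed
  have "(\<lambda>n. complex_of_real (1 + 1 / real (Suc n))) \<longlonglongrightarrow> of_real (1 + 0)"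
   by (intro tendsto_of_real tendsto_add tendsto_const LIMSEQ_Suc lim_1_over_n)
  then show "(\<lambda>n. complex_of_real (1 + 1 / real (Suc n))) \<longlonglongrightarrow> 1" by simp
 qed
 then show "1 islimpt complex_of_real ` {0<..}" .
 show "connected {s. Re s > 0}" by (intro convex_connected convex_halfspace_Re_gt)
qed (use assms in \<open>auto simp: open_halfspace_Re_gt intro: holomorphic_on_diff\<close>)

lemma Beta_holomorphic_left: assumes "Re b > 0" shows "(\<lambda>s. Beta s b) holomorphic_on {s. Re s > 0}"
proof -
 have [simp]: "z \<notin> \<int>\<^sub>\<le>\<^sub>0" if "Re z > 0" for z using that by (auto elim!: nonpos_Ints_cases)
 show ?thesis by (rule holomorphic_Beta[unfolded o_def] | auto intro!: holomorphic_intros simp: assms)+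
qed

lemma beta_kernel_integral: assumes "Re s > 0" "Re s' > 0" shows "(LINT u:{0..1}|lebesgue. beta_kernel s s' u) = Beta s s'"
proof -
 \<comment> \<open>The real Beta integral is continued in one exponent at a time: here the first
   becomes complex, below the second.\<close>
 have 1: "(LINT u:{0..1}|lebesgue. beta_kernel s (of_real b) u) = Beta s (of_real b)" if "Re s > 0" "b > 0" for s b
  by (rule halfplane_eq_from_reals[where s = s])
    (use that in \<open>auto intro!: beta_kernel_integral_holomorphic Beta_holomorphic_left beta_kernel_integral_real\<close>)
 have "(LINT u:{0..1}|lebesgue. beta_kernel s' s u) = Beta s' s"
 proof (rule halfplane_eq_from_reals[where s = s'])
  fix a :: real assume "a > 0"
  then show "(LINT u:{0..1}|lebesgue. beta_kernel (of_real a) s u) = Beta (of_real a) s"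
   using 1[OF assms(1)] by (simp add: beta_kernel_commute_integral[of "of_real a"] Beta_commute)
 qed (use assms in \<open>auto intro!: beta_kernel_integral_holomorphic Beta_holomorphic_left\<close>)
 then show ?thesis by (simp add: beta_kernel_commute_integral[of s] Beta_commute)
qed

text \<open>Holds for arbitrary functions: by completeness of the measure, measurability passes
  across almost everywhere equality, and if both functions are non-measurable both integrals are 0
  by default.\<close>

lemma LINT_cong_AE_lebesgue: fixes f g :: "'a::euclidean_space \<Rightarrow> 'b::euclidean_space"
 assumes "AE x in lebesgue. f x = g x" shows "integral\<^sup>L lebesgue f = integral\<^sup>L lebesgue g"
proof (cases "f \<in> borel_measurable lebesgue")
 case True
 then have "g \<in> borel_measurable lebesgue" using borel_measurable_AE assms by blast
 then show ?thesis using True assms by (intro integral_cong_AE)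
next
 case False
 have "AE x in lebesgue. g x = f x" using assms by eventually_elim simp
 then have "g \<notin> borel_measurable lebesgue" using borel_measurable_AE False by blast
 with False show ?thesis by (metis borel_measurable_integrable not_integrable_integral_eq)
qed

lemma set_LINT_cong_AE_lebesgue: fixes f g :: "'a::euclidean_space \<Rightarrow> 'b::euclidean_space"
 assumes "AE x in lebesgue. x \<in> A \<longrightarrow> f x = g x" shows "(LINT x:A|lebesgue. f x) = (LINT x:A|lebesgue. g x)"
 unfolding set_lebesgue_integral_def by (rule LINT_cong_AE_lebesgue, use assms in eventually_elim) (auto simp: indicator_def)

lemma set_LINT_unit_cong: fixes f g :: "real \<Rightarrow> 'b::euclidean_space"
 assumes "\<And>u. 0 < u \<Longrightarrow> u < 1 \<Longrightarrow> f u = g u"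
 shows "(LINT u:{0..1}|lebesgue. f u) = (LINT u:{0..1}|lebesgue. g u)"
proof (rule set_LINT_cong_AE_lebesgue)
 have "AE u in lebesgue. u \<noteq> (0::real)" "AE u in lebesgue. u \<noteq> (1::real)"
  by (simp_all add: AE_completion_iff AE_lborel_singleton)
 then show "AE u in lebesgue. u \<in> {0..1} \<longrightarrow> f u = g u" by eventually_elim (use assms in auto)
qed

section \<open>Star-shaped domains and bounds on compact sets\<close>

definition star_open :: "complex set \<Rightarrow> bool"
 where "star_open U \<longleftrightarrow> open U \<and> 0 \<in> U \<and> (\<forall>p\<in>U. \<forall>u\<in>{0..1}. of_real u * p \<in> U)"

lemma star_openD: assumes "star_open U"
 shows "open U" "0 \<in> U" "p \<in> U \<Longrightarrow> 0 \<le> u \<Longrightarrow> u \<le> 1 \<Longrightarrow> of_real u * p \<in> U"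
  "p \<in> U \<Longrightarrow> 0 \<le> u \<Longrightarrow> u \<le> 1 \<Longrightarrow> p - of_real u * p \<in> U"
proof -
 show "open U" "0 \<in> U" and *: "p \<in> U \<Longrightarrow> 0 \<le> u \<Longrightarrow> u \<le> 1 \<Longrightarrow> of_real u * p \<in> U" for u
  using assms by (auto simp: star_open_def)
 show "p \<in> U \<Longrightarrow> 0 \<le> u \<Longrightarrow> u \<le> 1 \<Longrightarrow> p - of_real u * p \<in> U"
  using *[of "1 - u"] by (simp add: algebra_simps)
qed

lemma star_open_connected: assumes "star_open U" shows "connected U"
proof (rule starlike_imp_connected)
 have "closed_segment 0 p \<subseteq> U" if "p \<in> U" for p
  using star_openD(3)[OF assms that] by (auto simp: closed_segment_def scaleR_conv_of_real)
 then show "starlike U" using star_openD(2)[OF assms] by (auto simp: starlike_def)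
qed

lemma star_open_Int: "star_open U \<Longrightarrow> star_open V \<Longrightarrow> star_open (U \<inter> V)"
 by (auto simp: star_open_def)

lemma star_compact_hull: assumes "star_open U" "compact K" "K \<subseteq> U"
 obtains K' where "compact K'" "K \<subseteq> K'" "K' \<subseteq> U"
  "\<And>p u. p \<in> K' \<Longrightarrow> 0 \<le> u \<Longrightarrow> u \<le> 1 \<Longrightarrow> of_real u * p \<in> K'"
proof
 define K' where "K' = (\<lambda>(u, p). complex_of_real u * p) ` ({0..1} \<times> K)"
 show "compact K'" unfolding K'_def case_prod_unfold
  by (intro compact_continuous_image compact_Times continuous_intros assms compact_Icc)
 show "K \<subseteq> K'" unfolding K'_def by (force intro: image_eqI[of _ _ "(1, _)"])
 show "K' \<subseteq> U" using assms unfolding K'_def star_open_def by auto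
 fix p and u :: real assume "p \<in> K'" "0 \<le> u" "u \<le> 1"
 then obtain v q where "p = of_real v * q" "v \<in> {0..1}" "q \<in> K" by (auto simp: K'_def)
 then show "of_real u * p \<in> K'" using \<open>0 \<le> u\<close> \<open>u \<le> 1\<close> unfolding K'_def
  by (intro image_eqI[of _ _ "(u * v, q)"]) (auto simp: mult_le_one)
qed

lemma holomorphic_bdd_on_compact: assumes "f holomorphic_on U" "compact D" "D \<subseteq> U"
 obtains c where "c \<ge> 0" "\<And>p. p \<in> D \<Longrightarrow> norm (f p) \<le> (c :: real)"
proof -
 have "compact (f ` D)"
  by (intro compact_continuous_image continuous_on_subset[OF holomorphic_on_imp_continuous_on[OF assms(1)]] assms)
 then obtain c where "\<forall>x\<in>f ` D. norm x \<le> c" using compact_imp_bounded bounded_iff by metis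
 then show thesis by (intro that[of "max c 0"]) auto
qed

lemma holomorphic_family_bdd:
 assumes "finite I" "\<And>x. x \<in> I \<Longrightarrow> f x holomorphic_on U" and D: "compact D" "D \<subseteq> U"
 shows "\<exists>c\<ge>0. \<forall>x\<in>I. \<forall>p\<in>D. norm (f x p) \<le> (c :: real)" using assms(1,2)
proof (induction I rule: finite_induct)
 case (insert x I)
 then obtain c where c: "c \<ge> 0" "\<forall>x\<in>I. \<forall>p\<in>D. norm (f x p) \<le> c" by auto
 have "f x holomorphic_on U" using insert.prems by simp
 then obtain d where "d \<ge> 0" "\<And>p. p \<in> D \<Longrightarrow> norm (f x p) \<le> d"
  by (rule holomorphic_bdd_on_compact[OF _ D]) (rule that; assumption)
 with c show ?case by (intro exI[of _ "max c d"]) (auto simp: le_max_iff_disj)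
qed auto

lemma compact_lower_bound: fixes \<mu> :: "'i::finite \<Rightarrow> complex"
 assumes A: "compact A" "A \<noteq> {}" and \<mu>: "\<And>i. \<mu> i \<notin> A"
 obtains d where "d > 0" "\<And>i p. p \<in> A \<Longrightarrow> d \<le> norm (\<mu> i - p)"
proof
 define d where "d = Min (range (\<lambda>i. infdist (\<mu> i) A))"
 have "infdist (\<mu> i) A > 0" for i
  using in_closed_iff_infdist_zero[OF compact_imp_closed[OF A(1)] A(2), of "\<mu> i"] \<mu>[of i] infdist_nonneg[of "\<mu> i" A]
  by force
 then show "d > 0" unfolding d_def by (subst Min_gr_iff) auto
 fix i p assume p: "p \<in> A"
 have "d \<le> infdist (\<mu> i) A" unfolding d_def by (rule Min_le) auto
 also have "\<dots> \<le> dist (\<mu> i) p" by (rule infdist_le[OF p])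
 finally show "d \<le> norm (\<mu> i - p)" by (simp add: dist_norm)
qed

text \<open>The convolution of \<open>p^(s-1) A\<close> and \<open>p^(s'-1) B\<close> with its
  factor \<open>p^(s+s'-1)\<close> removed; unlike the convolution itself it is analytic at
  0.\<close>

definition bconv :: "complex \<Rightarrow> complex \<Rightarrow> (complex \<Rightarrow> complex) \<Rightarrow> (complex \<Rightarrow> complex) \<Rightarrow> complex \<Rightarrow> complex"
 where "bconv s s' A B p = (LINT u:{0..1}|lebesgue. beta_kernel s s' u * (A (of_real u * p) * B (of_real (1 - u) * p)))"

lemma bconv_holomorphic: assumes U: "star_open U" and A: "A holomorphic_on U" and B: "B holomorphic_on U"
  and s: "Re s > 0" "Re s' > 0" shows "bconv s s' A B holomorphic_on U" unfolding bconv_def[abs_def] set_lebesgue_integral_def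
proof (rule holomorphic_LINT)
 show "open U" using U by (rule star_openD)
 have comp: "(\<lambda>p. A (of_real u * p)) holomorphic_on U" if "A holomorphic_on U" "u \<in> {0..1}" for A u
  using holomorphic_on_compose_gen[OF _ that(1), of "\<lambda>p. of_real u * p" U] that(2) star_openD(3)[OF U]
  by (auto simp: o_def image_subset_iff intro: holomorphic_intros)
 show "(\<lambda>p. indicat_real {0..1} u *\<^sub>R (beta_kernel s s' u * (A (of_real u * p) * B (of_real (1 - u) * p)))) holomorphic_on U" for u
  using comp[OF A, of u] comp[OF B, of "1 - u"]
  by (cases "u \<in> {0..1}") (auto simp: scaleR_conv_of_real intro!: holomorphic_intros)
 have mA: "(\<lambda>u. indicat_real {0..1} u *\<^sub>R A (of_real (if r then u else 1 - u) * p)) \<in> borel_measurable borel"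
  if "A holomorphic_on U" "p \<in> U" for A p r
 proof (rule borel_measurable_continuous_on_indicator)
  show "continuous_on {0..1} (\<lambda>u. A (of_real (if r then u else 1 - u) * p))" using star_openD(3)[OF U that(2)]
   by (intro continuous_on_compose2[OF holomorphic_on_imp_continuous_on[OF that(1)]])
    (cases r; auto intro!: continuous_intros simp del: of_real_diff)+
 qed auto
 show "(\<lambda>u. indicat_real {0..1} u *\<^sub>R (beta_kernel s s' u * (A (of_real u * p) * B (of_real (1 - u) * p))))
   \<in> borel_measurable lebesgue" if "p \<in> U" for p
 proof -
  have "(\<lambda>u. beta_kernel s s' u * ((indicat_real {0..1} u *\<^sub>R A (of_real (if True then u else 1 - u) * p))
    * (indicat_real {0..1} u *\<^sub>R B (of_real (if False then u else 1 - u) * p)))) \<in> borel_measurable borel"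
   by (intro borel_measurable_times mA A B that beta_kernel_measurable)
  then have "(\<lambda>u. beta_kernel s s' u * ((indicat_real {0..1} u *\<^sub>R A (of_real (if True then u else 1 - u) * p))
    * (indicat_real {0..1} u *\<^sub>R B (of_real (if False then u else 1 - u) * p)))) \<in> borel_measurable lebesgue"
   by (rule borel_imp_lebesgue_measurable)
  then show ?thesis by (rule iffD1[OF measurable_cong, rotated]) (auto simp: indicator_def)
 qed
 fix K assume K: "compact K" "K \<subseteq> U"
 obtain K' where K': "compact K'" "K \<subseteq> K'" "K' \<subseteq> U"
  "\<And>p u. p \<in> K' \<Longrightarrow> 0 \<le> u \<Longrightarrow> u \<le> 1 \<Longrightarrow> of_real u * p \<in> K'"
  using star_compact_hull[OF U K] by metis
 obtain a where a: "a \<ge> 0" "\<forall>p\<in>K'. norm (A p) \<le> a" using holomorphic_bdd_on_compact[OF A K'(1,3)] by metis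
 obtain b where b: "b \<ge> 0" "\<forall>p\<in>K'. norm (B p) \<le> b" using holomorphic_bdd_on_compact[OF B K'(1,3)] by metis
 show "\<exists>w. integrable lebesgue w \<and> (\<forall>p\<in>K. \<forall>u. norm (indicat_real {0..1} u *\<^sub>R
   (beta_kernel s s' u * (A (of_real u * p) * B (of_real (1 - u) * p)))) \<le> (w u :: real))"
 proof (intro exI conjI ballI allI)
  show "integrable lebesgue (\<lambda>u. norm (indicat_real {0..1} u *\<^sub>R beta_kernel s s' u) * (a * b))"
   using set_integrable_beta_kernel[OF s] by (simp add: set_integrable_def del: norm_scaleR)
  fix p u assume "p \<in> K"
  then have "p \<in> K'" using K' by auto
  then have "norm (A (of_real u * p) * B (of_real (1 - u) * p)) \<le> a * b" if "u \<in> {0..1}"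
   using that K'(4)[of p u] K'(4)[of p "1 - u"] a b by (auto simp: norm_mult simp del: of_real_diff intro!: mult_mono)
  then show "norm (indicat_real {0..1} u *\<^sub>R (beta_kernel s s' u * (A (of_real u * p) * B (of_real (1 - u) * p))))
   \<le> norm (indicat_real {0..1} u *\<^sub>R beta_kernel s s' u) * (a * b)"
   by (auto simp: indicator_def norm_mult intro!: mult_left_mono)
 qed
qed

text \<open>Borel coefficients of \<open>x^(-s) a(1/x)\<close> with the factor
  \<open>p^(s-1)\<close> removed. The reciprocal Gamma function is entire, so that
  \<open>s = 0\<close> is covered as well.\<close>

definition bor :: "complex \<Rightarrow> complex fps \<Rightarrow> complex fps"
 where "bor s a = Abs_fps (\<lambda>m. fps_nth a m * rGamma (s + of_nat m))"

lemma bor_nth [simp]: "fps_nth (bor s a) m = fps_nth a m * rGamma (s + of_nat m)" by (simp add: bor_def)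

lemma has_fps_expansion_sums_near_0: assumes "A has_fps_expansion (F :: complex fps)" obtains r where "r > 0"
  "\<And>p. norm p < r \<Longrightarrow> (\<lambda>n. fps_nth F n * p ^ n) sums A p"
  "\<And>p. norm p < r \<Longrightarrow> summable (\<lambda>n. norm (fps_nth F n * p ^ n))"
proof -
 obtain X where X: "open X" "0 \<in> X" "A holomorphic_on X" "\<And>z. z \<in> X \<Longrightarrow> A z = eval_fps F z"
  using has_fps_expansion_imp_holomorphic[OF assms] by metis
 have "0 < fps_conv_radius F" using assms by (simp add: has_fps_expansion_def)
 then obtain r1 where r1: "0 < ereal r1" "ereal r1 < fps_conv_radius F" using ereal_dense2 by blast
 obtain r2 where r2: "r2 > 0" "ball 0 r2 \<subseteq> X" using X open_contains_ball by blast
 show thesis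
 proof
  show "min r1 r2 > 0" using r1 r2 by auto
  fix p :: complex assume p: "norm p < min r1 r2"
  then have "p \<in> X" using r2 by auto
  have pr: "ereal (norm p) < fps_conv_radius F" using p r1 by (meson ereal_less_le less_ereal.simps(1) min_less_iff_conj order_less_trans)
  show "summable (\<lambda>n. norm (fps_nth F n * p ^ n))"
   using pr unfolding fps_conv_radius_def by (rule abs_summable_in_conv_radius)
  have "(\<lambda>n. fps_nth F n * p ^ n) sums eval_fps F p" using pr by (intro sums_eval_fps)
  then show "(\<lambda>n. fps_nth F n * p ^ n) sums A p" using X(4)[OF \<open>p \<in> X\<close>] by simp
 qed
qed

lemma beta_kernel_shift:
 "beta_kernel s s' u * (of_real u ^ i * of_real (1 - u) ^ j) = beta_kernel (s + of_nat i) (s' + of_nat j) u"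
proof -
 have "x powr (s - 1) * x ^ i = x powr (s + of_nat i - 1)" for x s :: complex and i
 proof (cases "x = 0")
  case False
  have "x powr (s + of_nat i - 1) = x powr (s - 1 + of_nat i)" by (simp add: algebra_simps)
  then show ?thesis using False by (simp add: powr_add powr_nat')
 qed simp
 from this[of "of_real u" s i] this[of "of_real (1 - u)" s' j] show ?thesis
  unfolding beta_kernel_def by (metis (no_types, opaque_lifting) mult.assoc mult.left_commute)
qed

lemma Beta_rGamma: assumes "Re s > 0" "Re s' > 0" shows "rGamma s * rGamma s' * Beta s s' = rGamma (s + s')"
proof -
 have "rGamma s * Gamma s = 1" if "Re s > 0" for s :: complex
 proof -
  have "rGamma s \<noteq> 0" using that by (auto simp: rGamma_eq_zero_iff elim!: nonpos_Ints_cases)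
  then show ?thesis by (simp add: Gamma_def)
 qed
 from this[OF assms(1)] this[OF assms(2)] show ?thesis unfolding Beta_altdef by algebra
qed

text \<open>For single powers this is the Beta integral together with \<open>Beta_rGamma\<close>. In
  general the Cauchy product of the two series is integrated term by term against the
  kernel.\<close>

lemma bconv_has_fps: assumes A: "A has_fps_expansion bor s a" and B: "B has_fps_expansion bor s' b" and s: "Re s > 0" "Re s' > 0"
 shows "bconv s s' A B has_fps_expansion bor (s + s') (a * b)"
proof -
 obtain r1 where r1: "r1 > 0" "\<And>p. norm p < r1 \<Longrightarrow> (\<lambda>n. fps_nth (bor s a) n * p ^ n) sums A p"
  "\<And>p. norm p < r1 \<Longrightarrow> summable (\<lambda>n. norm (fps_nth (bor s a) n * p ^ n))"
  using has_fps_expansion_sums_near_0[OF A] by metis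
 obtain r2 where r2: "r2 > 0" "\<And>p. norm p < r2 \<Longrightarrow> (\<lambda>n. fps_nth (bor s' b) n * p ^ n) sums B p"
  "\<And>p. norm p < r2 \<Longrightarrow> summable (\<lambda>n. norm (fps_nth (bor s' b) n * p ^ n))"
  using has_fps_expansion_sums_near_0[OF B] by metis
 define r where "r = min r1 r2"
 have "(\<lambda>n. fps_nth (bor (s + s') (a * b)) n * p ^ n) sums bconv s s' A B p" if p: "norm p < r" for p
 proof -
  define \<alpha> where "\<alpha> n = fps_nth (bor s a) n" for n
  define \<beta> where "\<beta> n = fps_nth (bor s' b) n" for n
  define f where "f n u = indicat_real {0..1} u *\<^sub>R (beta_kernel s s' u *
   (\<Sum>i\<le>n. (\<alpha> i * (of_real u * p) ^ i) * (\<beta> (n - i) * (of_real (1 - u) * p) ^ (n - i))))" for n u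
  \<comment> \<open>The Cauchy product of absolute values at \<open>p\<close> itself. As
    \<open>u\<close> and \<open>1 - u\<close> lie in \<open>[0, 1]\<close>, it dominates
    \<open>f n\<close> uniformly in \<open>u\<close>, up to the integrable kernel.\<close>
  define C where "C n = (\<Sum>i\<le>n. norm (\<alpha> i * p ^ i) * norm (\<beta> (n - i) * p ^ (n - i)))" for n
  have psmall: "norm (of_real u * p) < r1" "norm (of_real (1 - u) * p) < r2" if "u \<in> {0..1}" for u
  proof -
   have "\<bar>u\<bar> * norm p \<le> 1 * norm p" "\<bar>1 - u\<bar> * norm p \<le> 1 * norm p"
    using that by (intro mult_right_mono; auto)+
   then show "norm (of_real u * p) < r1" "norm (of_real (1 - u) * p) < r2"
    using p by (auto simp: norm_mult r_def simp del: of_real_diff)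
  qed
  have Csum: "summable C" unfolding C_def using p by (intro sums_summable[OF Cauchy_product_sums])
    (auto simp: \<alpha>_def \<beta>_def r_def simp del: bor_nth intro: r1(3) r2(3))
  have feq: "f n u = (\<Sum>i\<le>n. indicat_real {0..1} u *\<^sub>R beta_kernel (s + of_nat i) (s' + of_nat (n - i)) u * (\<alpha> i * \<beta> (n - i) * p ^ n))" for n u
  proof -
   have "beta_kernel s s' u * ((\<alpha> i * (of_real u * p) ^ i) * (\<beta> (n - i) * (of_real (1 - u) * p) ^ (n - i)))
    = beta_kernel (s + of_nat i) (s' + of_nat (n - i)) u * (\<alpha> i * \<beta> (n - i) * p ^ n)" if "i \<le> n" for i
   proof -
    have "p ^ n = p ^ i * p ^ (n - i)" using that by (simp flip: power_add)
    then show ?thesis unfolding beta_kernel_shift[symmetric] by (simp add: power_mult_distrib)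
   qed
   then show ?thesis unfolding f_def sum_distrib_left scaleR_sum_right by (intro sum.cong) auto
  qed
  have intk: "integrable lebesgue (\<lambda>u. indicat_real {0..1} u *\<^sub>R beta_kernel (s + of_nat i) (s' + of_nat j) u)" for i j
   using set_integrable_beta_kernel[of "s + of_nat i" "s' + of_nat j"] s by (simp add: set_integrable_def)
  have intf: "integrable lebesgue (f n)" for n
   unfolding feq by (intro Bochner_Integration.integrable_sum integrable_mult_left intk)
  have fint: "integral\<^sup>L lebesgue (f n) = fps_nth (bor (s + s') (a * b)) n * p ^ n" for n
  proof -
   have "integral\<^sup>L lebesgue (f n) = (\<Sum>i\<le>n. Beta (s + of_nat i) (s' + of_nat (n - i)) * (\<alpha> i * \<beta> (n - i) * p ^ n))"
    unfolding feq by (subst Bochner_Integration.integral_sum[OF integrable_mult_left[OF intk]])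
     (simp add: integral_mult_left_zero beta_kernel_integral[unfolded set_lebesgue_integral_def] s
      add_pos_nonneg del: of_nat_diff mult_scaleR_left)
   also have "\<dots> = (\<Sum>i\<le>n. fps_nth a i * fps_nth b (n - i) * (rGamma (s + s' + of_nat n) * p ^ n))"
   proof (intro sum.cong refl)
    fix i assume "i \<in> {..n}"
    then have eq: "s + of_nat i + (s' + of_nat (n - i)) = s + s' + of_nat n" by (simp add: of_nat_diff)
    have "rGamma (s + of_nat i) * rGamma (s' + of_nat (n - i)) * Beta (s + of_nat i) (s' + of_nat (n - i))
     = rGamma (s + s' + of_nat n)" unfolding eq[symmetric] using s by (intro Beta_rGamma) (simp_all add: add_pos_nonneg)
    note r = this
    show "Beta (s + of_nat i) (s' + of_nat (n - i)) * (\<alpha> i * \<beta> (n - i) * p ^ n)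
     = fps_nth a i * fps_nth b (n - i) * (rGamma (s + s' + of_nat n) * p ^ n)"
     unfolding \<alpha>_def \<beta>_def bor_nth r[symmetric] by (simp only: mult_ac)
   qed
   finally show ?thesis by (simp add: fps_mult_nth sum_distrib_right atMost_atLeast0 mult.assoc)
  qed
  have normf: "norm (f n u) \<le> norm (indicat_real {0..1} u *\<^sub>R beta_kernel s s' u) * C n" for n u
  proof (cases "u \<in> {0..1}")
   case True
   have "norm (\<Sum>i\<le>n. (\<alpha> i * (of_real u * p) ^ i) * (\<beta> (n - i) * (of_real (1 - u) * p) ^ (n - i))) \<le> C n"
    unfolding C_def
   proof (intro sum_norm_le)
    fix i
    have "norm ((of_real u * p) ^ i) \<le> norm (p ^ i)" "norm ((of_real (1 - u) * p) ^ (n - i)) \<le> norm (p ^ (n - i))"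
     using True unfolding norm_power norm_mult by (intro power_mono; auto simp: mult_left_le_one_le simp del: of_real_diff)+
    then show "norm (\<alpha> i * (of_real u * p) ^ i * (\<beta> (n - i) * (of_real (1 - u) * p) ^ (n - i)))
     \<le> norm (\<alpha> i * p ^ i) * norm (\<beta> (n - i) * p ^ (n - i))" unfolding norm_mult by (intro mult_mono) auto
   qed
   then show ?thesis using True by (simp add: f_def norm_mult mult_left_mono)
  qed (auto simp: f_def)
  have "(\<lambda>n. integral\<^sup>L lebesgue (f n)) sums (LINT u|lebesgue. (\<Sum>n. f n u))"
  proof (rule sums_integral)
   show "AE u in lebesgue. summable (\<lambda>n. norm (f n u))"
   proof (intro AE_I2)
    fix u
    show "summable (\<lambda>n. norm (f n u))"
     by (rule summable_comparison_test'[OF summable_mult[OF Csum, of "norm (indicat_real {0..1} u *\<^sub>R beta_kernel s s' u)"]])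
      (use normf[of _ u] in \<open>simp del: norm_scaleR\<close>)
   qed
   show "summable (\<lambda>n. LINT u|lebesgue. norm (f n u))"
   proof (rule summable_comparison_test'[OF summable_mult[OF Csum]])
    fix n
    have "(LINT u|lebesgue. norm (f n u)) \<le> (LINT u|lebesgue. norm (indicat_real {0..1} u *\<^sub>R beta_kernel s s' u) * C n)"
     using intf normf intk[of 0 0] by (intro integral_mono) (auto simp del: norm_scaleR)
    then show "norm (LINT u|lebesgue. norm (f n u)) \<le> (LINT u|lebesgue. norm (indicat_real {0..1} u *\<^sub>R beta_kernel s s' u)) * C n"
     using intk[of 0 0] by (simp del: norm_scaleR)
   qed
  qed (rule intf)
  also have "(LINT u|lebesgue. (\<Sum>n. f n u)) = bconv s s' A B p" unfolding bconv_def set_lebesgue_integral_def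
  proof (intro Bochner_Integration.integral_cong refl)
   fix u :: real
   show "(\<Sum>n. f n u) = indicat_real {0..1} u *\<^sub>R (beta_kernel s s' u * (A (of_real u * p) * B (of_real (1 - u) * p)))"
   proof (cases "u \<in> {0..1}")
    case True
    note ps = psmall[OF True]
    have "(\<lambda>n. \<Sum>i\<le>n. (\<alpha> i * (of_real u * p) ^ i) * (\<beta> (n - i) * (of_real (1 - u) * p) ^ (n - i)))
      sums (A (of_real u * p) * B (of_real (1 - u) * p))" using Cauchy_product_sums[OF r1(3)[OF ps(1)] r2(3)[OF ps(2)]]
     unfolding sums_unique[OF r1(2)[OF ps(1)], symmetric] sums_unique[OF r2(2)[OF ps(2)], symmetric]
     by (simp add: \<alpha>_def \<beta>_def)
    from sums_mult[OF this, of "beta_kernel s s' u"] True show ?thesis by (simp add: f_def sums_iff)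
   qed (simp add: f_def)
  qed
  finally show ?thesis by (simp add: fint)
 qed
 moreover have "eventually (\<lambda>p. norm p < r) (nhds (0::complex))"
 proof -
  have "r > 0" using r1 r2 by (simp add: r_def)
  then show ?thesis by (auto simp: eventually_nhds_metric dist_norm)
 qed
 ultimately show ?thesis by (intro has_fps_expansionI) (auto elim: eventually_mono)
qed

section \<open>Operations on series and their counterparts on Borel transforms\<close>

lemma bor_add: "bor s (a + b) = bor s a + bor s b" by (simp add: fps_eq_iff algebra_simps)

lemma bor_diff: "bor s (a - b) = bor s a - bor s b" by (simp add: fps_eq_iff algebra_simps)

lemma bor_cmult: "bor s (fps_const c * a) = fps_const c * bor s a" by (simp add: fps_eq_iff)

lemma bor_zero [simp]: "bor s 0 = 0" by (simp add: fps_eq_iff)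

text \<open>Both sides encode \<open>x^(-s-1) a(1/x)\<close>: a power of \<open>1/x\<close> can be
  moved from the prefactor into the series.\<close>

lemma fps_X_mult_bor: "fps_X * bor (s + 1) a = bor s (fps_X * a)"
proof (intro fps_ext)
 fix m show "fps_nth (fps_X * bor (s + 1) a) m = fps_nth (bor s (fps_X * a)) m" by (cases m) (simp_all add: add_ac)
qed

lemma bor_inj: assumes "bor s a = bor s b" "Re s > 0" shows "a = b"
proof (intro fps_ext)
 fix m
 have "rGamma (s + of_nat m) \<noteq> 0"
  using assms(2) by (auto simp: rGamma_eq_zero_iff elim!: nonpos_Ints_cases dest!: arg_cong[of _ _ Re])
 then show "fps_nth a m = fps_nth b m" using arg_cong[OF assms(1), of "\<lambda>f. fps_nth f m"] by simp
qed

lemma has_fps_bor_shift: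
 "A has_fps_expansion bor (s + 1) a \<Longrightarrow> (\<lambda>p. p * A p) has_fps_expansion bor s (fps_X * a)"
 using has_fps_expansion_mult[OF has_fps_expansion_fps_X] by (simp flip: fps_X_mult_bor)

text \<open>The kernel with both exponents 1 is the constant 1 only in the open interval, because
  \<open>0 powr 0 = 0\<close>; the endpoints form a null set.\<close>

lemma conv_eq_bconv: "conv f g p = p * bconv 1 1 f g p" unfolding conv_def seg_int_def bconv_def
 by (intro arg_cong[of _ _ "(*) p"] set_LINT_unit_cong) (auto simp: beta_kernel_def algebra_simps)

lemma conv_holomorphic: assumes "star_open U" "f holomorphic_on U" "g holomorphic_on U" shows "conv f g holomorphic_on U"
 unfolding conv_eq_bconv[abs_def] by (intro holomorphic_intros bconv_holomorphic assms) auto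

lemma conv_has_fps: assumes "f has_fps_expansion bor 1 a" "g has_fps_expansion bor 1 b"
 shows "conv f g has_fps_expansion bor 1 (fps_X * (a * b))" unfolding conv_eq_bconv[abs_def]
 by (rule has_fps_bor_shift) (use bconv_has_fps[OF assms] in simp)

lemma conv_zero [simp]: "conv f (\<lambda>_. 0) p = 0" "conv (\<lambda>_. 0) f p = 0" "conv f g 0 = 0"
 by (simp_all add: conv_def seg_int_def)

lemma conv_cmult: "conv (\<lambda>s. c * f s) g p = c * conv f g p" "conv f (\<lambda>s. c * g s) p = c * conv f g p"
 by (simp_all add: conv_def seg_int_def mult_ac set_lebesgue_integral_def
   flip: mult_scaleR_right mult_scaleR_left)

text \<open>A pair \<open>c \<delta> + f\<close> with \<open>f\<close> analytic on \<open>U\<close> is the Borel transform of the series \<open>w\<close> in \<open>1/x\<close>.\<close>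

definition HD :: "complex set \<Rightarrow> dfun \<Rightarrow> complex fps \<Rightarrow> bool"
 where "HD U F w \<longleftrightarrow> fst F = fps_nth w 0 \<and> snd F holomorphic_on U \<and>
  snd F has_fps_expansion bor 1 (fps_shift 1 w)"

lemma fps_const_X_shift: "w = fps_const (fps_nth w 0) + fps_X * fps_shift 1 (w :: 'a::comm_ring_1 fps)"
proof (intro fps_ext)
 fix n show "fps_nth w n = fps_nth (fps_const (fps_nth w 0) + fps_X * fps_shift 1 w) n" by (cases n) auto
qed

lemma fps_shift_const_X: "fps_shift 1 (fps_const c + fps_X * a) = (a :: 'a::comm_ring_1 fps)" by (simp add: fps_eq_iff)

text \<open>The function part of a product \<open>(c + \<xi> a)(d + \<xi> b)\<close> in the shape of
  \<open>dconv\<close>: two mixed terms with the delta parts, and one convolution, which costs a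
  factor \<open>\<xi>\<close>.\<close>

lemma fps_shift_mult: fixes w v :: "complex fps" shows "fps_shift 1 (w * v) = fps_const (fps_nth w 0) * fps_shift 1 v
  + fps_const (fps_nth v 0) * fps_shift 1 w + fps_X * (fps_shift 1 w * fps_shift 1 v)"
proof -
 have "w * v = fps_const (fps_nth w 0 * fps_nth v 0) + fps_X * (fps_const (fps_nth w 0) * fps_shift 1 v
  + fps_const (fps_nth v 0) * fps_shift 1 w + fps_X * (fps_shift 1 w * fps_shift 1 v))"
  apply (subst fps_const_X_shift[of w], subst fps_const_X_shift[of v])
  apply (simp only: fps_const_mult[symmetric]) by algebra
 then show ?thesis by (simp only: fps_shift_const_X)
qed

lemma HD_dconv: assumes U: "star_open U" and F: "HD U F w" and G: "HD U G v" shows "HD U (dconv F G) (w * v)"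
proof -
 have F: "fst F = fps_nth w 0" "snd F holomorphic_on U" "snd F has_fps_expansion bor 1 (fps_shift 1 w)"
  and G: "fst G = fps_nth v 0" "snd G holomorphic_on U" "snd G has_fps_expansion bor 1 (fps_shift 1 v)"
  using F G by (auto simp: HD_def)
 show ?thesis unfolding HD_def dconv_def fps_shift_mult bor_add bor_cmult prod.sel F(1) G(1) fps_mult_nth_0
  by (intro conjI refl holomorphic_intros conv_holomorphic has_fps_expansion_add
    has_fps_expansion_cmult_left conv_has_fps U F G)
qed

lemma HD_one: "HD U (1, \<lambda>p. 0) 1"
proof -
 have "fps_shift 1 (1 :: complex fps) = 0" by (simp add: fps_eq_iff)
 then show ?thesis by (auto simp: HD_def)
qed

lemma HD_add: "HD U F w \<Longrightarrow> HD U G v \<Longrightarrow> HD U (fst F + fst G, \<lambda>p. snd F p + snd G p) (w + v)"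
 by (auto simp: HD_def bor_add fps_shift_add intro!: holomorphic_intros has_fps_expansion_add)

lemma HD_cmult: assumes "HD U F w" shows "HD U (c * fst F, \<lambda>p. c * snd F p) (fps_const c * w)"
proof -
 have 1: "fps_shift 1 (fps_const c * w) = fps_const c * fps_shift 1 w" by (simp add: fps_eq_iff)
 show ?thesis using assms unfolding HD_def 1 bor_cmult by (auto intro!: holomorphic_intros has_fps_expansion_cmult_left)
qed

lemma HD_subset: "HD U F w \<Longrightarrow> V \<subseteq> U \<Longrightarrow> HD V F w"
 by (auto simp: HD_def intro: holomorphic_on_subset)

section \<open>Convolution products of many factors as products over a list of positions\<close>

definition idx :: "('n::{finite,linorder} \<Rightarrow> nat) \<Rightarrow> ('n \<times> nat) list"
 where "idx l = concat (map (\<lambda>i. map (Pair i) [1..<Suc (l i)]) (sorted_list_of_set UNIV))"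

lemma conv_prod_idx: "conv_prod l f = foldr dconv (map (\<lambda>(i, j). (0, f i j)) (idx l)) (1, \<lambda>p. 0)"
 unfolding conv_prod_def idx_def
 by (rule arg_cong[of _ _ "\<lambda>xs. foldr dconv xs _"]) (simp add: map_concat o_def del: upt_Suc)

lemma length_idx: "length (idx l) = msize l"
 by (simp add: idx_def msize_def length_concat o_def sum_list_distinct_conv_sum_set del: upt_Suc)

lemma idx_nonempty: "msize l \<noteq> 0 \<Longrightarrow> idx l \<noteq> []" by (metis length_idx list.size(3))

lemma set_idx: "set (idx l) = {(i, j). j \<in> {1..l i}}" by (force simp: idx_def simp del: upt_Suc)

lemma prod_list_concat_map: "prod_list (map f (concat xss)) = prod_list (map (\<lambda>xs. prod_list (map f xs)) xss)"
 by (induction xss) auto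

lemma prod_list_idx:
 "prod_list (map (\<lambda>(i, j). w i j) (idx l)) = (\<Prod>i\<in>UNIV. \<Prod>j\<in>{1..l i}. (w i j :: 'a::comm_monoid_mult))"
proof -
 have "prod_list (map (\<lambda>(i, j). w i j) (idx l)) =
  prod_list (map (\<lambda>i. prod_list (map (w i) [1..<Suc (l i)])) (sorted_list_of_set UNIV))"
  unfolding idx_def prod_list_concat_map by (simp add: o_def del: upt_Suc)
 also have "\<dots> = (\<Prod>i\<in>UNIV. prod_list (map (w i) [1..<Suc (l i)]))"
  by (subst prod.distinct_set_conv_list[symmetric]) auto
 also have "\<dots> = (\<Prod>i\<in>UNIV. \<Prod>j\<in>{1..l i}. w i j)"
  by (intro prod.cong refl, subst prod.distinct_set_conv_list[symmetric])
   (auto simp: atLeastLessThanSuc_atLeastAtMost simp del: upt_Suc)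
 finally show ?thesis .
qed

lemma sum_list_concat_map: "sum_list (map f (concat xss)) = sum_list (map (\<lambda>xs. sum_list (map f xs)) xss)"
 by (induction xss) auto

lemma sum_list_idx:
 "sum_list (map (\<lambda>(i, j). w i j) (idx l)) = (\<Sum>i\<in>UNIV. \<Sum>j\<in>{1..l i}. (w i j :: 'a::comm_monoid_add))"
proof -
 have "sum_list (map (\<lambda>(i, j). w i j) (idx l)) =
  sum_list (map (\<lambda>i. sum_list (map (w i) [1..<Suc (l i)])) (sorted_list_of_set UNIV))"
  unfolding idx_def sum_list_concat_map by (simp add: o_def del: upt_Suc)
 also have "\<dots> = (\<Sum>i\<in>UNIV. sum_list (map (w i) [1..<Suc (l i)]))"
  by (subst sum.distinct_set_conv_list[symmetric]) auto
 also have "\<dots> = (\<Sum>i\<in>UNIV. \<Sum>j\<in>{1..l i}. w i j)"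
  by (intro sum.cong refl, subst sum.distinct_set_conv_list[symmetric])
   (auto simp: atLeastLessThanSuc_atLeastAtMost simp del: upt_Suc)
 finally show ?thesis .
qed

lemma HD_foldr: assumes "star_open U" "\<And>x. x \<in> set xs \<Longrightarrow> HD U (F x) (w x)"
 shows "HD U (foldr dconv (map F xs) (1, \<lambda>p. 0)) (prod_list (map w xs))"
 using assms(2) by (induction xs) (auto intro: HD_one HD_dconv[OF assms(1)])

lemma HD_conv_pow: assumes "star_open U" "\<And>i. HD U (0, \<lambda>p. Y p $ i) (w i)"
 shows "HD U (conv_pow Y l) (\<Prod>i\<in>UNIV. w i ^ l i)"
proof -
 have "HD U (conv_pow Y l) (prod_list (map (\<lambda>(i, j). w i) (idx l)))" unfolding conv_pow_def conv_prod_idx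
  by (rule HD_foldr[OF assms(1)]) (auto intro: assms(2))
 then show ?thesis by (simp only: prod_list_idx) simp
qed

section \<open>Borel transforms with a complex power of p along a ray\<close>

lemma ray_power_minus: "p \<noteq> 0 \<Longrightarrow> p \<in> ray th \<Longrightarrow> ray_power th s p = p * ray_power th (s - 1) p"
proof -
 assume p: "p \<noteq> 0" "p \<in> ray th"
 then obtain t where t: "p = of_real t * cis th" "t > 0" by (auto simp: ray_def order_le_less)
 have "exp (Complex (ln (cmod p)) th) = p"
 proof -
  have "Complex (ln (cmod p)) th = of_real (ln t) + \<i> * of_real th"
  proof -
   have "cmod p = t" using t by (simp add: norm_mult)
   then show ?thesis by (simp add: complex_eq_iff)
  qed
  then show ?thesis using t by (simp add: exp_add cis_conv_exp exp_of_real)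
 qed
 then show ?thesis unfolding ray_power_def left_diff_distrib exp_diff using p(1) by (simp only: mult_1) simp
qed

lemma ray_power_scale: assumes "0 < u" "p \<noteq> 0" shows "ray_power th s (of_real u * p) = of_real u powr s * ray_power th s p"
proof -
 have "Complex (ln (cmod (of_real u * p))) th = of_real (ln u) + Complex (ln (cmod p)) th"
  using assms by (simp add: complex_eq_iff norm_mult ln_mult)
 then show ?thesis using assms by (simp add: ray_power_def powr_def Ln_of_real exp_add distrib_left)
qed

lemma ray_power_add: "ray_power th (s + s') p = ray_power th s p * ray_power th s' p"
 by (simp add: ray_power_def exp_add distrib_right)

lemma ray_power_0 [simp]: "ray_power th 0 p = 1" by (simp add: ray_power_def)

text \<open>\<open>F\<close> is, on \<open>ray th\<close>, the Borel transform of \<open>x^(-s) w(1/x)\<close>.\<close>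

definition RB :: "real \<Rightarrow> complex set \<Rightarrow> complex \<Rightarrow> complex fps \<Rightarrow> (complex \<Rightarrow> complex) \<Rightarrow> bool"
 where "RB th U s w F \<longleftrightarrow> (\<exists>A. A holomorphic_on U \<and> A has_fps_expansion bor s w \<and>
  (\<forall>p\<in>ray th - {0}. F p = ray_power th (s - 1) p * A p))"

lemma ray_scale: "p \<in> ray th - {0} \<Longrightarrow> 0 < u \<Longrightarrow> of_real u * p \<in> ray th - {0}"
 unfolding ray_def
proof (elim DiffE CollectE exE conjE)
 fix t assume "p \<notin> {0}" "0 < u" "p = of_real t * cis th" "0 \<le> t"
 then show "of_real u * p \<in> {of_real t * cis th |t. 0 \<le> t} - {0}" by (auto intro!: exI[of _ "u * t"])
qed

lemma RB_add: "RB th U s w F \<Longrightarrow> RB th U s v G \<Longrightarrow> RB th U s (w + v) (\<lambda>p. F p + G p)"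
 unfolding RB_def by (elim exE conjE, rule_tac x = "\<lambda>p. A p + Aa p" in exI)
  (auto intro!: holomorphic_intros has_fps_expansion_add simp: bor_add algebra_simps)

lemma RB_diff: "RB th U s w F \<Longrightarrow> RB th U s v G \<Longrightarrow> RB th U s (w - v) (\<lambda>p. F p - G p)"
 unfolding RB_def by (elim exE conjE, rule_tac x = "\<lambda>p. A p - Aa p" in exI)
  (auto intro!: holomorphic_intros has_fps_expansion_diff simp: bor_diff algebra_simps)

lemma RB_cmult: "RB th U s w F \<Longrightarrow> RB th U s (fps_const c * w) (\<lambda>p. c * F p)"
 unfolding RB_def by (elim exE conjE, rule_tac x = "\<lambda>p. c * A p" in exI)
  (auto intro!: holomorphic_intros has_fps_expansion_cmult_left simp: bor_cmult mult.left_commute)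

lemma RB_zero: "RB th U s 0 (\<lambda>p. 0)" unfolding RB_def by (rule exI[of _ "\<lambda>p. 0"]) auto

lemma RB_sum: "finite S \<Longrightarrow> (\<And>x. x \<in> S \<Longrightarrow> RB th U s (w x) (F x)) \<Longrightarrow>
  RB th U s (\<Sum>x\<in>S. w x) (\<lambda>p. \<Sum>x\<in>S. F x p)"
 by (induction S rule: finite_induct) (auto intro: RB_zero RB_add)

lemma RB_subset: "RB th U s w F \<Longrightarrow> V \<subseteq> U \<Longrightarrow> RB th V s w F"
 unfolding RB_def by (blast intro: holomorphic_on_subset)

lemma RB_shift: "RB th U (s + 1) w F \<Longrightarrow> RB th U s (fps_X * w) F"
 unfolding RB_def by (elim exE conjE, rule_tac x = "\<lambda>p. p * A p" in exI)
  (auto intro!: holomorphic_intros has_fps_bor_shift simp: ray_power_minus[of _ _ s] algebra_simps)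

lemma RB_HD: "HD U F w \<Longrightarrow> RB th U 1 (fps_shift 1 w) (snd F)" unfolding RB_def HD_def by auto

lemma RB_conv: assumes U: "star_open U" and F: "RB th U s w F" and G: "RB th U s' v G" and s: "Re s > 0" "Re s' > 0"
 shows "RB th U (s + s') (w * v) (conv F G)"
proof -
 obtain A where A: "A holomorphic_on U" "A has_fps_expansion bor s w"
  "\<And>p. p \<in> ray th - {0} \<Longrightarrow> F p = ray_power th (s - 1) p * A p" using F unfolding RB_def by blast
 obtain B where B: "B holomorphic_on U" "B has_fps_expansion bor s' v"
  "\<And>p. p \<in> ray th - {0} \<Longrightarrow> G p = ray_power th (s' - 1) p * B p" using G unfolding RB_def by blast
 have "conv F G p = ray_power th (s + s' - 1) p * bconv s s' A B p" if p: "p \<in> ray th - {0}" for p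
 proof -
  have p0: "p \<noteq> 0" using p by auto
  have "(LINT u:{0..1}|lebesgue. F (of_real u * p) * G (p - of_real u * p))
   = (LINT u:{0..1}|lebesgue. (ray_power th (s - 1) p * ray_power th (s' - 1) p) *
     (beta_kernel s s' u * (A (of_real u * p) * B (of_real (1 - u) * p))))"
  \<comment> \<open>By \<open>ray_power_scale\<close> the powers of \<open>u\<close> and
    \<open>1 - u\<close> form the Beta kernel, and the powers of \<open>p\<close> leave the
    integral.\<close>
  proof (rule set_LINT_unit_cong)
   fix u :: real assume u: "0 < u" "u < 1"
   have 1: "p - of_real u * p = of_real (1 - u) * p" by (simp add: algebra_simps)
   have "of_real u * p \<in> ray th - {0}" "of_real (1 - u) * p \<in> ray th - {0}"
    using u p ray_scale[of p th u] ray_scale[of p th "1 - u"] by auto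
   then show "F (of_real u * p) * G (p - of_real u * p) = (ray_power th (s - 1) p * ray_power th (s' - 1) p) *
     (beta_kernel s s' u * (A (of_real u * p) * B (of_real (1 - u) * p)))"
    unfolding 1 using u p0 by (simp add: A(3) B(3) ray_power_scale beta_kernel_def del: of_real_diff)
  qed
  then have "conv F G p = p * (ray_power th (s - 1) p * ray_power th (s' - 1) p) * bconv s s' A B p"
   by (simp add: conv_def seg_int_def bconv_def)
  also have "p * (ray_power th (s - 1) p * ray_power th (s' - 1) p) = ray_power th (s + s' - 1) p"
   using p ray_power_minus[of p th "s + s' - 1"] by (simp flip: ray_power_add add: algebra_simps)
  finally show ?thesis .
 qed
 then show ?thesis unfolding RB_def
  by (intro exI[of _ "bconv s s' A B"] conjI bconv_holomorphic[OF U A(1) B(1) s] bconv_has_fps[OF A(2) B(2) s]) auto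
qed

lemma RB_dconv: assumes U: "star_open U" and F: "HD U F w" and G: "RB th U s v G" and s: "Re s > 0"
 shows "RB th U s (w * v) (snd (dconv F (0, G)))"
proof -
 have "RB th U (s + 1) (fps_shift 1 w * v) (conv (snd F) G)" using RB_conv[OF U RB_HD[OF F] G] s by (simp add: add.commute)
 from RB_add[OF RB_cmult[OF G, of "fst F"] RB_shift[OF this]]
 have "RB th U s (fps_const (fst F) * v + fps_X * (fps_shift 1 w * v)) (snd (dconv F (0, G)))" by (simp add: dconv_def)
 moreover have "fps_const (fst F) * v + fps_X * (fps_shift 1 w * v) = w * v"
  using F by (subst (4) fps_const_X_shift) (simp add: HD_def algebra_simps)
 ultimately show ?thesis by simp
qed

lemma RB_one: "RB th U 1 1 (\<lambda>_. 1)"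
proof -
 have "bor 1 1 = 1" by (simp add: fps_eq_iff)
 then show ?thesis unfolding RB_def by (intro exI[of _ "\<lambda>_. 1"]) auto
qed

lemma seg_int_eq_conv: "seg_int F p = conv F (\<lambda>_. 1) p" by (simp add: conv_def)

lemma RB_seg_int: assumes "star_open U" "RB th U s w F" "Re s > 0" shows "RB th U s (fps_X * w) (seg_int F)"
 using RB_shift[of th U s w "conv F (\<lambda>_. 1)"] RB_conv[OF assms(1,2) RB_one assms(3)]
 by (simp add: seg_int_eq_conv[abs_def])

text \<open>Multiplication by \<open>p\<close> is the Borel counterpart of \<open>-d/dx\<close>:
  applied to \<open>x^(-s) w(\<xi>)\<close> with \<open>\<xi> = 1/x\<close>, this gives
  \<open>x^(-s) (\<xi>^2 w' + s \<xi> w)\<close>. In coefficients it is the functional equation of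
  Gamma.\<close>

lemma bor_deriv: "fps_X * bor s w = bor s (fps_X^2 * fps_deriv w + fps_const s * fps_X * w)"
proof (intro fps_ext)
 fix m show "fps_nth (fps_X * bor s w) m = fps_nth (bor s (fps_X^2 * fps_deriv w + fps_const s * fps_X * w)) m"
 proof (cases m)
  case (Suc n)
  have "fps_nth (fps_X^2 * fps_deriv w) (Suc n) = of_nat n * fps_nth w n" by (cases n) (simp_all add: power2_eq_square mult.assoc)
  then have "fps_nth (fps_X^2 * fps_deriv w + fps_const s * fps_X * w) (Suc n) = (s + of_nat n) * fps_nth w n"
   by (simp add: algebra_simps mult.assoc)
  moreover have "(s + of_nat n) * rGamma (s + of_nat (Suc n)) = rGamma (s + of_nat n)"
   using rGamma_plus1[of "s + of_nat n"] by (simp add: add_ac)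
  ultimately show ?thesis using Suc by (simp add: mult_ac)
 qed simp
qed

lemma RB_mult_p:
 "RB th U s w F \<Longrightarrow> RB th U s (fps_X^2 * fps_deriv w + fps_const s * fps_X * w) (\<lambda>p. p * F p)"
 unfolding RB_def by (elim exE conjE, rule_tac x = "\<lambda>p. p * A p" in exI)
  (auto intro!: holomorphic_intros has_fps_expansion_mult has_fps_expansion_fps_X simp flip: bor_deriv)

text \<open>Functions with the same series have analytic factors with the same expansion at 0, hence
  agree along the whole ray. This is how formal identities become identities of functions.\<close>

lemma RB_unique:
 assumes U: "star_open U" "ray th \<subseteq> U" and F: "RB th U s w F" and G: "RB th U s w G" and p: "p \<in> ray th - {0}"
 shows "F p = G p"
proof -
 obtain A where A: "A holomorphic_on U" "A has_fps_expansion bor s (w - w)"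
  "\<And>p. p \<in> ray th - {0} \<Longrightarrow> F p - G p = ray_power th (s - 1) p * A p"
  using RB_diff[OF F G] unfolding RB_def by blast
 have "A p = 0" using A p U by (intro has_fps_expansion_0_analytic_continuation[of A U])
   (auto intro: star_openD star_open_connected)
 then show ?thesis using A(3)[OF p] by simp
qed

text \<open>The exponents of the factors add up. The empty list is excluded because its product is a
  pure delta.\<close>

lemma RB_foldr:
 assumes U: "star_open U" and "xs \<noteq> []" "\<And>x. x \<in> set xs \<Longrightarrow> RB th U (s x) (w x) (F x) \<and> Re (s x) > 0"
 shows "fst (foldr dconv (map (\<lambda>x. (0, F x)) xs) (1, \<lambda>p. 0)) = 0 \<and>
  RB th U (sum_list (map s xs)) (prod_list (map w xs)) (snd (foldr dconv (map (\<lambda>x. (0, F x)) xs) (1, \<lambda>p. 0)))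
  \<and> Re (sum_list (map s xs)) > 0" using assms(2,3)
proof (induction xs rule: induct_list012)
 case (2 x)
 then show ?case by (auto simp: dconv_def)
next
 case (3 x y zs)
 let ?G = "foldr dconv (map (\<lambda>x. (0, F x)) (y # zs)) (1, \<lambda>p. 0)"
 have G: "fst ?G = 0" "RB th U (sum_list (map s (y # zs))) (prod_list (map w (y # zs))) (snd ?G)"
  "Re (sum_list (map s (y # zs))) > 0" using 3 by (auto simp del: foldr.simps list.map)
 have "RB th U (s x + sum_list (map s (y # zs))) (w x * prod_list (map w (y # zs))) (conv (F x) (snd ?G))"
  using "3.prems"(2)[of x] G by (intro RB_conv[OF U]) auto
 moreover have "foldr dconv (map (\<lambda>x. (0, F x)) (x # y # zs)) (1, \<lambda>p. 0) = dconv (0, F x) ?G" by simp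
 moreover have "snd (dconv (0, F x) ?G) = conv (F x) (snd ?G)" "fst (dconv (0, F x) ?G) = 0" using G(1) by (auto simp: dconv_def)
 ultimately show ?case using G(3) "3.prems"(2)[of x] by (simp del: foldr.simps)
qed simp

section \<open>Bounds on the coefficients of the system and on their Borel transforms\<close>

lemma abs_summable_complex: "(f :: 'a \<Rightarrow> complex) summable_on A \<Longrightarrow> (\<lambda>x. norm (f x)) summable_on A"
 by (simp add: summable_on_iff_abs_summable_on_complex)

lemma summable_on_le_real: fixes f g :: "'a \<Rightarrow> real"
 assumes "g summable_on A" "\<And>x. x \<in> A \<Longrightarrow> 0 \<le> f x" "\<And>x. x \<in> A \<Longrightarrow> f x \<le> g x"
 shows "f summable_on A" using assms(1) by (rule summable_on_comparison_test) (use assms in auto)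

lemma summable_on_finite_sum: fixes f :: "'i \<Rightarrow> 'a \<Rightarrow> 'b::{topological_comm_monoid_add}"
 assumes "\<And>i. i \<in> I \<Longrightarrow> f i summable_on A" shows "(\<lambda>x. \<Sum>i\<in>I. f i x) summable_on A"
 using assms by (induction I rule: infinite_finite_induct) (auto intro: summable_on_add)

text \<open>Unconditional convergence of complex series is absolute, so the expansion of
  \<open>g\<close> at one point with all arguments equal to \<open>\<rho>\<close> bounds every
  coefficient. Summing over \<open>m\<close> alone leaves \<open>K l\<close>, still summable against
  \<open>\<rho>^|l|\<close>.\<close>

lemma coeff_bounds: fixes lam b :: "'n::{finite,linorder} cvec" assumes "normal_form lam b f0 fc g gc"
 obtains \<rho> K where "\<rho> > 0" "\<And>l. K l \<ge> (0::real)" "(\<lambda>l. K l * \<rho> ^ msize l) summable_on UNIV"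
  "\<And>m l i. norm (gc m l $ i) \<le> K l / \<rho> ^ m"
proof -
 obtain r where r: "r > 0" and hs: "\<And>\<xi> y. 0 < cmod \<xi> \<Longrightarrow> cmod \<xi> < r \<Longrightarrow> norm (y :: 'n cvec) < r \<Longrightarrow>
    ((\<lambda>(m, l). (\<xi>^m * (\<Prod>i\<in>UNIV. (y $ i)^(l i))) *s gc m l) has_sum g (inverse \<xi>) y) UNIV"
  using assms unfolding normal_form_def by meson
 \<comment> \<open>A vector with all components equal to this \<open>\<rho>\<close> has norm at most
   \<open>CARD('n) * \<rho> = r / 2\<close>.\<close>
 define \<rho> where "\<rho> = r / (2 * real CARD('n))"
 have card: "real CARD('n) \<ge> 1" by (simp add: Suc_leI)
 have \<rho>: "\<rho> > 0" using r card by (simp add: \<rho>_def)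
 have "\<rho> < r" proof -
  have "\<rho> \<le> r / 2" unfolding \<rho>_def using r card by (intro divide_left_mono) auto
  then show ?thesis using r by linarith
 qed
 define y :: "'n cvec" where "y = (\<chi> i. of_real \<rho>)"
 have "norm y \<le> (\<Sum>i\<in>UNIV. norm (y $ i))" unfolding norm_vec_def by (rule L2_set_le_sum) auto
 also have "\<dots> = real CARD('n) * \<rho>" using \<rho> by (simp add: y_def)
 also have "\<dots> < r" using r card by (simp add: \<rho>_def)
 finally have "norm y < r" .
 have pw: "(\<Prod>i\<in>UNIV. (y $ i) ^ (l i)) = of_real (\<rho> ^ msize l)" for l :: "'n \<Rightarrow> nat"
  by (simp add: y_def msize_def power_sum)
 have "((\<lambda>(m, l). (of_real \<rho>^m * (\<Prod>i\<in>UNIV. (y $ i)^(l i))) *s gc m l) has_sum g (inverse (of_real \<rho>)) y) UNIV"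
  using \<rho> \<open>\<rho> < r\<close> \<open>norm y < r\<close> by (intro hs) auto
 then have sm: "(\<lambda>(m, l). (of_real \<rho>^m * of_real (\<rho> ^ msize l)) *s gc m l) summable_on UNIV"
  unfolding pw by (rule has_sum_imp_summable)
 have s1: "(\<lambda>(m, l). norm (gc m l $ i) * \<rho> ^ m * \<rho> ^ msize l) summable_on UNIV" for i
 proof -
  have "(\<lambda>x. (case x of (m, l) \<Rightarrow> (of_real \<rho>^m * of_real (\<rho> ^ msize l)) *s gc m l) $ i) summable_on UNIV"
   by (rule summable_on_bounded_linear[OF bounded_linear_vec_nth sm])
  from abs_summable_complex[OF this] show ?thesis using \<rho> by (simp add: case_prod_unfold norm_mult norm_power mult_ac)
 qed
 define a where "a l m = (\<Sum>i\<in>UNIV. norm (gc m l $ i)) * \<rho> ^ m * \<rho> ^ msize l" for l m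
 have "(\<lambda>x. \<Sum>i\<in>UNIV. case x of (m, l) \<Rightarrow> norm (gc m l $ i) * \<rho> ^ m * \<rho> ^ msize l) summable_on UNIV"
  by (intro summable_on_finite_sum s1)
 then have s2: "(\<lambda>(m, l). a l m) summable_on UNIV" by (simp add: a_def case_prod_unfold sum_distrib_right)
 have "(\<lambda>(l, m). a l m) summable_on (UNIV \<times> UNIV)"
 proof -
  have "bij_betw prod.swap (UNIV :: (('n \<Rightarrow> nat) \<times> nat) set) UNIV" by simp
  from summable_on_reindex_bij_betw[OF this, of "\<lambda>(m, l). a l m"] s2 show ?thesis
   by (simp add: case_prod_unfold prod.swap_def)
 qed
 then have abs: "(\<lambda>x. norm (case x of (l, m) \<Rightarrow> a l m)) summable_on (Sigma UNIV (\<lambda>_. UNIV))"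
  by (rule summable_on_iff_abs_summable_on_real[THEN iffD1])
 have a0: "a l m \<ge> 0" for l m using \<rho> by (auto simp: a_def intro!: mult_nonneg_nonneg sum_nonneg)
 have s3: "(\<lambda>m. a l m) summable_on UNIV" "(\<lambda>l. \<Sum>\<^sub>\<infinity>m. a l m) summable_on UNIV" for l
  using abs[unfolded Infinite_Sum.abs_summable_on_Sigma_iff] by (simp_all add: a0 infsum_nonneg)
 show thesis
 proof
  show "\<rho> > 0" by fact
  define K where "K l = (\<Sum>\<^sub>\<infinity>m. a l m) / \<rho> ^ msize l" for l
  show "K l \<ge> 0" for l using \<rho> a0 by (auto simp: K_def infsum_nonneg)
  show "(\<lambda>l. K l * \<rho> ^ msize l) summable_on UNIV" using s3 \<rho> by (simp add: K_def)
  show "norm (gc m l $ i) \<le> K l / \<rho> ^ m" for m l i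
  proof -
   have "norm (gc m l $ i) \<le> (\<Sum>i\<in>UNIV. norm (gc m l $ i))" by (rule member_le_sum) auto
   then have "norm (gc m l $ i) * \<rho> ^ m * \<rho> ^ msize l \<le> a l m"
    using \<rho> by (auto simp: a_def intro!: mult_right_mono)
   also have "\<dots> = (\<Sum>\<^sub>\<infinity>m\<in>{m}. a l m)" by simp
   also have "\<dots> \<le> (\<Sum>\<^sub>\<infinity>m. a l m)" using s3 a0 by (intro infsum_mono2) auto
   finally show ?thesis using \<rho> by (simp add: K_def field_simps)
  qed
 qed
qed

lemma inhom_bounds: fixes lam b :: "'n::{finite,linorder} cvec" assumes "normal_form lam b f0 fc g gc"
 obtains C R where "R > 0" "C \<ge> 0" "\<And>m i. norm (fc m $ i) \<le> C * R ^ m"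
proof -
 obtain r where r: "r > 0" and hs: "\<And>\<xi>. 0 < cmod \<xi> \<Longrightarrow> cmod \<xi> < r \<Longrightarrow>
    ((\<lambda>m. \<xi>^m *s fc m) has_sum f0 (inverse \<xi>)) UNIV" using assms unfolding normal_form_def by meson
 define \<rho> where "\<rho> = r / 2"
 have \<rho>: "\<rho> > 0" "\<rho> < r" using r by (auto simp: \<rho>_def)
 have sm: "(\<lambda>m. of_real \<rho>^m *s fc m) summable_on UNIV" by (rule has_sum_imp_summable[OF hs]) (use \<rho> in auto)
 have "(\<lambda>m. norm (fc m $ i) * \<rho> ^ m) summable_on UNIV" for i
  using abs_summable_complex[OF summable_on_bounded_linear[OF bounded_linear_vec_nth sm, of i]] \<rho>
  by (simp add: norm_mult norm_power mult_ac)
 then have s: "(\<lambda>m. \<Sum>i\<in>UNIV. norm (fc m $ i) * \<rho> ^ m) summable_on UNIV" by (intro summable_on_finite_sum)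
 define C where "C = (\<Sum>\<^sub>\<infinity>m. \<Sum>i\<in>UNIV. norm (fc m $ i) * \<rho> ^ m)"
 show thesis
 proof
  show "1 / \<rho> > 0" using \<rho> by simp
  show "C \<ge> 0" using \<rho> by (auto simp: C_def intro!: infsum_nonneg sum_nonneg)
  show "norm (fc m $ i) \<le> C * (1 / \<rho>) ^ m" for m i
  proof -
   have "norm (fc m $ i) * \<rho> ^ m \<le> (\<Sum>i\<in>UNIV. norm (fc m $ i) * \<rho> ^ m)"
    using \<rho> by (intro member_le_sum) auto
   also have "\<dots> = (\<Sum>\<^sub>\<infinity>m\<in>{m}. \<Sum>i\<in>UNIV. norm (fc m $ i) * \<rho> ^ m)" by simp
   also have "\<dots> \<le> C" unfolding C_def using s \<rho> by (intro infsum_mono2) (auto intro!: sum_nonneg)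
   finally show ?thesis using \<rho> by (simp add: field_simps)
  qed
 qed
qed

text \<open>Factorials turn geometric growth of the coefficients into an entire function of
  exponential type \<open>R\<close>.\<close>

lemma entire_borel: fixes c :: "nat \<Rightarrow> complex" assumes c: "\<And>m. norm (c m) \<le> C * R ^ m" and R: "R \<ge> 0"
 defines "f \<equiv> \<lambda>p. \<Sum>m. c m * p ^ m / fact m"
 shows "(\<lambda>m. c m * p ^ m / fact m) sums f p" "f holomorphic_on U" "f has_fps_expansion bor 1 (Abs_fps c)"
  "norm (f p) \<le> C * exp (R * norm p)"
proof -
 have C: "C \<ge> 0" using c[of 0] by (metis mult.right_neutral norm_ge_zero order_trans power_0)
 have E: "(\<lambda>m. (R * norm p) ^ m / fact m) sums exp (R * norm p)" for p :: complex
  using exp_converges[of "R * norm p"] by (simp add: field_simps)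
 have le: "norm (c m * p ^ m / fact m) \<le> C * ((R * norm p) ^ m / fact m)" for p m
 proof -
  have "norm (c m) * norm p ^ m \<le> C * R ^ m * norm p ^ m" by (intro mult_right_mono c) auto
  then show ?thesis by (simp add: norm_mult norm_divide norm_power power_mult_distrib divide_right_mono mult.assoc)
 qed
 have sn: "summable (\<lambda>m. norm (c m * p ^ m / fact m))" for p
  by (rule summable_comparison_test'[OF summable_mult[OF sums_summable[OF E[of p]], of C]]) (use le in simp)
 have S: "(\<lambda>m. c m * p ^ m / fact m) sums f p" for p
  unfolding f_def using summable_norm_cancel[OF sn] by (rule summable_sums)
 show "(\<lambda>m. c m * p ^ m / fact m) sums f p" by (rule S)
 have b: "fps_nth (bor 1 (Abs_fps c)) m * p ^ m = c m * p ^ m / fact m" for m p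
  using Gamma_fact[of m, where 'a = complex] by (simp add: rGamma_inverse_Gamma field_simps)
 have S': "(\<lambda>m. fps_nth (bor 1 (Abs_fps c)) m * p ^ m) sums f p" for p using S unfolding b .
 then show "f has_fps_expansion bor 1 (Abs_fps c)" by (intro has_fps_expansionI always_eventually allI)
 have "fps_conv_radius (bor 1 (Abs_fps c)) = \<infinity>"
  unfolding fps_conv_radius_def by (rule conv_radius_inftyI'', rule sums_summable[OF S'])
 then have "eval_fps (bor 1 (Abs_fps c)) holomorphic_on U" by (intro holomorphic_on_eval_fps) auto
 moreover have "eval_fps (bor 1 (Abs_fps c)) = f" using sums_unique[OF S'] by (auto simp: eval_fps_def fun_eq_iff)
 ultimately show "f holomorphic_on U" by simp
 have "norm (f p) \<le> (\<Sum>m. norm (c m * p ^ m / fact m))" unfolding f_def by (rule summable_norm[OF sn])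
 also have "\<dots> \<le> (\<Sum>m. C * ((R * norm p) ^ m / fact m))"
  by (intro suminf_le le sn summable_mult sums_summable[OF E])
 also have "\<dots> = C * exp (R * norm p)" using sums_mult[OF E[of p], of C] by (simp add: sums_iff)
 finally show "norm (f p) \<le> C * exp (R * norm p)" .
qed

definition Gfps :: "(nat \<Rightarrow> ('n \<Rightarrow> nat) \<Rightarrow> 'n::finite cvec) \<Rightarrow> ('n \<Rightarrow> nat) \<Rightarrow> 'n \<Rightarrow> complex fps"
 where "Gfps gc l i = Abs_fps (\<lambda>m. gc m l $ i)"

lemma Gl_props: assumes \<rho>: "\<rho> > 0" and K: "\<And>m. norm (gc m l $ i) \<le> K / \<rho> ^ m"
 shows "HD U (gc 0 l $ i, Gl gc l i) (Gfps gc l i)"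
  "norm (Gl gc l i p) \<le> K / \<rho> * exp (norm p / \<rho>)"
proof -
 have c: "norm (gc (m + 1) l $ i) \<le> K / \<rho> * (1 / \<rho>) ^ m" for m
  using K[of "m + 1"] by (simp add: power_one_over field_simps)
 have R: "1 / \<rho> \<ge> 0" using \<rho> by simp
 have sh: "fps_shift 1 (Gfps gc l i) = Abs_fps (\<lambda>m. gc (m + 1) l $ i)" by (simp add: Gfps_def fps_eq_iff)
 have eq: "Gl gc l i = (\<lambda>p. \<Sum>m. gc (m + 1) l $ i * p ^ m / fact m)" by (simp add: Gl_def fun_eq_iff)
 show "HD U (gc 0 l $ i, Gl gc l i) (Gfps gc l i)" unfolding HD_def sh eq prod.sel
  using entire_borel(2)[OF c R] entire_borel(3)[OF c R] by (auto simp: Gfps_def)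
 show "norm (Gl gc l i p) \<le> K / \<rho> * exp (norm p / \<rho>)" using entire_borel(4)[OF c R, of p] unfolding eq by simp
qed

text \<open>The series starts with the first power of \<open>p\<close>, and the bound keeps the
  factor \<open>norm p\<close>: with it the inhomogeneous term becomes small in sup norms of large
  exponential weight.\<close>

lemma F0_props: assumes R: "R > 0" and K: "\<And>m. norm (fc m $ i) \<le> C * R ^ m" and z: "fc 0 = 0" "fc (Suc 0) = 0"
 shows "HD U (0, \<lambda>p. F0 fc p i) (Abs_fps (\<lambda>m. fc m $ i))"
  "norm (F0 fc p i) \<le> C * R^2 * norm p * exp (R * norm p)"
proof -
 have C: "C \<ge> 0" using K[of 0] by (metis mult.right_neutral norm_ge_zero order_trans power_0)
 define c1 where "c1 m = fc (m + 1) $ i" for m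
 define c2 where "c2 m = fc (m + 2) $ i / of_nat (Suc m)" for m
 have k1: "norm (c1 m) \<le> (C * R) * R ^ m" for m using K[of "m + 1"] by (simp add: mult_ac c1_def)
 have k2: "norm (c2 m) \<le> (C * R^2) * R ^ m" for m
 proof -
  have "norm (c2 m) \<le> norm (fc (m + 2) $ i) / 1" unfolding c2_def norm_divide norm_of_nat by (rule divide_left_mono) auto
  then show ?thesis using K[of "m + 2"] by (simp add: power2_eq_square mult_ac)
 qed
 have R0: "R \<ge> 0" using R by simp
 have T: "fc (m + 2) $ i * p ^ (m + 1) / fact (m + 1) = c1 (Suc m) * p ^ Suc m / fact (Suc m)" for m p by (simp add: c1_def)
 have T2: "fc (m + 2) $ i * p ^ (m + 1) / fact (m + 1) = p * (c2 m * p ^ m / fact m)" for m p by (simp add: c2_def field_simps)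
 have eq1: "(\<lambda>p. F0 fc p i) = (\<lambda>p. \<Sum>m. c1 m * p ^ m / fact m)"
 proof
  fix p
  have "c1 0 = 0" using z by (simp add: c1_def)
  then show "F0 fc p i = (\<Sum>m. c1 m * p ^ m / fact m)" unfolding F0_def T using entire_borel(1)[OF k1 R0, of p]
   by (subst suminf_split_head) (auto simp: sums_iff)
 qed
 have eq2: "F0 fc p i = p * (\<Sum>m. c2 m * p ^ m / fact m)" for p unfolding F0_def T2 using entire_borel(1)[OF k2 R0, of p]
  by (subst suminf_mult) (auto simp: sums_iff)
 have sh: "fps_shift 1 (Abs_fps (\<lambda>m. fc m $ i)) = Abs_fps c1" by (simp add: c1_def fps_eq_iff)
 show "HD U (0, \<lambda>p. F0 fc p i) (Abs_fps (\<lambda>m. fc m $ i))" unfolding HD_def sh prod.sel eq1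
  using entire_borel(2)[OF k1 R0] entire_borel(3)[OF k1 R0] z by auto
 show "norm (F0 fc p i) \<le> C * R^2 * norm p * exp (R * norm p)"
  using mult_left_mono[OF entire_borel(4)[OF k2 R0, of p], of "norm p"] unfolding eq2 by (simp add: norm_mult mult_ac)
qed

text \<open>Weierstrass M-test along the net of finite subsets. Derivatives converge as well, which
  lets Taylor coefficients at 0 be summed termwise.\<close>

lemma holomorphic_infsum: fixes f :: "'a \<Rightarrow> complex \<Rightarrow> complex"
 assumes U: "open U" and hol: "\<And>l. l \<in> S \<Longrightarrow> f l holomorphic_on U"
  and bd: "\<And>K. compact K \<Longrightarrow> K \<subseteq> U \<Longrightarrow> \<exists>M. M summable_on S \<and> (\<forall>l\<in>S. \<forall>p\<in>K. norm (f l p) \<le> M l)"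
 shows "(\<lambda>p. \<Sum>\<^sub>\<infinity>l\<in>S. f l p) holomorphic_on U"
  and "p0 \<in> U \<Longrightarrow> ((\<lambda>l. (deriv ^^ m) (f l) p0) has_sum (deriv ^^ m) (\<lambda>p. \<Sum>\<^sub>\<infinity>l\<in>S. f l p) p0) S"
proof -
 let ?F = "finite_subsets_at_top S"
 have hs: "(\<lambda>p. \<Sum>l\<in>X. f l p) holomorphic_on U" if "X \<subseteq> S" for X
  using that hol by (intro holomorphic_on_sum) auto
 have fin: "eventually (\<lambda>X. finite X \<and> X \<subseteq> S) ?F" by (simp add: eventually_finite_subsets_at_top_weakI)
 have ul: "uniform_limit K (\<lambda>X p. \<Sum>l\<in>X. f l p) (\<lambda>p. \<Sum>\<^sub>\<infinity>l\<in>S. f l p) ?F"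
  if "compact K" "K \<subseteq> U" for K using bd[OF that] by (auto intro: Weierstrass_m_test_general)
 have "\<exists>r>0. cball p r \<subseteq> U" if "p \<in> U" for p using U that open_contains_cball by blast
 have loc: "\<exists>r>0. cball p r \<subseteq> U \<and> (\<lambda>p. \<Sum>\<^sub>\<infinity>l\<in>S. f l p) holomorphic_on ball p r" if "p \<in> U" for p
 proof -
  obtain r where r: "r > 0" "cball p r \<subseteq> U" using U \<open>p \<in> U\<close> open_contains_cball by blast
  have "eventually (\<lambda>X. continuous_on (cball p r) (\<lambda>p. \<Sum>l\<in>X. f l p) \<and> (\<lambda>p. \<Sum>l\<in>X. f l p) holomorphic_on ball p r) ?F"
   using fin
  proof eventually_elim
   case (elim X)
   then have "(\<lambda>p. \<Sum>l\<in>X. f l p) holomorphic_on cball p r" using hs[of X] r holomorphic_on_subset by blast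
   then show ?case using holomorphic_on_imp_continuous_on holomorphic_on_subset ball_subset_cball by blast
  qed
  from holomorphic_uniform_limit[OF this ul[of "cball p r"]] r show ?thesis by (auto simp: finite_subsets_at_top_neq_bot)
 qed
 show "(\<lambda>p. \<Sum>\<^sub>\<infinity>l\<in>S. f l p) holomorphic_on U"
 proof -
  have "\<exists>D. ((\<lambda>p. \<Sum>\<^sub>\<infinity>l\<in>S. f l p) has_field_derivative D) (at p)" if "p \<in> U" for p
  proof -
   from loc[OF that] obtain r where "r > 0" "cball p r \<subseteq> U"
    "(\<lambda>p. \<Sum>\<^sub>\<infinity>l\<in>S. f l p) holomorphic_on ball p r" by (elim exE conjE)
   then show ?thesis using holomorphic_on_open[OF open_ball] centre_in_ball by metis
  qed
  then show ?thesis using U by (simp add: holomorphic_on_open)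
 qed
 assume p0: "p0 \<in> U"
 then obtain r where r: "r > 0" "cball p0 r \<subseteq> U" using loc by blast
 have "((\<lambda>X. (deriv ^^ m) (\<lambda>p. \<Sum>l\<in>X. f l p) p0) \<longlongrightarrow> (deriv ^^ m) (\<lambda>p. \<Sum>\<^sub>\<infinity>l\<in>S. f l p) p0) ?F"
 proof (rule higher_deriv_complex_uniform_limit)
  show "uniform_limit (ball p0 r) (\<lambda>X p. \<Sum>l\<in>X. f l p) (\<lambda>p. \<Sum>\<^sub>\<infinity>l\<in>S. f l p) ?F"
   by (rule uniform_limit_on_subset[OF ul[of "cball p0 r"]]) (use r in auto)
  show "eventually (\<lambda>X. (\<lambda>p. \<Sum>l\<in>X. f l p) holomorphic_on ball p0 r) ?F" using fin
  proof eventually_elim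
   case (elim X)
   have "ball p0 r \<subseteq> U" using r(2) ball_subset_cball[of p0 r] by (rule order_trans[rotated])
   with elim show ?case by (intro holomorphic_on_subset[OF hs[of X]]) auto
  qed
 qed (use r in \<open>auto simp: finite_subsets_at_top_neq_bot\<close>)
 moreover have "eventually (\<lambda>X. (deriv ^^ m) (\<lambda>p. \<Sum>l\<in>X. f l p) p0 = (\<Sum>l\<in>X. (deriv ^^ m) (f l) p0)) ?F"
  using fin
 proof eventually_elim
  case (elim X)
  have "finite X \<Longrightarrow> X \<subseteq> S \<Longrightarrow> (deriv ^^ m) (\<lambda>p. \<Sum>l\<in>X. f l p) p0 = (\<Sum>l\<in>X. (deriv ^^ m) (f l) p0)"
  proof (induction X rule: finite_induct)
   case (insert x F)
   then have "(deriv ^^ m) (\<lambda>p. f x p + (\<Sum>l\<in>F. f l p)) p0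
     = (deriv ^^ m) (f x) p0 + (deriv ^^ m) (\<lambda>p. \<Sum>l\<in>F. f l p) p0"
    using hol hs U p0 by (intro higher_deriv_add[where S = U]) auto
   then show ?case using insert by simp
  qed simp
  then show ?case using elim by simp
 qed
 ultimately show "((\<lambda>l. (deriv ^^ m) (f l) p0) has_sum (deriv ^^ m) (\<lambda>p. \<Sum>\<^sub>\<infinity>l\<in>S. f l p) p0) S"
  unfolding has_sum_def by (rule Lim_transform_eventually)
qed

lemma has_fps_iff_derivs: assumes "f holomorphic_on U" "open U" "0 \<in> U"
 shows "f has_fps_expansion F \<longleftrightarrow> (\<forall>m. (deriv ^^ m) f 0 / fact m = fps_nth F m)"
proof -
 have *: "f has_fps_expansion fps_expansion f 0"
  using assms by (intro analytic_at_imp_has_fps_expansion_0) (auto simp: analytic_at)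
 show ?thesis
 proof
  assume "f has_fps_expansion F"
  then have "F = fps_expansion f 0" by (metis fps_expansion_eqI)
  then show "\<forall>m. (deriv ^^ m) f 0 / fact m = fps_nth F m" by (simp add: fps_expansion_def)
 next
  assume "\<forall>m. (deriv ^^ m) f 0 / fact m = fps_nth F m"
  then have "F = fps_expansion f 0" by (simp add: fps_expansion_def fps_eq_iff)
  with * show "f has_fps_expansion F" by simp
 qed
qed

lemma HD_infsum: assumes U: "star_open U" and F: "\<And>l. l \<in> S \<Longrightarrow> HD U (F l) (w l)"
  and bd: "\<And>K. compact K \<Longrightarrow> K \<subseteq> U \<Longrightarrow> \<exists>M. M summable_on S \<and> (\<forall>l\<in>S. \<forall>p\<in>K. norm (snd (F l) p) \<le> M l)"
 shows "HD U (\<Sum>\<^sub>\<infinity>l\<in>S. fst (F l), \<lambda>p. \<Sum>\<^sub>\<infinity>l\<in>S. snd (F l) p) (Abs_fps (\<lambda>N. \<Sum>\<^sub>\<infinity>l\<in>S. fps_nth (w l) N))"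
proof -
 have hol: "snd (F l) holomorphic_on U" if "l \<in> S" for l using F[OF that] by (simp add: HD_def)
 have H1: "(\<lambda>p. \<Sum>\<^sub>\<infinity>l\<in>S. snd (F l) p) holomorphic_on U"
  by (rule holomorphic_infsum(1)[OF star_openD(1)[OF U]]) ((rule hol, assumption), (rule bd; assumption))
 have H2: "((\<lambda>l. (deriv ^^ m) (snd (F l)) 0) has_sum (deriv ^^ m) (\<lambda>p. \<Sum>\<^sub>\<infinity>l\<in>S. snd (F l) p) 0) S" for m
  by (rule holomorphic_infsum(2)[OF star_openD(1)[OF U] _ _ star_openD(2)[OF U]]) ((rule hol, assumption), (rule bd; assumption))
 have "(deriv ^^ m) (\<lambda>p. \<Sum>\<^sub>\<infinity>l\<in>S. snd (F l) p) 0 / fact m = (\<Sum>\<^sub>\<infinity>l\<in>S. fps_nth (w l) (m + 1)) * rGamma (1 + of_nat m)" for m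
 proof -
  have "(deriv ^^ m) (snd (F l)) 0 / fact m = fps_nth (w l) (m + 1) * rGamma (1 + of_nat m)" if "l \<in> S" for l
   using F[OF that] hol[OF that] has_fps_iff_derivs[OF hol[OF that] star_openD(1,2)[OF U]] by (simp add: HD_def)
  then have "(deriv ^^ m) (snd (F l)) 0 = fact m * (fps_nth (w l) (m + 1) * rGamma (1 + of_nat m))" if "l \<in> S" for l
   using that by (simp add: field_simps)
  then have "(\<Sum>\<^sub>\<infinity>l\<in>S. (deriv ^^ m) (snd (F l)) 0) = (\<Sum>\<^sub>\<infinity>l\<in>S. fact m * (fps_nth (w l) (m + 1) * rGamma (1 + of_nat m)))"
   by (intro infsum_cong)
  then show ?thesis using infsumI[OF H2] by (simp add: infsum_cmult_right' infsum_cmult_left')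
 qed
 then have "(\<lambda>p. \<Sum>\<^sub>\<infinity>l\<in>S. snd (F l) p) has_fps_expansion bor 1 (fps_shift 1 (Abs_fps (\<lambda>N. \<Sum>\<^sub>\<infinity>l\<in>S. fps_nth (w l) N)))"
  using H1 by (subst has_fps_iff_derivs[OF _ star_openD(1,2)[OF U]]) auto
 moreover have "(\<Sum>\<^sub>\<infinity>l\<in>S. fst (F l)) = (\<Sum>\<^sub>\<infinity>l\<in>S. fps_nth (w l) 0)"
  using F by (intro infsum_cong) (simp add: HD_def)
 ultimately show ?thesis using H1 by (simp add: HD_def)
qed

section \<open>Estimates for convolution products\<close>

abbreviation cprod :: "('a \<Rightarrow> complex \<Rightarrow> complex) \<Rightarrow> 'a list \<Rightarrow> complex \<Rightarrow> complex"
 where "cprod F xs \<equiv> snd (foldr dconv (map (\<lambda>x. (0, F x)) xs) (1, \<lambda>p. 0))"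

lemma cprod_simps:
 "cprod F [x] = F x" "cprod F (x # y # zs) = conv (F x) (cprod F (y # zs))" by (auto simp: dconv_def fun_eq_iff)

lemma fst_cprod: "xs \<noteq> [] \<Longrightarrow> fst (foldr dconv (map (\<lambda>x. (0, F x)) xs) (1, \<lambda>p. 0)) = 0"
 by (cases xs) (auto simp: dconv_def)

lemma conv_prod_cprod: "conv_prod l f = foldr dconv (map (\<lambda>x. (0, (\<lambda>(i, j). f i j) x)) (idx l)) (1, \<lambda>p. 0)"
 unfolding conv_prod_idx by (rule arg_cong[of _ _ "\<lambda>h. foldr dconv (map h _) _"]) auto

lemma conv_pow_cprod: "conv_pow Y l = foldr dconv (map (\<lambda>x. (0, \<lambda>p. Y p $ fst x)) (idx l)) (1, \<lambda>p. 0)"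
 unfolding conv_pow_def conv_prod_cprod by (rule arg_cong[of _ _ "\<lambda>h. foldr dconv (map h _) _"]) (auto simp: fun_eq_iff)

lemma real_le_two_power: "n \<ge> 1 \<Longrightarrow> real n \<le> 2 ^ (n - 1)"
proof (induction n rule: nat_induct_at_least)
 case (Suc n)
 have "(1::real) \<le> 2 ^ (n - 1)" by simp
 moreover have "(2::real) ^ n = 2 * 2 ^ (n - 1)" using Suc by (simp flip: power_Suc)
 moreover have "real n \<le> 2 ^ (n - 1)" using Suc.IH .
 moreover have "real (Suc n) = real n + 1" by simp
 ultimately show ?case unfolding diff_Suc_1 by linarith
qed simp

text \<open>The difference of two n-fold products costs a factor \<open>n\<close>, which powers of 2
  absorb; the room for them is the gap between \<open>\<rho> / 4\<close> and \<open>\<rho>\<close>.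
  The second estimate keeps one factor \<open>x\<close> as a source of smallness.\<close>

lemma mult_power_le: fixes x \<rho> :: real assumes "0 \<le> x" "x \<le> \<rho> / 4" "\<rho> > 0"
 shows "n \<ge> 1 \<Longrightarrow> real n * x ^ (n - 1) \<le> \<rho> ^ n / \<rho>"
  and "n \<ge> 2 \<Longrightarrow> real n * x ^ (n - 1) \<le> \<rho> ^ n * (2 * x / \<rho>\<^sup>2)"
proof -
 show "real n * x ^ (n - 1) \<le> \<rho> ^ n / \<rho>" if "n \<ge> 1"
 proof -
  have "real n * x ^ (n - 1) \<le> 2 ^ (n - 1) * (\<rho> / 2) ^ (n - 1)"
   using assms that real_le_two_power[OF that] by (intro mult_mono power_mono) auto
  also have "\<dots> = \<rho> ^ (n - 1)" by (simp flip: power_mult_distrib)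
  also have "\<dots> = \<rho> ^ n / \<rho>" using that assms by (simp add: power_diff)
  finally show ?thesis .
 qed
 show "real n * x ^ (n - 1) \<le> \<rho> ^ n * (2 * x / \<rho>\<^sup>2)" if "n \<ge> 2"
 proof -
  define m where "m = n - 2"
  have m: "n = m + 2" using that by (simp add: m_def)
  have "real n \<le> 2 ^ (m + 1)" using real_le_two_power[of n] m by simp
  also have "\<dots> \<le> 2 * 4 ^ m" using power_mono[of "2::real" 4 m] by simp
  finally have "real n * x ^ m \<le> 2 * 4 ^ m * (\<rho> / 4) ^ m" using assms by (intro mult_mono power_mono) auto
  also have "\<dots> = 2 * \<rho> ^ m" by (simp add: power_divide)
  finally have "x * (real n * x ^ m) \<le> x * (2 * \<rho> ^ m)" using assms by (intro mult_left_mono) auto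
  then show ?thesis using assms m by (simp add: power2_eq_square power_add field_simps)
 qed
qed

abbreviation wt :: "(('n::finite \<Rightarrow> nat) \<Rightarrow> real) \<Rightarrow> real \<Rightarrow> ('n \<Rightarrow> nat) \<Rightarrow> real"
 where "wt K \<rho> l \<equiv> K l * \<rho> ^ msize l"

abbreviation nlt where "nlt gc Y l i p \<equiv> gc 0 l $ i * snd (conv_pow Y l) p"

abbreviation Gconv where "Gconv gc Y l i \<equiv> conv (Gl gc l i) (snd (conv_pow Y l))"

text \<open>The estimates on the nonlinear operator are needed for weighted sup norms of analytic
 functions and for weighted \<open>L1\<close> norms on a ray. \<open>bd f c\<close> is the bound of the norm of \<open>f\<close> by \<open>c\<close>.\<close>

locale conv_bound =
 fixes H :: "(complex \<Rightarrow> complex) \<Rightarrow> bool" and bd :: "(complex \<Rightarrow> complex) \<Rightarrow> real \<Rightarrow> bool"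
  and \<tau> \<eta> \<rho> :: real and K :: "('n::{finite,linorder} \<Rightarrow> nat) \<Rightarrow> real" and gc :: "nat \<Rightarrow> ('n \<Rightarrow> nat) \<Rightarrow> 'n cvec"
 assumes \<tau>: "\<tau> \<ge> 0" and \<eta>: "\<eta> \<ge> 0" and \<rho>: "\<rho> > 0"
  and K: "\<And>l. K l \<ge> 0" "(\<lambda>l. wt K \<rho> l) summable_on UNIV" and gc0: "\<And>l i. norm (gc 0 l $ i) \<le> K l"
  and H_conv: "H f \<Longrightarrow> H g \<Longrightarrow> H (conv f g)" and H_Gl: "H (Gl gc l i)"
  and H_zero: "H (\<lambda>_. 0)" and H_cmult: "H f \<Longrightarrow> H (\<lambda>p. a * f p)"
  and bd_nonneg: "bd f c \<Longrightarrow> c \<ge> 0" and bd_zero: "bd (\<lambda>_. 0) 0"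
  and bd_mono: "bd f c \<Longrightarrow> c \<le> d \<Longrightarrow> bd f d"
  and bd_add: "bd f c \<Longrightarrow> bd g d \<Longrightarrow> bd (\<lambda>p. f p + g p) (c + d)"
  and bd_cmult: "bd f c \<Longrightarrow> bd (\<lambda>p. a * f p) (norm a * c)"
  and bd_conv_diff: "H f \<Longrightarrow> H g \<Longrightarrow> H f' \<Longrightarrow> H g' \<Longrightarrow> bd (\<lambda>p. f p - f' p) c1 \<Longrightarrow> bd g d \<Longrightarrow>
   bd f' c \<Longrightarrow> bd (\<lambda>p. g p - g' p) d1 \<Longrightarrow> bd (\<lambda>p. conv f g p - conv f' g' p) (\<tau> * (c1 * d + c * d1))"
  and bd_kernel_diff: "H f \<Longrightarrow> H f' \<Longrightarrow> bd (\<lambda>p. f p - f' p) c \<Longrightarrow>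
   bd (\<lambda>p. conv (Gl gc l i) f p - conv (Gl gc l i) f' p) (K l * \<eta> * c)"
  and bd_infsum: "(\<And>l. l \<in> S \<Longrightarrow> H (h l)) \<Longrightarrow> (\<And>l. l \<in> S \<Longrightarrow> H (h' l)) \<Longrightarrow> (\<And>l. l \<in> S \<Longrightarrow> bd (h l) (A l)) \<Longrightarrow>
   (\<And>l. l \<in> S \<Longrightarrow> bd (h' l) (A l)) \<Longrightarrow> (\<And>l. l \<in> S \<Longrightarrow> bd (\<lambda>p. h l p - h' l p) (dl l)) \<Longrightarrow>
   A summable_on S \<Longrightarrow> dl summable_on (S :: ('n \<Rightarrow> nat) set) \<Longrightarrow>
   bd (\<lambda>p. (\<Sum>\<^sub>\<infinity>l\<in>S. h l p) - (\<Sum>\<^sub>\<infinity>l\<in>S. h' l p)) (\<Sum>\<^sub>\<infinity>l\<in>S. dl l)"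
begin

lemma bd_conv: "H f \<Longrightarrow> H g \<Longrightarrow> bd f c \<Longrightarrow> bd g d \<Longrightarrow> bd (conv f g) (\<tau> * (c * d))"
 using bd_conv_diff[of f g "\<lambda>_. 0" "\<lambda>_. 0" c d 0 d] H_zero bd_zero by simp

lemma bd_kernel: "H f \<Longrightarrow> bd f c \<Longrightarrow> bd (conv (Gl gc l i) f) (K l * \<eta> * c)"
 using bd_kernel_diff[of f "\<lambda>_. 0" c] H_zero by simp

lemma cprod_bounds:
 assumes "xs \<noteq> []" and "\<And>x. x \<in> set xs \<Longrightarrow> H (F x)" "\<And>x. x \<in> set xs \<Longrightarrow> bd (F x) \<kappa>"
 shows "H (cprod F xs)" "bd (cprod F xs) (\<kappa> * (\<tau> * \<kappa>) ^ (length xs - 1))"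
proof -
 have "H (cprod F xs) \<and> bd (cprod F xs) (\<kappa> * (\<tau> * \<kappa>) ^ (length xs - 1))" using assms
 proof (induction xs rule: induct_list012)
  case (3 x y zs)
  then have IH: "H (cprod F (y # zs))" "bd (cprod F (y # zs)) (\<kappa> * (\<tau> * \<kappa>) ^ length zs)" by auto
  have "bd (conv (F x) (cprod F (y # zs))) (\<tau> * (\<kappa> * (\<kappa> * (\<tau> * \<kappa>) ^ length zs)))"
   by (rule bd_conv) (use IH 3 in auto)
  then have "bd (conv (F x) (cprod F (y # zs))) (\<kappa> * (\<tau> * \<kappa>) ^ (length (x # y # zs) - 1))"
   by (simp add: mult_ac)
  moreover have "H (conv (F x) (cprod F (y # zs)))" by (rule H_conv) (use IH 3 in auto)
  ultimately show ?case unfolding cprod_simps by blast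
 qed (auto simp: cprod_simps(1) simp del: foldr.simps list.map)
 then show "H (cprod F xs)" "bd (cprod F xs) (\<kappa> * (\<tau> * \<kappa>) ^ (length xs - 1))" by auto
qed

text \<open>Telescoping: at each factor \<open>f g - f' g'\<close> splits into
  \<open>(f - f') g\<close> and \<open>f' (g - g')\<close>.\<close>

lemma cprod_diff_bound:
 assumes "xs \<noteq> []" and "\<And>x. x \<in> set xs \<Longrightarrow> H (F x)" "\<And>x. x \<in> set xs \<Longrightarrow> bd (F x) \<kappa>"
  and "\<And>x. x \<in> set xs \<Longrightarrow> H (G x)" "\<And>x. x \<in> set xs \<Longrightarrow> bd (G x) \<kappa>"
  and "\<And>x. x \<in> set xs \<Longrightarrow> bd (\<lambda>p. F x p - G x p) \<epsilon>"
 shows "bd (\<lambda>p. cprod F xs p - cprod G xs p) (real (length xs) * (\<tau> * \<kappa>) ^ (length xs - 1) * \<epsilon>)"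
 using assms
proof (induction xs rule: induct_list012)
 case (3 x y zs)
 have IH: "bd (\<lambda>p. cprod F (y # zs) p - cprod G (y # zs) p) (real (Suc (length zs)) * (\<tau> * \<kappa>) ^ length zs * \<epsilon>)"
  using 3 by auto
 have F: "H (cprod F (y # zs))" "bd (cprod F (y # zs)) (\<kappa> * (\<tau> * \<kappa>) ^ (length (y # zs) - 1))"
  by (rule cprod_bounds; use 3 in auto)+
 have G: "H (cprod G (y # zs))" by (rule cprod_bounds; use 3 in auto)
 have "bd (\<lambda>p. conv (F x) (cprod F (y # zs)) p - conv (G x) (cprod G (y # zs)) p)
   (\<tau> * (\<epsilon> * (\<kappa> * (\<tau> * \<kappa>) ^ (length (y # zs) - 1)) + \<kappa> * (real (Suc (length zs)) * (\<tau> * \<kappa>) ^ length zs * \<epsilon>)))"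
  using 3 by (intro bd_conv_diff F G IH) auto
 also have "\<tau> * (\<epsilon> * (\<kappa> * (\<tau> * \<kappa>) ^ (length (y # zs) - 1)) + \<kappa> * (real (Suc (length zs)) * (\<tau> * \<kappa>) ^ length zs * \<epsilon>))
  = real (length (x # y # zs)) * (\<tau> * \<kappa>) ^ (length (x # y # zs) - 1) * \<epsilon>" by (simp add: algebra_simps)
 finally show ?case unfolding cprod_simps .
qed (auto simp: cprod_simps(1) simp del: foldr.simps list.map)

lemma conv_pow_bounds: assumes "msize l \<ge> 1" "\<And>i. H (\<lambda>p. Y p $ i)" "\<And>i. bd (\<lambda>p. Y p $ i) \<kappa>"
 shows "H (snd (conv_pow Y l))" "bd (snd (conv_pow Y l)) (\<kappa> * (\<tau> * \<kappa>) ^ (msize l - 1))"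
proof -
 have "idx l \<noteq> []" using assms(1) idx_nonempty[of l] by auto
 from cprod_bounds[OF this, of "\<lambda>x p. Y p $ fst x" \<kappa>] assms
 show "H (snd (conv_pow Y l))" "bd (snd (conv_pow Y l)) (\<kappa> * (\<tau> * \<kappa>) ^ (msize l - 1))"
  by (simp_all add: conv_pow_cprod length_idx)
qed

lemma conv_pow_diff_bound:
 assumes "msize l \<ge> 1" "\<And>i. H (\<lambda>p. Y p $ i)" "\<And>i. bd (\<lambda>p. Y p $ i) \<kappa>"
  "\<And>i. H (\<lambda>p. Z p $ i)" "\<And>i. bd (\<lambda>p. Z p $ i) \<kappa>" "\<And>i. bd (\<lambda>p. Y p $ i - Z p $ i) \<epsilon>"
 shows "bd (\<lambda>p. snd (conv_pow Y l) p - snd (conv_pow Z l) p) (real (msize l) * (\<tau> * \<kappa>) ^ (msize l - 1) * \<epsilon>)"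
proof -
 have "idx l \<noteq> []" using assms(1) idx_nonempty[of l] by auto
 from cprod_diff_bound[OF this, of "\<lambda>x p. Y p $ fst x" \<kappa> "\<lambda>x p. Z p $ fst x"] assms
 show ?thesis by (simp add: conv_pow_cprod length_idx)
qed

lemma bd_scale_mono: "bd f c \<Longrightarrow> norm a \<le> d \<Longrightarrow> bd (\<lambda>p. a * f p) (d * c)"
 using bd_cmult bd_mono mult_right_mono bd_nonneg by meson

lemma weight_summable: "(\<lambda>l. wt K \<rho> l * c) summable_on S"
 using summable_on_subset_banach[OF K(2)] by (intro summable_on_cmult_left) auto

lemma weight_infsum_le: "c \<ge> 0 \<Longrightarrow> (\<Sum>\<^sub>\<infinity>l\<in>S. wt K \<rho> l * c) \<le> (\<Sum>\<^sub>\<infinity>l. wt K \<rho> l) * c"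
 unfolding infsum_cmult_left' using summable_on_subset_banach[OF K(2)] K \<rho> by (intro mult_right_mono infsum_mono2) auto

lemma Nop_term_bounds: assumes \<kappa>: "\<tau> * \<kappa> \<le> \<rho> / 4"
  and Y: "\<And>i. H (\<lambda>p. Y p $ i)" "\<And>i. bd (\<lambda>p. Y p $ i) \<kappa>"
 shows "msize l \<ge> 1 \<Longrightarrow> bd (snd (conv_pow Y l)) (\<rho> ^ msize l * (\<kappa> / \<rho>))"
  "msize l \<ge> 1 \<Longrightarrow> bd (Gconv gc Y l i) (wt K \<rho> l * (\<eta> * (\<kappa> / \<rho>)))"
  "msize l \<ge> 1 \<Longrightarrow> bd (\<lambda>p. nlt gc Y l i p) (wt K \<rho> l * (\<kappa> / \<rho>))"
proof -
 assume l: "msize l \<ge> 1"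
 have \<kappa>0: "\<kappa> \<ge> 0" using Y(2) bd_nonneg by blast
 have x0: "\<tau> * \<kappa> \<ge> 0" using \<kappa>0 \<tau> by simp
 have "(\<tau> * \<kappa>) ^ (msize l - 1) \<le> \<rho> ^ (msize l - 1)" using \<kappa> x0 \<rho> by (intro power_mono) auto
 also have "\<dots> = \<rho> ^ msize l / \<rho>" using l \<rho> by (simp add: power_diff)
 finally have "\<kappa> * (\<tau> * \<kappa>) ^ (msize l - 1) \<le> \<kappa> * (\<rho> ^ msize l / \<rho>)" using \<kappa>0 by (rule mult_left_mono)
 then show 1: "bd (snd (conv_pow Y l)) (\<rho> ^ msize l * (\<kappa> / \<rho>))"
  using conv_pow_bounds(2)[OF l Y] bd_mono by (simp add: mult_ac)
 show "bd (Gconv gc Y l i) (wt K \<rho> l * (\<eta> * (\<kappa> / \<rho>)))"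
  using bd_kernel[OF conv_pow_bounds(1)[OF l Y] 1] by (simp add: mult_ac)
 show "bd (\<lambda>p. nlt gc Y l i p) (wt K \<rho> l * (\<kappa> / \<rho>))" using bd_scale_mono[OF 1 gc0] by (simp add: mult_ac)
qed

text \<open>The two sums contract for different reasons: the kernels \<open>Gl\<close> bring the
  factor \<open>\<eta>\<close>, small for large weights, and in the terms without kernel
  \<open>|l| \<ge> 2\<close> leaves at least one further factor
  \<open>\<tau> * \<kappa>\<close>.\<close>

lemma Nop_lipschitz: assumes \<kappa>: "\<tau> * \<kappa> \<le> \<rho> / 4"
  and Y: "\<And>i. H (\<lambda>p. Y p $ i)" "\<And>i. bd (\<lambda>p. Y p $ i) \<kappa>"
  and Z: "\<And>i. H (\<lambda>p. Z p $ i)" "\<And>i. bd (\<lambda>p. Z p $ i) \<kappa>"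
  and d: "\<And>i. bd (\<lambda>p. Y p $ i - Z p $ i) \<epsilon>" shows "bd (\<lambda>p. Nop gc Y p i - Nop gc Z p i)
  ((\<Sum>\<^sub>\<infinity>l. wt K \<rho> l) * (\<eta> / \<rho> + 2 * (\<tau> * \<kappa>) / \<rho>\<^sup>2) * \<epsilon>)"
proof -
 have \<kappa>0: "\<kappa> \<ge> 0" using Y(2) bd_nonneg by blast
 have x0: "\<tau> * \<kappa> \<ge> 0" using \<kappa>0 \<tau> by simp
 have \<epsilon>: "\<epsilon> \<ge> 0" using d bd_nonneg by blast
 note T = Nop_term_bounds[OF \<kappa>]
 have D: "bd (\<lambda>p. snd (conv_pow Y l) p - snd (conv_pow Z l) p) (real (msize l) * (\<tau> * \<kappa>) ^ (msize l - 1) * \<epsilon>)"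
  if "msize l \<ge> 1" for l by (rule conv_pow_diff_bound[OF that Y Z d])
 have P: "H (snd (conv_pow Y l))" "H (snd (conv_pow Z l))" if "msize l \<ge> 1" for l
  using conv_pow_bounds(1)[OF that] Y Z by auto
 have 1: "bd (\<lambda>p. (\<Sum>\<^sub>\<infinity>l\<in>{l. msize l \<ge> 1}. Gconv gc Y l i p)
   - (\<Sum>\<^sub>\<infinity>l\<in>{l. msize l \<ge> 1}. Gconv gc Z l i p))
   (\<Sum>\<^sub>\<infinity>l\<in>{l. msize l \<ge> 1}. wt K \<rho> l * (\<eta> / \<rho> * \<epsilon>))"
 proof (rule bd_infsum[OF _ _ _ _ _ weight_summable weight_summable])
  fix l :: "'n \<Rightarrow> nat" assume "l \<in> {l. msize l \<ge> 1}"
  then have l: "msize l \<ge> 1" by simp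
  show "H (Gconv gc Y l i)" "H (Gconv gc Z l i)" using P[OF l] H_conv H_Gl by auto
  show "bd (Gconv gc Y l i) (wt K \<rho> l * (\<eta> * (\<kappa> / \<rho>)))" 
   "bd (Gconv gc Z l i) (wt K \<rho> l * (\<eta> * (\<kappa> / \<rho>)))" by (rule T(2)[OF _ _ l]; fact Y Z)+
  have "K l * \<eta> * (real (msize l) * (\<tau> * \<kappa>) ^ (msize l - 1) * \<epsilon>) \<le> K l * \<eta> * (\<rho> ^ msize l / \<rho> * \<epsilon>)"
   using mult_power_le(1)[OF x0 \<kappa> \<rho> l] \<epsilon> K \<eta> by (intro mult_left_mono mult_right_mono) auto
  then show "bd (\<lambda>p. Gconv gc Y l i p - Gconv gc Z l i p) (wt K \<rho> l * (\<eta> / \<rho> * \<epsilon>))"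
   using bd_mono[OF bd_kernel_diff[OF P[OF l] D[OF l]]] by (simp add: mult_ac)
 qed
 have 2: "bd (\<lambda>p. (\<Sum>\<^sub>\<infinity>l\<in>{l. msize l \<ge> 2}. nlt gc Y l i p)
   - (\<Sum>\<^sub>\<infinity>l\<in>{l. msize l \<ge> 2}. nlt gc Z l i p))
   (\<Sum>\<^sub>\<infinity>l\<in>{l. msize l \<ge> 2}. wt K \<rho> l * (2 * (\<tau> * \<kappa>) / \<rho>\<^sup>2 * \<epsilon>))"
 proof (rule bd_infsum[OF _ _ _ _ _ weight_summable weight_summable])
  fix l :: "'n \<Rightarrow> nat" assume "l \<in> {l. msize l \<ge> 2}"
  then have l: "msize l \<ge> 1" "msize l \<ge> 2" by auto
  show "H (\<lambda>p. nlt gc Y l i p)" "H (\<lambda>p. nlt gc Z l i p)" using P[OF l(1)] H_cmult by auto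
  show "bd (\<lambda>p. nlt gc Y l i p) (wt K \<rho> l * (\<kappa> / \<rho>))" 
   "bd (\<lambda>p. nlt gc Z l i p) (wt K \<rho> l * (\<kappa> / \<rho>))" by (rule T(3)[OF _ _ l(1)]; fact Y Z)+
  have "K l * (real (msize l) * (\<tau> * \<kappa>) ^ (msize l - 1) * \<epsilon>) \<le> K l * (\<rho> ^ msize l * (2 * (\<tau> * \<kappa>) / \<rho>\<^sup>2) * \<epsilon>)"
   using mult_power_le(2)[OF x0 \<kappa> \<rho> l(2)] \<epsilon> K by (intro mult_left_mono mult_right_mono) auto
  then have "bd (\<lambda>p. gc 0 l $ i * (snd (conv_pow Y l) p - snd (conv_pow Z l) p))
    (K l * (\<rho> ^ msize l * (2 * (\<tau> * \<kappa>) / \<rho>\<^sup>2) * \<epsilon>))"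
   by (rule bd_mono[OF bd_scale_mono[OF D[OF l(1)] gc0]])
  then show "bd (\<lambda>p. nlt gc Y l i p - nlt gc Z l i p)
    (wt K \<rho> l * (2 * (\<tau> * \<kappa>) / \<rho>\<^sup>2 * \<epsilon>))" by (simp add: algebra_simps)
 qed
 have 3: "\<eta> / \<rho> * \<epsilon> \<ge> 0" "2 * (\<tau> * \<kappa>) / \<rho>\<^sup>2 * \<epsilon> \<ge> 0" using \<eta> \<rho> \<epsilon> x0 by auto
 have "bd (\<lambda>p. ((\<Sum>\<^sub>\<infinity>l\<in>{l. msize l \<ge> 1}. Gconv gc Y l i p)
   - (\<Sum>\<^sub>\<infinity>l\<in>{l. msize l \<ge> 1}. Gconv gc Z l i p)) +
   ((\<Sum>\<^sub>\<infinity>l\<in>{l. msize l \<ge> 2}. nlt gc Y l i p)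
   - (\<Sum>\<^sub>\<infinity>l\<in>{l. msize l \<ge> 2}. nlt gc Z l i p)))
   ((\<Sum>\<^sub>\<infinity>l. wt K \<rho> l) * (\<eta> / \<rho> * \<epsilon>) + (\<Sum>\<^sub>\<infinity>l. wt K \<rho> l) * (2 * (\<tau> * \<kappa>) / \<rho>\<^sup>2 * \<epsilon>))"
  by (intro bd_add bd_mono[OF 1 weight_infsum_le[OF 3(1)]] bd_mono[OF 2 weight_infsum_le[OF 3(2)]])
 then show ?thesis by (simp add: Nop_def algebra_simps)
qed

end

section \<open>Weighted sup norms on compact star-shaped sets\<close>

lemma star_conv_integrable: assumes U: "star_open U" and f: "f holomorphic_on U" and g: "g holomorphic_on U" and p: "p \<in> U"
 shows "set_integrable lebesgue {0..1} (\<lambda>u. f (of_real u * p) * g (p - of_real u * p))"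
proof -
 have "continuous_on {0..1} (\<lambda>u. f (of_real u * p) * g (p - of_real u * p))" using star_openD(3,4)[OF U p]
  by (intro continuous_on_mult continuous_on_compose2[OF holomorphic_on_imp_continuous_on[OF f]]
    continuous_on_compose2[OF holomorphic_on_imp_continuous_on[OF g]]) (auto intro!: continuous_intros)
 then show ?thesis by (intro absolutely_integrable_continuous_real)
qed

lemma conv_diff_split:
 assumes U: "star_open U" and "f holomorphic_on U" "g holomorphic_on U" "f' holomorphic_on U" "g' holomorphic_on U" "p \<in> U"
 shows "conv f g p - conv f' g' p = conv (\<lambda>p. f p - f' p) g p + conv f' (\<lambda>p. g p - g' p) p"
proof -
 have 1: "(LINT u:{0..1}|lebesgue. (f (of_real u * p) - f' (of_real u * p)) * g (p - of_real u * p))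
   = (LINT u:{0..1}|lebesgue. f (of_real u * p) * g (p - of_real u * p)) - (LINT u:{0..1}|lebesgue. f' (of_real u * p) * g (p - of_real u * p))"
  unfolding left_diff_distrib using assms by (intro set_integral_diff star_conv_integrable[of U]) auto
 have 2: "(LINT u:{0..1}|lebesgue. f' (of_real u * p) * (g (p - of_real u * p) - g' (p - of_real u * p)))
   = (LINT u:{0..1}|lebesgue. f' (of_real u * p) * g (p - of_real u * p)) - (LINT u:{0..1}|lebesgue. f' (of_real u * p) * g' (p - of_real u * p))"
  unfolding right_diff_distrib using assms by (intro set_integral_diff star_conv_integrable[of U]) auto
 show ?thesis unfolding conv_def seg_int_def 1 2 by (simp add: algebra_simps)
qed

text \<open>With \<open>a = norm p\<close> this measures the convolution of functions of different
  exponential rates: the gap \<open>\<delta>\<close> of the rates gives a factor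
  \<open>1 / \<delta>\<close>, whatever the length of the segment.\<close>

lemma exp_kernel_integral: fixes a \<delta> :: real assumes "a \<ge> 0" "\<delta> > 0"
 shows "a * (LINT u:{0..1}|lebesgue. exp (- \<delta> * a * u)) \<le> 1 / \<delta>"
  "set_integrable lebesgue {0..1} (\<lambda>u. exp (- \<delta> * a * u))"
  "a * (LINT u:{0..1}|lebesgue. exp (- \<delta> * a * (1 - u))) \<le> 1 / \<delta>"
  "set_integrable lebesgue {0..1} (\<lambda>u. exp (- \<delta> * a * (1 - u)))"
proof -
 show s1: "set_integrable lebesgue {0..1} (\<lambda>u. exp (- \<delta> * a * u))"
  and s2: "set_integrable lebesgue {0..1} (\<lambda>u. exp (- \<delta> * a * (1 - u)))"
  by (intro absolutely_integrable_continuous_real continuous_intros)+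
 have "((\<lambda>u. a * exp (- \<delta> * a * u)) has_integral (- exp (- \<delta> * a * 1) / \<delta> - (- exp (- \<delta> * a * 0) / \<delta>))) {0..1}"
  using assms by (intro fundamental_theorem_of_calculus)
   (auto intro!: derivative_eq_intros simp flip: has_real_derivative_iff_has_vector_derivative)
 from integral_unique[OF this] have "a * (LINT u:{0..1}|lebesgue. exp (- \<delta> * a * u)) = (1 - exp (- \<delta> * a)) / \<delta>"
  using set_lebesgue_integral_eq_integral(2)[OF s1] assms by (simp add: field_simps)
 then show "a * (LINT u:{0..1}|lebesgue. exp (- \<delta> * a * u)) \<le> 1 / \<delta>"
  using assms by (simp add: divide_right_mono)
 have "((\<lambda>u. a * exp (- \<delta> * a * (1 - u))) has_integral (exp (- \<delta> * a * (1 - 1)) / \<delta> - exp (- \<delta> * a * (1 - 0)) / \<delta>)) {0..1}"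
  using assms by (intro fundamental_theorem_of_calculus)
   (auto intro!: derivative_eq_intros simp flip: has_real_derivative_iff_has_vector_derivative)
 from integral_unique[OF this] have "a * (LINT u:{0..1}|lebesgue. exp (- \<delta> * a * (1 - u))) = (1 - exp (- \<delta> * a)) / \<delta>"
  using set_lebesgue_integral_eq_integral(2)[OF s2] assms by (simp add: field_simps)
 then show "a * (LINT u:{0..1}|lebesgue. exp (- \<delta> * a * (1 - u))) \<le> 1 / \<delta>"
  using assms by (simp add: divide_right_mono)
qed

text \<open>Holds for arbitrary \<open>f\<close>: a non-integrable one has integral 0 by default,
  and \<open>B\<close> is nonnegative on the interval.\<close>

lemma norm_set_LINT_le: fixes f :: "real \<Rightarrow> complex"
 assumes "set_integrable lebesgue {0..1} B" "\<And>u. u \<in> {0..1} \<Longrightarrow> norm (f u) \<le> B u"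
 shows "norm (LINT u:{0..1}|lebesgue. f u) \<le> (LINT u:{0..1}|lebesgue. B u)"
proof (cases "integrable lebesgue (\<lambda>u. indicat_real {0..1} u *\<^sub>R f u)")
 case True
 have "norm (LINT u:{0..1}|lebesgue. f u) \<le> (LINT u|lebesgue. norm (indicat_real {0..1} u *\<^sub>R f u))"
  unfolding set_lebesgue_integral_def by (rule integral_norm_bound)
 also have "\<dots> \<le> (LINT u:{0..1}|lebesgue. B u)" unfolding set_lebesgue_integral_def
  using assms True by (intro integral_mono) (auto simp: set_integrable_def indicator_def simp del: norm_scaleR)
 finally show ?thesis .
next
 case False
 have "0 \<le> B u" if "u \<in> {0..1}" for u using assms(2)[OF that] norm_ge_zero order_trans by blast
 then have "0 \<le> (LINT u:{0..1}|lebesgue. B u)"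
  unfolding set_lebesgue_integral_def by (intro integral_nonneg_AE AE_I2) (auto simp: indicator_def)
 then show ?thesis using False by (simp add: set_lebesgue_integral_def not_integrable_integral_eq)
qed

lemma summable_on_diff_infsum: fixes f g :: "'a \<Rightarrow> 'b::{topological_ab_group_add, t2_space}"
 assumes "f summable_on A" "g summable_on A"
 shows "(\<lambda>x. f x - g x) summable_on A" "(\<Sum>\<^sub>\<infinity>x\<in>A. f x - g x) = infsum f A - infsum g A"
proof -
 have "((\<lambda>x. - g x) has_sum - infsum g A) A" using assms(2) by (intro iffD2[OF has_sum_uminus]) auto
 from has_sum_add[OF has_sum_infsum[OF assms(1)] this]
 have "((\<lambda>x. f x - g x) has_sum (infsum f A - infsum g A)) A" by simp
 then show "(\<lambda>x. f x - g x) summable_on A" "(\<Sum>\<^sub>\<infinity>x\<in>A. f x - g x) = infsum f A - infsum g A"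
  by (auto intro: infsumI has_sum_imp_summable)
qed

definition supbd :: "real \<Rightarrow> complex set \<Rightarrow> (complex \<Rightarrow> complex) \<Rightarrow> real \<Rightarrow> bool"
 where "supbd \<nu> D f c \<longleftrightarrow> c \<ge> 0 \<and> (\<forall>p\<in>D. norm (f p) \<le> c * exp (\<nu> * norm p))"

definition star_compact :: "complex set \<Rightarrow> bool"
 where "star_compact D \<longleftrightarrow> compact D \<and> D \<noteq> {} \<and> (\<forall>p\<in>D. \<forall>u\<in>{0..1}. of_real u * p \<in> D)"

lemma star_compactD: assumes "star_compact D" "p \<in> D" "0 \<le> u" "u \<le> 1"
 shows "of_real u * p \<in> D" "p - of_real u * p \<in> D"
proof -
 show *: "of_real u * p \<in> D" using assms by (auto simp: star_compact_def)
 have "of_real (1 - u) * p \<in> D" using assms unfolding star_compact_def by (metis atLeastAtMost_iff diff_ge_0_iff_ge diff_le_eq le_add_same_cancel1)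
 then show "p - of_real u * p \<in> D" by (simp add: algebra_simps)
qed

lemma norm_split_segment:
 "0 \<le> u \<Longrightarrow> u \<le> 1 \<Longrightarrow> norm (of_real u * p) = u * norm p \<and> norm (p - of_real u * p) = (1 - u) * norm (p :: complex)"
proof -
 assume "0 \<le> u" "u \<le> 1"
 then have "p - of_real u * p = of_real (1 - u) * p" "\<bar>1 - u\<bar> = 1 - u" by (simp_all add: algebra_simps)
 then show ?thesis using \<open>0 \<le> u\<close> by (metis abs_of_nonneg norm_mult norm_of_real)
qed

lemma conv_supbd: assumes D: "star_compact D" and f: "supbd \<nu> D f c" and g: "supbd \<nu> D g d" and p: "p \<in> D"
 shows "norm (conv f g p) \<le> norm p * (c * d * exp (\<nu> * norm p))"
proof -
 have "norm (LINT u:{0..1}|lebesgue. f (of_real u * p) * g (p - of_real u * p)) \<le> (LINT u:{0..1::real}|lebesgue. c * d * exp (\<nu> * norm p))"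
 proof (rule norm_set_LINT_le[where B = "\<lambda>_. c * d * exp (\<nu> * norm p)"])
  fix u :: real assume u: "u \<in> {0..1}"
  note n = norm_split_segment[of u p]
  have "norm (f (of_real u * p)) \<le> c * exp (\<nu> * (u * norm p))" "norm (g (p - of_real u * p)) \<le> d * exp (\<nu> * ((1 - u) * norm p))"
   using f g star_compactD[OF D p, of u] u n unfolding supbd_def by (metis atLeastAtMost_iff)+
  then have "norm (f (of_real u * p) * g (p - of_real u * p)) \<le> (c * exp (\<nu> * (u * norm p))) * (d * exp (\<nu> * ((1 - u) * norm p)))"
   unfolding norm_mult using f by (intro mult_mono) (auto simp: supbd_def)
  also have "\<dots> = c * d * exp (\<nu> * norm p)" by (simp add: algebra_simps flip: exp_add)
  finally show "norm (f (of_real u * p) * g (p - of_real u * p)) \<le> c * d * exp (\<nu> * norm p)" .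
 qed (auto intro!: absolutely_integrable_continuous_real)
 also have "(LINT u:{0..1::real}|lebesgue. c * d * exp (\<nu> * norm p)) = c * d * exp (\<nu> * norm p)"
  by (simp add: set_lebesgue_integral_def)
 finally show ?thesis unfolding conv_def seg_int_def norm_mult by (intro mult_left_mono) auto
qed

lemma conv_supbd_less:
 assumes D: "star_compact D" and f: "supbd \<mu> D f c" and g: "supbd \<nu> D g d" and \<mu>: "\<mu> < \<nu>" and p: "p \<in> D"
 shows "norm (conv f g p) \<le> c * d / (\<nu> - \<mu>) * exp (\<nu> * norm p)"
  "norm (conv g f p) \<le> c * d / (\<nu> - \<mu>) * exp (\<nu> * norm p)"
proof -
 define \<delta> where "\<delta> = \<nu> - \<mu>"
 have \<delta>: "\<delta> > 0" using \<mu> by (simp add: \<delta>_def)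
 note E = exp_kernel_integral[OF norm_ge_zero[of p] \<delta>]
 have c: "c \<ge> 0" "d \<ge> 0" using f g by (auto simp: supbd_def)
 have bounds: "norm (f (of_real u * p)) \<le> c * exp (\<mu> * (u * norm p))" "norm (f (p - of_real u * p)) \<le> c * exp (\<mu> * ((1 - u) * norm p))"
  "norm (g (of_real u * p)) \<le> d * exp (\<nu> * (u * norm p))" "norm (g (p - of_real u * p)) \<le> d * exp (\<nu> * ((1 - u) * norm p))"
  if "u \<in> {0..1}" for u
  using f g star_compactD[OF D p, of u] that norm_split_segment[of u p] unfolding supbd_def by (metis atLeastAtMost_iff)+
 have "norm (LINT u:{0..1}|lebesgue. f (of_real u * p) * g (p - of_real u * p))
   \<le> (LINT u:{0..1}|lebesgue. (c * d * exp (\<nu> * norm p)) * exp (- \<delta> * norm p * u))"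
 proof (rule norm_set_LINT_le)
  fix u :: real assume u: "u \<in> {0..1}"
  have "norm (f (of_real u * p) * g (p - of_real u * p)) \<le> (c * exp (\<mu> * (u * norm p))) * (d * exp (\<nu> * ((1 - u) * norm p)))"
   unfolding norm_mult using bounds[OF u] c by (intro mult_mono) auto
  also have "\<dots> = (c * d * exp (\<nu> * norm p)) * exp (- \<delta> * norm p * u)" by (simp add: \<delta>_def algebra_simps flip: exp_add)
  finally show "norm (f (of_real u * p) * g (p - of_real u * p)) \<le> (c * d * exp (\<nu> * norm p)) * exp (- \<delta> * norm p * u)" .
 qed (use E in auto)
 then have "norm (conv f g p) \<le> norm p * ((c * d * exp (\<nu> * norm p)) * (LINT u:{0..1}|lebesgue. exp (- \<delta> * norm p * u)))"
  unfolding conv_def seg_int_def norm_mult set_integral_mult_right by (intro mult_left_mono) auto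
 also have "\<dots> \<le> (c * d * exp (\<nu> * norm p)) * (1 / \<delta>)"
  using mult_left_mono[OF E(1), of "c * d * exp (\<nu> * norm p)"] c by (simp add: mult_ac)
 finally show "norm (conv f g p) \<le> c * d / (\<nu> - \<mu>) * exp (\<nu> * norm p)" by (simp add: \<delta>_def)
 have "norm (LINT u:{0..1}|lebesgue. g (of_real u * p) * f (p - of_real u * p))
   \<le> (LINT u:{0..1}|lebesgue. (c * d * exp (\<nu> * norm p)) * exp (- \<delta> * norm p * (1 - u)))"
 proof (rule norm_set_LINT_le)
  fix u :: real assume u: "u \<in> {0..1}"
  have "norm (g (of_real u * p) * f (p - of_real u * p)) \<le> (d * exp (\<nu> * (u * norm p))) * (c * exp (\<mu> * ((1 - u) * norm p)))"
   unfolding norm_mult using bounds[OF u] c by (intro mult_mono) auto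
  also have "\<dots> = (c * d * exp (\<nu> * norm p)) * exp (- \<delta> * norm p * (1 - u))" by (simp add: \<delta>_def algebra_simps flip: exp_add)
  finally show "norm (g (of_real u * p) * f (p - of_real u * p)) \<le> (c * d * exp (\<nu> * norm p)) * exp (- \<delta> * norm p * (1 - u))" .
 qed (use E in auto)
 then have "norm (conv g f p) \<le> norm p * ((c * d * exp (\<nu> * norm p)) * (LINT u:{0..1}|lebesgue. exp (- \<delta> * norm p * (1 - u))))"
  unfolding conv_def seg_int_def norm_mult set_integral_mult_right by (intro mult_left_mono) auto
 also have "\<dots> \<le> (c * d * exp (\<nu> * norm p)) * (1 / \<delta>)"
  using mult_left_mono[OF E(3), of "c * d * exp (\<nu> * norm p)"] c by (simp add: mult_ac)
 finally show "norm (conv g f p) \<le> c * d / (\<nu> - \<mu>) * exp (\<nu> * norm p)" by (simp add: \<delta>_def)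
qed

lemma seg_int_supbd: assumes "star_compact D" "supbd \<nu> D f c" "\<nu> > 0" "p \<in> D"
 shows "norm (seg_int f p) \<le> c / \<nu> * exp (\<nu> * norm p)"
 using conv_supbd_less(2)[of D 0 "\<lambda>_. 1" 1 \<nu> f c p] assms by (simp add: seg_int_eq_conv supbd_def)

lemma seg_int_diff: assumes "star_open U" "f holomorphic_on U" "g holomorphic_on U" "p \<in> U"
 shows "seg_int f p - seg_int g p = seg_int (\<lambda>p. f p - g p) p"
 using conv_diff_split[OF assms(1,2) holomorphic_on_const assms(3) holomorphic_on_const assms(4), of 1 1]
 by (simp add: seg_int_eq_conv)

locale coeff_bound =
 fixes \<rho> :: real and K :: "('n::{finite,linorder} \<Rightarrow> nat) \<Rightarrow> real" and gc :: "nat \<Rightarrow> ('n \<Rightarrow> nat) \<Rightarrow> 'n cvec"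
 assumes \<rho>: "\<rho> > 0" and K0: "\<And>l. K l \<ge> 0" and Ksum: "(\<lambda>l. wt K \<rho> l) summable_on UNIV"
  and gcK: "\<And>m l i. norm (gc m l $ i) \<le> K l / \<rho> ^ m"
begin

text \<open>A convolution in the sup norm costs the length of the segment, whence
  \<open>\<tau> = T\<close>. The kernels have exponential type \<open>1 / \<rho>\<close>, and their
  gap to the weight \<open>\<nu>\<close> gives \<open>\<eta>\<close>.\<close>

lemma sup_conv_bound:
 assumes U: "star_open U" and D: "star_compact D" "D \<subseteq> U" and T: "\<And>p. p \<in> D \<Longrightarrow> norm p \<le> T" and \<nu>: "\<nu> > 1 / \<rho>"
 shows "conv_bound (\<lambda>f. f holomorphic_on U) (supbd \<nu> D) T (1 / (\<rho> * (\<nu> - 1 / \<rho>))) \<rho> K gc"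
proof
 obtain p0 where "p0 \<in> D" using D by (auto simp: star_compact_def)
 then show T0: "T \<ge> 0" using T norm_ge_zero order_trans by blast
 show "0 \<le> 1 / (\<rho> * (\<nu> - 1 / \<rho>))" using \<rho> \<nu> by simp
 show "\<rho> > 0" "\<And>l. K l \<ge> 0" "(\<lambda>l. wt K \<rho> l) summable_on UNIV" by (fact \<rho> K0 Ksum)+
 show "norm (gc 0 l $ i) \<le> K l" for l i using gcK[of 0] by simp
 show "conv f g holomorphic_on U" if "f holomorphic_on U" "g holomorphic_on U" for f g using conv_holomorphic[OF U] that by blast
 show HG: "Gl gc l i holomorphic_on U" for l i using Gl_props(1)[OF \<rho>, of gc l i "K l" U] gcK by (simp add: HD_def)
 show "(\<lambda>p. a * f p) holomorphic_on U" if "f holomorphic_on U" for f a using that by (intro holomorphic_intros)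
 show "supbd \<nu> D f c \<Longrightarrow> c \<ge> 0" for f c by (simp add: supbd_def)
 show "supbd \<nu> D (\<lambda>_. 0) 0" by (simp add: supbd_def)
 show "supbd \<nu> D f c \<Longrightarrow> c \<le> d \<Longrightarrow> supbd \<nu> D f d" for f c d
  unfolding supbd_def by (auto intro: order_trans mult_right_mono)
 show "supbd \<nu> D f c \<Longrightarrow> supbd \<nu> D g d \<Longrightarrow> supbd \<nu> D (\<lambda>p. f p + g p) (c + d)" for f g c d
  unfolding supbd_def distrib_right by (auto intro: norm_triangle_mono)
 show "supbd \<nu> D f c \<Longrightarrow> supbd \<nu> D (\<lambda>p. a * f p) (norm a * c)" for f c a
  unfolding supbd_def by (auto simp: norm_mult mult.assoc intro: mult_left_mono)
 show "supbd \<nu> D (\<lambda>p. conv f g p - conv f' g' p) (T * (c1 * d + c * d1))"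
  if H: "f holomorphic_on U" "g holomorphic_on U" "f' holomorphic_on U" "g' holomorphic_on U"
   and b: "supbd \<nu> D (\<lambda>p. f p - f' p) c1" "supbd \<nu> D g d" "supbd \<nu> D f' c" "supbd \<nu> D (\<lambda>p. g p - g' p) d1"
  for f g f' g' c1 d c d1 unfolding supbd_def
 proof (intro conjI ballI)
  have nn: "c1 \<ge> 0" "d \<ge> 0" "c \<ge> 0" "d1 \<ge> 0" using b by (auto simp: supbd_def)
  then show "0 \<le> T * (c1 * d + c * d1)" using T0 by simp
  fix p assume p: "p \<in> D"
  have "norm (conv f g p - conv f' g' p) \<le> norm p * (c1 * d * exp (\<nu> * norm p)) + norm p * (c * d1 * exp (\<nu> * norm p))"
   unfolding conv_diff_split[OF U H subsetD[OF D(2) p]] by (intro norm_triangle_mono conv_supbd[OF D(1) _ _ p] b)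
  also have "\<dots> = norm p * (c1 * d + c * d1) * exp (\<nu> * norm p)" by (simp add: algebra_simps)
  also have "\<dots> \<le> T * (c1 * d + c * d1) * exp (\<nu> * norm p)" using T[OF p] nn by (intro mult_right_mono) auto
  finally show "norm (conv f g p - conv f' g' p) \<le> T * (c1 * d + c * d1) * exp (\<nu> * norm p)" .
 qed
 show "supbd \<nu> D (\<lambda>p. conv (Gl gc l i) f p - conv (Gl gc l i) f' p) (K l * (1 / (\<rho> * (\<nu> - 1 / \<rho>))) * c)"
  if H: "f holomorphic_on U" "f' holomorphic_on U" and b: "supbd \<nu> D (\<lambda>p. f p - f' p) c" for f f' c l i
  unfolding supbd_def
 proof (intro conjI ballI)
  show "0 \<le> K l * (1 / (\<rho> * (\<nu> - 1 / \<rho>))) * c" using K0 \<rho> \<nu> b by (simp add: supbd_def)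
  have G: "supbd (1 / \<rho>) D (Gl gc l i) (K l / \<rho>)"
   using Gl_props(2)[OF \<rho>, of gc l i "K l"] gcK K0 \<rho> by (simp add: supbd_def)
  fix p assume p: "p \<in> D"
  have "conv (Gl gc l i) f p - conv (Gl gc l i) f' p = conv (Gl gc l i) (\<lambda>p. f p - f' p) p"
   using conv_diff_split[OF U HG[of l i] H(1) HG[of l i] H(2) subsetD[OF D(2) p]] by simp
  also have "norm \<dots> \<le> K l / \<rho> * c / (\<nu> - 1 / \<rho>) * exp (\<nu> * norm p)"
   by (rule conv_supbd_less(1)[OF D(1) G b \<nu> p])
  finally show "norm (conv (Gl gc l i) f p - conv (Gl gc l i) f' p) \<le> K l * (1 / (\<rho> * (\<nu> - 1 / \<rho>))) * c * exp (\<nu> * norm p)"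
   by simp
 qed
 show "supbd \<nu> D (\<lambda>p. (\<Sum>\<^sub>\<infinity>l\<in>S. h l p) - (\<Sum>\<^sub>\<infinity>l\<in>S. h' l p)) (\<Sum>\<^sub>\<infinity>l\<in>S. dl l)"
  if b: "\<And>l. l \<in> S \<Longrightarrow> supbd \<nu> D (h l) (A l)" "\<And>l. l \<in> S \<Longrightarrow> supbd \<nu> D (h' l) (A l)"
   "\<And>l. l \<in> S \<Longrightarrow> supbd \<nu> D (\<lambda>p. h l p - h' l p) (dl l)" and s: "A summable_on S" "dl summable_on S"
  for S :: "('n \<Rightarrow> nat) set" and h h' A dl unfolding supbd_def
 proof (intro conjI ballI)
  show "0 \<le> (\<Sum>\<^sub>\<infinity>l\<in>S. dl l)" using b by (intro infsum_nonneg) (auto simp: supbd_def)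
  fix p assume p: "p \<in> D"
  have sm: "(\<lambda>l. h l p) summable_on S" "(\<lambda>l. h' l p) summable_on S"
   by (rule abs_summable_summable, rule summable_on_le_real[OF summable_on_cmult_left[OF s(1), of "exp (\<nu> * norm p)"]];
     use b p in \<open>auto simp: supbd_def\<close>)+
  have "norm (\<Sum>\<^sub>\<infinity>l\<in>S. h l p - h' l p) \<le> (\<Sum>\<^sub>\<infinity>l\<in>S. dl l * exp (\<nu> * norm p))"
   using b p by (intro norm_infsum_le[OF has_sum_infsum[OF summable_on_diff_infsum(1)[OF sm]] has_sum_infsum])
    (auto simp: supbd_def intro: summable_on_cmult_left s)
  moreover have "(\<Sum>\<^sub>\<infinity>l\<in>S. h l p - h' l p) = (\<Sum>\<^sub>\<infinity>l\<in>S. h l p) - (\<Sum>\<^sub>\<infinity>l\<in>S. h' l p)"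
   using sm by (rule summable_on_diff_infsum(2))
  ultimately show "norm ((\<Sum>\<^sub>\<infinity>l\<in>S. h l p) - (\<Sum>\<^sub>\<infinity>l\<in>S. h' l p)) \<le> (\<Sum>\<^sub>\<infinity>l\<in>S. dl l) * exp (\<nu> * norm p)"
   by (simp add: infsum_cmult_left')
 qed
qed auto

end

section \<open>Fixed points in weighted sup norms\<close>

lemma star_compact_cover: assumes "star_open U" "compact C" "C \<subseteq> U" "C \<noteq> {}"
 obtains D where "star_compact D" "C \<subseteq> D" "D \<subseteq> U"
 using star_compact_hull[OF assms(1-3)] assms(4) unfolding star_compact_def by (metis atLeastAtMost_iff subset_empty)

abbreviation bdd_family :: "complex set \<Rightarrow> (complex set \<Rightarrow> real) \<Rightarrow> (complex set \<Rightarrow> real) \<Rightarrow> ('i \<Rightarrow> complex \<Rightarrow> complex) \<Rightarrow> bool"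
 where "bdd_family U \<nu> \<kappa> Y \<equiv> (\<forall>i. Y i holomorphic_on U) \<and>
  (\<forall>D. star_compact D \<longrightarrow> D \<subseteq> U \<longrightarrow> (\<forall>i. supbd (\<nu> D) D (Y i) (\<kappa> D)))"

text \<open>Contraction with a weight \<open>\<nu> D\<close> and a radius \<open>\<kappa> D\<close>
  chosen separately for each compact set. The iterates start from 0 and do not depend on
  \<open>D\<close>, so the local limits form one function on \<open>U\<close>.\<close>

lemma Picard_iteration:
 fixes \<Phi> :: "('i::finite \<Rightarrow> complex \<Rightarrow> complex) \<Rightarrow> 'i \<Rightarrow> complex \<Rightarrow> complex"
 assumes U: "star_open U" and good: "\<And>Y. good Y \<longleftrightarrow> bdd_family U \<nu> \<kappa> Y"
  and hol: "\<And>Y i. good Y \<Longrightarrow> \<Phi> Y i holomorphic_on U"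
  and init: "\<And>D i. star_compact D \<Longrightarrow> D \<subseteq> U \<Longrightarrow> supbd (\<nu> D) D (\<Phi> (\<lambda>_ _. 0) i) (\<kappa> D / 2)"
  and lip: "\<And>D Y Z \<epsilon> i. star_compact D \<Longrightarrow> D \<subseteq> U \<Longrightarrow> good Y \<Longrightarrow> good Z \<Longrightarrow>
    (\<And>i. supbd (\<nu> D) D (\<lambda>p. Y i p - Z i p) \<epsilon>) \<Longrightarrow> supbd (\<nu> D) D (\<lambda>p. \<Phi> Y i p - \<Phi> Z i p) (\<epsilon> / 2)"
 shows "\<exists>Y. good Y \<and> (\<forall>i. \<forall>p\<in>U. \<Phi> Y i p = Y i p)"
proof -
 define Y where "Y n = (\<Phi> ^^ n) (\<lambda>_ _. 0)" for n
 have Y0: "Y 0 = (\<lambda>_ _. 0)" and YS: "Y (Suc n) = \<Phi> (Y n)" for n by (auto simp: Y_def)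
 have \<kappa>: "\<kappa> D \<ge> 0" if "star_compact D" "D \<subseteq> U" for D using init[OF that] by (simp add: supbd_def)
 have good0: "good (\<lambda>_ _. 0)" using \<kappa> by (auto simp: good supbd_def)
 have goodS: "good (\<Phi> Y)" if Y: "good Y" for Y unfolding good
 proof (intro conjI allI impI)
  show "\<Phi> Y i holomorphic_on U" for i by (rule hol[OF Y])
  fix D i assume D: "star_compact D" "D \<subseteq> U"
  have "supbd (\<nu> D) D (\<lambda>p. \<Phi> Y i p - \<Phi> (\<lambda>_ _. 0) i p) (\<kappa> D / 2)"
   by (rule lip[OF D Y good0]) (use Y D good in auto)
  \<comment> \<open>Half of the radius is spent on the image of 0, the other half on the
    contraction.\<close>
  then show "supbd (\<nu> D) D (\<Phi> Y i) (\<kappa> D)" using init[OF D, of i] unfolding supbd_def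
   by (smt (verit, del_insts) add_divide_distrib distrib_right field_sum_of_halves norm_triangle_sub)
 qed
 have goodY: "good (Y n)" for n by (induction n) (auto simp: Y0 YS good0 goodS)
 have step: "supbd (\<nu> D) D (\<lambda>p. Y (Suc n) i p - Y n i p) (\<kappa> D * (1/2) ^ Suc n)"
  if D: "star_compact D" "D \<subseteq> U" for D n i
 proof (induction n arbitrary: i)
  case 0 then show ?case using init[OF D] by (simp add: Y0 YS)
 next
  case (Suc n)
  have "supbd (\<nu> D) D (\<lambda>p. \<Phi> (Y (Suc n)) i p - \<Phi> (Y n) i p) (\<kappa> D * (1/2) ^ Suc n / 2)"
   by (rule lip[OF D goodY goodY Suc])
  then show ?case by (simp add: YS)
 qed
 have tail: "norm (Y (n + m) i p - Y n i p) \<le> \<kappa> D * (1/2) ^ n * exp (\<nu> D * norm p)"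
  if D: "star_compact D" "D \<subseteq> U" "p \<in> D" for D n m i p
 proof -
  \<comment> \<open>The induction carries the exact partial sum of the geometric series; its
    negative last term is dropped afterwards.\<close>
  have "norm (Y (n + m) i p - Y n i p) \<le> \<kappa> D * ((1/2) ^ n - (1/2) ^ (n + m)) * exp (\<nu> D * norm p)"
  proof (induction m)
   case (Suc m)
   have "norm (Y (Suc (n + m)) i p - Y (n + m) i p) \<le> \<kappa> D * (1/2) ^ Suc (n + m) * exp (\<nu> D * norm p)"
    using step[OF D(1,2)] D(3) unfolding supbd_def by blast
   from norm_triangle_mono[OF this Suc] show ?case by (simp add: algebra_simps)
  qed simp
  also have "\<dots> \<le> \<kappa> D * (1/2) ^ n * exp (\<nu> D * norm p)"
   using \<kappa>[OF D(1,2)] by (intro mult_right_mono mult_left_mono) auto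
  finally show ?thesis .
 qed
 have small: "(\<lambda>n. \<kappa> D * (1/2) ^ n * e) \<longlonglongrightarrow> 0" for D e
  by (intro tendsto_mult_left_zero tendsto_mult_right_zero LIMSEQ_power_zero) auto
 have cauchy: "Cauchy (\<lambda>n. Y n i p)" if p: "p \<in> U" for i p
 proof (rule metric_CauchyI)
  fix e :: real assume "e > 0"
  obtain D where D: "star_compact D" "{p} \<subseteq> D" "D \<subseteq> U" using star_compact_cover[OF U, of "{p}"] p by auto
  have "eventually (\<lambda>n. \<kappa> D * (1/2) ^ n * exp (\<nu> D * norm p) < e / 2) sequentially"
   using small[of D] \<open>e > 0\<close> by (intro order_tendstoD(2)[of _ 0]) auto
  then obtain N where N: "\<kappa> D * (1/2) ^ N * exp (\<nu> D * norm p) < e / 2" by (auto simp: eventually_sequentially)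
  have "dist (Y m i p) (Y N i p) < e / 2" if "m \<ge> N" for m
   using tail[OF D(1,3), of p N "m - N" i] that N D(2) by (simp add: dist_norm)
  then show "\<exists>M. \<forall>m\<ge>M. \<forall>n\<ge>M. dist (Y m i p) (Y n i p) < e" by (meson dist_triangle_half_l)
 qed
 define L where "L i p = lim (\<lambda>n. Y n i p)" for i p
 have lim: "(\<lambda>n. Y n i p) \<longlonglongrightarrow> L i p" if "p \<in> U" for i p
  unfolding L_def using cauchy[OF that] Cauchy_convergent_iff convergent_LIMSEQ_iff by blast
 have err: "supbd (\<nu> D) D (\<lambda>p. L i p - Y n i p) (\<kappa> D * (1/2) ^ n)"
  if D: "star_compact D" "D \<subseteq> U" for D n i unfolding supbd_def
 proof (intro conjI ballI)
  show "0 \<le> \<kappa> D * (1/2) ^ n" using \<kappa>[OF D] by simp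
  fix p assume p: "p \<in> D"
  have "(\<lambda>m. norm (Y (m + n) i p - Y n i p)) \<longlonglongrightarrow> norm (L i p - Y n i p)"
   using p D by (intro tendsto_intros LIMSEQ_ignore_initial_segment lim) auto
  then show "norm (L i p - Y n i p) \<le> \<kappa> D * (1/2) ^ n * exp (\<nu> D * norm p)"
   by (rule LIMSEQ_le_const2) (use tail[OF D p, of n _ i] in \<open>auto simp: add.commute\<close>)
 qed
 have Lhol: "L i holomorphic_on U" for i
 proof (rule holomorphic_uniform_sequence[of U "\<lambda>n. Y n i"])
  show "open U" using U by (rule star_openD)
  show "Y n i holomorphic_on U" for n using goodY good by blast
  fix x assume "x \<in> U"
  then obtain r where r: "r > 0" "cball x r \<subseteq> U" using star_openD(1)[OF U] open_contains_cball by blast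
  then have "x \<in> cball x r" by auto
  then obtain D where D: "star_compact D" "cball x r \<subseteq> D" "D \<subseteq> U"
   using star_compact_cover[OF U compact_cball r(2)] by auto
  have "bounded D" using D by (simp add: star_compact_def compact_imp_bounded)
  then obtain T where T: "\<And>p. p \<in> D \<Longrightarrow> norm p \<le> T" by (auto simp: bounded_iff)
  have "uniform_limit (cball x r) (\<lambda>n. Y n i) (L i) sequentially"
  proof (rule uniform_limitI)
   fix e :: real assume "e > 0"
   then have "eventually (\<lambda>n. \<kappa> D * (1/2) ^ n * exp (\<bar>\<nu> D\<bar> * T) < e) sequentially"
    using small[of D] by (intro order_tendstoD(2)[of _ 0]) auto
   then show "\<forall>\<^sub>F n in sequentially. \<forall>p\<in>cball x r. dist (Y n i p) (L i p) < e"
   proof (eventually_elim, intro ballI)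
    fix n p assume elim: "\<kappa> D * (1/2) ^ n * exp (\<bar>\<nu> D\<bar> * T) < e" and "p \<in> cball x r"
    then have p: "p \<in> D" using D by auto
    have "\<nu> D * norm p \<le> \<bar>\<nu> D\<bar> * T" using T[OF p] by (intro mult_mono) auto
    then have "norm (L i p - Y n i p) \<le> \<kappa> D * (1/2) ^ n * exp (\<bar>\<nu> D\<bar> * T)"
     using err[OF D(1,3), of i n] p \<kappa>[OF D(1,3)] unfolding supbd_def
     by (meson exp_le_cancel_iff mult_left_mono order_trans)
    then show "dist (Y n i p) (L i p) < e" using elim by (simp add: dist_norm norm_minus_commute)
   qed
  qed
  with r show "\<exists>d>0. cball x d \<subseteq> U \<and> uniform_limit (cball x d) (\<lambda>n. Y n i) (L i) sequentially" by blast
 qed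
 have goodL: "good L" unfolding good using Lhol err[of _ _ 0] by (simp add: Y0)
 have "\<Phi> L i p = L i p" if p: "p \<in> U" for i p
 proof -
  obtain D where D: "star_compact D" "{p} \<subseteq> D" "D \<subseteq> U" using star_compact_cover[OF U, of "{p}"] p by auto
  have "norm (\<Phi> L i p - Y (Suc n) i p) \<le> \<kappa> D * (1/2) ^ n * (exp (\<nu> D * norm p) / 2)" for n
   using lip[OF D(1,3) goodL goodY err[OF D(1,3)], of i n] D(2) unfolding supbd_def YS by auto
  then have "(\<lambda>n. \<Phi> L i p - Y (Suc n) i p) \<longlonglongrightarrow> 0"
   by (intro Lim_null_comparison[OF _ small[of D "exp (\<nu> D * norm p) / 2"]] always_eventually allI)
  moreover have "(\<lambda>n. \<Phi> L i p - Y (Suc n) i p) \<longlonglongrightarrow> \<Phi> L i p - L i p"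
   by (intro tendsto_intros LIMSEQ_Suc lim p)
  ultimately show ?thesis using LIMSEQ_unique by fastforce
 qed
 with goodL show ?thesis by blast
qed

section \<open>Formal solutions and the convolution equation\<close>

lemma finite_msize_le: "finite {l :: 'n::finite \<Rightarrow> nat. msize l \<le> d}"
proof (rule finite_subset)
 show "{l :: 'n \<Rightarrow> nat. msize l \<le> d} \<subseteq> PiE UNIV (\<lambda>_. {..d})"
 proof (auto simp: msize_def PiE_def)
  fix l :: "'n \<Rightarrow> nat" and i assume "sum l UNIV \<le> d"
  moreover have "l i \<le> sum l UNIV" by (rule member_le_sum) auto
  ultimately show "l i \<le> d" by simp
 qed
qed (intro finite_PiE, auto)

lemma infsum_finite_support: assumes "finite L" "L \<subseteq> S" "\<And>x. x \<in> S - L \<Longrightarrow> f x = 0"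
 shows "(\<Sum>\<^sub>\<infinity>x\<in>S. f x) = (\<Sum>x\<in>L. f x)"
proof -
 have "infsum f S = infsum f L" by (rule infsum_cong_neutral) (use assms in auto)
 then show ?thesis using assms by simp
qed

text \<open>The coefficients of \<open>\<zeta>^k \<xi>^n\<close> with \<open>k + n < d\<close> vanish.\<close>

definition bigrade :: "nat \<Rightarrow> complex fps fps \<Rightarrow> bool"
 where "bigrade d w \<longleftrightarrow> (\<forall>k n. k + n < d \<longrightarrow> fps_nth (fps_nth w k) n = 0)"

lemma bigrade_mult: assumes "bigrade d w" "bigrade e v" shows "bigrade (d + e) (w * v)" unfolding bigrade_def
proof (intro allI impI)
 fix k n assume kn: "k + n < d + e"
 have "fps_nth (fps_nth w i * fps_nth v (k - i)) n = 0" if "i \<le> k" for i unfolding fps_mult_nth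
 proof (intro sum.neutral ballI)
  fix j assume "j \<in> {0..n}"
  then have "i + j < d \<or> (k - i) + (n - j) < e" using that kn by auto
  then show "fps_nth (fps_nth w i) j * fps_nth (fps_nth v (k - i)) (n - j) = 0" using assms by (auto simp: bigrade_def)
 qed
 then show "fps_nth (fps_nth (w * v) k) n = 0" by (simp add: fps_mult_nth[of w] fps_sum_nth)
qed

lemma bigrade_power: "bigrade 1 w \<Longrightarrow> bigrade l (w ^ l)"
proof (induction l)
 case (Suc l)
 then show ?case using bigrade_mult[of 1 w l "w ^ l"] by simp
qed (simp add: bigrade_def)

lemma bigrade_prod:
 assumes "\<And>j. bigrade 1 (y j)" shows "bigrade (msize l) (\<Prod>j\<in>(UNIV :: 'n::finite set). y j ^ l j)"
proof -
 have "finite A \<Longrightarrow> bigrade (\<Sum>j\<in>A. l j) (\<Prod>j\<in>A. y j ^ l j)" for A :: "'n set"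
  by (induction A rule: finite_induct) (auto intro!: bigrade_mult bigrade_power assms simp: bigrade_def[of 0])
 then show ?thesis unfolding msize_def by simp
qed

text \<open>A product of \<open>|l|\<close> factors of bidegree at least 1 has no coefficient at
  \<open>\<zeta>^k \<xi>^n\<close> with \<open>k + n < |l|\<close>. Hence only
  \<open>|l| \<le> k + N\<close> contributes to degree \<open>N\<close>, and the double sum is
  finite and may be rearranged.\<close>

lemma ts_g_eq: fixes y :: "'n::finite \<Rightarrow> complex fps fps" assumes "\<And>j. bigrade 1 (y j)"
 shows "ts_g gc y k i = Abs_fps (\<lambda>N. \<Sum>\<^sub>\<infinity>l\<in>{l. msize l \<ge> 1}.
   fps_nth (Gfps gc l i * fps_nth (\<Prod>j\<in>UNIV. y j ^ l j) k) N)" unfolding ts_g_def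
proof (intro arg_cong[of _ _ Abs_fps] ext)
 fix N
 define L where "L = {l :: 'n \<Rightarrow> nat. 1 \<le> msize l \<and> msize l \<le> k + N}"
 define c where "c l n = fps_nth (fps_nth (\<Prod>j\<in>UNIV. y j ^ l j) k) n" for l n
 have L: "finite L" unfolding L_def by (rule finite_subset[OF _ finite_msize_le[of "k + N"]]) auto
 have c0: "c l n = 0" if "k + n < msize l" for l n using bigrade_prod[OF assms, of l] that unfolding bigrade_def c_def by auto
 have "(\<Sum>\<^sub>\<infinity>(m, l)\<in>{(m, l). m \<le> N \<and> msize l \<ge> 1}. gc m l $ i * c l (N - m))
   = (\<Sum>(m, l)\<in>{..N} \<times> L. gc m l $ i * c l (N - m))"
  using L c0 by (intro infsum_finite_support) (auto simp: L_def intro!: c0)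
 also have "\<dots> = (\<Sum>m\<le>N. \<Sum>l\<in>L. gc m l $ i * c l (N - m))" by (simp add: sum.cartesian_product)
 also have "\<dots> = (\<Sum>l\<in>L. \<Sum>m\<le>N. gc m l $ i * c l (N - m))" by (rule sum.swap)
 also have "\<dots> = (\<Sum>l\<in>L. fps_nth (Gfps gc l i * fps_nth (\<Prod>j\<in>UNIV. y j ^ l j) k) N)"
  by (simp add: fps_mult_nth Gfps_def c_def atLeast0AtMost)
 also have "\<dots> = (\<Sum>\<^sub>\<infinity>l\<in>{l. msize l \<ge> 1}. fps_nth (Gfps gc l i * fps_nth (\<Prod>j\<in>UNIV. y j ^ l j) k) N)"
 proof (intro infsum_finite_support[symmetric] L)
  fix l :: "'n \<Rightarrow> nat" assume "l \<in> {l. 1 \<le> msize l} - L"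
  then show "fps_nth (Gfps gc l i * fps_nth (\<Prod>j\<in>UNIV. y j ^ l j) k) N = 0"
   unfolding fps_mult_nth c_def[symmetric] by (intro sum.neutral) (auto simp: L_def intro!: c0)
 qed (auto simp: L_def)
 finally show "(\<Sum>\<^sub>\<infinity>(m, l)\<in>{(m, l). m \<le> N \<and> msize l \<ge> 1}.
   gc m l $ i * fps_nth (fps_nth (\<Prod>j\<in>UNIV. y j ^ l j) k) (N - m)) = \<dots>" by (simp add: c_def)
qed

lemma fps_nth_0_prod_power: "fps_nth (\<Prod>j\<in>A. y j ^ l j) 0 = (\<Prod>j\<in>A. fps_nth (y j) 0 ^ l j :: 'a::comm_ring_1)"
proof -
 have "fps_nth (w ^ n) 0 = fps_nth w 0 ^ n" for w :: "'a fps" and n by (induction n) auto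
 then show ?thesis by (induction A rule: infinite_finite_induct) auto
qed

lemma fps_X_power_dvd_iff: "fps_X ^ n dvd (a :: complex fps) \<longleftrightarrow> (\<forall>m<n. fps_nth a m = 0)"
proof
 assume "fps_X ^ n dvd a"
 then show "\<forall>m<n. fps_nth a m = 0" by (auto simp: dvd_def fps_X_power_mult_nth)
next
 assume "\<forall>m<n. fps_nth a m = 0"
 then have "a = fps_X ^ n * fps_shift n a" by (auto simp: fps_eq_iff fps_X_power_mult_nth)
 then show "fps_X ^ n dvd a" by (metis dvd_triv_left)
qed

text \<open>Telescoping; every factor other than the difference contributes one power of
  \<open>fps_X\<close>.\<close>

lemma prod_list_dvd_diff: fixes v w :: "'a \<Rightarrow> complex fps"
 assumes "xs \<noteq> []" "\<And>x. fps_X dvd v x" "\<And>x. fps_X dvd w x" "\<And>x. fps_X ^ n dvd v x - w x"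
 shows "fps_X ^ (length xs - 1 + n) dvd prod_list (map v xs) - prod_list (map w xs)" using assms(1)
proof (induction xs rule: induct_list012)
 case (3 x y zs)
 have p: "fps_X ^ length xs dvd prod_list (map v xs)" for xs :: "'a list" by (induction xs) (auto intro: mult_dvd_mono assms)
 have "fps_X ^ (n + length (y # zs)) dvd (v x - w x) * prod_list (map v (y # zs))"
  unfolding power_add by (rule mult_dvd_mono[OF assms(4) p])
 moreover have "fps_X ^ (1 + (length (y # zs) - 1 + n)) dvd w x * (prod_list (map v (y # zs)) - prod_list (map w (y # zs)))"
  unfolding power_add power_one_right using assms(3) 3 by (intro mult_dvd_mono) (auto simp: power_add)
 ultimately have "fps_X ^ (n + length (y # zs)) dvd (v x - w x) * prod_list (map v (y # zs)) +
   w x * (prod_list (map v (y # zs)) - prod_list (map w (y # zs)))" by (intro dvd_add) (simp_all add: add_ac)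
 then show ?case by (simp add: algebra_simps)
qed (use assms in auto)

definition Nfps :: "(nat \<Rightarrow> ('n \<Rightarrow> nat) \<Rightarrow> 'n::{finite,linorder} cvec) \<Rightarrow> ('n \<Rightarrow> complex fps) \<Rightarrow> 'n \<Rightarrow> complex fps"
 where "Nfps gc v i = Abs_fps (\<lambda>N. \<Sum>\<^sub>\<infinity>l\<in>{l. msize l \<ge> 1}. fps_nth (Gfps gc l i * (\<Prod>j\<in>UNIV. v j ^ l j)) N)"

lemma prod_power_idx: "(\<Prod>j\<in>UNIV. v j ^ l j) = prod_list (map (\<lambda>x. v (fst x)) (idx l))"
 using prod_list_idx[of "\<lambda>i j. v i" l] by (simp add: case_prod_unfold)

text \<open>A disagreement starting in degree \<open>n\<close> reaches the nonlinear term only in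
  degree \<open>n + 1\<close>: for \<open>|l| \<ge> 2\<close> another factor of the product is
  divisible by \<open>fps_X\<close>, and for \<open>|l| = 1\<close> the coefficient is.\<close>

lemma Nfps_nth_cong: assumes g1: "\<And>l. msize l = 1 \<Longrightarrow> gc 0 l = 0 \<and> gc 1 l = 0" and n: "n \<ge> 1"
  and X: "\<And>j. fps_X dvd v j" "\<And>j. fps_X dvd w j" and d: "\<And>j. fps_X ^ n dvd v j - w j"
 shows "fps_nth (Nfps gc v i) n = fps_nth (Nfps gc w i) n" unfolding Nfps_def fps_nth_Abs_fps
proof (intro infsum_cong)
 fix l :: "'a \<Rightarrow> nat" assume l: "l \<in> {l. 1 \<le> msize l}"
 have "fps_X ^ (length (idx l) - 1 + n) dvd (\<Prod>j\<in>UNIV. v j ^ l j) - (\<Prod>j\<in>UNIV. w j ^ l j)"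
  unfolding prod_power_idx using l idx_nonempty[of l] X d by (intro prod_list_dvd_diff) auto
 \<comment> \<open>The truncated difference \<open>2 - msize l\<close> is 1 for
   \<open>|l| = 1\<close> and 0 otherwise.\<close>
 moreover have "fps_X ^ (2 - msize l) dvd Gfps gc l i"
  using l g1[of l] by (cases "msize l = 1") (auto simp: fps_X_power_dvd_iff[of 1, simplified] Gfps_def)
 ultimately have "fps_X ^ (2 - msize l) * fps_X ^ (length (idx l) - 1 + n) dvd Gfps gc l i * ((\<Prod>j\<in>UNIV. v j ^ l j) - (\<Prod>j\<in>UNIV. w j ^ l j))"
  by (rule mult_dvd_mono[rotated])
 then have "fps_X ^ (2 - msize l + (msize l - 1 + n)) dvd Gfps gc l i * ((\<Prod>j\<in>UNIV. v j ^ l j) - (\<Prod>j\<in>UNIV. w j ^ l j))"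
  by (simp add: power_add length_idx)
 then have "fps_nth (Gfps gc l i * ((\<Prod>j\<in>UNIV. v j ^ l j) - (\<Prod>j\<in>UNIV. w j ^ l j))) n = 0"
  using l unfolding fps_X_power_dvd_iff by auto
 then show "fps_nth (Gfps gc l i * (\<Prod>j\<in>UNIV. v j ^ l j)) n = fps_nth (Gfps gc l i * (\<Prod>j\<in>UNIV. w j ^ l j)) n"
  by (simp add: right_diff_distrib)
qed

lemma fps_X_sq_deriv_nth: "fps_nth (fps_X^2 * fps_deriv w) (Suc n) = of_nat n * fps_nth (w :: complex fps) n"
 "fps_nth (fps_X^2 * fps_deriv w) 0 = 0" by (cases n; simp add: power2_eq_square mult.assoc)+

text \<open>In degree \<open>n\<close> only the left side contains the coefficient of degree
  \<open>n\<close>; all other terms see lower degrees. As \<open>lam $ i\<close> is nonzero, the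
  recursion determines every coefficient.\<close>

lemma formal_unique_0: assumes g1: "\<And>l. msize l = 1 \<Longrightarrow> gc 0 l = 0 \<and> gc 1 l = 0"
  and lam: "\<And>i. lam $ i \<noteq> 0"
  and v: "\<And>i. fps_nth (v i) 0 = 0" "\<And>i. fps_const (lam $ i) * v i = f i + fps_X^2 * fps_deriv (v i) - fps_const (b $ i) * fps_X * v i + Nfps gc v i"
  and w: "\<And>i. fps_nth (w i) 0 = 0" "\<And>i. fps_const (lam $ i) * w i = f i + fps_X^2 * fps_deriv (w i) - fps_const (b $ i) * fps_X * w i + Nfps gc w i"
 shows "v i = w i"
proof -
 have X: "fps_X dvd v j" "fps_X dvd w j" for j using v(1) w(1) fps_X_power_dvd_iff[of 1] by auto
 have "\<forall>j. fps_nth (v j) n = fps_nth (w j) n" for n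
 proof (induction n rule: less_induct)
  case (less n)
  show ?case
  proof (cases n)
   case 0 then show ?thesis using v w by simp
  next
   case (Suc m)
   have d: "fps_X ^ n dvd v j - w j" for j using less by (simp add: fps_X_power_dvd_iff)
   have N: "fps_nth (Nfps gc v j) n = fps_nth (Nfps gc w j) n" for j by (rule Nfps_nth_cong[OF g1 _ X d]) (use Suc in auto)
   have "lam $ j * fps_nth (v j) n = lam $ j * fps_nth (w j) n" for j
    using arg_cong[OF v(2)[of j], of "\<lambda>a. fps_nth a n"] arg_cong[OF w(2)[of j], of "\<lambda>a. fps_nth a n"] N[of j] less[of m] Suc
    by (simp add: fps_X_sq_deriv_nth mult.assoc)
   then show ?thesis using lam by simp
  qed
 qed
 then show ?thesis by (simp add: fps_eq_iff)
qed

section \<open>Passing between analytic functions and their series\<close>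

lemma HD_cong: assumes "star_open U" "HD U F w" "fst F = fst G" "\<And>p. p \<in> U \<Longrightarrow> snd F p = snd G p"
 shows "HD U G w"
proof -
 have "eventually (\<lambda>p. p \<in> U) (nhds 0)" using star_openD[OF assms(1)] by (simp add: eventually_nhds_in_open)
 then have "eventually (\<lambda>p. snd F p = snd G p) (nhds 0)" by eventually_elim (use assms in auto)
 then have "snd G has_fps_expansion bor 1 (fps_shift 1 w)"
  using assms(2) has_fps_expansion_cong[of "snd F" "snd G"] by (auto simp: HD_def)
 moreover have "snd G holomorphic_on U" using assms by (auto simp: HD_def cong: holomorphic_cong)
 ultimately show ?thesis using assms by (simp add: HD_def)
qed

lemma bor_surj: "\<exists>a. bor 1 a = F"
proof
 show "bor 1 (Abs_fps (\<lambda>n. fps_nth F n * fact n)) = F"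
  using Gamma_fact[where 'a = complex] by (simp add: fps_eq_iff rGamma_inverse_Gamma)
qed

text \<open>Division by factorials is invertible, so every function analytic at 0 is the Borel
  transform of some formal series, convergent or not.\<close>

lemma HD_exists: assumes "star_open U" "f holomorphic_on U" shows "\<exists>w. HD U (c, f) w"
proof -
 have "f has_fps_expansion fps_expansion f 0"
  using assms star_openD[OF assms(1)] by (intro analytic_at_imp_has_fps_expansion_0) (auto simp: analytic_at)
 moreover obtain a where "bor 1 a = fps_expansion f 0" using bor_surj by blast
 ultimately have "HD U (c, f) (fps_const c + fps_X * a)" unfolding HD_def fps_shift_const_X using assms by simp
 then show ?thesis by blast
qed

lemma HD_unique:
 assumes "HD U F w" "HD U G v" "fst F = fst G" "\<And>p. p \<in> U \<Longrightarrow> snd F p = snd G p" "star_open U"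
 shows "w = v"
proof -
 have "HD U G w" using HD_cong[OF assms(5,1,3)] assms(4) by blast
 then have "bor 1 (fps_shift 1 w) = bor 1 (fps_shift 1 v)" "fps_nth w 0 = fps_nth v 0"
  using assms(2) by (auto simp: HD_def dest!: fps_expansion_eqI)
 moreover from this(1) have "fps_shift 1 w = fps_shift 1 v" by (rule bor_inj) simp
 ultimately show ?thesis using fps_const_X_shift[of w] fps_const_X_shift[of v] by metis
qed

lemma HD_mult_p: assumes "HD U (0, f) w" shows "HD U (0, \<lambda>p. p * f p) (fps_X^2 * fps_deriv w)"
proof -
 define a where "a = fps_shift 1 w"
 have w: "w = fps_X * a" using assms fps_const_X_shift[of w] by (simp add: HD_def a_def)
 have "fps_X^2 * fps_deriv w = fps_const 0 + fps_X * (fps_X^2 * fps_deriv a + fps_const 1 * fps_X * a)"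
  unfolding w by (simp add: power2_eq_square algebra_simps)
 then have "fps_shift 1 (fps_X^2 * fps_deriv w) = fps_X^2 * fps_deriv a + fps_const 1 * fps_X * a"
  "fps_nth (fps_X^2 * fps_deriv w) 0 = 0" by (simp_all only: fps_shift_const_X) simp
 moreover have "(\<lambda>p. p * f p) has_fps_expansion bor 1 (fps_X^2 * fps_deriv a + fps_const 1 * fps_X * a)"
  unfolding bor_deriv[symmetric] using assms by (intro has_fps_expansion_mult has_fps_expansion_fps_X) (simp add: HD_def a_def)
 moreover have "(\<lambda>p. p * f p) holomorphic_on U" using assms by (auto simp: HD_def intro!: holomorphic_intros)
 ultimately show ?thesis unfolding HD_def by simp
qed

lemma HD_seg_int: assumes "star_open U" "HD U (0, f) w" shows "HD U (0, seg_int f) (fps_X * w)"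
proof -
 have "bor 1 1 = 1" by (simp add: fps_eq_iff)
 moreover have "fps_shift 1 (fps_X :: complex fps) = 1" by (simp add: fps_eq_iff)
 ultimately have "HD U (0, \<lambda>_. 1) fps_X" by (simp add: HD_def del: One_nat_def)
 from HD_dconv[OF assms this] show ?thesis by (simp add: dconv_def seg_int_eq_conv[abs_def] mult.commute)
qed

lemma HD_diff: "HD U F w \<Longrightarrow> HD U G v \<Longrightarrow> HD U (fst F - fst G, \<lambda>p. snd F p - snd G p) (w - v)"
 by (auto simp: HD_def bor_diff fps_shift_diff intro!: holomorphic_intros has_fps_expansion_diff)

section \<open>The convolution equation on a star-shaped domain\<close>

locale conv_system = coeff_bound \<rho> K gc
 for \<rho> and K :: "('n::{finite,linorder} \<Rightarrow> nat) \<Rightarrow> real" and gc +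
 fixes lam b :: "'n cvec" and fc :: "nat \<Rightarrow> 'n cvec" and R C :: real
 assumes R: "R > 0" and C: "C \<ge> 0" and fcK: "\<And>m i. norm (fc m $ i) \<le> C * R ^ m"
  and fc0: "\<And>m. m < 2 \<Longrightarrow> fc m = 0" and gc_0: "\<And>m l. msize l = 0 \<Longrightarrow> gc m l = 0"
  and gc_1: "\<And>l. msize l = 1 \<Longrightarrow> gc 0 l = 0 \<and> gc 1 l = 0"
  and lam_nz: "\<And>i. lam $ i \<noteq> 0" and lam_1: "lam $ ix1 = 1"
  and lam_arg: "\<And>i j. i < j \<Longrightarrow> Arg2pi (lam $ i) < Arg2pi (lam $ j)"
  and beta: "0 < Re (b $ ix1)" "Re (b $ ix1) \<le> 1"
begin

text \<open>Smallness in some weighted norm on each compact set, enough for absolute convergence of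
  the nonlinear series. It is recorded with the solution because the coefficients
  \<open>dcoef\<close> need it again.\<close>

definition small_on :: "complex set \<Rightarrow> (complex \<Rightarrow> 'n cvec) \<Rightarrow> bool"
 where "small_on U Y \<longleftrightarrow> (\<forall>D. star_compact D \<longrightarrow> D \<subseteq> U \<longrightarrow>
  (\<exists>\<nu> \<kappa> T. \<nu> > 1 / \<rho> \<and> (\<forall>p\<in>D. norm p \<le> T) \<and> T * \<kappa> \<le> \<rho> / 4 \<and> (\<forall>i. supbd \<nu> D (\<lambda>p. Y p $ i) \<kappa>)))"

text \<open>\<open>Nop\<close> separates the delta and the kernel part of each term, whereas the
  series side has one product per \<open>l\<close>. Both parts are summable by the same majorant, so
  they can be joined; the terms \<open>|l| = 1\<close> absent from the second sum have coefficient 0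
  by \<open>gc_1\<close>.\<close>

lemma Nop_HD: assumes U: "star_open U" and Y: "\<And>i. HD U (0, \<lambda>p. Y p $ i) (v i)" and small: "small_on U Y"
 shows "HD U (0, \<lambda>p. Nop gc Y p i) (Nfps gc v i)"
proof -
 define F where "F l = dconv (gc 0 l $ i, Gl gc l i) (conv_pow Y l)" for l
 have hol: "(\<lambda>p. Y p $ i) holomorphic_on U" for i using Y[of i] by (simp add: HD_def)
 have F: "HD U (F l) (Gfps gc l i * (\<Prod>j\<in>UNIV. v j ^ l j))" for l
  unfolding F_def by (rule HD_dconv[OF U Gl_props(1)[OF \<rho> gcK] HD_conv_pow[OF U Y]])
 have fst0: "fst (conv_pow Y l) = 0" if "msize l \<ge> 1" for l
  unfolding conv_pow_cprod using that idx_nonempty[of l] by (intro fst_cprod) auto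
 have sF: "snd (F l) p = nlt gc Y l i p + Gconv gc Y l i p" "fst (F l) = 0" if "msize l \<ge> 1" for l p
  using fst0[OF that] by (simp_all add: F_def dconv_def)
 have bd: "\<exists>B. \<forall>l p. msize l \<ge> 1 \<longrightarrow> p \<in> A \<longrightarrow>
   norm (nlt gc Y l i p) \<le> wt K \<rho> l * B \<and>
   norm (Gconv gc Y l i p) \<le> wt K \<rho> l * B" if A: "compact A" "A \<subseteq> U" for A
 proof (cases "A = {}")
  case False
  obtain D where D: "star_compact D" "A \<subseteq> D" "D \<subseteq> U" using star_compact_cover[OF U A False] by metis
  obtain \<nu> \<kappa> T where \<nu>: "\<nu> > 1 / \<rho>" and T: "\<And>p. p \<in> D \<Longrightarrow> norm p \<le> T" "T * \<kappa> \<le> \<rho> / 4"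
   and Yb: "\<And>i. supbd \<nu> D (\<lambda>p. Y p $ i) \<kappa>" using small D(1,3) unfolding small_on_def by blast
  define \<eta> where "\<eta> = 1 / (\<rho> * (\<nu> - 1 / \<rho>))"
  interpret conv_bound "\<lambda>f. f holomorphic_on U" "supbd \<nu> D" T \<eta> \<rho> K gc
   unfolding \<eta>_def by (rule sup_conv_bound[OF U D(1,3) T(1) \<nu>])
  have \<kappa>: "\<kappa> \<ge> 0" using Yb by (auto simp: supbd_def)
  have \<nu>0: "\<nu> > 0" using \<nu> \<rho> by (meson divide_pos_pos order_less_trans zero_less_one)
  define B where "B = (1 + \<eta>) * (\<kappa> / \<rho>) * exp (\<nu> * T)"
  have e: "\<kappa> / \<rho> * exp (\<nu> * norm p) \<le> B" "\<eta> * (\<kappa> / \<rho>) * exp (\<nu> * norm p) \<le> B" if "p \<in> D" for p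
  proof -
   have "exp (\<nu> * norm p) \<le> exp (\<nu> * T)" using T(1)[OF that] \<nu>0 by simp
   moreover have "1 * (\<kappa> / \<rho>) \<le> (1 + \<eta>) * (\<kappa> / \<rho>)" "\<eta> * (\<kappa> / \<rho>) \<le> (1 + \<eta>) * (\<kappa> / \<rho>)"
    using \<eta> \<kappa> \<rho> by (intro mult_right_mono; simp)+
   ultimately show "\<kappa> / \<rho> * exp (\<nu> * norm p) \<le> B" "\<eta> * (\<kappa> / \<rho>) * exp (\<nu> * norm p) \<le> B"
    unfolding B_def using \<eta> \<kappa> \<rho> by (intro mult_mono; simp)+
  qed
  have "norm (nlt gc Y l i p) \<le> wt K \<rho> l * B \<and>
   norm (Gconv gc Y l i p) \<le> wt K \<rho> l * B" if l: "msize l \<ge> 1" and p: "p \<in> A" for l p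
  proof -
   have pD: "p \<in> D" using p D by auto
   have k: "wt K \<rho> l \<ge> 0" using K0 \<rho> by simp
   have "norm (nlt gc Y l i p) \<le> wt K \<rho> l * (\<kappa> / \<rho>) * exp (\<nu> * norm p)"
    using Nop_term_bounds(3)[OF T(2) hol Yb l] pD unfolding supbd_def by blast
   also have "\<dots> \<le> wt K \<rho> l * B" using mult_left_mono[OF e(1)[OF pD] k] by (simp add: mult.assoc)
   finally have 1: "norm (nlt gc Y l i p) \<le> wt K \<rho> l * B" .
   have "norm (Gconv gc Y l i p) \<le> wt K \<rho> l * (\<eta> * (\<kappa> / \<rho>)) * exp (\<nu> * norm p)"
    using Nop_term_bounds(2)[OF T(2) hol Yb l] pD unfolding supbd_def by blast
   also have "\<dots> \<le> wt K \<rho> l * B" using mult_left_mono[OF e(2)[OF pD] k] by (simp add: mult.assoc)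
   finally show ?thesis using 1 by blast
  qed
  then show ?thesis by blast
 qed auto
 have sumK: "(\<lambda>l. wt K \<rho> l * B) summable_on S" for B and S :: "('n \<Rightarrow> nat) set"
  using summable_on_subset_banach[OF Ksum] by (intro summable_on_cmult_left) auto
 have "HD U (\<Sum>\<^sub>\<infinity>l\<in>{l. msize l \<ge> 1}. fst (F l), \<lambda>p. \<Sum>\<^sub>\<infinity>l\<in>{l. msize l \<ge> 1}. snd (F l) p) (Nfps gc v i)"
  unfolding Nfps_def
 proof (rule HD_infsum[OF U F])
  fix A assume A: "compact A" "A \<subseteq> U"
  obtain B where B: "\<And>l p. msize l \<ge> 1 \<Longrightarrow> p \<in> A \<Longrightarrow> norm (nlt gc Y l i p) \<le> wt K \<rho> l * B \<and>
   norm (Gconv gc Y l i p) \<le> wt K \<rho> l * B" using bd[OF A] by blast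
  show "\<exists>M. M summable_on {l. msize l \<ge> 1} \<and> (\<forall>l\<in>{l. msize l \<ge> 1}. \<forall>p\<in>A. norm (snd (F l) p) \<le> M l)"
  proof (intro exI[of _ "\<lambda>l. wt K \<rho> l * (2 * B)"] conjI sumK ballI)
   fix l :: "'n \<Rightarrow> nat" and p assume "l \<in> {l. msize l \<ge> 1}" and p: "p \<in> A"
   then have l: "msize l \<ge> 1" by simp
   have "norm (snd (F l) p) \<le> wt K \<rho> l * B + wt K \<rho> l * B"
    unfolding sF(1)[OF l] by (rule norm_triangle_mono) (use B[OF l p] in blast)+
   then show "norm (snd (F l) p) \<le> wt K \<rho> l * (2 * B)" by (simp add: mult_ac)
  qed
 qed
 then show ?thesis
 proof (rule HD_cong[OF U])
  show "fst (\<Sum>\<^sub>\<infinity>l\<in>{l. msize l \<ge> 1}. fst (F l), \<lambda>p. \<Sum>\<^sub>\<infinity>l\<in>{l. msize l \<ge> 1}. snd (F l) p) = fst (0, \<lambda>p. Nop gc Y p i)"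
   using sF(2) by (auto intro!: infsum_0)
  fix p assume p: "p \<in> U"
  obtain B where B: "\<And>l. msize l \<ge> 1 \<Longrightarrow> norm (nlt gc Y l i p) \<le> wt K \<rho> l * B"
   "\<And>l. msize l \<ge> 1 \<Longrightarrow> norm (Gconv gc Y l i p) \<le> wt K \<rho> l * B" using bd[of "{p}"] p by auto
  have sm: "(\<lambda>l. nlt gc Y l i p) summable_on {l. msize l \<ge> 1}"
   "(\<lambda>l. Gconv gc Y l i p) summable_on {l. msize l \<ge> 1}"
   by (rule abs_summable_summable, rule summable_on_le_real[OF sumK[of B]]; use B in simp)+
  have "(\<Sum>\<^sub>\<infinity>l\<in>{l. msize l \<ge> 1}. snd (F l) p) =
    (\<Sum>\<^sub>\<infinity>l\<in>{l. msize l \<ge> 1}. nlt gc Y l i p + Gconv gc Y l i p)" by (intro infsum_cong) (simp add: sF)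
  also have "\<dots> = (\<Sum>\<^sub>\<infinity>l\<in>{l. msize l \<ge> 1}. nlt gc Y l i p) + (\<Sum>\<^sub>\<infinity>l\<in>{l. msize l \<ge> 1}. Gconv gc Y l i p)"
   by (rule infsum_add[OF sm])
  also have "(\<Sum>\<^sub>\<infinity>l\<in>{l. msize l \<ge> 1}. nlt gc Y l i p) = (\<Sum>\<^sub>\<infinity>l\<in>{l. msize l \<ge> 2}. nlt gc Y l i p)"
  proof (intro infsum_cong_neutral)
   fix l :: "'n \<Rightarrow> nat" assume "l \<in> {l. msize l \<ge> 1} - {l. msize l \<ge> 2}"
   then have "msize l = 1" by auto
   then show "nlt gc Y l i p = 0" using gc_1[of l] by simp
  qed auto
  finally show "snd (\<Sum>\<^sub>\<infinity>l\<in>{l. msize l \<ge> 1}. fst (F l), \<lambda>p. \<Sum>\<^sub>\<infinity>l\<in>{l. msize l \<ge> 1}. snd (F l) p) p = snd (0, \<lambda>p. Nop gc Y p i) p"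
   by (simp add: Nop_def add.commute)
 qed
qed

end

lemma cprod_zero: "xs \<noteq> [] \<Longrightarrow> cprod (\<lambda>x p. 0) xs = (\<lambda>p. 0)"
 by (induction xs rule: induct_list012) (auto simp: dconv_def fun_eq_iff)

lemma Nop_zero: "Nop gc (\<lambda>p. \<chi> j. 0) p i = 0"
proof -
 have "snd (conv_pow (\<lambda>p. \<chi> j. 0) l) = (\<lambda>p. 0 :: complex)" if "msize l \<ge> 1" for l :: "'a \<Rightarrow> nat"
  using cprod_zero[of "idx l"] that idx_nonempty[of l] by (simp add: conv_pow_cprod)
 note z = this
 have "(\<Sum>\<^sub>\<infinity>l\<in>{l. msize l \<ge> 1}. conv (Gl gc l i) (snd (conv_pow (\<lambda>p. \<chi> j. 0) l)) p) = 0"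
  by (rule infsum_0) (simp add: z)
 moreover have "(\<Sum>\<^sub>\<infinity>l\<in>{l. msize l \<ge> 2}. gc 0 l $ i * snd (conv_pow (\<lambda>p. \<chi> j. 0) l) p) = 0"
  by (rule infsum_0) (simp add: z)
 ultimately show ?thesis unfolding Nop_def by simp
qed

lemma exp_absorb: fixes x \<delta> :: real assumes "\<delta> > 0" shows "x \<le> exp (\<delta> * x) / \<delta>"
proof -
 have "1 + \<delta> * x \<le> exp (\<delta> * x)" by (rule exp_ge_add_one_self)
 then have "x * \<delta> \<le> exp (\<delta> * x)" by (subst mult.commute) linarith
 then show ?thesis using assms by (simp add: pos_le_divide_eq)
qed

context conv_system
begin

abbreviation conv_eq_at :: "(complex \<Rightarrow> 'n cvec) \<Rightarrow> complex \<Rightarrow> 'n \<Rightarrow> bool"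
 where "conv_eq_at Y p i \<equiv> (lam $ i - p) * Y p $ i = F0 fc p i - b $ i * seg_int (\<lambda>s. Y s $ i) p + Nop gc Y p i"

lemma fst_conv_pow: "msize l \<ge> 1 \<Longrightarrow> fst (conv_pow Y (l :: 'n \<Rightarrow> nat)) = 0"
 unfolding conv_pow_cprod using idx_nonempty[of l] by (intro fst_cprod) auto

text \<open>\<open>d\<close> bounds the distance from \<open>D\<close> to the points
  \<open>lam $ i\<close>. The last two inequalities say that, after division by
  \<open>lam $ i - p\<close>, the image of 0 lies within \<open>\<kappa> / 2\<close> and the
  Lipschitz constant is at most \<open>1 / 2\<close>.\<close>

definition good_weights :: "complex set \<Rightarrow> real \<Rightarrow> real \<Rightarrow> real \<Rightarrow> real \<Rightarrow> bool"
 where "good_weights D \<nu> \<kappa> T d \<longleftrightarrow> \<nu> > 1 / \<rho> \<and> \<nu> > R \<and> \<nu> > 0 \<and> \<kappa> > 0 \<and> d > 0 \<and> (\<forall>p\<in>D. norm p \<le> T) \<and> T * \<kappa> \<le> \<rho> / 4 \<and>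
   (\<forall>p\<in>D. \<forall>i. norm (lam $ i - p) \<ge> d) \<and> C * R^2 / (\<nu> - R) \<le> d * \<kappa> / 2 \<and>
   (\<Sum>i\<in>UNIV. norm (b $ i)) / \<nu> + (\<Sum>\<^sub>\<infinity>l. wt K \<rho> l) * (1 / (\<rho> * (\<nu> - 1 / \<rho>)) / \<rho> + 2 * (T * \<kappa>) / \<rho>\<^sup>2) \<le> d / 2"

lemma good_weightsD: assumes "good_weights D \<nu> \<kappa> T d"
 shows "\<nu> > 1 / \<rho>" "\<nu> > R" "\<nu> > 0" "\<kappa> > 0" "d > 0" "\<And>p. p \<in> D \<Longrightarrow> norm p \<le> T" "T * \<kappa> \<le> \<rho> / 4"
  "\<And>p i. p \<in> D \<Longrightarrow> d \<le> norm (lam $ i - p)" "C * R^2 / (\<nu> - R) \<le> d * \<kappa> / 2"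
  "(\<Sum>i\<in>UNIV. norm (b $ i)) / \<nu> + (\<Sum>\<^sub>\<infinity>l. wt K \<rho> l) * (1 / (\<rho> * (\<nu> - 1 / \<rho>)) / \<rho> + 2 * (T * \<kappa>) / \<rho>\<^sup>2) \<le> d / 2"
 using assms unfolding good_weights_def by blast+

lemma weight_choice:
 assumes U: "star_open U" and lamU: "\<And>p i. p \<in> U \<Longrightarrow> p \<noteq> lam $ i" and D: "star_compact D" "D \<subseteq> U"
 shows "\<exists>\<nu> \<kappa> T d. good_weights D \<nu> \<kappa> T d"
proof -
 have cD: "compact D" "D \<noteq> {}" using D by (auto simp: star_compact_def)
 obtain T0 where T0: "\<And>p. p \<in> D \<Longrightarrow> norm p \<le> T0"
  using compact_imp_bounded[OF cD(1)] by (auto simp: bounded_iff)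
 define T where "T = max T0 1"
 have T: "\<And>p. p \<in> D \<Longrightarrow> norm p \<le> T" "T \<ge> 1" using T0 by (auto simp: T_def le_max_iff_disj)
 obtain d where d: "d > 0" "\<And>i p. p \<in> D \<Longrightarrow> d \<le> norm (lam $ i - p)"
  by (rule compact_lower_bound[OF cD, of "\<lambda>i. lam $ i"]) (use lamU D in auto)
 define B where "B = (\<Sum>i\<in>UNIV. norm (b $ i))"
 define S where "S = (\<Sum>\<^sub>\<infinity>l. wt K \<rho> l)"
 have B: "B \<ge> 0" by (auto simp: B_def intro: sum_nonneg)
 have S: "S \<ge> 0" unfolding S_def using K0 \<rho> by (intro infsum_nonneg) auto
 \<comment> \<open>Fixed before \<open>\<nu>\<close>: the quadratic part of the Lipschitz constant
   depends on \<open>\<kappa>\<close> but not on \<open>\<nu>\<close> and is kept below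
   \<open>d / 8\<close>; a large \<open>\<nu>\<close> then makes the rest small.
   \<open>S + 1\<close> avoids a zero denominator.\<close>
 define \<kappa> where "\<kappa> = min (\<rho> / (4 * T)) (d * \<rho>\<^sup>2 / (16 * T * (S + 1)))"
 have \<kappa>: "\<kappa> > 0" "T * \<kappa> \<le> \<rho> / 4" "S * (2 * (T * \<kappa>) / \<rho>\<^sup>2) \<le> d / 8"
 proof -
  show "\<kappa> > 0" using \<rho> T d S by (simp add: \<kappa>_def)
  have "T * \<kappa> \<le> T * (\<rho> / (4 * T))" using T by (intro mult_left_mono) (auto simp: \<kappa>_def)
  then show "T * \<kappa> \<le> \<rho> / 4" using T by simp
  have "T * \<kappa> \<le> T * (d * \<rho>\<^sup>2 / (16 * T * (S + 1)))" using T by (intro mult_left_mono) (auto simp: \<kappa>_def)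
  also have "\<dots> = d * \<rho>\<^sup>2 / (16 * (S + 1))" using T by simp
  finally have "(S + 1) * (T * \<kappa>) \<le> d * \<rho>\<^sup>2 / 16" using S by (simp add: field_simps)
  moreover have "S * (T * \<kappa>) \<le> (S + 1) * (T * \<kappa>)" using \<open>\<kappa> > 0\<close> T by (intro mult_right_mono) auto
  ultimately have "S * (T * \<kappa>) \<le> d * \<rho>\<^sup>2 / 16" by simp
  then show "S * (2 * (T * \<kappa>) / \<rho>\<^sup>2) \<le> d / 8" using \<rho> by (simp add: field_simps)
 qed
 have "((\<lambda>\<nu>. B / \<nu> + S * (1 / (\<rho> * (\<nu> - 1 / \<rho>)) / \<rho>)) \<longlongrightarrow> 0) at_top" using \<rho> by real_asymp
 then have 1: "eventually (\<lambda>\<nu>. B / \<nu> + S * (1 / (\<rho> * (\<nu> - 1 / \<rho>)) / \<rho>) < d / 4) at_top"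
  using d by (intro order_tendstoD(2)) auto
 have "((\<lambda>\<nu>. C * R^2 / (\<nu> - R)) \<longlongrightarrow> 0) at_top" by real_asymp
 then have 2: "eventually (\<lambda>\<nu>. C * R^2 / (\<nu> - R) < d * \<kappa> / 2) at_top"
  using d \<kappa> by (intro order_tendstoD(2)) auto
 obtain \<nu> where N: "B / \<nu> + S * (1 / (\<rho> * (\<nu> - 1 / \<rho>)) / \<rho>) < d / 4" "C * R^2 / (\<nu> - R) < d * \<kappa> / 2" "\<nu> \<ge> 1 / \<rho> + R + 1"
  using eventually_conj[OF 1 eventually_conj[OF 2 eventually_ge_at_top[of "1 / \<rho> + R + 1"]]]
  unfolding eventually_at_top_linorder by blast
 have "1 / \<rho> > 0" using \<rho> by simp
 then have \<nu>: "\<nu> > 1 / \<rho>" "\<nu> > R" "\<nu> > 0" using N(3) R by linarith+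
 have 3: "C * R^2 / (\<nu> - R) \<le> d * \<kappa> / 2" using N(2) by simp
 have "B / \<nu> + S * (1 / (\<rho> * (\<nu> - 1 / \<rho>)) / \<rho> + 2 * (T * \<kappa>) / \<rho>\<^sup>2) \<le> d / 2"
  unfolding distrib_left using N(1) \<kappa>(3) d(1) by linarith
 note 4 = this[unfolded B_def S_def]
 have "good_weights D \<nu> \<kappa> T d"
  unfolding good_weights_def by (intro conjI ballI allI \<nu>(1-3) \<kappa>(1,2) d 3 4 T(1))
 then show ?thesis by blast
qed

lemma conv_eq_analytic_solution: assumes U: "star_open U" and lamU: "\<And>p i. p \<in> U \<Longrightarrow> p \<noteq> lam $ i"
 obtains Y where "\<And>i. (\<lambda>p. Y p $ i) holomorphic_on U" "small_on U Y"
  "\<And>p i. p \<in> U \<Longrightarrow> conv_eq_at Y p i"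
proof -
 have "\<exists>\<nu> \<kappa> T d. \<forall>D. star_compact D \<longrightarrow> D \<subseteq> U \<longrightarrow> good_weights D (\<nu> D) (\<kappa> D) (T D) (d D)"
 proof -
  have "\<exists>h. \<forall>D. star_compact D \<longrightarrow> D \<subseteq> U \<longrightarrow> (case h D of (\<nu>, \<kappa>, T, d) \<Rightarrow> good_weights D \<nu> \<kappa> T d)"
   by (rule choice) (use weight_choice[OF U lamU] in auto)
  then obtain h where h: "\<And>D. star_compact D \<Longrightarrow> D \<subseteq> U \<Longrightarrow> (case h D of (\<nu>, \<kappa>, T, d) \<Rightarrow> good_weights D \<nu> \<kappa> T d)"
   by blast
  show ?thesis by (rule exI[of _ "\<lambda>D. fst (h D)"], rule exI[of _ "\<lambda>D. fst (snd (h D))"],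
     rule exI[of _ "\<lambda>D. fst (snd (snd (h D)))"], rule exI[of _ "\<lambda>D. snd (snd (snd (h D)))"])
    (use h in \<open>auto simp: case_prod_unfold\<close>)
 qed
 then obtain \<nu> \<kappa> T d where W0: "\<And>D. star_compact D \<Longrightarrow> D \<subseteq> U \<Longrightarrow> good_weights D (\<nu> D) (\<kappa> D) (T D) (d D)"
  by blast
 note W = good_weightsD[OF W0]
 define vec where "vec Y p = (\<chi> j. Y j p)" for Y :: "'n \<Rightarrow> complex \<Rightarrow> complex" and p
 have vec: "vec Y p $ j = Y j p" for Y p j by (simp add: vec_def)
 define \<Phi> where "\<Phi> Y i p = (F0 fc p i - b $ i * seg_int (Y i) p + Nop gc (vec Y) p i) / (lam $ i - p)" for Y i p
 define good where "good Y \<longleftrightarrow> bdd_family U \<nu> \<kappa> Y" for Y :: "'n \<Rightarrow> complex \<Rightarrow> complex"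
 have small: "small_on U (vec Y)" if "good Y" for Y unfolding small_on_def vec
 proof (intro allI impI)
  fix D assume D: "star_compact D" "D \<subseteq> U"
  then have "\<forall>i. supbd (\<nu> D) D (Y i) (\<kappa> D)" using that unfolding good_def by simp
  then show "\<exists>\<nu> \<kappa> T. 1 / \<rho> < \<nu> \<and> (\<forall>p\<in>D. norm p \<le> T) \<and> T * \<kappa> \<le> \<rho> / 4 \<and> (\<forall>i. supbd \<nu> D (Y i) \<kappa>)"
   using W(1,6,7)[OF D] by blast
 qed
 have "\<exists>Y. good Y \<and> (\<forall>i. \<forall>p\<in>U. \<Phi> Y i p = Y i p)"
 proof (rule Picard_iteration[OF U, of good \<nu> \<kappa>])
  show "good Y \<longleftrightarrow> bdd_family U \<nu> \<kappa> Y" for Y by (rule good_def)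
  show "\<Phi> Y i holomorphic_on U" if Y: "good Y" for Y i
  proof -
   have "\<exists>v. \<forall>i. HD U (0, \<lambda>p. vec Y p $ i) (v i)"
    using HD_exists[OF U, where c = 0] Y unfolding good_def vec by (intro choice allI) auto
   then obtain v where v: "\<And>i. HD U (0, \<lambda>p. vec Y p $ i) (v i)" by blast
   have "(\<lambda>p. Nop gc (vec Y) p i) holomorphic_on U" using Nop_HD[OF U v small[OF Y]] by (simp add: HD_def)
   moreover have "(\<lambda>p. F0 fc p i) holomorphic_on U" using F0_props(1)[OF R fcK, of U i] fc0 by (simp add: HD_def)
   moreover have "seg_int (Y i) holomorphic_on U"
    using conv_holomorphic[OF U, of "Y i" "\<lambda>_. 1"] Y by (simp add: seg_int_eq_conv[abs_def] good_def)
   ultimately show ?thesis unfolding \<Phi>_def[abs_def] using lamU by (intro holomorphic_intros) auto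
  qed
  show "supbd (\<nu> D) D (\<Phi> (\<lambda>_ _. 0) i) (\<kappa> D / 2)" if D: "star_compact D" "D \<subseteq> U" for D i
   unfolding supbd_def
  proof (intro conjI ballI)
   note W = W[OF D]
   show "0 \<le> \<kappa> D / 2" using W(4) by simp
   fix p assume p: "p \<in> D"
   have dp: "d D \<le> norm (lam $ i - p)" "d D > 0" using W(5) W(8)[OF p] by auto
   have "vec (\<lambda>_ _. 0) = (\<lambda>p. \<chi> j. 0)" by (simp add: vec_def fun_eq_iff)
   then have "\<Phi> (\<lambda>_ _. 0) i p = F0 fc p i / (lam $ i - p)" by (simp add: \<Phi>_def Nop_zero seg_int_def)
   then have "norm (\<Phi> (\<lambda>_ _. 0) i p) = norm (F0 fc p i) / norm (lam $ i - p)" by (simp add: norm_divide)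
   also have "\<dots> \<le> norm (F0 fc p i) / d D" using dp by (intro divide_left_mono mult_pos_pos) auto
   also have "norm (F0 fc p i) \<le> C * R^2 * norm p * exp (R * norm p)" using F0_props(2)[OF R fcK] fc0 by simp
   \<comment> \<open>The factor \<open>norm p\<close> is traded for growth at the rate
     \<open>\<nu> D - R\<close>, which produces the denominator \<open>\<nu> D - R\<close>.\<close>
   also have "\<dots> \<le> C * R^2 * (exp ((\<nu> D - R) * norm p) / (\<nu> D - R)) * exp (R * norm p)"
    using W(2) C by (intro mult_right_mono mult_left_mono exp_absorb) auto
   also have "\<dots> = C * R^2 / (\<nu> D - R) * exp (\<nu> D * norm p)" by (simp add: algebra_simps flip: exp_add)
   also have "\<dots> \<le> d D * \<kappa> D / 2 * exp (\<nu> D * norm p)" using W(9) by (intro mult_right_mono) auto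
   finally show "norm (\<Phi> (\<lambda>_ _. 0) i p) \<le> \<kappa> D / 2 * exp (\<nu> D * norm p)"
    using dp by (simp add: divide_right_mono field_simps)
  qed
  show "supbd (\<nu> D) D (\<lambda>p. \<Phi> Y i p - \<Phi> Z i p) (\<epsilon> / 2)"
   if D: "star_compact D" "D \<subseteq> U" and Y: "good Y" and Z: "good Z"
    and \<epsilon>: "\<And>i. supbd (\<nu> D) D (\<lambda>p. Y i p - Z i p) \<epsilon>" for D Y Z \<epsilon> i unfolding supbd_def
  proof (intro conjI ballI)
   note W = W[OF D]
   have e0: "\<epsilon> \<ge> 0" using \<epsilon> by (simp add: supbd_def)
   then show "0 \<le> \<epsilon> / 2" by simp
   interpret conv_bound "\<lambda>f. f holomorphic_on U" "supbd (\<nu> D) D" "T D" "1 / (\<rho> * (\<nu> D - 1 / \<rho>))" \<rho> K gc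
    by (rule sup_conv_bound[OF U D W(6,1)])
   fix p assume p: "p \<in> D"
   have dp: "d D \<le> norm (lam $ i - p)" "d D > 0" using W(5) W(8)[OF p] by auto
   have hol: "Y i holomorphic_on U" "Z i holomorphic_on U" for i using Y Z by (auto simp: good_def)
   let ?E = "exp (\<nu> D * norm p)"
   let ?q = "(\<Sum>\<^sub>\<infinity>l. wt K \<rho> l) * (1 / (\<rho> * (\<nu> D - 1 / \<rho>)) / \<rho> + 2 * (T D * \<kappa> D) / \<rho>\<^sup>2)"
   have N: "norm (Nop gc (vec Y) p i - Nop gc (vec Z) p i) \<le> ?q * \<epsilon> * ?E"
   proof -
    have "supbd (\<nu> D) D (\<lambda>p. Nop gc (vec Y) p i - Nop gc (vec Z) p i) (?q * \<epsilon>)"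
     by (rule Nop_lipschitz) (use W(7) hol Y Z D \<epsilon> in \<open>auto simp: vec good_def\<close>)
    then show ?thesis using p by (auto simp: supbd_def)
   qed
   have s: "norm (seg_int (Y i) p - seg_int (Z i) p) \<le> \<epsilon> / \<nu> D * ?E"
    unfolding seg_int_diff[OF U hol subsetD[OF D(2) p]] by (rule seg_int_supbd[OF D(1) \<epsilon> W(3) p])
   have "\<Phi> Y i p - \<Phi> Z i p = ((Nop gc (vec Y) p i - Nop gc (vec Z) p i) - b $ i * (seg_int (Y i) p - seg_int (Z i) p)) / (lam $ i - p)"
    by (simp add: \<Phi>_def diff_divide_distrib add_divide_distrib right_diff_distrib)
   also have "norm \<dots> \<le> norm ((Nop gc (vec Y) p i - Nop gc (vec Z) p i) - b $ i * (seg_int (Y i) p - seg_int (Z i) p)) / d D"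
    unfolding norm_divide using dp by (intro divide_left_mono mult_pos_pos) auto
   also have "norm ((Nop gc (vec Y) p i - Nop gc (vec Z) p i) - b $ i * (seg_int (Y i) p - seg_int (Z i) p))
     \<le> ?q * \<epsilon> * ?E + norm (b $ i) * (\<epsilon> / \<nu> D * ?E)"
    by (rule order_trans[OF norm_triangle_ineq4], unfold norm_mult) (intro add_mono N mult_left_mono s, simp)
   also have "norm (b $ i) * (\<epsilon> / \<nu> D * ?E) \<le> (\<Sum>i\<in>UNIV. norm (b $ i)) * (\<epsilon> / \<nu> D * ?E)"
    using e0 W(3) by (intro mult_right_mono member_le_sum) auto
   also have "?q * \<epsilon> * ?E + (\<Sum>i\<in>UNIV. norm (b $ i)) * (\<epsilon> / \<nu> D * ?E) = ((\<Sum>i\<in>UNIV. norm (b $ i)) / \<nu> D + ?q) * (\<epsilon> * ?E)"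
    by (simp add: algebra_simps)
   also have "\<dots> \<le> d D / 2 * (\<epsilon> * ?E)" using W(10) e0 by (intro mult_right_mono) auto
   finally show "norm (\<Phi> Y i p - \<Phi> Z i p) \<le> \<epsilon> / 2 * ?E"
    using dp by (simp add: divide_right_mono field_simps)
  qed
 qed
 then obtain Y where Y: "good Y" "\<And>i p. p \<in> U \<Longrightarrow> \<Phi> Y i p = Y i p" by blast
 show thesis
 proof
  show "(\<lambda>p. vec Y p $ i) holomorphic_on U" for i using Y by (simp add: vec good_def)
  show "small_on U (vec Y)" by (rule small[OF Y(1)])
  fix p i assume p: "p \<in> U"
  show "conv_eq_at (vec Y) p i" using Y(2)[OF p, of i] lamU[OF p, of i] unfolding vec \<Phi>_def by (simp add: field_simps)
 qed
qed

lemma ts0_order: assumes "transseries lam b fc gc y" shows "fps_nth (fps_nth (y i) 0) 0 = 0" "bigrade 1 (y i)"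
proof -
 show "fps_nth (fps_nth (y i) 0) 0 = 0" using assms by (simp add: transseries_def)
 then show "bigrade 1 (y i)" by (simp add: bigrade_def)
qed

lemma conv_eq_solution:
 assumes U: "star_open U" and lamU: "\<And>p i. p \<in> U \<Longrightarrow> p \<noteq> lam $ i" and y: "transseries lam b fc gc y"
 obtains Y where "\<And>i. HD U (0, \<lambda>p. Y p $ i) (fps_nth (y i) 0)" "small_on U Y"
  "\<And>p i. p \<in> U \<Longrightarrow> conv_eq_at Y p i"
proof -
 obtain Y where Y: "\<And>i. (\<lambda>p. Y p $ i) holomorphic_on U" "small_on U Y"
  "\<And>p i. p \<in> U \<Longrightarrow> conv_eq_at Y p i" using conv_eq_analytic_solution[OF U lamU] by metis
 have "\<exists>v. \<forall>i. HD U (0, \<lambda>p. Y p $ i) (v i)" using HD_exists[OF U Y(1), where c = 0] by (intro choice allI)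
 then obtain v where v: "\<And>i. HD U (0, \<lambda>p. Y p $ i) (v i)" by blast
 define f where "f i = Abs_fps (\<lambda>m. fc m $ i)" for i
 have F0: "HD U (0, \<lambda>p. F0 fc p i) (f i)" for i unfolding f_def using F0_props(1)[OF R fcK, of U i] fc0 by simp
 have "v i = fps_nth (y i) 0" for i
 proof (rule formal_unique_0[where gc = gc and lam = lam and b = b and f = f and v = v and w = "\<lambda>i. fps_nth (y i) 0"])
  show "msize l = 1 \<Longrightarrow> gc 0 l = 0 \<and> gc 1 l = 0" for l by (rule gc_1)
  show "lam $ i \<noteq> 0" for i by (rule lam_nz)
  fix i
  have l: "HD U (0, \<lambda>p. lam $ i * Y p $ i) (fps_const (lam $ i) * v i)" using HD_cmult[OF v[of i], of "lam $ i"] by simp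
  have r: "HD U (0, \<lambda>p. F0 fc p i + p * Y p $ i - b $ i * seg_int (\<lambda>s. Y s $ i) p + Nop gc Y p i)
    (f i + fps_X^2 * fps_deriv (v i) - fps_const (b $ i) * (fps_X * v i) + Nfps gc v i)"
   using HD_add[OF HD_diff[OF HD_add[OF F0[of i] HD_mult_p[OF v[of i]]] HD_cmult[OF HD_seg_int[OF U v[of i]], of "b $ i"]] Nop_HD[OF U v Y(2), of i]]
   by simp
  have "fps_const (lam $ i) * v i = f i + fps_X^2 * fps_deriv (v i) - fps_const (b $ i) * (fps_X * v i) + Nfps gc v i"
   by (rule HD_unique[OF l r _ _ U]) (use Y(3)[of _ i] in \<open>auto simp: algebra_simps\<close>)
  then show "fps_const (lam $ i) * v i = f i + fps_X^2 * fps_deriv (v i) - fps_const (b $ i) * fps_X * v i + Nfps gc v i"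
   by (simp only: mult.assoc)
  show "fps_nth (v i) 0 = 0" using v[of i] by (simp add: HD_def)
  show "fps_nth (fps_nth (y i) 0) 0 = 0" by (rule ts0_order[OF y])
  have "ts_g gc y 0 i = Nfps gc (\<lambda>i. fps_nth (y i) 0) i"
   unfolding ts_g_eq[OF ts0_order(2)[OF y]] Nfps_def fps_nth_0_prod_power ..
  moreover have "ts_deriv (b $ ix1) 0 (fps_nth (y i) 0) = f i - fps_const (lam $ i) * fps_nth (y i) 0
    - fps_const (b $ i) * fps_X * fps_nth (y i) 0 + ts_g gc y 0 i" using y unfolding transseries_def f_def by auto
  ultimately show "fps_const (lam $ i) * fps_nth (y i) 0 = f i + fps_X^2 * fps_deriv (fps_nth (y i) 0)
    - fps_const (b $ i) * fps_X * fps_nth (y i) 0 + Nfps gc (\<lambda>i. fps_nth (y i) 0) i"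
   by (simp add: ts_deriv_def algebra_simps)
 qed
 then show thesis using that[of Y] v Y by simp
qed

end

section \<open>Linear equations of the hierarchy\<close>

text \<open>A convolution with powers of \<open>p\<close> divided out: \<open>n = 0\<close> is
  \<open>conv A f\<close> without its factor \<open>p\<close>, and \<open>n = 1\<close> is the
  convolution of \<open>q * A q\<close> with \<open>f\<close> without \<open>p^2\<close>.\<close>

definition kconv :: "nat \<Rightarrow> (complex \<Rightarrow> complex) \<Rightarrow> (complex \<Rightarrow> complex) \<Rightarrow> complex \<Rightarrow> complex"
 where "kconv n A f p = (LINT u:{0..1}|lebesgue. of_real (u ^ n) * (A (of_real u * p) * f (p - of_real u * p)))"

lemma kconv_eq_bconv: "kconv n A f p = bconv (of_nat (Suc n)) 1 A f p" unfolding kconv_def bconv_def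
 by (rule set_LINT_unit_cong) (auto simp: beta_kernel_def powr_nat' algebra_simps)

lemma kconv_holomorphic:
 "star_open U \<Longrightarrow> A holomorphic_on U \<Longrightarrow> f holomorphic_on U \<Longrightarrow> kconv n A f holomorphic_on U"
 unfolding kconv_eq_bconv[abs_def] by (rule bconv_holomorphic) (auto simp: add_pos_nonneg)

lemma kconv_diff: assumes U: "star_open U" "A holomorphic_on U" "f holomorphic_on U" "g holomorphic_on U" "p \<in> U"
 shows "kconv n A f p - kconv n A g p = kconv n A (\<lambda>p. f p - g p) p"
proof -
 have "set_integrable lebesgue {0..1} (\<lambda>u. of_real (u ^ n) * (A (of_real u * p) * f (p - of_real u * p)))"
  if "f holomorphic_on U" for f using star_openD(3,4)[OF U(1,5)]
  by (intro absolutely_integrable_continuous_real continuous_on_mult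
    continuous_on_compose2[OF holomorphic_on_imp_continuous_on[OF U(2)]]
    continuous_on_compose2[OF holomorphic_on_imp_continuous_on[OF that]]) (auto intro!: continuous_intros)
 from set_integral_diff(2)[OF this[OF U(3)] this[OF U(4)]] show ?thesis unfolding kconv_def by (simp add: algebra_simps)
qed

lemma kconv_bound:
 assumes D: "star_compact D" and A: "\<And>p. p \<in> D \<Longrightarrow> norm (A p) \<le> a" and f: "supbd \<nu> D f \<epsilon>" and \<nu>: "\<nu> > 0" and p: "p \<in> D"
 shows "norm (p * kconv n A f p) \<le> a * \<epsilon> / \<nu> * exp (\<nu> * norm p)"
proof -
 note E = exp_kernel_integral[OF norm_ge_zero[of p] \<nu>]
 have \<epsilon>: "\<epsilon> \<ge> 0" using f by (auto simp: supbd_def)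
 have a: "a \<ge> 0" using A[OF p] norm_ge_zero order_trans by blast
 have "norm (kconv n A f p) \<le> (LINT u:{0..1}|lebesgue. (a * \<epsilon> * exp (\<nu> * norm p)) * exp (- \<nu> * norm p * u))"
  unfolding kconv_def
 proof (rule norm_set_LINT_le)
  fix u :: real assume u: "u \<in> {0..1}"
  have "norm (A (of_real u * p)) \<le> a" using u by (intro A star_compactD[OF D p]) auto
  moreover have "norm (f (p - of_real u * p)) \<le> \<epsilon> * exp (\<nu> * ((1 - u) * norm p))"
   using f star_compactD[OF D p, of u] u norm_split_segment[of u p] unfolding supbd_def by (metis atLeastAtMost_iff)
  ultimately have "norm (A (of_real u * p) * f (p - of_real u * p)) \<le> a * (\<epsilon> * exp (\<nu> * ((1 - u) * norm p)))"
   unfolding norm_mult using a by (intro mult_mono) auto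
  moreover have "\<bar>u ^ n\<bar> \<le> 1" using u by (simp add: power_le_one)
  ultimately have "norm (of_real (u ^ n) * (A (of_real u * p) * f (p - of_real u * p))) \<le> 1 * (a * (\<epsilon> * exp (\<nu> * ((1 - u) * norm p))))"
   unfolding norm_mult[of "of_real (u ^ n)"] norm_of_real by (intro mult_mono) auto
  also have "\<dots> = (a * \<epsilon> * exp (\<nu> * norm p)) * exp (- \<nu> * norm p * u)"
   by (simp add: algebra_simps flip: exp_add)
  finally show "norm (of_real (u ^ n) * (A (of_real u * p) * f (p - of_real u * p))) \<le> (a * \<epsilon> * exp (\<nu> * norm p)) * exp (- \<nu> * norm p * u)" .
 qed (use E in auto)
 then have "norm (p * kconv n A f p) \<le> norm p * ((a * \<epsilon> * exp (\<nu> * norm p)) * (LINT u:{0..1}|lebesgue. exp (- \<nu> * norm p * u)))"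
  unfolding norm_mult set_integral_mult_right by (intro mult_left_mono) auto
 also have "\<dots> \<le> (a * \<epsilon> * exp (\<nu> * norm p)) * (1 / \<nu>)"
  using mult_left_mono[OF E(1), of "a * \<epsilon> * exp (\<nu> * norm p)"] a \<epsilon> by (simp add: mult_ac)
 finally show ?thesis by simp
qed

lemma conv_eq_kconv: "conv A f p = p * kconv 0 A f p" by (simp add: conv_def seg_int_def kconv_def)

lemma conv_mult_p_eq_kconv: "conv (\<lambda>q. q * \<psi> q) f p = p * (p * kconv 1 \<psi> f p)"
proof -
 have "(LINT u:{0..1}|lebesgue. of_real u * p * \<psi> (of_real u * p) * f (p - of_real u * p)) = p * kconv 1 \<psi> f p"
  unfolding kconv_def set_integral_mult_right[symmetric] by (rule set_LINT_unit_cong) (simp add: mult_ac)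
 then show ?thesis by (simp add: conv_def seg_int_def)
qed

text \<open>Regular components use \<open>N i = 0\<close>; singular ones, from which a factor
  \<open>p\<close> has been cancelled, use \<open>N i = 1\<close>. The factor \<open>p\<close> that
  stays in front of \<open>kconv\<close> supplies the decay in \<open>\<nu>\<close>.\<close>

lemma linear_Picard:
 fixes \<alpha> \<gamma> :: "'i::finite \<Rightarrow> complex \<Rightarrow> complex" and A :: "'i \<Rightarrow> 'i \<Rightarrow> complex \<Rightarrow> complex" and N :: "'i \<Rightarrow> nat"
 assumes U: "star_open U" and \<alpha>: "\<And>i. \<alpha> i holomorphic_on U" and \<gamma>: "\<And>i. \<gamma> i holomorphic_on U"
  and A: "\<And>i j. A i j holomorphic_on U" obtains f where "\<And>i. f i holomorphic_on U"
  "\<And>i p. p \<in> U \<Longrightarrow> f i p = \<alpha> i p + \<gamma> i p * (\<Sum>j\<in>UNIV. p * kconv (N i) (A i j) (f j) p)"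
proof -
 define \<Phi> where "\<Phi> f i p = \<alpha> i p + \<gamma> i p * (\<Sum>j\<in>UNIV. p * kconv (N i) (A i j) (f j) p)" for f i p
 define P where "P D c \<longleftrightarrow> c \<ge> 0 \<and> (\<forall>p\<in>D. \<forall>i. norm (\<alpha> i p) \<le> c \<and> norm (\<gamma> i p) \<le> c \<and> (\<forall>j. norm (A i j p) \<le> c))"
  for D :: "complex set" and c :: real
 have exP: "\<exists>c. P D c" if D: "star_compact D" "D \<subseteq> U" for D
 proof -
  have cD: "compact D" using D by (simp add: star_compact_def)
  obtain c1 c2 c3 where c: "c1 \<ge> 0" "\<And>i p. p \<in> D \<Longrightarrow> norm (\<alpha> i p) \<le> c1" "c2 \<ge> 0" "\<And>i p. p \<in> D \<Longrightarrow> norm (\<gamma> i p) \<le> c2"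
   "c3 \<ge> 0" "\<And>x p. p \<in> D \<Longrightarrow> norm (A (fst x) (snd x) p) \<le> c3"
   using holomorphic_family_bdd[where f = \<alpha> and I = UNIV, OF finite \<alpha> cD D(2)] holomorphic_family_bdd[where f = \<gamma> and I = UNIV, OF finite \<gamma> cD D(2)]
    holomorphic_family_bdd[where f = "\<lambda>x. A (fst x) (snd x)" and I = UNIV, OF finite A cD D(2)] by auto
  define c where "c = c1 + c2 + c3"
  have le: "c1 \<le> c" "c2 \<le> c" "c3 \<le> c" using c(1,3,5) unfolding c_def by linarith+
  have "P D c" unfolding P_def
  proof (intro conjI ballI allI)
   show "c \<ge> 0" using c(1,3,5) by (simp add: c_def)
   fix p i j assume p: "p \<in> D"
   show "norm (\<alpha> i p) \<le> c" "norm (\<gamma> i p) \<le> c" "norm (A i j p) \<le> c"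
    using order_trans[OF c(2)[OF p] le(1)] order_trans[OF c(4)[OF p] le(2)] order_trans[OF c(6)[OF p] le(3), of "(i, j)"] by auto
  qed
  then show ?thesis by blast
 qed
 define c where "c D = (SOME c. P D c)" for D
 have Pc: "P D (c D)" if "star_compact D" "D \<subseteq> U" for D using exP[OF that] unfolding c_def by (rule someI_ex)
 define n where "n = real CARD('i)"
 \<comment> \<open>The Lipschitz constant is \<open>c D\<close> from \<open>\<gamma>\<close>,
   \<open>c D\<close> from the kernels, \<open>n\<close> summands and \<open>1 / \<nu>\<close> from
   \<open>kconv_bound\<close>; this value keeps it at most \<open>1 / 2\<close>.\<close>
 define \<nu> where "\<nu> D = 2 * c D * c D * n + 1" for D
 have n: "n \<ge> 0" by (simp add: n_def)
 have \<nu>: "\<nu> D > 0" if "star_compact D" "D \<subseteq> U" for D using n by (simp add: \<nu>_def add_nonneg_pos mult.assoc)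
 have "\<exists>f. (bdd_family U \<nu> (\<lambda>D. 2 * c D) f) \<and> (\<forall>i. \<forall>p\<in>U. \<Phi> f i p = f i p)"
 proof (rule Picard_iteration[OF U, where \<nu> = \<nu> and \<kappa> = "\<lambda>D. 2 * c D"])
  show "\<Phi> f i holomorphic_on U" if "bdd_family U \<nu> (\<lambda>D. 2 * c D) f" for f i
   unfolding \<Phi>_def[abs_def] using that
   by (intro holomorphic_intros holomorphic_on_sum kconv_holomorphic \<alpha> \<gamma> A U) auto
  show "supbd (\<nu> D) D (\<Phi> (\<lambda>_ _. 0) i) (2 * c D / 2)" if D: "star_compact D" "D \<subseteq> U" for D i
   unfolding supbd_def
  proof (intro conjI ballI)
   show "0 \<le> 2 * c D / 2" using Pc[OF D] by (simp add: P_def)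
   fix p assume p: "p \<in> D"
   have "norm (\<Phi> (\<lambda>_ _. 0) i p) = norm (\<alpha> i p)" by (simp add: \<Phi>_def kconv_def)
   also have "\<dots> \<le> c D * 1" using Pc[OF D] p by (simp add: P_def)
   also have "\<dots> \<le> c D * exp (\<nu> D * norm p)"
    using Pc[OF D] \<nu>[OF D] by (intro mult_left_mono) (auto simp: P_def)
   finally show "norm (\<Phi> (\<lambda>_ _. 0) i p) \<le> 2 * c D / 2 * exp (\<nu> D * norm p)" by simp
  qed
  show "supbd (\<nu> D) D (\<lambda>p. \<Phi> f i p - \<Phi> g i p) (\<epsilon> / 2)"
   if D: "star_compact D" "D \<subseteq> U" and f: "bdd_family U \<nu> (\<lambda>D. 2 * c D) f"
    and g: "bdd_family U \<nu> (\<lambda>D. 2 * c D) g"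
    and e: "\<And>i. supbd (\<nu> D) D (\<lambda>p. f i p - g i p) \<epsilon>" for D f g \<epsilon> i unfolding supbd_def
  proof (intro conjI ballI)
   have e0: "\<epsilon> \<ge> 0" using e by (simp add: supbd_def)
   then show "0 \<le> \<epsilon> / 2" by simp
   fix p assume p: "p \<in> D"
   have c: "c D \<ge> 0" "norm (\<gamma> i p) \<le> c D" "\<And>j q. q \<in> D \<Longrightarrow> norm (A i j q) \<le> c D"
    using Pc[OF D] p by (auto simp: P_def)
   have hol: "f i holomorphic_on U" "g i holomorphic_on U" for i using f g by auto
   have pU: "p \<in> U" using p D by auto
   have "\<Phi> f i p - \<Phi> g i p = \<gamma> i p * (\<Sum>j\<in>UNIV. p * (kconv (N i) (A i j) (f j) p - kconv (N i) (A i j) (g j) p))"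
    by (simp add: \<Phi>_def algebra_simps sum_subtractf)
   also have "\<dots> = \<gamma> i p * (\<Sum>j\<in>UNIV. p * kconv (N i) (A i j) (\<lambda>p. f j p - g j p) p)"
    by (simp add: kconv_diff[OF U A hol pU])
   also have "norm \<dots> \<le> c D * (\<Sum>j\<in>(UNIV::'i set). c D * \<epsilon> / \<nu> D * exp (\<nu> D * norm p))"
    unfolding norm_mult[of "\<gamma> i p"] by (intro mult_mono c sum_norm_le kconv_bound[OF D(1) _ e \<nu>[OF D] p]) auto
   also have "\<dots> = (c D * c D * n / \<nu> D) * (\<epsilon> * exp (\<nu> D * norm p))" by (simp add: n_def)
   also have "\<dots> \<le> (1 / 2) * (\<epsilon> * exp (\<nu> D * norm p))"
   proof (rule mult_right_mono)
    have "c D * c D * n * 2 \<le> \<nu> D" by (simp add: \<nu>_def)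
    then show "c D * c D * n / \<nu> D \<le> 1 / 2" using \<nu>[OF D] by (simp add: divide_le_eq)
   qed (use e0 in auto)
   finally show "norm (\<Phi> f i p - \<Phi> g i p) \<le> \<epsilon> / 2 * exp (\<nu> D * norm p)" by simp
  qed
 qed simp
 then obtain f where f: "(\<forall>i. f i holomorphic_on U)" "\<forall>i. \<forall>p\<in>U. \<Phi> f i p = f i p" by (elim exE conjE)
 show thesis
 proof
  show "f i holomorphic_on U" for i using f(1) ..
  show "f i p = \<alpha> i p + \<gamma> i p * (\<Sum>j\<in>UNIV. p * kconv (N i) (A i j) (f j) p)" if "p \<in> U" for i p
   using f(2)[rule_format, OF that, of i] unfolding \<Phi>_def by (rule sym)
 qed
qed

section \<open>Linear equations for series with analytic Borel transform\<close>

definition RR :: "complex set \<Rightarrow> complex fps \<Rightarrow> bool" where "RR U w \<longleftrightarrow> (\<exists>F. HD U F w)"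

lemma RR_mult: "star_open U \<Longrightarrow> RR U w \<Longrightarrow> RR U v \<Longrightarrow> RR U (w * v)"
 unfolding RR_def using HD_dconv by blast

lemma RR_add: "RR U w \<Longrightarrow> RR U v \<Longrightarrow> RR U (w + v)" unfolding RR_def using HD_add by blast

lemma RR_zero: "RR U 0" using HD_cmult[OF HD_one, of U 0] unfolding RR_def by auto

lemma RR_sum: "(\<And>x. x \<in> A \<Longrightarrow> RR U (w x)) \<Longrightarrow> RR U (\<Sum>x\<in>A. w x)"
 by (induction A rule: infinite_finite_induct) (auto intro: RR_add RR_zero)

lemma RR_prod: "star_open U \<Longrightarrow> (\<And>x. x \<in> A \<Longrightarrow> RR U (w x)) \<Longrightarrow> RR U (\<Prod>x\<in>A. w x)"
 by (induction A rule: infinite_finite_induct) (auto intro: RR_mult HD_one simp: RR_def[of U 1])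

lemma RR_subset: "RR U w \<Longrightarrow> V \<subseteq> U \<Longrightarrow> RR V w" unfolding RR_def using HD_subset by blast

lemma RR_obtain: assumes "RR U w" obtains f where "HD U (fps_nth w 0, f) w"
proof -
 obtain F where F: "HD U F w" using assms unfolding RR_def by blast
 then have "F = (fps_nth w 0, snd F)" by (simp add: HD_def prod_eq_iff)
 with F that[of "snd F"] show thesis by simp
qed

lemma HD_sum: "(\<And>j. j \<in> A \<Longrightarrow> HD U (F j) (w j)) \<Longrightarrow> HD U (\<Sum>j\<in>A. fst (F j), \<lambda>p. \<Sum>j\<in>A. snd (F j) p) (\<Sum>j\<in>A. w j)"
proof (induction A rule: infinite_finite_induct)
 case (insert x A)
 then have "HD U (F x) (w x)" "HD U (\<Sum>j\<in>A. fst (F j), \<lambda>p. \<Sum>j\<in>A. snd (F j) p) (\<Sum>j\<in>A. w j)" by auto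
 from HD_add[OF this] insert show ?case by simp
qed (use HD_cmult[OF HD_one, of U 0] in auto)

lemma holomorphic_divide_p: assumes "f holomorphic_on U" "open U" "0 \<in> U" "f 0 = 0"
 obtains g where "g holomorphic_on U" "\<And>p. f p = p * g p"
proof
 show "(\<lambda>z. if z = 0 then deriv f 0 else (f z - f 0) / (z - 0)) holomorphic_on U"
  using assms by (intro pole_lemma) (auto simp: interior_open)
 show "f p = p * (if p = 0 then deriv f 0 else (f p - f 0) / (p - 0))" for p using assms by auto
qed

lemma fps_X_sq_dvd_mult_nth: fixes D v w :: "complex fps"
 assumes "fps_nth D 0 = 0" "fps_nth D 1 = 0" "\<And>m. m + 2 \<le> n \<Longrightarrow> fps_nth v m = fps_nth w m"
 shows "fps_nth (D * v) n = fps_nth (D * w) n" unfolding fps_mult_nth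
proof (intro sum.cong refl)
 fix i assume i: "i \<in> {0..n}"
 show "fps_nth D i * fps_nth v (n - i) = fps_nth D i * fps_nth w (n - i)"
 proof (cases "i < 2")
  case True then have "i = 0 \<or> i = 1" by auto
  then show ?thesis using assms by auto
 next
  case False then show ?thesis using i assms(3)[of "n - i"] by simp
 qed
qed

text \<open>If \<open>\<mu> i\<close> is nonzero, degree \<open>n\<close> of the equation determines
  the coefficient of degree \<open>n\<close>. If \<open>\<mu> i = B i = 0\<close>, degree
  \<open>n + 1\<close> does: there \<open>\<xi>^2 d/d\<xi>\<close> yields \<open>n\<close> times the
  coefficient, while \<open>D\<close>, of order 2, sees degrees below \<open>n\<close> only. Degree
  0 is then free and has to be prescribed.\<close>

lemma formal_linear_unique: fixes D :: "'i::finite \<Rightarrow> 'i \<Rightarrow> complex fps"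
 assumes D: "\<And>i j. fps_nth (D i j) 0 = 0" "\<And>i j. fps_nth (D i j) 1 = 0"
  and \<mu>: "\<And>i. \<mu> i = 0 \<Longrightarrow> B i = 0"
  and v: "\<And>i. fps_const (\<mu> i) * v i + fps_const (B i) * fps_X * v i - fps_X^2 * fps_deriv (v i) - (\<Sum>j\<in>UNIV. D i j * v j) = H i"
  and w: "\<And>i. fps_const (\<mu> i) * w i + fps_const (B i) * fps_X * w i - fps_X^2 * fps_deriv (w i) - (\<Sum>j\<in>UNIV. D i j * w j) = H i"
  and 0: "\<And>i. fps_nth (v i) 0 = fps_nth (w i) 0" shows "v i = w i"
proof -
 have "\<forall>i. fps_nth (v i) n = fps_nth (w i) n" for n
 proof (induction n rule: less_induct)
  case (less n)
  show ?case
  proof (cases n)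
   case 0 then show ?thesis using assms(6) by simp
  next
   case (Suc m)
   have S: "fps_nth (\<Sum>j\<in>UNIV. D i j * v j) k = fps_nth (\<Sum>j\<in>UNIV. D i j * w j) k" if "k \<le> Suc n" for i k
    unfolding fps_sum_nth using that less by (intro sum.cong refl fps_X_sq_dvd_mult_nth D) auto
   show ?thesis
   proof
    fix i
    have e: "fps_nth (fps_const (\<mu> i) * v i + fps_const (B i) * fps_X * v i - fps_X^2 * fps_deriv (v i) - (\<Sum>j\<in>UNIV. D i j * v j)) k
      = fps_nth (fps_const (\<mu> i) * w i + fps_const (B i) * fps_X * w i - fps_X^2 * fps_deriv (w i) - (\<Sum>j\<in>UNIV. D i j * w j)) k" for k
     unfolding v w ..
    show "fps_nth (v i) n = fps_nth (w i) n"
    proof (cases "\<mu> i = 0")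
     case False
     then show ?thesis using e[of n] S[of n i] less[of m] Suc by (simp add: fps_X_sq_deriv_nth mult.assoc)
    next
     case True
     then show ?thesis using e[of "Suc n"] S[of "Suc n" i] \<mu>[OF True] Suc
      by (simp add: fps_X_sq_deriv_nth mult.assoc del: of_nat_Suc)
    qed
   qed
  qed
 qed
 then show ?thesis by (simp add: fps_eq_iff)
qed

text \<open>The formal solution is given, and analytic functions are sought for it. Write
  \<open>w i\<close> as its constant term \<open>c i\<close> plus the series of an unknown
  \<open>f i\<close>, solve for \<open>f\<close> by \<open>linear_Picard\<close>, and identify the
  series by \<open>formal_linear_unique\<close>. In components with \<open>\<mu> i = B i = 0\<close>
  the left side is \<open>- p f\<close>, so the right side has to be divisible by
  \<open>p\<close>.\<close>

lemma formal_linear_RR: fixes D :: "'i::finite \<Rightarrow> 'i \<Rightarrow> complex fps" assumes U: "star_open U"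
  and D: "\<And>i j. RR U (D i j)" "\<And>i j. fps_nth (D i j) 0 = 0" "\<And>i j. fps_nth (D i j) 1 = 0"
  and H: "\<And>i. RR U (H i)" and \<mu>: "\<And>i. (\<forall>p\<in>U. p \<noteq> \<mu> i) \<or> \<mu> i = 0 \<and> B i = 0"
  and w: "\<And>i. fps_const (\<mu> i) * w i + fps_const (B i) * fps_X * w i - fps_X^2 * fps_deriv (w i) - (\<Sum>j\<in>UNIV. D i j * w j) = H i"
 shows "RR U (w i)"
proof -
 note oU = star_openD(1,2)[OF U]
 have "\<exists>\<delta>. \<forall>x. HD U (0, \<delta> x) (D (fst x) (snd x))"
 proof (rule choice, rule allI)
  fix x
  obtain f where "HD U (fps_nth (D (fst x) (snd x)) 0, f) (D (fst x) (snd x))" by (rule RR_obtain[OF D(1)])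
  then show "\<exists>f. HD U (0, f) (D (fst x) (snd x))" using D(2) by auto
 qed
 then obtain \<delta>' where "\<And>x. HD U (0, \<delta>' x) (D (fst x) (snd x))" by blast
 then have \<delta>: "HD U (0, (\<lambda>i j. \<delta>' (i, j)) i j) (D i j)" for i j by (metis fst_conv snd_conv)
 define \<delta> where "\<delta> i j = \<delta>' (i, j)" for i j
 note \<delta> = \<delta>[folded \<delta>_def]
 have "\<exists>h. \<forall>i. HD U (fps_nth (H i) 0, h i) (H i)"
 proof (rule choice, rule allI)
  fix i
  obtain f where "HD U (fps_nth (H i) 0, f) (H i)" by (rule RR_obtain[OF H])
  then show "\<exists>f. HD U (fps_nth (H i) 0, f) (H i)" by blast
 qed
 then obtain h where h: "\<And>i. HD U (fps_nth (H i) 0, h i) (H i)" by blast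
 have val0: "f 0 = fps_nth w 1" if "HD U (c, f) w" for c f w
  using that has_fps_expansion_imp_0_eq_fps_nth_0[of f "bor 1 (fps_shift 1 w)"] by (simp add: HD_def)
 have \<delta>hol: "\<delta> i j holomorphic_on U" and \<delta>0: "\<delta> i j 0 = 0" for i j
  using \<delta>[of i j] val0[OF \<delta>[of i j]] D(3) by (auto simp: HD_def)
 have hhol: "h i holomorphic_on U" for i using h[of i] by (auto simp: HD_def)
 define \<psi> where "\<psi> i j = (SOME g. g holomorphic_on U \<and> (\<forall>p. \<delta> i j p = p * g p))" for i j
 have \<psi>: "\<psi> i j holomorphic_on U" "\<delta> i j p = p * \<psi> i j p" for i j p
 proof -
  obtain g where "g holomorphic_on U" "\<And>p. \<delta> i j p = p * g p"
   by (rule holomorphic_divide_p[OF \<delta>hol[of i j] oU \<delta>0]) (rule that; assumption)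
  then have "\<exists>g. g holomorphic_on U \<and> (\<forall>p. \<delta> i j p = p * g p)" by blast
  from someI_ex[OF this] show "\<psi> i j holomorphic_on U" "\<delta> i j p = p * \<psi> i j p" unfolding \<psi>_def by blast+
 qed
 define c where "c i = fps_nth (w i) 0" for i
 define sing where "sing i \<longleftrightarrow> \<not> (\<forall>p\<in>U. p \<noteq> \<mu> i)" for i
 have sing: "\<mu> i = 0" "B i = 0" if "sing i" for i using \<mu>[of i] that by (auto simp: sing_def)
 \<comment> \<open>The compatibility condition: in degree 1 every term on the left of the formal
   identity vanishes when \<open>\<mu> i = B i = 0\<close>, so \<open>H i\<close> has no term of
   degree 1.\<close>
 have h0: "h i 0 = 0" if "sing i" for i
 proof -
  have "fps_nth (D i j * w j) 1 = fps_nth (D i j * 0) 1" for j by (rule fps_X_sq_dvd_mult_nth) (use D in auto)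
  then have "fps_nth (H i) 1 = 0" unfolding w[of i, symmetric] using sing[OF that] fps_X_sq_deriv_nth(1)[of "w i" 0]
   by (simp add: fps_sum_nth)
  then show ?thesis using val0[OF h] by simp
 qed
 define h' where "h' i = (if sing i then (SOME g. g holomorphic_on U \<and> (\<forall>p. h i p = p * g p)) else h i)" for i
 have h': "h' i holomorphic_on U \<and> (\<forall>p. h i p = (if sing i then p else 1) * h' i p)" for i
 proof (cases "sing i")
  case True
  obtain g where "g holomorphic_on U" "\<And>p. h i p = p * g p"
   by (rule holomorphic_divide_p[OF hhol oU h0[OF True]]) (rule that; assumption)
  then have "\<exists>g. g holomorphic_on U \<and> (\<forall>p. h i p = p * g p)" by blast
  from someI_ex[OF this] show ?thesis unfolding h'_def if_P[OF True] .
 qed (simp add: h'_def hhol)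
 \<comment> \<open>In a singular component \<open>\<mu> i - p = - p\<close>, and the common factor
   \<open>p\<close> is cancelled from the equation.\<close>
 define \<gamma> where "\<gamma> i p = (if sing i then -1 else 1 / (\<mu> i - p))" for i p
 \<comment> \<open>\<open>B i\<close> times the integral of \<open>f i\<close> is convolution with a
   constant, so it joins the kernel on the diagonal.\<close>
 define A where "A i j p = (if sing i then \<psi> i j p else \<delta> i j p - (if i = j then B i else 0))" for i j p
 define \<alpha> where "\<alpha> i p = \<gamma> i p * (h' i p + (\<Sum>j\<in>UNIV. c j * A i j p))" for i p
 have \<gamma>hol: "\<gamma> i holomorphic_on U" for i
 proof (cases "sing i")
  case False
  then have "\<mu> i - p \<noteq> 0" if "p \<in> U" for p using that by (auto simp: sing_def)
  then have "(\<lambda>p. 1 / (\<mu> i - p)) holomorphic_on U" by (intro holomorphic_intros)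
  then show ?thesis using False by (simp add: \<gamma>_def[abs_def])
 qed (simp add: \<gamma>_def[abs_def])
 have Ahol: "A i j holomorphic_on U" for i j
 proof -
  have "(\<lambda>p. \<delta> i j p - c) holomorphic_on U" for c by (intro holomorphic_intros \<delta>hol)
  then show ?thesis using \<psi>(1)[of i j] by (cases "sing i") (simp_all add: A_def[abs_def])
 qed
 have \<alpha>hol: "\<alpha> i holomorphic_on U" for i unfolding \<alpha>_def[abs_def]
  by (intro holomorphic_on_mult holomorphic_on_add holomorphic_on_sum holomorphic_on_const \<gamma>hol Ahol conjunct1[OF h'])
 obtain f where f: "\<And>i. f i holomorphic_on U"
  "\<And>i p. p \<in> U \<Longrightarrow> f i p = \<alpha> i p + \<gamma> i p * (\<Sum>j\<in>UNIV. p * kconv (if sing i then 1 else 0) (A i j) (f j) p)"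
  by (rule linear_Picard[OF U \<alpha>hol \<gamma>hol Ahol, where N = "\<lambda>i. if sing i then 1 else 0"]) (rule that; assumption)
 \<comment> \<open>\<open>c i + conv (\<lambda>_. 1) (f i) p\<close> is the function part of
   \<open>\<xi>\<close> times \<open>c i \<delta> + f i\<close>.\<close>
 have eq: "(\<mu> i - p) * f i p = h i p - B i * (c i + conv (\<lambda>_. 1) (f i) p) + (\<Sum>j\<in>UNIV. c j * \<delta> i j p + conv (\<delta> i j) (f j) p)"
  if p: "p \<in> U" for i p
 proof (cases "sing i")
  case True
  have cs: "conv (\<delta> i j) (f j) p = p * (p * kconv 1 (\<psi> i j) (f j) p)" for j
  proof -
   have "\<delta> i j = (\<lambda>q. q * \<psi> i j q)" by (rule ext) (rule \<psi>(2))
   then have "conv (\<delta> i j) (f j) p = conv (\<lambda>q. q * \<psi> i j q) (f j) p" by (rule arg_cong)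
   then show ?thesis unfolding conv_mult_p_eq_kconv .
  qed
  have fi: "f i p = - (h' i p + (\<Sum>j\<in>UNIV. c j * \<psi> i j p)) - (\<Sum>j\<in>UNIV. p * kconv 1 (\<psi> i j) (f j) p)"
   using f(2)[OF p, of i] True by (simp add: \<alpha>_def \<gamma>_def A_def[abs_def])
  have "- p * f i p = p * h' i p + (p * (\<Sum>j\<in>UNIV. c j * \<psi> i j p) + p * (\<Sum>j\<in>UNIV. p * kconv 1 (\<psi> i j) (f j) p))"
   unfolding fi by (simp add: algebra_simps)
  also have "\<dots> = p * h' i p + (\<Sum>j\<in>UNIV. c j * (p * \<psi> i j p) + p * (p * kconv 1 (\<psi> i j) (f j) p))"
   by (simp add: sum_distrib_left sum.distrib mult.left_commute)
  finally show ?thesis using True sing[OF True] h'[of i] unfolding cs \<psi>(2)[symmetric] by simp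
 next
  case False
  then have ne: "\<mu> i - p \<noteq> 0" using p by (auto simp: sing_def)
  have k: "p * kconv 0 (A i j) (f j) p = conv (\<delta> i j) (f j) p - (if i = j then B i * conv (\<lambda>_. 1) (f i) p else 0)" for j
  proof -
   have "conv (\<delta> i j) (f j) p - conv (\<lambda>_. if i = j then B i else 0) (f j) p
     = conv (\<lambda>q. \<delta> i j q - (if i = j then B i else 0)) (f j) p"
    using conv_diff_split[OF U \<delta>hol f(1) holomorphic_on_const f(1) p, of i j j "if i = j then B i else 0" j] by simp
   moreover have "conv (\<lambda>_. if i = j then B i else 0) (f j) p = (if i = j then B i * conv (\<lambda>_. 1) (f i) p else 0)"
    using conv_cmult(1)[of "B i" "\<lambda>_. 1" "f i" p] by auto
   ultimately show ?thesis using False by (simp add: A_def[abs_def] conv_eq_kconv[symmetric])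
  qed
  have "(\<mu> i - p) * f i p = h i p + (\<Sum>j\<in>UNIV. c j * A i j p) + (\<Sum>j\<in>UNIV. p * kconv 0 (A i j) (f j) p)"
  proof -
   have "f i p = (h i p + (\<Sum>j\<in>UNIV. c j * A i j p)) / (\<mu> i - p) + (\<Sum>j\<in>UNIV. p * kconv 0 (A i j) (f j) p) / (\<mu> i - p)"
    using f(2)[OF p, of i] False h'[of i] by (simp add: \<alpha>_def \<gamma>_def)
   then have "f i p = (h i p + (\<Sum>j\<in>UNIV. c j * A i j p) + (\<Sum>j\<in>UNIV. p * kconv 0 (A i j) (f j) p)) / (\<mu> i - p)"
    by (simp only: add_divide_distrib)
   then show ?thesis using ne by simp
  qed
  also have "(\<Sum>j\<in>UNIV. c j * A i j p) = (\<Sum>j\<in>UNIV. c j * \<delta> i j p) - B i * c i"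
  proof -
   have "c j * A i j p = c j * \<delta> i j p - (if i = j then B i * c i else 0)" for j
    using False by (simp add: A_def algebra_simps)
   then show ?thesis by (simp add: sum_subtractf)
  qed
  also have "(\<Sum>j\<in>UNIV. p * kconv 0 (A i j) (f j) p) = (\<Sum>j\<in>UNIV. conv (\<delta> i j) (f j) p) - B i * conv (\<lambda>_. 1) (f i) p"
   unfolding k by (simp add: sum_subtractf)
  finally show ?thesis by (simp add: algebra_simps sum.distrib)
 qed
 have "\<exists>v. \<forall>i. HD U (c i, f i) (v i)" by (rule choice, rule allI, rule HD_exists[OF U f(1)])
 then obtain v where v: "\<And>i. HD U (c i, f i) (v i)" by blast
 have v0: "fps_nth (v i) 0 = c i" for i using v[of i] by (simp add: HD_def)
 have "fps_const (\<mu> i) * v i + fps_const (B i) * fps_X * v i - fps_X^2 * fps_deriv (v i) - (\<Sum>j\<in>UNIV. D i j * v j) = H i" for i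
 proof -
  have X: "HD U (0, \<lambda>_. 1) fps_X"
  proof -
   have "bor 1 1 = 1" by (simp add: fps_eq_iff)
   moreover have "fps_shift 1 (fps_X :: complex fps) = 1" by (simp add: fps_eq_iff)
   ultimately show ?thesis by (simp add: HD_def del: One_nat_def)
  qed
  have dv: "HD U (0, \<lambda>p. p * f i p) (fps_X^2 * fps_deriv (v i))"
  proof -
   have "HD U (0, f i) (v i - fps_const (c i))"
   proof -
    have "fps_shift (Suc 0) (fps_const (x :: complex)) = 0" for x by (simp add: fps_eq_iff)
    then show ?thesis using v[of i] by (simp add: HD_def fps_shift_diff)
   qed
   from HD_mult_p[OF this] show ?thesis by simp
  qed
  have l: "HD U (\<mu> i * c i, \<lambda>p. \<mu> i * f i p + B i * (c i + conv (\<lambda>_. 1) (f i) p) - p * f i p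
    - (\<Sum>j\<in>UNIV. c j * \<delta> i j p + conv (\<delta> i j) (f j) p))
   (fps_const (\<mu> i) * v i + fps_const (B i) * (fps_X * v i) - fps_X^2 * fps_deriv (v i) - (\<Sum>j\<in>UNIV. D i j * v j))"
   using HD_diff[OF HD_diff[OF HD_add[OF HD_cmult[OF v[of i], of "\<mu> i"] HD_cmult[OF HD_dconv[OF U X v[of i]], of "B i"]] dv]
     HD_sum[of UNIV U "\<lambda>j. dconv (0, \<delta> i j) (c j, f j)" "\<lambda>j. D i j * v j"]] HD_dconv[OF U \<delta> v]
   by (simp add: dconv_def)
  \<comment> \<open>Degree 0 of the given identity is the equality of the delta parts.\<close>
  have c0: "\<mu> i * c i = fps_nth (H i) 0"
  proof -
   have "fps_nth (D i j * w j) 0 = 0" for j using D by simp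
   then show ?thesis unfolding w[of i, symmetric] by (simp add: c_def fps_sum_nth fps_X_sq_deriv_nth mult.assoc D(2))
  qed
  have "fps_const (\<mu> i) * v i + fps_const (B i) * (fps_X * v i) - fps_X^2 * fps_deriv (v i) - (\<Sum>j\<in>UNIV. D i j * v j) = H i"
   by (rule HD_unique[OF l h _ _ U]) (use c0 eq[of _ i] in \<open>auto simp: algebra_simps\<close>)
  then show ?thesis by (simp only: mult.assoc)
 qed
 moreover have "\<mu> i = 0 \<Longrightarrow> B i = 0" for i using \<mu>[of i] oU by auto
 ultimately have "v i = w i"
  by (intro formal_linear_unique[where D = D and \<mu> = \<mu> and B = B and v = v and w = w and H = H] D(2,3) w)
   (simp_all add: v0 c_def)
 then show ?thesis using v[of i] unfolding RR_def by metis
qed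

section \<open>Powers of a trans-series and sums over compositions\<close>

definition CS :: "'a set \<Rightarrow> nat \<Rightarrow> ('a \<Rightarrow> nat) set"
 where "CS P k = {c. (\<forall>x. x \<notin> P \<longrightarrow> c x = 0) \<and> (\<Sum>x\<in>P. c x) = k}"

lemma finite_CS: "finite P \<Longrightarrow> finite (CS P k)"
proof (rule finite_subset)
 assume P: "finite P"
 show "CS P k \<subseteq> {c. \<forall>x. (x \<in> P \<longrightarrow> c x \<in> {..k}) \<and> (x \<notin> P \<longrightarrow> c x = 0)}"
  using P by (auto simp: CS_def intro: member_le_sum)
 show "finite {c. \<forall>x. (x \<in> P \<longrightarrow> c x \<in> {..k}) \<and> (x \<notin> P \<longrightarrow> c x = 0)}"
  using P by (intro finite_set_of_finite_funs) auto
qed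

lemma fps_nth_prod_CS: fixes w :: "'a \<Rightarrow> 'b::comm_ring_1 fps" assumes "finite P"
 shows "fps_nth (\<Prod>x\<in>P. w x) k = (\<Sum>c\<in>CS P k. \<Prod>x\<in>P. fps_nth (w x) (c x))" using assms
proof (induction P arbitrary: k rule: finite_induct)
 case empty
 have "CS ({} :: 'a set) 0 = {\<lambda>_. 0}" "k \<noteq> 0 \<Longrightarrow> CS ({} :: 'a set) k = {}" by (auto simp: CS_def)
 then show ?case by (cases "k = 0") simp_all
next
 case (insert x P)
 have "fps_nth (\<Prod>x\<in>insert x P. w x) k = (\<Sum>a\<le>k. fps_nth (w x) a * (\<Sum>c\<in>CS P (k - a). \<Prod>x\<in>P. fps_nth (w x) (c x)))"
  using insert by (simp add: fps_mult_nth atLeast0AtMost)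
 also have "\<dots> = (\<Sum>a\<le>k. \<Sum>c\<in>CS P (k - a). fps_nth (w x) a * (\<Prod>x\<in>P. fps_nth (w x) (c x)))"
  by (simp add: sum_distrib_left)
 also have "\<dots> = (\<Sum>(a, c)\<in>Sigma {..k} (\<lambda>a. CS P (k - a)). fps_nth (w x) a * (\<Prod>x\<in>P. fps_nth (w x) (c x)))"
  using finite_CS[OF insert(1)] by (intro sum.Sigma) auto
 also have "\<dots> = (\<Sum>c\<in>CS (insert x P) k. \<Prod>x\<in>insert x P. fps_nth (w x) (c x))"
 proof (rule sum.reindex_bij_witness[of _ "\<lambda>c. (c x, c(x := 0))" "\<lambda>(a, c). c(x := a)"])
  fix y assume y: "y \<in> Sigma {..k} (\<lambda>a. CS P (k - a))"
  obtain a c where ac: "y = (a, c)" by (cases y)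
  have c: "a \<le> k" "\<And>z. z \<notin> P \<Longrightarrow> c z = 0" "(\<Sum>z\<in>P. c z) = k - a" using y ac by (auto simp: CS_def)
  show "(\<lambda>c. (c x, c(x := 0))) ((\<lambda>(a, c). c(x := a)) y) = y" using ac c insert by (auto simp: fun_eq_iff)
  have "(\<Sum>z\<in>P. (c(x := a)) z) = (\<Sum>z\<in>P. c z)" using insert by (intro sum.cong) auto
  then show "(\<lambda>(a, c). c(x := a)) y \<in> CS (insert x P) k" using ac c insert by (auto simp: CS_def)
  have "(\<Prod>z\<in>P. fps_nth (w z) ((c(x := a)) z)) = (\<Prod>z\<in>P. fps_nth (w z) (c z))"
   using insert by (intro prod.cong) auto
  then show "(\<Prod>z\<in>insert x P. fps_nth (w z) ((\<lambda>(a, c). c(x := a)) y z)) = (case y of (a, c) \<Rightarrow> fps_nth (w x) a * (\<Prod>x\<in>P. fps_nth (w x) (c x)))"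
   using ac insert by simp
 next
  fix c assume c: "c \<in> CS (insert x P) k"
  then have s: "c x + (\<Sum>z\<in>P. c z) = k" "\<And>z. z \<notin> insert x P \<Longrightarrow> c z = 0" using insert by (auto simp: CS_def)
  have "(\<Sum>z\<in>P. (c(x := 0)) z) = (\<Sum>z\<in>P. c z)" using insert by (intro sum.cong) auto
  then show "(c x, c(x := 0)) \<in> Sigma {..k} (\<lambda>a. CS P (k - a))" using s by (auto simp: CS_def)
  show "(\<lambda>(a, c). c(x := a)) (c x, c(x := 0)) = c" by auto
 qed
 finally show ?case .
qed

text \<open>The coefficient of \<open>\<zeta>^k\<close> in the m-th power of \<open>y - y_0\<close>;
  it corresponds to the inner sum of the hierarchy.\<close>

definition Wk :: "('n::finite \<Rightarrow> complex fps fps) \<Rightarrow> ('n \<Rightarrow> nat) \<Rightarrow> nat \<Rightarrow> complex fps"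
 where "Wk y m k = fps_nth (\<Prod>j\<in>UNIV. (y j - fps_const (fps_nth (y j) 0)) ^ m j) k"

lemma finite_compositions: "finite (compositions l k)"
proof -
 define P where "P = Sigma (UNIV :: 'a set) (\<lambda>i. {1..l i})"
 have "compositions l k \<subseteq> curry ` CS P k"
 proof
  fix m assume m: "m \<in> compositions l k"
  have "(\<Sum>x\<in>P. case_prod m x) = k" using m unfolding P_def compositions_def by (subst sum.Sigma[symmetric]) auto
  then have "case_prod m \<in> CS P k" using m unfolding CS_def P_def compositions_def by auto
  then show "m \<in> curry ` CS P k" by (intro image_eqI[of _ _ "case_prod m"]) auto
 qed
 moreover have "finite P" unfolding P_def by auto
 ultimately show ?thesis using finite_CS finite_surj by blast
qed

text \<open>Subtracting \<open>y_0\<close> kills every factor of index 0, so the weak compositions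
  with a zero part drop out.\<close>

lemma Wk_compositions:
 "Wk y m k = (\<Sum>c\<in>compositions m k. \<Prod>i\<in>UNIV. \<Prod>j\<in>{1..m i}. fps_nth (y i) (c i j))"
proof -
 define P where "P = Sigma (UNIV :: 'a set) (\<lambda>i. {1..m i})"
 define w where "w j = y j - fps_const (fps_nth (y j) 0)" for j
 have P: "finite P" by (auto simp: P_def)
 have "Wk y m k = fps_nth (\<Prod>x\<in>P. w (fst x)) k" unfolding Wk_def w_def P_def
  by (subst prod.Sigma[symmetric, of UNIV _ "\<lambda>i j. y i - fps_const (fps_nth (y i) 0)", unfolded case_prod_unfold]) auto
 also have "\<dots> = (\<Sum>c\<in>CS P k. \<Prod>x\<in>P. fps_nth (w (fst x)) (c x))" by (rule fps_nth_prod_CS[OF P])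
 also have "\<dots> = (\<Sum>c\<in>{c \<in> CS P k. \<forall>x\<in>P. c x \<ge> 1}. \<Prod>x\<in>P. fps_nth (w (fst x)) (c x))"
 proof (rule sum.mono_neutral_right[OF finite_CS[OF P]])
  show "\<forall>c\<in>CS P k - {c \<in> CS P k. \<forall>x\<in>P. c x \<ge> 1}. (\<Prod>x\<in>P. fps_nth (w (fst x)) (c x)) = 0"
  proof
   fix c assume "c \<in> CS P k - {c \<in> CS P k. \<forall>x\<in>P. c x \<ge> 1}"
   then obtain x where "x \<in> P" "c x = 0" by force
   then show "(\<Prod>x\<in>P. fps_nth (w (fst x)) (c x)) = 0" using P by (intro prod_zero bexI[of _ x]) (auto simp: w_def)
  qed
 qed auto
 also have "\<dots> = (\<Sum>c\<in>compositions m k. \<Prod>x\<in>P. fps_nth (y (fst x)) (c (fst x) (snd x)))"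
 proof (rule sum.reindex_bij_witness[of _ case_prod curry])
  fix c assume c: "c \<in> {c \<in> CS P k. \<forall>x\<in>P. c x \<ge> 1}"
  show "case_prod (curry c) = c" by simp
  have "(\<Sum>x\<in>P. c x) = (\<Sum>i\<in>UNIV. \<Sum>j\<in>{1..m i}. c (i, j))" unfolding P_def by (subst sum.Sigma) auto
  then show "curry c \<in> compositions m k" using c by (auto simp: compositions_def CS_def P_def)
  show "(\<Prod>x\<in>P. fps_nth (y (fst x)) (curry c (fst x) (snd x))) = (\<Prod>x\<in>P. fps_nth (w (fst x)) (c x))"
   using c by (intro prod.cong refl) (force simp: w_def)
 next
  fix c assume c: "c \<in> compositions m k"
  show "curry (case_prod c) = c" by simp
  have "(\<Sum>x\<in>P. case_prod c x) = k" using c unfolding P_def compositions_def by (subst sum.Sigma[symmetric]) auto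
  then show "case_prod c \<in> {c \<in> CS P k. \<forall>x\<in>P. c x \<ge> 1}" using c by (auto simp: compositions_def CS_def P_def)
 qed
 also have "\<dots> = (\<Sum>c\<in>compositions m k. \<Prod>i\<in>UNIV. \<Prod>j\<in>{1..m i}. fps_nth (y i) (c i j))"
  unfolding P_def by (intro sum.cong refl, subst prod.Sigma) (auto simp: case_prod_unfold)
 finally show ?thesis .
qed

text \<open>Two or more positive parts of sum \<open>k\<close> are each below \<open>k\<close>;
  hence the nonlinear terms of level \<open>k\<close> involve lower levels only.\<close>

lemma compositions_part: assumes c: "c \<in> compositions l k" and l: "msize l > 1" and ij: "j \<in> {1..l i}"
 shows "1 \<le> c i j" "c i j < k"
proof -
 define P where "P = Sigma (UNIV :: 'a set) (\<lambda>i. {1..l i})"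
 have P: "finite P" "(i, j) \<in> P" "card P = msize l" using ij by (auto simp: P_def msize_def card_SigmaI)
 have ge: "\<And>x. x \<in> P \<Longrightarrow> case_prod c x \<ge> 1" using c by (auto simp: P_def compositions_def)
 show "1 \<le> c i j" using ge[OF P(2)] by simp
 have "k = (\<Sum>x\<in>P. case_prod c x)" using c unfolding P_def compositions_def by (subst sum.Sigma[symmetric]) auto
 also have "\<dots> = c i j + (\<Sum>x\<in>P - {(i, j)}. case_prod c x)" using P by (subst sum.remove[of P "(i, j)"]) auto
 finally have k: "k = c i j + (\<Sum>x\<in>P - {(i, j)}. case_prod c x)" .
 have "(\<Sum>x\<in>P - {(i, j)}. (1::nat)) \<le> (\<Sum>x\<in>P - {(i, j)}. case_prod c x)" by (intro sum_mono ge) auto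
 moreover have "(\<Sum>x\<in>P - {(i, j)}. (1::nat)) \<ge> 1" using P l by simp
 ultimately show "c i j < k" using k by linarith
qed

lemma compositions_msize: "c \<in> compositions l k \<Longrightarrow> msize l \<le> k"
proof -
 assume c: "c \<in> compositions l k"
 have "(\<Sum>j\<in>{1..l i}. 1) \<le> (\<Sum>j\<in>{1..l i}. c i j)" for i
  using c by (intro sum_mono) (auto simp: compositions_def)
 then have "(\<Sum>i\<in>UNIV. l i) \<le> (\<Sum>i\<in>UNIV. \<Sum>j\<in>{1..l i}. c i j)" by (intro sum_mono) simp
 then show ?thesis using c by (simp add: compositions_def msize_def)
qed

text \<open>The series in \<open>1/x\<close> of \<open>g^(m)(x, w) / m!\<close>, the formal
  counterpart of \<open>dcoef\<close>.\<close>

definition dfps :: "(nat \<Rightarrow> ('n \<Rightarrow> nat) \<Rightarrow> 'n::{finite,linorder} cvec) \<Rightarrow> ('n \<Rightarrow> complex fps) \<Rightarrow> ('n \<Rightarrow> nat) \<Rightarrow> 'n \<Rightarrow> complex fps"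
 where "dfps gc w m i = Abs_fps (\<lambda>N. \<Sum>\<^sub>\<infinity>l\<in>{l. m \<le> l}.
  fps_nth (fps_const (of_nat (mbinom l m)) * (Gfps gc l i * (\<Prod>j\<in>UNIV. w j ^ (l j - m j)))) N)"

lemma msize_diff: "m \<le> l \<Longrightarrow> msize (\<lambda>j. l j - m j) + msize m = msize (l :: 'n::finite \<Rightarrow> nat)"
 unfolding msize_def sum.distrib[symmetric] by (intro sum.cong) (auto simp: le_fun_def)

lemma msize_mono: "m \<le> l \<Longrightarrow> msize m \<le> msize (l :: 'n::finite \<Rightarrow> nat)"
 using msize_diff[of m l] by simp

lemma mbinom_le: "mbinom l m \<le> 2 ^ msize (l :: 'n::finite \<Rightarrow> nat)"
 unfolding mbinom_def msize_def power_sum by (intro prod_mono) (auto simp: binomial_le_pow2)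

lemma finite_le_multiindex: "finite {m. m \<le> (l :: 'n::finite \<Rightarrow> nat)}"
 by (rule finite_subset[OF _ finite_msize_le[of "msize l"]]) (auto intro: msize_mono)

lemma multibinomial: fixes a c :: "'n::finite \<Rightarrow> 'b::comm_ring_1"
 shows "(\<Prod>j\<in>UNIV. (a j + c j) ^ l j) = (\<Sum>m\<in>{m. m \<le> l}. of_nat (mbinom l m) * (\<Prod>j\<in>UNIV. a j ^ (l j - m j)) * (\<Prod>j\<in>UNIV. c j ^ m j))"
proof -
 have "(\<Prod>j\<in>UNIV. (a j + c j) ^ l j) = (\<Prod>j\<in>UNIV. \<Sum>k\<in>{..l j}. of_nat (l j choose k) * c j ^ k * a j ^ (l j - k))"
  by (subst add.commute, simp add: binomial_ring)
 also have "\<dots> = (\<Sum>m\<in>PiE UNIV (\<lambda>j. {..l j}). \<Prod>j\<in>UNIV. of_nat (l j choose m j) * c j ^ m j * a j ^ (l j - m j))"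
  by (rule prod_sum_PiE) auto
 also have "PiE UNIV (\<lambda>j. {..l j}) = {m. m \<le> l}" by (auto simp: PiE_def Pi_def le_fun_def)
 finally show ?thesis by (simp add: prod.distrib mbinom_def mult_ac)
qed

text \<open>Taylor expansion of \<open>g\<close> about \<open>y_0\<close>, by the multinomial
  formula for \<open>y_0 + (y - y_0)\<close>. In a fixed degree only finitely many \<open>l\<close>
  matter, which justifies exchanging the sums over \<open>l\<close> and \<open>m\<close>.\<close>

lemma ts_g_hierarchy: fixes y :: "'n::{finite,linorder} \<Rightarrow> complex fps fps"
 assumes y: "\<And>j. bigrade 1 (y j)" and k: "k \<ge> 1"
 shows "ts_g gc y k i = (\<Sum>m\<in>{m. 1 \<le> msize m \<and> msize m \<le> k}. dfps gc (\<lambda>j. fps_nth (y j) 0) m i * Wk y m k)"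
proof (intro fps_ext)
 fix N
 define w where "w j = y j - fps_const (fps_nth (y j) 0)" for j
 define y0 where "y0 j = fps_nth (y j) 0" for j
 define M where "M = {m :: 'n \<Rightarrow> nat. 1 \<le> msize m \<and> msize m \<le> k}"
 define L where "L = {l :: 'n \<Rightarrow> nat. msize l \<le> k + N}"
 define c where "c l m = fps_const (of_nat (mbinom l m)) * (Gfps gc l i * (\<Prod>j\<in>UNIV. y0 j ^ (l j - m j)))" for l m :: "'n \<Rightarrow> nat"
 have M: "finite M" unfolding M_def by (rule finite_subset[OF _ finite_msize_le[of k]]) auto
 have L: "finite L" unfolding L_def by (rule finite_msize_le)
 have gw: "bigrade 1 (w j)" and gy0: "bigrade 1 (fps_const (y0 j))" for j using y[of j] by (auto simp: bigrade_def w_def y0_def)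
 have W0: "Wk y m k = 0" if "m \<notin> M" for m
 proof (cases "msize m = 0")
  case True
  then have "m j = 0" for j by (simp add: msize_def)
  then show ?thesis using k by (simp add: Wk_def)
 next
  case False
  then have mk: "k < msize m" using that by (simp add: M_def)
  show ?thesis unfolding Wk_compositions
  proof (rule sum.neutral, rule ballI)
   fix x assume "x \<in> compositions m k"
   from compositions_msize[OF this] mk show "(\<Prod>i\<in>UNIV. \<Prod>j\<in>{1..m i}. fps_nth (y i) (x i j)) = 0" by simp
  qed
 qed
 have expand: "fps_nth (\<Prod>j\<in>UNIV. y j ^ l j) k = (\<Sum>m\<in>{m \<in> M. m \<le> l}. fps_const (of_nat (mbinom l m)) * (\<Prod>j\<in>UNIV. y0 j ^ (l j - m j)) * Wk y m k)" for l
 proof -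
  have "(\<Prod>j\<in>UNIV. y j ^ l j) = (\<Prod>j\<in>UNIV. (fps_const (y0 j) + w j) ^ l j)" by (simp add: w_def y0_def)
  also have "\<dots> = (\<Sum>m\<in>{m. m \<le> l}. of_nat (mbinom l m) * (\<Prod>j\<in>UNIV. fps_const (y0 j) ^ (l j - m j)) * (\<Prod>j\<in>UNIV. w j ^ m j))"
   by (rule multibinomial)
  also have "\<dots> = (\<Sum>m\<in>{m. m \<le> l}. fps_const (fps_const (of_nat (mbinom l m)) * (\<Prod>j\<in>UNIV. y0 j ^ (l j - m j))) * (\<Prod>j\<in>UNIV. w j ^ m j))"
  proof -
   have "(\<Prod>j\<in>A. fps_const (f j)) = fps_const (\<Prod>j\<in>A. f j)" for f :: "'n \<Rightarrow> complex fps" and A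
    by (induction A rule: infinite_finite_induct) auto
   then show ?thesis by (simp add: fps_const_power fps_of_nat flip: fps_const_mult)
  qed
  finally have "fps_nth (\<Prod>j\<in>UNIV. y j ^ l j) k = (\<Sum>m\<in>{m. m \<le> l}. fps_const (of_nat (mbinom l m)) * (\<Prod>j\<in>UNIV. y0 j ^ (l j - m j)) * Wk y m k)"
   by (simp add: fps_sum_nth Wk_def w_def)
  also have "\<dots> = (\<Sum>m\<in>{m \<in> M. m \<le> l}. fps_const (of_nat (mbinom l m)) * (\<Prod>j\<in>UNIV. y0 j ^ (l j - m j)) * Wk y m k)"
   using W0 by (intro sum.mono_neutral_right finite_le_multiindex) auto
  finally show ?thesis .
 qed
 \<comment> \<open>\<open>y_0\<close> is divisible by \<open>fps_X\<close>, and
   \<open>|l - m| > N\<close> because \<open>|l| > k + N\<close> and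
   \<open>|m| \<le> k\<close>.\<close>
 have cl0: "fps_nth (c l m) a = 0" if "m \<in> M" "m \<le> l" "a \<le> N" "l \<notin> L" for l m a
 proof -
  have "bigrade (msize (\<lambda>j. l j - m j)) (\<Prod>j\<in>UNIV. fps_const (y0 j) ^ (l j - m j))" by (rule bigrade_prod[OF gy0])
  moreover have "(\<Prod>j\<in>A. fps_const (y0 j) ^ n j) = fps_const (\<Prod>j\<in>A. y0 j ^ n j)" for A n
   by (induction A rule: infinite_finite_induct) auto
  moreover have "msize (\<lambda>j. l j - m j) > N" using that msize_diff[OF that(2)] by (auto simp: L_def M_def)
  ultimately have bg: "bigrade (msize (\<lambda>j. l j - m j)) (fps_const (\<Prod>j\<in>UNIV. y0 j ^ (l j - m j)))"
   and ms: "msize (\<lambda>j. l j - m j) > N" by simp_all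
  have "fps_nth (\<Prod>j\<in>UNIV. y0 j ^ (l j - m j)) b = 0" if "b \<le> N" for b
   using bg[unfolded bigrade_def, rule_format, of 0 b] that ms by simp
  then have "fps_nth (Gfps gc l i * (\<Prod>j\<in>UNIV. y0 j ^ (l j - m j))) a = 0"
   unfolding fps_mult_nth using \<open>a \<le> N\<close> by (intro sum.neutral) auto
  then show ?thesis by (simp add: c_def)
 qed
 have "fps_nth (ts_g gc y k i) N = (\<Sum>\<^sub>\<infinity>l\<in>{l. msize l \<ge> 1}. fps_nth (Gfps gc l i * fps_nth (\<Prod>j\<in>UNIV. y j ^ l j) k) N)"
  unfolding ts_g_eq[OF y] by simp
 also have "\<dots> = (\<Sum>\<^sub>\<infinity>l\<in>{l. msize l \<ge> 1}. \<Sum>m\<in>{m \<in> M. m \<le> l}. fps_nth (c l m * Wk y m k) N)"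
  unfolding expand sum_distrib_left fps_sum_nth c_def by (simp add: mult_ac)
 also have "\<dots> = (\<Sum>l\<in>{l \<in> L. msize l \<ge> 1}. \<Sum>m\<in>{m \<in> M. m \<le> l}. fps_nth (c l m * Wk y m k) N)"
 proof (rule infsum_finite_support)
  fix l assume "l \<in> {l. 1 \<le> msize l} - {l \<in> L. 1 \<le> msize l}"
  then have "l \<notin> L" by auto
  then show "(\<Sum>m\<in>{m \<in> M. m \<le> l}. fps_nth (c l m * Wk y m k) N) = 0"
   unfolding fps_mult_nth[of "c l _"] by (intro sum.neutral ballI) (auto simp: cl0)
 qed (use L in auto)
 also have "\<dots> = (\<Sum>l\<in>L. \<Sum>m\<in>{m \<in> M. m \<le> l}. fps_nth (c l m * Wk y m k) N)"
 proof (rule sum.mono_neutral_left[OF L])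
  show "\<forall>l\<in>L - {l \<in> L. 1 \<le> msize l}. (\<Sum>m\<in>{m \<in> M. m \<le> l}. fps_nth (c l m * Wk y m k) N) = 0"
  proof
   fix l assume "l \<in> L - {l \<in> L. 1 \<le> msize l}"
   then have "{m \<in> M. m \<le> l} = {}" using msize_mono[of _ l] by (fastforce simp: M_def)
   then show "(\<Sum>m\<in>{m \<in> M. m \<le> l}. fps_nth (c l m * Wk y m k) N) = 0" by (simp only: sum.empty)
  qed
 qed auto
 also have "\<dots> = (\<Sum>m\<in>M. \<Sum>l\<in>{l \<in> L. m \<le> l}. fps_nth (c l m * Wk y m k) N)"
  by (rule sum.swap_restrict[OF L M])
 also have "\<dots> = (\<Sum>m\<in>M. fps_nth (dfps gc y0 m i * Wk y m k) N)"
 proof (rule sum.cong[OF refl])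
  fix m assume m: "m \<in> M"
  have d: "fps_nth (dfps gc y0 m i) a = (\<Sum>l\<in>{l \<in> L. m \<le> l}. fps_nth (c l m) a)" if "a \<le> N" for a
   unfolding dfps_def fps_nth_Abs_fps c_def[symmetric] by (rule infsum_finite_support) (use L cl0[OF m _ that] in auto)
  have "(\<Sum>l\<in>{l \<in> L. m \<le> l}. fps_nth (c l m * Wk y m k) N)
    = (\<Sum>a\<le>N. \<Sum>l\<in>{l \<in> L. m \<le> l}. fps_nth (c l m) a * fps_nth (Wk y m k) (N - a))"
   unfolding fps_mult_nth[of "c _ m"] atLeast0AtMost by (rule sum.swap)
  also have "\<dots> = fps_nth (dfps gc y0 m i * Wk y m k) N" unfolding fps_mult_nth[of "dfps gc y0 m i"] atLeast0AtMost
   by (intro sum.cong refl) (simp add: d sum_distrib_right)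
  finally show "(\<Sum>l\<in>{l \<in> L. m \<le> l}. fps_nth (c l m * Wk y m k) N) = fps_nth (dfps gc y0 m i * Wk y m k) N" .
 qed
 also have "\<dots> = fps_nth (\<Sum>m\<in>M. dfps gc y0 m i * Wk y m k) N" by (simp add: fps_sum_nth)
 finally show "fps_nth (ts_g gc y k i) N = fps_nth (\<Sum>m\<in>{m. 1 \<le> msize m \<and> msize m \<le> k}. dfps gc (\<lambda>j. fps_nth (y j) 0) m i * Wk y m k) N"
  by (simp add: M_def y0_def[abs_def])
qed

lemma msize_munit: "msize (munit j :: 'n::finite \<Rightarrow> nat) = 1" by (simp add: msize_def munit_def)

lemma msize_eq_1: "{m :: 'n::finite \<Rightarrow> nat. msize m = 1} = range munit"
proof (intro set_eqI iffI)
 fix m :: "'n \<Rightarrow> nat" assume "m \<in> {m. msize m = 1}"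
 then have "(\<Sum>i\<in>UNIV. m i) = 1" by (simp add: msize_def)
 then obtain j where j: "m j = 1" "\<And>i. i \<noteq> j \<Longrightarrow> m i = 0" by (subst (asm) sum_eq_1_iff) auto
 then have "m = munit j" by (auto simp: munit_def fun_eq_iff)
 then show "m \<in> range munit" by auto
qed (auto simp: msize_munit)

lemma inj_munit: "inj munit" by (rule injI) (metis munit_def zero_neq_one)

lemma Wk_munit: "k \<ge> 1 \<Longrightarrow> Wk y (munit j) k = fps_nth (y j) k"
proof -
 assume k: "k \<ge> 1"
 have "(\<Prod>i\<in>UNIV. (y i - fps_const (fps_nth (y i) 0)) ^ munit j i) = (\<Prod>i\<in>{j}. (y i - fps_const (fps_nth (y i) 0)) ^ munit j i)"
  by (rule prod.mono_neutral_right) (auto simp: munit_def)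
 then show ?thesis using k by (simp add: Wk_def munit_def)
qed

text \<open>Differentiating \<open>exp (-k x) x^(-k \<beta>)\<close> shifts the diagonal to
  \<open>lam - k\<close> and \<open>b - k \<beta>\<close>. The unit multi-indices give the terms
  linear in level \<open>k\<close>; all others involve lower levels.\<close>

lemma formal_hierarchy: fixes y :: "'n::{finite,linorder} \<Rightarrow> complex fps fps"
 assumes y: "transseries lam b fc gc y" and k: "k \<ge> 1"
 shows "fps_const (lam $ i - of_nat k) * fps_nth (y i) k + fps_const (b $ i - of_nat k * b $ ix1) * fps_X * fps_nth (y i) k
   - fps_X^2 * fps_deriv (fps_nth (y i) k) - (\<Sum>j\<in>UNIV. dfps gc (\<lambda>j. fps_nth (y j) 0) (munit j) i * fps_nth (y j) k)
  = (\<Sum>m\<in>{m. 2 \<le> msize m \<and> msize m \<le> k}. dfps gc (\<lambda>j. fps_nth (y j) 0) m i * Wk y m k)"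
proof -
 let ?d = "\<lambda>m. dfps gc (\<lambda>j. fps_nth (y j) 0) m i"
 have g: "bigrade 1 (y j)" for j using y by (simp add: transseries_def bigrade_def)
 have f1: "finite {m :: 'n \<Rightarrow> nat. msize m = 1}" "finite {m :: 'n \<Rightarrow> nat. 2 \<le> msize m \<and> msize m \<le> k}"
  by (rule finite_subset[OF _ finite_msize_le[of "max 1 k"]]; auto)+
 have "{m :: 'n \<Rightarrow> nat. 1 \<le> msize m \<and> msize m \<le> k} = {m. msize m = 1} \<union> {m. 2 \<le> msize m \<and> msize m \<le> k}"
  using k by auto
 then have "ts_g gc y k i = (\<Sum>m\<in>{m. msize m = 1}. ?d m * Wk y m k) + (\<Sum>m\<in>{m. 2 \<le> msize m \<and> msize m \<le> k}. ?d m * Wk y m k)"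
  unfolding ts_g_hierarchy[OF g k] using f1 by (simp add: sum.union_disjoint disjoint_iff)
 also have "(\<Sum>m\<in>{m. msize m = 1}. ?d m * Wk y m k) = (\<Sum>j\<in>UNIV. ?d (munit j) * fps_nth (y j) k)"
  unfolding msize_eq_1 by (subst sum.reindex[OF inj_munit]) (simp add: Wk_munit[OF k])
 finally have t: "ts_g gc y k i = (\<Sum>j\<in>UNIV. ?d (munit j) * fps_nth (y j) k) + (\<Sum>m\<in>{m. 2 \<le> msize m \<and> msize m \<le> k}. ?d m * Wk y m k)" .
 have "ts_deriv (b $ ix1) k (fps_nth (y i) k) = - (fps_const (lam $ i) * fps_nth (y i) k) - fps_const (b $ i) * fps_X * fps_nth (y i) k + ts_g gc y k i"
  using y k unfolding transseries_def by simp
 note ts = this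
 have e: "fps_const (lam $ i - of_nat k) = fps_const (lam $ i) - fps_const (of_nat k)"
  "fps_const (b $ i - of_nat k * b $ ix1) = fps_const (b $ i) - fps_const (of_nat k * b $ ix1)" by simp_all
 show ?thesis using ts unfolding t ts_deriv_def e
  by (simp add: algebra_simps del: fps_const_sub fps_const_add fps_const_neg fps_const_mult)
qed

section \<open>Analytic solutions of the hierarchy\<close>

lemma conv_pow_msize_0: "msize l = 0 \<Longrightarrow> conv_pow Y l = (1, \<lambda>p. 0)"
 unfolding conv_pow_cprod using length_idx[of l] by simp

context conv_system
begin

text \<open>The binomial factor is at most \<open>2^|l|\<close>. It is absorbed because each further
  factor of the convolution power contributes \<open>T * \<kappa> \<le> \<rho> / 4\<close>, and
  twice this is still below \<open>\<rho>\<close>.\<close>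

lemma dcoef_HD: assumes U: "star_open U" and Y: "\<And>i. HD U (0, \<lambda>p. Y p $ i) (w i)" and small: "small_on U Y"
 shows "HD U (dcoef gc Y m i) (dfps gc w m i)"
proof -
 define t where "t l = dconv (gc 0 l $ i, Gl gc l i) (conv_pow Y (\<lambda>j. l j - m j))" for l
 define F where "F l = (of_nat (mbinom l m) * fst (t l), \<lambda>p. of_nat (mbinom l m) * snd (t l) p)" for l
 have hol: "(\<lambda>p. Y p $ i) holomorphic_on U" for i using Y[of i] by (simp add: HD_def)
 have F: "HD U (F l) (fps_const (of_nat (mbinom l m)) * (Gfps gc l i * (\<Prod>j\<in>UNIV. w j ^ (l j - m j))))" for l
  unfolding F_def t_def by (rule HD_cmult[OF HD_dconv[OF U Gl_props(1)[OF \<rho> gcK] HD_conv_pow[OF U Y]]])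
 have bd: "\<exists>M. M summable_on {l. m \<le> l} \<and> (\<forall>l\<in>{l. m \<le> l}. \<forall>p\<in>A. norm (snd (F l) p) \<le> M l)"
  if A: "compact A" "A \<subseteq> U" for A
 proof (cases "A = {}")
  case True then show ?thesis by (intro exI[of _ "\<lambda>_. 0"]) auto
 next
  case False
  obtain D where D: "star_compact D" "A \<subseteq> D" "D \<subseteq> U" using star_compact_cover[OF U A False] by metis
  obtain \<nu> \<kappa> T where \<nu>: "\<nu> > 1 / \<rho>" and T: "\<And>p. p \<in> D \<Longrightarrow> norm p \<le> T" "T * \<kappa> \<le> \<rho> / 4"
   and Yb: "\<And>i. supbd \<nu> D (\<lambda>p. Y p $ i) \<kappa>" using small D(1,3) unfolding small_on_def by blast
  define \<eta> where "\<eta> = 1 / (\<rho> * (\<nu> - 1 / \<rho>))"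
  interpret conv_bound "\<lambda>f. f holomorphic_on U" "supbd \<nu> D" T \<eta> \<rho> K gc
   unfolding \<eta>_def by (rule sup_conv_bound[OF U D(1,3) T(1) \<nu>])
  have \<kappa>: "\<kappa> \<ge> 0" using Yb by (auto simp: supbd_def)
  have \<nu>0: "\<nu> > 0" using \<nu> \<rho> by (meson divide_pos_pos order_less_trans zero_less_one)
  have x0: "T * \<kappa> \<ge> 0" using \<kappa> \<tau> by simp
  \<comment> \<open>\<open>B1\<close> is for \<open>l = m\<close>, where the convolution power is
    \<open>\<delta>\<close>; \<open>B2\<close> is for all other \<open>l\<close>.\<close>
  define B1 where "B1 = 2 ^ msize m / \<rho> ^ Suc (msize m) * exp (T / \<rho>)"
  define B2 where "B2 = 2 ^ Suc (msize m) * (1 + \<eta>) * \<kappa> / \<rho> ^ Suc (msize m) * exp (\<nu> * T)"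
  have B: "B1 \<ge> 0" "B2 \<ge> 0" using \<rho> \<eta> \<kappa> by (auto simp: B1_def B2_def)
  have main: "norm (snd (F l) p) \<le> wt K \<rho> l * (B1 + B2)" if l: "m \<le> l" and p: "p \<in> D" for l p
  proof -
   define n where "n = msize (\<lambda>j. l j - m j)"
   have nl: "msize l = n + msize m" using msize_diff[OF l] by (simp add: n_def)
   have kl: "wt K \<rho> l \<ge> 0" using K0 \<rho> by simp
   have mb: "norm (of_nat (mbinom l m) :: complex) \<le> 2 ^ msize l"
    using mbinom_le[of l m] by (metis norm_of_nat of_nat_le_iff of_nat_numeral of_nat_power)
   have nF: "norm (snd (F l) p) \<le> 2 ^ msize l * norm (snd (t l) p)"
    unfolding F_def snd_conv norm_mult by (rule mult_right_mono[OF mb]) simp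
   show ?thesis
   proof (cases "n = 0")
    case True
    then have "snd (t l) p = Gl gc l i p" unfolding t_def by (subst conv_pow_msize_0) (auto simp: n_def dconv_def)
    then have "norm (snd (t l) p) \<le> K l / \<rho> * exp (norm p / \<rho>)"
     using Gl_props(2)[OF \<rho>, of gc l i "K l" p] gcK by simp
    also have "\<dots> \<le> K l / \<rho> * exp (T / \<rho>)"
     using T(1)[OF p] K0 \<rho> by (intro mult_left_mono) (auto simp: divide_right_mono)
    finally have "2 ^ msize l * norm (snd (t l) p) \<le> 2 ^ msize l * (K l / \<rho> * exp (T / \<rho>))"
     by (rule mult_left_mono) simp
    also have "\<dots> = wt K \<rho> l * B1" using nl True \<rho> by (simp add: B1_def)
    also have "\<dots> \<le> wt K \<rho> l * (B1 + B2)" using B kl by (intro mult_left_mono) auto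
    finally show ?thesis using nF by linarith
   next
    case False
    then have n1: "msize (\<lambda>j. l j - m j) \<ge> 1" by (simp add: n_def)
    note P = conv_pow_bounds[OF n1 hol Yb]
    have "norm (snd (t l) p) \<le> norm (gc 0 l $ i * snd (conv_pow Y (\<lambda>j. l j - m j)) p) + norm (conv (Gl gc l i) (snd (conv_pow Y (\<lambda>j. l j - m j))) p)"
     unfolding t_def dconv_def using fst_conv_pow[OF n1] by (simp add: norm_triangle_ineq)
    also have "norm (gc 0 l $ i * snd (conv_pow Y (\<lambda>j. l j - m j)) p) \<le> K l * (\<kappa> * (T * \<kappa>) ^ (n - 1)) * exp (\<nu> * norm p)"
     using bd_scale_mono[OF P(2) gc0] p unfolding supbd_def n_def by blast
    also have "norm (conv (Gl gc l i) (snd (conv_pow Y (\<lambda>j. l j - m j))) p) \<le> K l * \<eta> * (\<kappa> * (T * \<kappa>) ^ (n - 1)) * exp (\<nu> * norm p)"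
     using bd_kernel[OF P] p unfolding supbd_def n_def by blast
    finally have "norm (snd (t l) p) \<le> K l * (1 + \<eta>) * \<kappa> * ((T * \<kappa>) ^ (n - 1) * exp (\<nu> * norm p))"
     by (simp add: algebra_simps)
    also have "\<dots> \<le> K l * (1 + \<eta>) * \<kappa> * ((\<rho> / 4) ^ (n - 1) * exp (\<nu> * T))"
     using K0 \<eta> \<kappa> \<rho> T(1)[OF p] T(2) x0 \<nu>0 by (intro mult_left_mono mult_mono power_mono) auto
    finally have "2 ^ msize l * norm (snd (t l) p) \<le> 2 ^ msize l * (K l * (1 + \<eta>) * \<kappa> * ((\<rho> / 4) ^ (n - 1) * exp (\<nu> * T)))"
     by (rule mult_left_mono) simp
    also have "\<dots> = K l * (1 + \<eta>) * \<kappa> * exp (\<nu> * T) * 2 ^ Suc (msize m) * (2 ^ (n - 1) * (\<rho> / 4) ^ (n - 1))"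
     using nl False by (cases n) (simp_all add: power_add)
    also have "2 ^ (n - 1) * (\<rho> / 4) ^ (n - 1) = (\<rho> / 2) ^ (n - 1)" by (simp flip: power_mult_distrib)
    also have "K l * (1 + \<eta>) * \<kappa> * exp (\<nu> * T) * 2 ^ Suc (msize m) * (\<rho> / 2) ^ (n - 1) \<le> K l * (1 + \<eta>) * \<kappa> * exp (\<nu> * T) * 2 ^ Suc (msize m) * \<rho> ^ (n - 1)"
     using K0 \<eta> \<kappa> \<rho> by (intro mult_left_mono power_mono) auto
    also have "\<dots> = wt K \<rho> l * B2" using nl False \<rho> by (cases n) (simp_all add: B2_def power_add)
    also have "\<dots> \<le> wt K \<rho> l * (B1 + B2)" using B kl by (intro mult_left_mono) auto
    finally show ?thesis using nF by linarith
   qed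
  qed
  have "(\<lambda>l. wt K \<rho> l * (B1 + B2)) summable_on {l. m \<le> l}" by (rule weight_summable)
  then show ?thesis using main D(2) by (intro exI[of _ "\<lambda>l. wt K \<rho> l * (B1 + B2)"]) blast
 qed
 have "dcoef gc Y m i = (\<Sum>\<^sub>\<infinity>l\<in>{l. m \<le> l}. fst (F l), \<lambda>p. \<Sum>\<^sub>\<infinity>l\<in>{l. m \<le> l}. snd (F l) p)"
  by (simp add: dcoef_def Let_def F_def t_def)
 then show ?thesis unfolding dfps_def using HD_infsum[OF U, of "{l. m \<le> l}" F, OF F bd] by simp
qed

text \<open>For \<open>|l| = 1\<close> the coefficients of \<open>g\<close> of order 0 and 1 vanish;
  for larger \<open>l\<close> a factor of order 2 from \<open>w\<close> remains. So the kernels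
  \<open>d_j\<close> have no delta part and vanish at \<open>p = 0\<close>, which permits division
  by \<open>p\<close>.\<close>

lemma dfps_munit_low: assumes w: "\<And>j. fps_nth (w j) 0 = 0" "\<And>j. fps_nth (w j) 1 = 0" and N: "N < 2"
 shows "fps_nth (dfps gc w (munit j) i) N = 0" unfolding dfps_def fps_nth_Abs_fps
proof (rule infsum_0)
 fix l :: "'n \<Rightarrow> nat" assume "l \<in> {l. munit j \<le> l}"
 then have l: "msize (\<lambda>i. l i - munit j i) + 1 = msize l" using msize_diff[of "munit j" l] msize_munit[of j] by simp
 let ?Q = "\<Prod>ja\<in>UNIV. w ja ^ (l ja - munit j ja)"
 have "fps_X ^ 2 dvd Gfps gc l i * ?Q"
 proof (cases "msize l = 1")
  case True
  then have "fps_X ^ 2 dvd Gfps gc l i"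
   unfolding fps_X_power_dvd_iff using gc_1[OF True] by (auto simp: Gfps_def less_2_cases_iff)
  then show ?thesis by (rule dvd_mult2)
 next
  case False
  then have "msize (\<lambda>i. l i - munit j i) \<noteq> 0" using l by auto
  then obtain a where a: "l a - munit j a \<noteq> 0" by (auto simp: msize_def)
  have "fps_X ^ 2 dvd w a" unfolding fps_X_power_dvd_iff using w[of a] by (auto simp: less_2_cases_iff)
  also have "w a dvd w a ^ (l a - munit j a)" using a by (intro dvd_power) auto
  also have "\<dots> dvd ?Q" by (rule dvd_prodI) auto
  finally show ?thesis by (rule dvd_mult)
 qed
 then have "fps_nth (Gfps gc l i * ?Q) N = 0" using N unfolding fps_X_power_dvd_iff by blast
 then show "fps_nth (fps_const (of_nat (mbinom l (munit j))) * (Gfps gc l i * ?Q)) N = 0" by simp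
qed

text \<open>The domains decrease because level \<open>k\<close> uses all lower ones. The exception
  is the zero at \<open>p = 0\<close>, which a domain containing 0 cannot avoid.\<close>

definition star_levels :: "(nat \<Rightarrow> complex set) \<Rightarrow> bool"
 where "star_levels U \<longleftrightarrow> (\<forall>k. star_open (U k)) \<and> (\<forall>k. U (Suc k) \<subseteq> U k) \<and> (\<forall>p\<in>U 0. \<forall>i. p \<noteq> lam $ i) \<and>
  (\<forall>k\<ge>1. \<forall>i. (\<forall>p\<in>U k. p \<noteq> lam $ i - of_nat k) \<or> i = ix1 \<and> k = 1)"

abbreviation hier_eq :: "(nat \<Rightarrow> complex \<Rightarrow> 'n cvec) \<Rightarrow> nat \<Rightarrow> complex \<Rightarrow> 'n \<Rightarrow> bool"
 where "hier_eq Y k p i \<equiv> (lam $ i - p - of_nat k) * Y k p $ i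
    + b $ i * seg_int (\<lambda>s. Y k s $ i) p
    - (\<Sum>j\<in>UNIV. conv (\<lambda>s. Y k s $ j) (snd (dcoef gc (Y 0) (munit j) i)) p) =
   (\<Sum>\<^sub>\<infinity>l\<in>{l. msize l > 1}.
     snd (dconv (dcoef gc (Y 0) l i)
      (0, \<lambda>q. \<Sum>m\<in>compositions l k. snd (conv_prod l (\<lambda>i' j s. Y (m i' j) s $ i')) q)) p)"

lemma star_levels_mono: "star_levels U \<Longrightarrow> j \<le> k \<Longrightarrow> U k \<subseteq> U j"
 by (rule lift_Suc_antimono_le[of U]) (auto simp: star_levels_def)

text \<open>The prefactor \<open>x^(-k \<beta>)\<close> is absent here, so every level is a delta
  plus an analytic function, and the products over lower levels stay in the same ring.\<close>

lemma RR_levels: assumes U: "star_levels U" and y: "transseries lam b fc gc y" shows "RR (U k) (fps_nth (y i) k)"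
proof (induction k arbitrary: i rule: less_induct)
 case (less k)
 have sU: "star_open (U k)" for k using U by (simp add: star_levels_def)
 obtain Y0 where Y0: "\<And>i. HD (U 0) (0, \<lambda>p. Y0 p $ i) (fps_nth (y i) 0)" "small_on (U 0) Y0"
 proof (rule conv_eq_solution[OF sU _ y, of 0])
  show "p \<in> U 0 \<Longrightarrow> p \<noteq> lam $ i" for p i using U by (auto simp: star_levels_def)
 qed blast
 have low: "fps_nth (fps_nth (y j) 0) 0 = 0" "fps_nth (fps_nth (y j) 0) 1 = 0" for j using y by (auto simp: transseries_def)
 show ?case
 proof (cases "k = 0")
  case True then show ?thesis using Y0(1) unfolding RR_def by blast
 next
  case False
  then have k: "k \<ge> 1" by simp
  have d: "RR (U k) (dfps gc (\<lambda>j. fps_nth (y j) 0) m i)" for m i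
   using dcoef_HD[OF sU Y0] RR_subset[OF _ star_levels_mono[OF U, of 0 k]] unfolding RR_def by blast
  have W: "RR (U k) (Wk y m k)" if "2 \<le> msize m" for m unfolding Wk_compositions
  proof (intro RR_sum RR_prod sU)
   fix c i j assume c: "c \<in> compositions m k" "j \<in> {1..m i}"
   have "c i j < k" using compositions_part(2)[OF c(1) _ c(2)] that by simp
   then show "RR (U k) (fps_nth (y i) (c i j))" using less RR_subset star_levels_mono[OF U, of "c i j" k] by (meson less_imp_le)
  qed
  show ?thesis
  proof (rule formal_linear_RR[OF sU, where \<mu> = "\<lambda>i. lam $ i - of_nat k" and B = "\<lambda>i. b $ i - of_nat k * b $ ix1"
     and D = "\<lambda>i j. dfps gc (\<lambda>j. fps_nth (y j) 0) (munit j) i" and w = "\<lambda>i. fps_nth (y i) k"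
     and H = "\<lambda>i. \<Sum>m\<in>{m. 2 \<le> msize m \<and> msize m \<le> k}. dfps gc (\<lambda>j. fps_nth (y j) 0) m i * Wk y m k"])
   show "RR (U k) (dfps gc (\<lambda>j. fps_nth (y j) 0) (munit j) i)" for i j by (rule d)
   show "fps_nth (dfps gc (\<lambda>j. fps_nth (y j) 0) (munit j) i) 0 = 0"
    "fps_nth (dfps gc (\<lambda>j. fps_nth (y j) 0) (munit j) i) 1 = 0" for i j by (rule dfps_munit_low[OF low]; simp)+
   show "RR (U k) (\<Sum>m\<in>{m. 2 \<le> msize m \<and> msize m \<le> k}. dfps gc (\<lambda>j. fps_nth (y j) 0) m i * Wk y m k)" for i
    by (intro RR_sum RR_mult sU d W) auto
   show "(\<forall>p\<in>U k. p \<noteq> lam $ i - of_nat k) \<or> lam $ i - of_nat k = 0 \<and> b $ i - of_nat k * b $ ix1 = 0" for i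
    using U k lam_1 unfolding star_levels_def by fastforce
  qed (rule formal_hierarchy[OF y k])
 qed
qed

text \<open>Over a composition the exponents \<open>c i j * \<beta>\<close> add up to
  \<open>k * \<beta>\<close>. There are no compositions with \<open>|l| > k\<close>, so the sum over
  \<open>l\<close> is finite.\<close>

lemma hierarchy_rhs_RB: assumes U: "star_open U" and k: "k \<ge> 1"
  and Y: "\<And>k' i. 1 \<le> k' \<Longrightarrow> k' < k \<Longrightarrow> RB th U (of_nat k' * b $ ix1) (fps_nth (y i) k') (\<lambda>p. Y k' p $ i)"
  and d: "\<And>m. HD U (dcoef gc (Y 0) m i) (dfps gc w m i)"
 shows "RB th U (of_nat k * b $ ix1) (\<Sum>m\<in>{m. 2 \<le> msize m \<and> msize m \<le> k}. dfps gc w m i * Wk y m k)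
  (\<lambda>p. \<Sum>\<^sub>\<infinity>l\<in>{l. msize l > 1}. snd (dconv (dcoef gc (Y 0) l i)
    (0, \<lambda>q. \<Sum>m\<in>compositions l k. snd (conv_prod l (\<lambda>i' j s. Y (m i' j) s $ i')) q)) p)"
proof -
 let ?\<beta> = "b $ ix1"
 define S where "S l = (\<lambda>q. \<Sum>m\<in>compositions l k. snd (conv_prod l (\<lambda>i' j s. Y (m i' j) s $ i')) q)" for l
 have Re: "Re (of_nat n * ?\<beta>) > 0" if "n \<ge> 1" for n using beta that by simp
 have P: "RB th U (of_nat k * ?\<beta>) (\<Prod>i\<in>UNIV. \<Prod>j\<in>{1..l i}. fps_nth (y i) (c i j)) (snd (conv_prod l (\<lambda>i' j s. Y (c i' j) s $ i')))"
  if l: "msize l > 1" and c: "c \<in> compositions l k" for l c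
 proof -
  have ne: "idx l \<noteq> []" using l idx_nonempty[of l] by auto
  have "RB th U (sum_list (map (\<lambda>(i, j). of_nat (c i j) * ?\<beta>) (idx l))) (prod_list (map (\<lambda>(i, j). fps_nth (y i) (c i j)) (idx l)))
    (cprod (\<lambda>x. case x of (i, j) \<Rightarrow> (\<lambda>s. Y (c i j) s $ i)) (idx l))"
  proof (rule conjunct1[OF conjunct2[OF RB_foldr[OF U ne]]])
   fix x assume "x \<in> set (idx l)"
   then obtain i j where x: "x = (i, j)" "j \<in> {1..l i}" by (auto simp: set_idx)
   have "1 \<le> c i j" "c i j < k" using compositions_part[OF c l x(2)] by auto
   then show "RB th U (case x of (i, j) \<Rightarrow> of_nat (c i j) * ?\<beta>) (case x of (i, j) \<Rightarrow> fps_nth (y i) (c i j)) (case x of (i, j) \<Rightarrow> (\<lambda>s. Y (c i j) s $ i))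
     \<and> 0 < Re (case x of (i, j) \<Rightarrow> of_nat (c i j) * ?\<beta>)" using x Y Re by auto
  qed
  moreover have "sum_list (map (\<lambda>(i, j). of_nat (c i j) * ?\<beta>) (idx l)) = of_nat k * ?\<beta>"
  proof -
   have "(\<Sum>i\<in>UNIV. \<Sum>j\<in>{1..l i}. of_nat (c i j) * ?\<beta>) = of_nat (\<Sum>i\<in>UNIV. \<Sum>j\<in>{1..l i}. c i j) * ?\<beta>"
    by (simp add: sum_distrib_right)
   also have "(\<Sum>i\<in>UNIV. \<Sum>j\<in>{1..l i}. c i j) = k" using c by (simp add: compositions_def)
   finally show ?thesis unfolding sum_list_idx .
  qed
  ultimately show ?thesis unfolding prod_list_idx conv_prod_cprod by (simp add: case_prod_unfold)
 qed
 have S: "RB th U (of_nat k * ?\<beta>) (Wk y l k) (S l)" if "msize l > 1" for l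
  unfolding S_def Wk_compositions by (intro RB_sum finite_compositions P that)
 have T: "RB th U (of_nat k * ?\<beta>) (dfps gc w l i * Wk y l k) (snd (dconv (dcoef gc (Y 0) l i) (0, S l)))" if "msize l > 1" for l
  by (rule RB_dconv[OF U d S[OF that] Re[OF k]])
 have fin: "finite {m :: 'n \<Rightarrow> nat. 2 \<le> msize m \<and> msize m \<le> k}"
  by (rule finite_subset[OF _ finite_msize_le[of k]]) auto
 have "RB th U (of_nat k * ?\<beta>) (\<Sum>m\<in>{m. 2 \<le> msize m \<and> msize m \<le> k}. dfps gc w m i * Wk y m k)
   (\<lambda>p. \<Sum>m\<in>{m. 2 \<le> msize m \<and> msize m \<le> k}. snd (dconv (dcoef gc (Y 0) m i) (0, S m)) p)"
  by (rule RB_sum[OF fin]) (auto intro: T)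
 moreover have "(\<Sum>\<^sub>\<infinity>l\<in>{l. msize l > 1}. snd (dconv (dcoef gc (Y 0) l i) (0, S l)) p)
   = (\<Sum>m\<in>{m. 2 \<le> msize m \<and> msize m \<le> k}. snd (dconv (dcoef gc (Y 0) m i) (0, S m)) p)" for p
 proof (rule infsum_finite_support[OF fin])
  fix l :: "'n \<Rightarrow> nat" assume "l \<in> {l. 1 < msize l} - {m. 2 \<le> msize m \<and> msize m \<le> k}"
  then have "compositions l k = {}" using compositions_msize[of _ l k] by auto
  then have "S l = (\<lambda>q. 0)" by (simp add: S_def)
  then show "snd (dconv (dcoef gc (Y 0) l i) (0, S l)) p = 0" by (simp add: dconv_def)
 qed auto
 ultimately show ?thesis by (simp add: S_def)
qed

lemma hierarchy_solution: assumes U: "star_levels U" and y: "transseries lam b fc gc y" and ray: "\<And>k. ray th \<subseteq> U k"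
 obtains Y where "\<And>i. HD (U 0) (0, \<lambda>p. Y 0 p $ i) (fps_nth (y i) 0)" "small_on (U 0) (Y 0)"
  "\<And>p i. p \<in> U 0 \<Longrightarrow> conv_eq_at (Y 0) p i"
  "\<And>k i. k \<ge> 1 \<Longrightarrow> RB th (U k) (of_nat k * b $ ix1) (fps_nth (y i) k) (\<lambda>p. Y k p $ i)"
  "\<And>k i p. k \<ge> 1 \<Longrightarrow> p \<in> ray th - {0} \<Longrightarrow> hier_eq Y k p i"
proof -
 have sU: "star_open (U k)" for k using U by (simp add: star_levels_def)
 obtain Y0 where Y0: "\<And>i. HD (U 0) (0, \<lambda>p. Y0 p $ i) (fps_nth (y i) 0)" "small_on (U 0) Y0"
  "\<And>p i. p \<in> U 0 \<Longrightarrow> conv_eq_at Y0 p i"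
 proof (rule conv_eq_solution[OF sU _ y, of 0])
  show "p \<in> U 0 \<Longrightarrow> p \<noteq> lam $ i" for p i using U by (auto simp: star_levels_def)
 qed blast
 let ?\<beta> = "b $ ix1"
 have Re: "Re (of_nat n * ?\<beta>) > 0" if "n \<ge> 1" for n using beta that by simp
 have exF: "\<exists>G. RB th (U k) (of_nat k * ?\<beta>) (fps_nth (y i) k) G" if k: "k \<ge> 1" for k i
 proof -
  obtain F where F: "HD (U k) F (fps_nth (y i) k)" using RR_levels[OF U y, of k i] unfolding RR_def by blast
  \<comment> \<open>Convolution with \<open>p^(k \<beta> - 1) / Gamma (k \<beta>)\<close>, the Borel
    transform of \<open>x^(-k \<beta>)\<close>, restores the prefactor of the series from
    \<open>RR_levels\<close>.\<close>
  have "RB th (U k) (of_nat k * ?\<beta>) 1 (\<lambda>p. ray_power th (of_nat k * ?\<beta> - 1) p * rGamma (of_nat k * ?\<beta>))"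
   unfolding RB_def
  proof (intro exI[of _ "\<lambda>_. rGamma (of_nat k * ?\<beta>)"] conjI)
   have "bor (of_nat k * ?\<beta>) 1 = fps_const (rGamma (of_nat k * ?\<beta>))" by (simp add: fps_eq_iff)
   then show "(\<lambda>_. rGamma (of_nat k * ?\<beta>)) has_fps_expansion bor (of_nat k * ?\<beta>) 1" by simp
  qed auto
  from RB_dconv[OF sU F this Re[OF k]] show ?thesis by auto
 qed
 define G where "G k i = (SOME G. RB th (U k) (of_nat k * ?\<beta>) (fps_nth (y i) k) G)" for k i
 have G: "RB th (U k) (of_nat k * ?\<beta>) (fps_nth (y i) k) (G k i)" if "k \<ge> 1" for k i
  using someI_ex[OF exF[OF that]] unfolding G_def .
 define Y where "Y k = (if k = 0 then Y0 else (\<lambda>p. \<chi> i. G k i p))" for k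
 have Y00: "Y 0 = Y0" by (simp add: Y_def)
 have YR: "RB th (U k) (of_nat k * ?\<beta>) (fps_nth (y i) k) (\<lambda>p. Y k p $ i)" if "k \<ge> 1" for k i
  using G[OF that, of i] that by (simp add: Y_def)
 show thesis
 proof (rule that[of Y])
  show "\<And>i. HD (U 0) (0, \<lambda>p. Y 0 p $ i) (fps_nth (y i) 0)" "small_on (U 0) (Y 0)"
   "\<And>p i. p \<in> U 0 \<Longrightarrow> conv_eq_at (Y 0) p i" unfolding Y00 by (fact Y0)+
  show "RB th (U k) (of_nat k * ?\<beta>) (fps_nth (y i) k) (\<lambda>p. Y k p $ i)" if "k \<ge> 1" for k i by (rule YR[OF that])
  fix k :: nat and i p assume k: "k \<ge> 1" and p: "p \<in> ray th - {0}"
  let ?w = "\<lambda>i. fps_nth (y i) k" and ?d = "\<lambda>m. dfps gc (\<lambda>j. fps_nth (y j) 0) m i" and ?s = "of_nat k * ?\<beta>"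
  have sub: "U k \<subseteq> U 0" using star_levels_mono[OF U, of 0 k] by simp
  have d: "HD (U k) (dcoef gc (Y 0) m i) (?d m)" for m unfolding Y00 by (rule HD_subset[OF dcoef_HD[OF sU Y0(1,2)] sub])
  have R: "RB th (U k) ?s (\<Sum>m\<in>{m. 2 \<le> msize m \<and> msize m \<le> k}. ?d m * Wk y m k)
   (\<lambda>p. \<Sum>\<^sub>\<infinity>l\<in>{l. msize l > 1}. snd (dconv (dcoef gc (Y 0) l i)
    (0, \<lambda>q. \<Sum>m\<in>compositions l k. snd (conv_prod l (\<lambda>i' j s. Y (m i' j) s $ i')) q)) p)"
  proof (rule hierarchy_rhs_RB[where Y = Y and U = "U k", OF sU k _ d])
   fix k' i assume "1 \<le> k'" "k' < k"
   then show "RB th (U k) (of_nat k' * ?\<beta>) (fps_nth (y i) k') (\<lambda>p. Y k' p $ i)"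
    by (intro RB_subset[OF YR star_levels_mono[OF U]]) auto
  qed
  have low: "fps_nth (fps_nth (y j) 0) 0 = 0" "fps_nth (fps_nth (y j) 0) 1 = 0" for j using y by (auto simp: transseries_def)
  have D: "RB th (U k) ?s (?d (munit j) * ?w j) (conv (\<lambda>s. Y k s $ j) (snd (dcoef gc (Y 0) (munit j) i)))" for j
  proof -
   \<comment> \<open>The delta part of \<open>d_j\<close> is 0, so only its function part appears,
     at the price of a factor \<open>\<xi>\<close>.\<close>
   have e: "?d (munit j) = fps_X * fps_shift 1 (?d (munit j))"
    using fps_const_X_shift[of "?d (munit j)"] dfps_munit_low[where w = "\<lambda>j. fps_nth (y j) 0" and N = 0 and j = j and i = i] low by simp
   have "?d (munit j) * ?w j = (fps_X * fps_shift 1 (?d (munit j))) * ?w j" by (rule arg_cong[OF e, of "\<lambda>a. a * ?w j"])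
   also have "\<dots> = fps_X * (?w j * fps_shift 1 (?d (munit j)))" by (simp only: mult_ac)
   finally have e2: "?d (munit j) * ?w j = fps_X * (?w j * fps_shift 1 (?d (munit j)))" .
   have "RB th (U k) ?s (fps_X * (?w j * fps_shift 1 (?d (munit j)))) (conv (\<lambda>s. Y k s $ j) (snd (dcoef gc (Y 0) (munit j) i)))"
    by (rule RB_shift, rule RB_conv[OF sU YR[OF k] RB_HD[OF d] Re[OF k]]) simp
   then show ?thesis unfolding e2 .
  qed
  have L: "RB th (U k) ?s ((fps_const (lam $ i - of_nat k) * ?w i - (fps_X^2 * fps_deriv (?w i) + fps_const ?s * fps_X * ?w i))
     + fps_const (b $ i) * (fps_X * ?w i) - (\<Sum>j\<in>UNIV. ?d (munit j) * ?w j))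
    (\<lambda>p. ((lam $ i - of_nat k) * Y k p $ i - p * Y k p $ i) + b $ i * seg_int (\<lambda>s. Y k s $ i) p
     - (\<Sum>j\<in>UNIV. conv (\<lambda>s. Y k s $ j) (snd (dcoef gc (Y 0) (munit j) i)) p))"
   by (intro RB_diff RB_add RB_cmult RB_mult_p RB_seg_int RB_sum YR[OF k] D sU Re[OF k]) simp
  \<comment> \<open>Multiplication by \<open>p\<close> contributes \<open>k \<beta> \<xi>\<close>,
    which turns \<open>b\<close> into \<open>b - k \<beta>\<close> as in the formal
    equation.\<close>
  have eqf: "(fps_const (lam $ i - of_nat k) * ?w i - (fps_X^2 * fps_deriv (?w i) + fps_const ?s * fps_X * ?w i))
     + fps_const (b $ i) * (fps_X * ?w i) - (\<Sum>j\<in>UNIV. ?d (munit j) * ?w j)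
    = (\<Sum>m\<in>{m. 2 \<le> msize m \<and> msize m \<le> k}. ?d m * Wk y m k)"
  proof -
   have "fps_const (b $ i - of_nat k * b $ ix1) = fps_const (b $ i) - fps_const ?s" by simp
   with formal_hierarchy[OF y k, of i] show ?thesis
    by (simp add: algebra_simps del: fps_const_sub fps_const_add fps_const_neg fps_const_mult)
  qed
  have "((lam $ i - of_nat k) * Y k p $ i - p * Y k p $ i) + b $ i * seg_int (\<lambda>s. Y k s $ i) p
     - (\<Sum>j\<in>UNIV. conv (\<lambda>s. Y k s $ j) (snd (dcoef gc (Y 0) (munit j) i)) p) =
   (\<Sum>\<^sub>\<infinity>l\<in>{l. msize l > 1}. snd (dconv (dcoef gc (Y 0) l i)
    (0, \<lambda>q. \<Sum>m\<in>compositions l k. snd (conv_prod l (\<lambda>i' j s. Y (m i' j) s $ i')) q)) p)"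
   by (rule RB_unique[OF sU ray L[unfolded eqf] R p])
  then show "hier_eq Y k p i" by (simp add: algebra_simps)
 qed
qed

end

abbreviation rp :: "real \<Rightarrow> real \<Rightarrow> complex" where "rp th t \<equiv> of_real t * cis th"

section \<open>Locally integrable functions on a ray\<close>

text \<open>A Borel representative, extended by 0 to the negative axis, of \<open>f\<close> on \<open>ray th\<close>.\<close>

definition ray_rep :: "real \<Rightarrow> (complex \<Rightarrow> complex) \<Rightarrow> (real \<Rightarrow> complex) \<Rightarrow> bool"
 where "ray_rep th f \<phi> \<longleftrightarrow> \<phi> \<in> borel_measurable borel \<and> (\<forall>t<0. \<phi> t = 0) \<and>
  (AE t in lebesgue. t \<ge> 0 \<longrightarrow> f (rp th t) = \<phi> t) \<and> (\<forall>T. set_integrable lborel {0..T} \<phi>)"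

lemma ray_repD: assumes "ray_rep th f \<phi>" shows "\<phi> \<in> borel_measurable borel" "t < 0 \<Longrightarrow> \<phi> t = 0"
  "AE t in lebesgue. t \<ge> 0 \<longrightarrow> f (rp th t) = \<phi> t" "set_integrable lborel {0..T} \<phi>"
 using assms by (auto simp: ray_rep_def)

lemma ray_rep_cong: "ray_rep th f \<phi> \<Longrightarrow> AE_ray th (\<lambda>p. f p = g p) \<Longrightarrow> ray_rep th g \<phi>"
 unfolding ray_rep_def AE_ray_def
proof (elim conjE, intro conjI)
 assume 1: "AE t in lebesgue. 0 \<le> t \<longrightarrow> f (rp th t) = \<phi> t"
  and 2: "AE t in lebesgue. 0 \<le> t \<longrightarrow> f (rp th t) = g (rp th t)"
 show "AE t in lebesgue. 0 \<le> t \<longrightarrow> g (rp th t) = \<phi> t" using 1 2 by eventually_elim auto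
qed

lemma completion_ex_borel_measurable_complex: fixes g :: "real \<Rightarrow> complex" assumes "g \<in> borel_measurable lebesgue"
 obtains g' where "g' \<in> borel_measurable borel" "AE x in lebesgue. g x = g' x"
proof -
 have "(\<lambda>x. Re (g x)) \<in> borel_measurable lebesgue" "(\<lambda>x. Im (g x)) \<in> borel_measurable lebesgue"
  using assms by (simp_all add: borel_measurable_complex_iff)
 from this[THEN completion_ex_borel_measurable_real] obtain a b where
  ab: "a \<in> borel_measurable lborel" "AE x in lborel. Re (g x) = a x" "b \<in> borel_measurable lborel" "AE x in lborel. Im (g x) = b x"
  by blast
 have "AE x in lborel. g x = Complex (a x) (b x)" using ab(2,4) by eventually_elim (simp add: complex_eq_iff)
 moreover have "(\<lambda>x. Complex (a x) (b x)) \<in> borel_measurable borel" using ab by (simp add: borel_measurable_complex_iff)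
 ultimately show thesis using that[of "\<lambda>x. Complex (a x) (b x)"] by (simp add: AE_completion_iff)
qed

lemma ray_rep_exists: assumes f: "\<And>T. set_integrable lebesgue {0..T} (\<lambda>t. f (rp th t))"
 obtains \<phi> where "ray_rep th f \<phi>"
proof -
 let ?f = "\<lambda>t. f (rp th t)"
 have "(\<lambda>t. indicat_real {0..} t *\<^sub>R ?f t) \<in> borel_measurable lebesgue"
 proof (rule borel_measurable_LIMSEQ_metric)
  show "(\<lambda>t. indicat_real {0..real n} t *\<^sub>R ?f t) \<in> borel_measurable lebesgue" for n
   using f[of "real n"] unfolding set_integrable_def by (rule borel_measurable_integrable)
  fix t :: real
  obtain N where N: "t \<le> real N" using real_arch_simple by blast
  have "eventually (\<lambda>n. indicat_real {0..real n} t *\<^sub>R ?f t = indicat_real {0..} t *\<^sub>R ?f t) sequentially"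
   using eventually_ge_at_top[of N] by eventually_elim (use N in \<open>auto simp: indicator_def\<close>)
  then show "(\<lambda>n. indicat_real {0..real n} t *\<^sub>R ?f t) \<longlonglongrightarrow> indicat_real {0..} t *\<^sub>R ?f t"
   by (rule tendsto_eventually)
 qed
 then obtain g where g: "g \<in> borel_measurable borel" "AE t in lebesgue. indicat_real {0..} t *\<^sub>R ?f t = g t"
  by (rule completion_ex_borel_measurable_complex)
 define \<phi> where "\<phi> t = indicat_real {0..} t *\<^sub>R g t" for t
 have m: "\<phi> \<in> borel_measurable borel" unfolding \<phi>_def using g(1) by measurable
 have ae: "AE t in lebesgue. t \<ge> 0 \<longrightarrow> ?f t = \<phi> t" using g(2) by eventually_elim (auto simp: \<phi>_def)
 have "set_integrable lborel {0..T} \<phi>" for T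
 proof -
  have "integrable lebesgue (\<lambda>t. indicat_real {0..T} t *\<^sub>R \<phi> t)"
  proof (rule iffD1[OF integrable_cong_AE f[of T, unfolded set_integrable_def]])
   show "(\<lambda>t. indicat_real {0..T} t *\<^sub>R ?f t) \<in> borel_measurable lebesgue"
    using f[of T] unfolding set_integrable_def by (rule borel_measurable_integrable)
   show "(\<lambda>t. indicat_real {0..T} t *\<^sub>R \<phi> t) \<in> borel_measurable lebesgue"
    using m by (intro borel_imp_lebesgue_measurable) measurable
   show "AE t in lebesgue. indicat_real {0..T} t *\<^sub>R ?f t = indicat_real {0..T} t *\<^sub>R \<phi> t"
    using ae by eventually_elim (auto simp: indicator_def)
  qed
  then show ?thesis unfolding set_integrable_def using m by (subst (asm) integrable_completion) auto
 qed
 then show thesis using m ae that[of \<phi>] by (auto simp: ray_rep_def \<phi>_def)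
qed

lemma ray_rep_integrable: assumes "ray_rep th f \<phi>" shows "set_integrable lebesgue {0..T} (\<lambda>t. f (rp th t))"
proof -
 note r = ray_repD[OF assms]
 have i: "integrable lebesgue (\<lambda>t. indicat_real {0..T} t *\<^sub>R \<phi> t)"
  using r(4)[of T] r(1) unfolding set_integrable_def by (subst integrable_completion) auto
 have ae: "AE t in lebesgue. indicat_real {0..T} t *\<^sub>R \<phi> t = indicat_real {0..T} t *\<^sub>R f (rp th t)"
  using r(3) by eventually_elim (auto simp: indicator_def)
 have "(\<lambda>t. indicat_real {0..T} t *\<^sub>R f (rp th t)) \<in> borel_measurable lebesgue"
  using borel_measurable_AE[OF borel_measurable_integrable[OF i] ae] .
 then show ?thesis unfolding set_integrable_def using iffD1[OF integrable_cong_AE i] ae borel_measurable_integrable[OF i] by blast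
qed

section \<open>Convolution of locally integrable functions on the half-line\<close>

lemma AE_lebesgue_reflect: assumes "AE x in lebesgue. P (x :: real)" shows "AE s in lebesgue. P (t - s)"
proof -
 have "AE x in lborel. P x" using assms by (simp add: AE_completion_iff)
 then obtain N where N: "N \<in> null_sets lborel" "{x \<in> space lborel. \<not> P x} \<subseteq> N"
  unfolding eventually_ae_filter by blast
 have "AE x in lborel. x \<notin> N" using N(1) by (rule AE_not_in)
 then have "AE s in lborel. t + (-1) * s \<notin> N" using N(1) by (intro AE_borel_affine) (auto simp: null_sets_def)
 then have "AE s in lborel. P (t - s)" by eventually_elim (use N(2) in auto)
 then show ?thesis by (rule AE_completion)
qed

text \<open>The integral may run over the whole line because representatives vanish for negative
  arguments, which confines \<open>s\<close> to \<open>[0, t]\<close>.\<close>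

definition rconv :: "(real \<Rightarrow> complex) \<Rightarrow> (real \<Rightarrow> complex) \<Rightarrow> real \<Rightarrow> complex"
 where "rconv \<phi> \<psi> t = (LINT s|lborel. \<phi> s * \<psi> (t - s))"

lemma conv_on_ray: assumes t: "t > 0" shows "conv f g (rp th t) = cis th *
  (LINT s|lebesgue. indicat_real {0..t} s *\<^sub>R (f (rp th s) * g (rp th (t - s))))"
proof -
 define h where "h s = indicat_real {0..t} s *\<^sub>R (f (rp th s) * g (rp th (t - s)))" for s
 have "(LINT u:{0..1}|lebesgue. f (of_real u * (rp th t)) * g (of_real t * cis th - of_real u * (rp th t)))
   = (LINT u|lebesgue. h (0 + t * u))" unfolding set_lebesgue_integral_def h_def
 proof (intro Bochner_Integration.integral_cong refl)
  fix u :: real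
  have 1: "of_real u * (rp th t) = of_real (t * u) * cis th"
   "of_real t * cis th - of_real u * (rp th t) = of_real (t - t * u) * cis th" by (simp_all add: algebra_simps)
  have 2: "indicat_real {0..1} u = indicat_real {0..t} (t * u)" using t by (auto simp: indicator_def zero_le_mult_iff)
  show "indicat_real {0..1} u *\<^sub>R (f (of_real u * (rp th t)) * g (of_real t * cis th - of_real u * (rp th t)))
    = indicat_real {0..t} (0 + t * u) *\<^sub>R (f (rp th (0 + t * u)) * g (of_real (t - (0 + t * u)) * cis th))"
   unfolding 1(2) unfolding 1(1) 2 by (simp only: add_0)
 qed
 moreover have "(LINT s|lebesgue. h s) = \<bar>t\<bar> *\<^sub>R (LINT u|lebesgue. h (0 + t * u))"
  using t by (intro lebesgue_integral_real_affine) auto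
 ultimately show ?thesis using t unfolding h_def[symmetric] by (simp add: conv_def seg_int_def scaleR_conv_of_real)
qed

text \<open>Almost everywhere equality of the factors suffices at every single point of the ray,
  since the reflection of \<open>s\<close> into \<open>t - s\<close> preserves null sets.\<close>

lemma conv_cong_ray:
 assumes f: "AE_ray th (\<lambda>p. f p = f' p)" and g: "AE_ray th (\<lambda>p. g p = g' p)" and p: "p \<in> ray th"
 shows "conv f g p = conv f' g' p"
proof -
 obtain t where t: "t \<ge> 0" "p = of_real t * cis th" using p by (auto simp: ray_def)
 show ?thesis
 proof (cases "t = 0")
  case False
  have "(LINT s|lebesgue. indicat_real {0..t} s *\<^sub>R (f (rp th s) * g (rp th (t - s))))
   = (LINT s|lebesgue. indicat_real {0..t} s *\<^sub>R (f' (rp th s) * g' (rp th (t - s))))"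
  proof (rule LINT_cong_AE_lebesgue)
   show "AE s in lebesgue. indicat_real {0..t} s *\<^sub>R (f (rp th s) * g (rp th (t - s)))
    = indicat_real {0..t} s *\<^sub>R (f' (rp th s) * g' (rp th (t - s)))"
    using f[unfolded AE_ray_def] AE_lebesgue_reflect[OF g[unfolded AE_ray_def], of t]
    by eventually_elim (auto simp: indicator_def)
  qed
  then show ?thesis using conv_on_ray[of t f g th] conv_on_ray[of t f' g' th] t False by simp
 qed (use t in simp)
qed

lemma seg_int_cong_ray: assumes "AE_ray th (\<lambda>p. f p = f' p)" and "p \<in> ray th" shows "seg_int f p = seg_int f' p"
 unfolding seg_int_eq_conv by (rule conv_cong_ray[OF assms(1) _ assms(2)]) (simp add: AE_ray_def)

lemma conv_eq_rconv: assumes f: "ray_rep th f \<phi>" and g: "ray_rep th g \<psi>" and t: "t > 0"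
 shows "conv f g (rp th t) = cis th * rconv \<phi> \<psi> t"
proof -
 note F = ray_repD[OF f] and G = ray_repD[OF g]
 have "(LINT s|lebesgue. indicat_real {0..t} s *\<^sub>R (f (rp th s) * g (rp th (t - s))))
   = (LINT s|lebesgue. \<phi> s * \<psi> (t - s))"
 proof (rule LINT_cong_AE_lebesgue)
  show "AE s in lebesgue. indicat_real {0..t} s *\<^sub>R (f (rp th s) * g (rp th (t - s))) = \<phi> s * \<psi> (t - s)"
   using F(3) AE_lebesgue_reflect[OF G(3), of t]
  proof eventually_elim
   case (elim s)
   consider "s < 0" | "s > t" | "0 \<le> s" "s \<le> t" by linarith
   then show ?case using elim F(2)[of s] G(2)[of "t - s"] by cases auto
  qed
 qed
 also have "\<dots> = rconv \<phi> \<psi> t" unfolding rconv_def using F(1) G(1) by (intro integral_completion) simp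
 finally show ?thesis unfolding conv_on_ray[OF t] by simp
qed

section \<open>Weighted L1 norms\<close>

definition wnorm :: "real \<Rightarrow> real \<Rightarrow> (real \<Rightarrow> complex) \<Rightarrow> ennreal"
 where "wnorm T \<nu> \<phi> = (\<integral>\<^sup>+t. ennreal (indicat_real {0..T} t * exp (- \<nu> * t) * norm (\<phi> t)) \<partial>lborel)"

lemma wnorm_finite: assumes "set_integrable lborel {0..T} \<phi>" shows "wnorm T \<nu> \<phi> < \<infinity>"
proof -
 have "wnorm T \<nu> \<phi> \<le> (\<integral>\<^sup>+t. ennreal (exp (\<bar>\<nu>\<bar> * \<bar>T\<bar>)) * ennreal (norm (indicat_real {0..T} t *\<^sub>R \<phi> t)) \<partial>lborel)"
  unfolding wnorm_def
 proof (intro nn_integral_mono)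
  fix t
  have "exp (- \<nu> * t) \<le> exp (\<bar>\<nu>\<bar> * \<bar>T\<bar>)" if "t \<in> {0..T}"
  proof -
   have "- \<nu> * t \<le> \<bar>\<nu>\<bar> * t" using that by (intro mult_right_mono) auto
   also have "\<dots> \<le> \<bar>\<nu>\<bar> * \<bar>T\<bar>" using that by (intro mult_left_mono) auto
   finally show ?thesis by simp
  qed
  then show "ennreal (indicat_real {0..T} t * exp (- \<nu> * t) * norm (\<phi> t)) \<le> ennreal (exp (\<bar>\<nu>\<bar> * \<bar>T\<bar>)) * ennreal (norm (indicat_real {0..T} t *\<^sub>R \<phi> t))"
   by (auto simp: indicator_def ennreal_mult[symmetric] intro!: ennreal_leI mult_right_mono)
 qed
 also have "\<dots> = ennreal (exp (\<bar>\<nu>\<bar> * \<bar>T\<bar>)) * (\<integral>\<^sup>+t. ennreal (norm (indicat_real {0..T} t *\<^sub>R \<phi> t)) \<partial>lborel)"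
  by (rule nn_integral_cmult[OF measurable_compose[OF measurable_compose[OF
     borel_measurable_integrable[OF assms[unfolded set_integrable_def]] borel_measurable_norm] measurable_ennreal]])
 also have "\<dots> < \<infinity>"
  using assms unfolding set_integrable_def integrable_iff_bounded by (auto simp: ennreal_mult_less_top)
 finally show ?thesis .
qed

text \<open>Young's inequality through Tonelli. The weight splits as
  \<open>exp (- \<nu> s) exp (- \<nu> (t - s))\<close>, and \<open>0 \<le> s \<le> t \<le> T\<close>
  keeps both arguments in \<open>[0, T]\<close>. Absolute values stand inside, so finiteness also
  yields integrability of the convolution integrand for almost every \<open>t\<close>.\<close>

lemma wnorm_rconv_le: assumes [measurable]: "\<phi> \<in> borel_measurable borel" "\<psi> \<in> borel_measurable borel"
  and z: "\<And>t. t < 0 \<Longrightarrow> \<phi> t = 0" "\<And>t. t < 0 \<Longrightarrow> \<psi> t = 0"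
 shows "(\<integral>\<^sup>+t. ennreal (indicat_real {0..T} t * exp (- \<nu> * t)) * (\<integral>\<^sup>+s. ennreal (norm (\<phi> s * \<psi> (t - s))) \<partial>lborel) \<partial>lborel)
  \<le> wnorm T \<nu> \<phi> * wnorm T \<nu> \<psi>"
proof -
 define a where "a t = ennreal (indicat_real {0..T} t * exp (- \<nu> * t) * norm (\<phi> t))" for t
 define b where "b t = ennreal (indicat_real {0..T} t * exp (- \<nu> * t) * norm (\<psi> t))" for t
 have [measurable]: "a \<in> borel_measurable borel" "b \<in> borel_measurable borel" unfolding a_def b_def by measurable
 have "(\<integral>\<^sup>+t. ennreal (indicat_real {0..T} t * exp (- \<nu> * t)) * (\<integral>\<^sup>+s. ennreal (norm (\<phi> s * \<psi> (t - s))) \<partial>lborel) \<partial>lborel)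
   = (\<integral>\<^sup>+t. (\<integral>\<^sup>+s. ennreal (indicat_real {0..T} t * exp (- \<nu> * t)) * ennreal (norm (\<phi> s * \<psi> (t - s))) \<partial>lborel) \<partial>lborel)"
  by (intro nn_integral_cong nn_integral_cmult[symmetric]) measurable
 also have "\<dots> \<le> (\<integral>\<^sup>+t. (\<integral>\<^sup>+s. a s * b (t - s) \<partial>lborel) \<partial>lborel)"
 proof (intro nn_integral_mono)
  fix t s :: real
  consider "s < 0" | "t - s < 0" | "0 \<le> s" "s \<le> t" by linarith
  then show "ennreal (indicat_real {0..T} t * exp (- \<nu> * t)) * ennreal (norm (\<phi> s * \<psi> (t - s))) \<le> a s * b (t - s)"
  proof cases
   case 3
   have "exp (- \<nu> * t) = exp (- \<nu> * s) * exp (- \<nu> * (t - s))" by (simp add: algebra_simps flip: exp_add)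
   then show ?thesis using 3
    by (auto simp: a_def b_def indicator_def norm_mult ennreal_mult[symmetric] mult_ac intro!: ennreal_leI)
  qed (auto simp: z)
 qed
 also have "\<dots> = (\<integral>\<^sup>+s. (\<integral>\<^sup>+t. a s * b (t - s) \<partial>lborel) \<partial>lborel)"
  by (rule lborel_pair.Fubini') measurable
 also have "\<dots> = (\<integral>\<^sup>+s. a s * (\<integral>\<^sup>+t. b t \<partial>lborel) \<partial>lborel)"
 proof (intro nn_integral_cong)
  fix s :: real
  have "(\<integral>\<^sup>+t. b t \<partial>lborel) = (\<integral>\<^sup>+t. b (- s + 1 * t) \<partial>lborel)"
   by (subst nn_integral_real_affine[of b 1 "- s"]) auto
  then show "(\<integral>\<^sup>+t. a s * b (t - s) \<partial>lborel) = a s * (\<integral>\<^sup>+t. b t \<partial>lborel)"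
   by (subst nn_integral_cmult) auto
 qed
 also have "\<dots> = wnorm T \<nu> \<phi> * wnorm T \<nu> \<psi>"
  unfolding wnorm_def a_def[symmetric] b_def[symmetric] by (rule nn_integral_multc) simp
 finally show ?thesis .
qed

lemma rconv_measurable [measurable]:
 assumes [measurable]: "\<phi> \<in> borel_measurable borel" "\<psi> \<in> borel_measurable borel"
 shows "rconv \<phi> \<psi> \<in> borel_measurable borel" unfolding rconv_def[abs_def] by measurable

lemma rconv_AE_integrable: assumes f: "ray_rep th f \<phi>" and g: "ray_rep th g \<psi>"
 shows "AE t in lborel. integrable lborel (\<lambda>s. \<phi> s * \<psi> (t - s))"
proof -
 note F = ray_repD[OF f] and G = ray_repD[OF g]
 note [measurable] = F(1) G(1)
 have "AE t in lborel. \<forall>n::nat. ennreal (indicat_real {0..real n} t * exp (- 0 * t)) * (\<integral>\<^sup>+s. ennreal (norm (\<phi> s * \<psi> (t - s))) \<partial>lborel) \<noteq> \<infinity>"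
  unfolding AE_all_countable
 proof (intro allI nn_integral_PInf_AE)
  fix n :: nat
  have "(\<integral>\<^sup>+t. ennreal (indicat_real {0..real n} t * exp (- 0 * t)) * (\<integral>\<^sup>+s. ennreal (norm (\<phi> s * \<psi> (t - s))) \<partial>lborel) \<partial>lborel)
    \<le> wnorm (real n) 0 \<phi> * wnorm (real n) 0 \<psi>" by (rule wnorm_rconv_le[OF F(1) G(1) F(2) G(2)])
  also have "\<dots> < \<infinity>" using wnorm_finite[OF F(4)] wnorm_finite[OF G(4)] by (simp add: ennreal_mult_less_top)
  finally show "(\<integral>\<^sup>+t. ennreal (indicat_real {0..real n} t * exp (- 0 * t)) * (\<integral>\<^sup>+s. ennreal (norm (\<phi> s * \<psi> (t - s))) \<partial>lborel) \<partial>lborel) \<noteq> \<infinity>"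
   by simp
  show "(\<lambda>t. ennreal (indicat_real {0..real n} t * exp (- 0 * t)) * (\<integral>\<^sup>+s. ennreal (norm (\<phi> s * \<psi> (t - s))) \<partial>lborel)) \<in> borel_measurable lborel"
   by measurable
 qed
 then show ?thesis
 proof eventually_elim
  case (elim t)
  show ?case
  proof (cases "t < 0")
   case True
   have "(\<lambda>s. \<phi> s * \<psi> (t - s)) = (\<lambda>s. 0)"
   proof
    fix s show "\<phi> s * \<psi> (t - s) = 0" using True F(2)[of s] G(2)[of "t - s"] by (cases "s < 0") auto
   qed
   then show ?thesis by simp
  next
   case False
   obtain n where "t \<le> real n" using real_arch_simple by blast
   then have "(\<integral>\<^sup>+s. ennreal (norm (\<phi> s * \<psi> (t - s))) \<partial>lborel) < \<infinity>"
    using elim[rule_format, of n] False by (simp add: indicator_def top.not_eq_extremum)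
   then show ?thesis by (intro integrableI_bounded) measurable
  qed
 qed
qed

lemma norm_rconv_le: "ennreal (norm (rconv \<phi> \<psi> t)) \<le> (\<integral>\<^sup>+s. ennreal (norm (\<phi> s * \<psi> (t - s))) \<partial>lborel)"
 unfolding rconv_def by (cases "integrable lborel (\<lambda>s. \<phi> s * \<psi> (t - s))")
  (auto intro: integral_norm_bound_ennreal simp: not_integrable_integral_eq)

lemma ray_rep_conv: assumes f: "ray_rep th f \<phi>" and g: "ray_rep th g \<psi>"
 shows "ray_rep th (conv f g) (\<lambda>t. cis th * rconv \<phi> \<psi> t)" unfolding ray_rep_def
proof (intro conjI allI impI)
 note F = ray_repD[OF f] and G = ray_repD[OF g]
 note [measurable] = F(1) G(1)
 show "(\<lambda>t. cis th * rconv \<phi> \<psi> t) \<in> borel_measurable borel" by measurable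
 show "cis th * rconv \<phi> \<psi> t = 0" if "t < 0" for t
 proof -
  have "(\<lambda>s. \<phi> s * \<psi> (t - s)) = (\<lambda>s. 0)"
  proof
   fix s show "\<phi> s * \<psi> (t - s) = 0" using that F(2)[of s] G(2)[of "t - s"] by (cases "s < 0") auto
  qed
  then show ?thesis by (simp add: rconv_def)
 qed
 have "AE t in lebesgue. t \<noteq> (0::real)" by (simp add: AE_completion_iff AE_lborel_singleton)
 then show "AE t in lebesgue. 0 \<le> t \<longrightarrow> conv f g (rp th t) = cis th * rconv \<phi> \<psi> t"
  by eventually_elim (use conv_eq_rconv[OF f g] in auto)
 fix T
 show "set_integrable lborel {0..T} (\<lambda>t. cis th * rconv \<phi> \<psi> t)" unfolding set_integrable_def
 proof (rule integrableI_bounded)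
  show "(\<lambda>t. indicat_real {0..T} t *\<^sub>R (cis th * rconv \<phi> \<psi> t)) \<in> borel_measurable lborel" by measurable
  have "(\<integral>\<^sup>+t. ennreal (norm (indicat_real {0..T} t *\<^sub>R (cis th * rconv \<phi> \<psi> t))) \<partial>lborel)
   \<le> (\<integral>\<^sup>+t. ennreal (indicat_real {0..T} t * exp (- 0 * t)) * (\<integral>\<^sup>+s. ennreal (norm (\<phi> s * \<psi> (t - s))) \<partial>lborel) \<partial>lborel)"
   using norm_rconv_le[of \<phi> \<psi>] by (intro nn_integral_mono) (auto simp: indicator_def norm_mult)
  also have "\<dots> \<le> wnorm T 0 \<phi> * wnorm T 0 \<psi>" by (rule wnorm_rconv_le[OF F(1) G(1) F(2) G(2)])
  also have "\<dots> < \<infinity>" using wnorm_finite[OF F(4)] wnorm_finite[OF G(4)] by (simp add: ennreal_mult_less_top)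
  finally show "(\<integral>\<^sup>+t. ennreal (norm (indicat_real {0..T} t *\<^sub>R (cis th * rconv \<phi> \<psi> t))) \<partial>lborel) < \<infinity>" .
 qed
qed

lemma ray_rep_add: "ray_rep th f \<phi> \<Longrightarrow> ray_rep th g \<psi> \<Longrightarrow> ray_rep th (\<lambda>p. f p + g p) (\<lambda>t. \<phi> t + \<psi> t)"
 unfolding ray_rep_def
proof (elim conjE, intro conjI)
 assume 1: "AE t in lebesgue. 0 \<le> t \<longrightarrow> f (rp th t) = \<phi> t" "AE t in lebesgue. 0 \<le> t \<longrightarrow> g (rp th t) = \<psi> t"
 then show "AE t in lebesgue. 0 \<le> t \<longrightarrow> f (rp th t) + g (rp th t) = \<phi> t + \<psi> t" by eventually_elim auto
qed (auto intro: set_integral_add)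

lemma ray_rep_cmult: "ray_rep th f \<phi> \<Longrightarrow> ray_rep th (\<lambda>p. a * f p) (\<lambda>t. a * \<phi> t)"
 unfolding ray_rep_def by (auto intro: set_integrable_mult_right)

lemma ray_rep_diff: "ray_rep th f \<phi> \<Longrightarrow> ray_rep th g \<psi> \<Longrightarrow> ray_rep th (\<lambda>p. f p - g p) (\<lambda>t. \<phi> t - \<psi> t)"
 using ray_rep_add[of th f \<phi> "\<lambda>p. -1 * g p"] ray_rep_cmult[of th g \<psi> "-1"] by fastforce

lemma rconv_diff_AE: assumes f: "ray_rep th f \<phi>" "ray_rep th f' \<phi>'" and g: "ray_rep th g \<psi>" "ray_rep th g' \<psi>'"
 shows "AE t in lborel. rconv \<phi> \<psi> t - rconv \<phi>' \<psi>' t = rconv (\<lambda>t. \<phi> t - \<phi>' t) \<psi> t + rconv \<phi>' (\<lambda>t. \<psi> t - \<psi>' t) t"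
 using rconv_AE_integrable[OF f(1) g(1)] rconv_AE_integrable[OF f(2) g(1)] rconv_AE_integrable[OF f(2) g(2)]
 by eventually_elim (simp add: rconv_def left_diff_distrib right_diff_distrib)

lemma wnorm_rconv: assumes "\<phi> \<in> borel_measurable borel" "\<psi> \<in> borel_measurable borel"
  and z: "\<And>t. t < 0 \<Longrightarrow> \<phi> t = 0" "\<And>t. t < 0 \<Longrightarrow> \<psi> t = 0"
 shows "wnorm T \<nu> (rconv \<phi> \<psi>) \<le> wnorm T \<nu> \<phi> * wnorm T \<nu> \<psi>"
proof (rule order_trans[OF _ wnorm_rconv_le[OF assms]])
 show "wnorm T \<nu> (rconv \<phi> \<psi>) \<le> (\<integral>\<^sup>+t. ennreal (indicat_real {0..T} t * exp (- \<nu> * t)) * (\<integral>\<^sup>+s. ennreal (norm (\<phi> s * \<psi> (t - s))) \<partial>lborel) \<partial>lborel)"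
  unfolding wnorm_def
 proof (intro nn_integral_mono)
  fix t
  show "ennreal (indicat_real {0..T} t * exp (- \<nu> * t) * norm (rconv \<phi> \<psi> t))
    \<le> ennreal (indicat_real {0..T} t * exp (- \<nu> * t)) * (\<integral>\<^sup>+s. ennreal (norm (\<phi> s * \<psi> (t - s))) \<partial>lborel)"
   using norm_rconv_le[of \<phi> \<psi> t] by (subst ennreal_mult) (auto intro: mult_left_mono)
 qed
qed

lemma wnorm_add: assumes [measurable]: "\<phi> \<in> borel_measurable borel" "\<psi> \<in> borel_measurable borel"
 shows "wnorm T \<nu> (\<lambda>t. \<phi> t + \<psi> t) \<le> wnorm T \<nu> \<phi> + wnorm T \<nu> \<psi>"
proof -
 have "wnorm T \<nu> (\<lambda>t. \<phi> t + \<psi> t) \<le> (\<integral>\<^sup>+t. ennreal (indicat_real {0..T} t * exp (- \<nu> * t) * norm (\<phi> t)) +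
   ennreal (indicat_real {0..T} t * exp (- \<nu> * t) * norm (\<psi> t)) \<partial>lborel)" unfolding wnorm_def
  by (intro nn_integral_mono)
   (auto simp: indicator_def ennreal_plus[symmetric] distrib_left[symmetric] norm_triangle_ineq simp del: ennreal_plus intro!: ennreal_leI)
 also have "\<dots> = wnorm T \<nu> \<phi> + wnorm T \<nu> \<psi>" unfolding wnorm_def by (intro nn_integral_add) measurable
 finally show ?thesis .
qed

abbreviation wabs :: "real \<Rightarrow> real \<Rightarrow> (complex \<Rightarrow> complex) \<Rightarrow> real \<Rightarrow> ennreal"
 where "wabs th \<nu> f t \<equiv> ennreal (exp (- \<nu> * t) * norm (f (rp th t)))"

abbreviation maj :: "real \<Rightarrow> real \<Rightarrow> real \<Rightarrow> (complex \<Rightarrow> complex) \<Rightarrow> (real \<Rightarrow> ennreal) \<Rightarrow> bool"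
 where "maj th T \<nu> f w \<equiv> AE t in lborel. t \<in> {0..T} \<longrightarrow> wabs th \<nu> f t \<le> w t"

text \<open>Weighted \<open>L1\<close> bounds on the part \<open>[0, T]\<close> of \<open>ray th\<close>, formulated by a measurable majorant
 because the infinite sums below are not known to be measurable functions.\<close>

definition l1bd :: "real \<Rightarrow> real \<Rightarrow> real \<Rightarrow> (complex \<Rightarrow> complex) \<Rightarrow> real \<Rightarrow> bool"
 where "l1bd th T \<nu> f c \<longleftrightarrow> c \<ge> 0 \<and> (\<exists>w. w \<in> borel_measurable borel \<and>
  (maj th T \<nu> f w) \<and> (\<integral>\<^sup>+t. w t \<partial>lborel) \<le> ennreal c)"

lemma l1bdI:
 "c \<ge> 0 \<Longrightarrow> w \<in> borel_measurable borel \<Longrightarrow> (maj th T \<nu> f w) \<Longrightarrow>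
  (\<integral>\<^sup>+t. w t \<partial>lborel) \<le> ennreal c \<Longrightarrow> l1bd th T \<nu> f c" unfolding l1bd_def by blast

lemma l1bdE: assumes "l1bd th T \<nu> f c" obtains w where "w \<in> borel_measurable borel"
  "maj th T \<nu> f w"
  "(\<integral>\<^sup>+t. w t \<partial>lborel) \<le> ennreal c" "c \<ge> 0" using assms unfolding l1bd_def by blast

lemma l1bd_mono_AE:
 assumes g: "l1bd th T \<nu> g c" and le: "AE t in lebesgue. t \<in> {0..T} \<longrightarrow> norm (f (rp th t)) \<le> norm (g (rp th t))"
 shows "l1bd th T \<nu> f c"
proof -
 obtain w where w: "w \<in> borel_measurable borel"
  "maj th T \<nu> g w"
  "(\<integral>\<^sup>+t. w t \<partial>lborel) \<le> ennreal c" "c \<ge> 0" using g by (rule l1bdE)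
 have le': "AE t in lborel. t \<in> {0..T} \<longrightarrow> norm (f (rp th t)) \<le> norm (g (rp th t))"
  using le by (simp add: AE_completion_iff)
 show ?thesis
 proof (rule l1bdI[OF w(4,1) _ w(3)])
  show "maj th T \<nu> f w" using w(2) le'
  proof eventually_elim
   case (elim t)
   show ?case
   proof
    assume t: "t \<in> {0..T}"
    have "wabs th \<nu> f t \<le> wabs th \<nu> g t" using elim t by (intro ennreal_leI mult_left_mono) auto
    also have "\<dots> \<le> w t" using elim t by blast
    finally show "wabs th \<nu> f t \<le> w t" .
   qed
  qed
 qed
qed

lemma rep_l1bd: assumes "ray_rep th f \<phi>" "wnorm T \<nu> \<phi> \<le> ennreal c" "c \<ge> 0" shows "l1bd th T \<nu> f c"
proof -
 note r = ray_repD[OF assms(1)]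
 note [measurable] = r(1)
 show ?thesis
 proof (rule l1bdI[OF assms(3) _ _ assms(2)[unfolded wnorm_def]])
  show "(\<lambda>t. ennreal (indicat_real {0..T} t * exp (- \<nu> * t) * norm (\<phi> t))) \<in> borel_measurable borel" by measurable
  have "AE t in lborel. t \<ge> 0 \<longrightarrow> f (rp th t) = \<phi> t" using r(3) by (simp add: AE_completion_iff)
  then show "AE t in lborel. t \<in> {0..T} \<longrightarrow> wabs th \<nu> f t
   \<le> ennreal (indicat_real {0..T} t * exp (- \<nu> * t) * norm (\<phi> t))" by eventually_elim auto
 qed
qed

lemma l1bd_rep: assumes "l1bd th T \<nu> f c" "ray_rep th f \<phi>" shows "wnorm T \<nu> \<phi> \<le> ennreal c"
proof -
 obtain w where w: "w \<in> borel_measurable borel"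
  "maj th T \<nu> f w"
  "(\<integral>\<^sup>+t. w t \<partial>lborel) \<le> ennreal c" "c \<ge> 0" using assms(1) by (rule l1bdE)
 have "AE t in lborel. t \<ge> 0 \<longrightarrow> f (rp th t) = \<phi> t" using ray_repD(3)[OF assms(2)] by (simp add: AE_completion_iff)
 then have "wnorm T \<nu> \<phi> \<le> (\<integral>\<^sup>+t. w t \<partial>lborel)" unfolding wnorm_def using w(2)
  by (intro nn_integral_mono_AE, eventually_elim) (auto simp: indicator_def)
 then show ?thesis using w(3) by (rule order_trans)
qed

lemma l1bd_finite: assumes "ray_rep th f \<phi>" obtains c where "l1bd th T \<nu> f c"
proof -
 have "wnorm T \<nu> \<phi> < \<infinity>" by (rule wnorm_finite[OF ray_repD(4)[OF assms]])
 then have "wnorm T \<nu> \<phi> = ennreal (enn2real (wnorm T \<nu> \<phi>))" by (simp add: less_top)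
 then have "l1bd th T \<nu> f (enn2real (wnorm T \<nu> \<phi>))" by (intro rep_l1bd[OF assms]) auto
 then show thesis by (rule that)
qed

lemma l1bd_zero: "l1bd th T \<nu> (\<lambda>_. 0) 0" by (rule l1bdI[where w = "\<lambda>_. 0"]) auto

lemma l1bd_mono: "l1bd th T \<nu> f c \<Longrightarrow> c \<le> d \<Longrightarrow> l1bd th T \<nu> f d"
proof (erule l1bdE)
 fix w assume "c \<le> d" and w: "w \<in> borel_measurable borel"
  "maj th T \<nu> f w"
  "(\<integral>\<^sup>+t. w t \<partial>lborel) \<le> ennreal c" "c \<ge> 0"
 then show "l1bd th T \<nu> f d" using order_trans[OF w(3) ennreal_leI[of c d]] by (intro l1bdI[OF _ w(1,2)]) auto
qed

lemma l1bd_add: assumes "l1bd th T \<nu> f c" "l1bd th T \<nu> g d" shows "l1bd th T \<nu> (\<lambda>p. f p + g p) (c + d)"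
proof -
 obtain w where w: "w \<in> borel_measurable borel"
  "maj th T \<nu> f w"
  "(\<integral>\<^sup>+t. w t \<partial>lborel) \<le> ennreal c" "c \<ge> 0" using assms(1) by (rule l1bdE)
 obtain v where v: "v \<in> borel_measurable borel"
  "maj th T \<nu> g v"
  "(\<integral>\<^sup>+t. v t \<partial>lborel) \<le> ennreal d" "d \<ge> 0" using assms(2) by (rule l1bdE)
 note [measurable] = w(1) v(1)
 show ?thesis
 proof (rule l1bdI)
  show "(\<lambda>t. w t + v t) \<in> borel_measurable borel" by measurable
  show "0 \<le> c + d" using w v by simp
  have "(\<integral>\<^sup>+t. w t + v t \<partial>lborel) = (\<integral>\<^sup>+t. w t \<partial>lborel) + (\<integral>\<^sup>+t. v t \<partial>lborel)" by (intro nn_integral_add) measurable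
  then show "(\<integral>\<^sup>+t. w t + v t \<partial>lborel) \<le> ennreal (c + d)" using add_mono[OF w(3) v(3)] w(4) v(4) by simp
  show "AE t in lborel. t \<in> {0..T} \<longrightarrow> ennreal (exp (- \<nu> * t) * norm (f (rp th t) + g (rp th t))) \<le> w t + v t"
   using w(2) v(2)
  proof eventually_elim
   case (elim t)
   have "ennreal (exp (- \<nu> * t) * norm (f (rp th t) + g (rp th t)))
    \<le> ennreal (exp (- \<nu> * t) * norm (f (rp th t)) + exp (- \<nu> * t) * norm (g (rp th t)))"
    unfolding distrib_left[symmetric] by (intro ennreal_leI mult_left_mono norm_triangle_ineq) auto
   also have "\<dots> = wabs th \<nu> f t + wabs th \<nu> g t" by (intro ennreal_plus) auto
   finally show ?case using elim add_mono order_trans by blast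
  qed
 qed
qed

lemma l1bd_cmult: assumes "l1bd th T \<nu> f c" shows "l1bd th T \<nu> (\<lambda>p. a * f p) (norm a * c)"
proof -
 obtain w where w: "w \<in> borel_measurable borel"
  "maj th T \<nu> f w"
  "(\<integral>\<^sup>+t. w t \<partial>lborel) \<le> ennreal c" "c \<ge> 0" using assms(1) by (rule l1bdE)
 note [measurable] = w(1)
 show ?thesis
 proof (rule l1bdI)
  show "(\<lambda>t. ennreal (norm a) * w t) \<in> borel_measurable borel" by measurable
  show "0 \<le> norm a * c" using w by simp
  show "(\<integral>\<^sup>+t. ennreal (norm a) * w t \<partial>lborel) \<le> ennreal (norm a * c)"
   using mult_left_mono[OF w(3), of "ennreal (norm a)"] w(4) by (subst nn_integral_cmult) (auto simp: ennreal_mult)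
  show "AE t in lborel. t \<in> {0..T} \<longrightarrow> ennreal (exp (- \<nu> * t) * norm (a * f (rp th t))) \<le> ennreal (norm a) * w t"
   using w(2)
  proof eventually_elim
   case (elim t)
   have "ennreal (exp (- \<nu> * t) * norm (a * f (rp th t))) = ennreal (norm a) * wabs th \<nu> f t"
    by (simp add: norm_mult ennreal_mult[symmetric] mult_ac)
   then show ?case using elim by (auto intro!: mult_left_mono)
  qed
 qed
qed

lemma l1bd_sum: "(\<And>i. i \<in> I \<Longrightarrow> l1bd th T \<nu> (f i) (c i)) \<Longrightarrow> l1bd th T \<nu> (\<lambda>p. \<Sum>i\<in>I. f i p) (\<Sum>i\<in>I. c i)"
 by (induction I rule: infinite_finite_induct) (auto intro: l1bd_zero l1bd_add)

text \<open>The finite partial sums are controlled uniformly. The norm bound survives a failure of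
  summability because \<open>infsum\<close> is then 0 by default.\<close>

lemma ennreal_norm_infsum: fixes f :: "'a \<Rightarrow> complex" and w :: ennreal
 assumes F: "\<And>F. finite F \<Longrightarrow> F \<subseteq> S \<Longrightarrow> (\<Sum>l\<in>F. ennreal (e * norm (f l))) \<le> w" and e: "e > 0"
 shows "w \<noteq> \<infinity> \<Longrightarrow> f summable_on S" "ennreal (e * norm (infsum f S)) \<le> w"
proof -
 have F': "ennreal (\<Sum>l\<in>F. e * norm (f l)) \<le> w" if "finite F" "F \<subseteq> S" for F
  using F[OF that] e by (subst sum_ennreal[symmetric]) simp_all
 show "f summable_on S" if w: "w \<noteq> \<infinity>"
 proof (rule abs_summable_summable, rule nonneg_bounded_partial_sums_imp_summable_on[where C = "enn2real w / e"])
  show "\<forall>\<^sub>F F in finite_subsets_at_top S. (\<Sum>l\<in>F. norm (f l)) \<le> enn2real w / e"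
  proof (rule eventually_finite_subsets_at_top_weakI)
   fix F assume "finite F" "F \<subseteq> S"
   from enn2real_mono[OF F'[OF this]] have "(\<Sum>l\<in>F. e * norm (f l)) \<le> enn2real w"
    using w e by (simp add: less_top sum_nonneg)
   then show "(\<Sum>l\<in>F. norm (f l)) \<le> enn2real w / e" using e by (simp add: sum_distrib_left[symmetric] field_simps)
  qed
 qed auto
 show "ennreal (e * norm (infsum f S)) \<le> w"
 proof (cases "f summable_on S")
  case True
  have "((\<lambda>F. ennreal (e * norm (sum f F))) \<longlongrightarrow> ennreal (e * norm (infsum f S))) (finite_subsets_at_top S)"
   using has_sum_infsum[OF True] unfolding has_sum_def by (intro tendsto_intros)
  then show ?thesis
  proof (rule tendsto_upperbound)
   show "\<forall>\<^sub>F F in finite_subsets_at_top S. ennreal (e * norm (sum f F)) \<le> w"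
   proof (rule eventually_finite_subsets_at_top_weakI)
    fix F assume "finite F" "F \<subseteq> S"
    have "e * norm (sum f F) \<le> (\<Sum>l\<in>F. e * norm (f l))" using e by (simp add: sum_distrib_left[symmetric] norm_sum)
    then show "ennreal (e * norm (sum f F)) \<le> w" using F'[OF \<open>finite F\<close> \<open>F \<subseteq> S\<close>] ennreal_leI order_trans by blast
   qed
  qed simp
 qed (simp add: infsum_not_exists)
qed

text \<open>Countability of the index set lets the almost everywhere bounds of all terms hold at
  once; the sum of their majorants is then a measurable majorant.\<close>

lemma l1bd_infsum: fixes h h' :: "'a::countable \<Rightarrow> complex \<Rightarrow> complex"
 assumes h: "\<And>l. l \<in> S \<Longrightarrow> l1bd th T \<nu> (h l) (A l)" "\<And>l. l \<in> S \<Longrightarrow> l1bd th T \<nu> (h' l) (A l)"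
  "\<And>l. l \<in> S \<Longrightarrow> l1bd th T \<nu> (\<lambda>p. h l p - h' l p) (d l)"
  and A: "A summable_on S" and d: "d summable_on S"
 shows "l1bd th T \<nu> (\<lambda>p. (\<Sum>\<^sub>\<infinity>l\<in>S. h l p) - (\<Sum>\<^sub>\<infinity>l\<in>S. h' l p)) (\<Sum>\<^sub>\<infinity>l\<in>S. d l)"
proof -
 have key: "\<exists>W. W \<in> borel_measurable borel \<and> (\<integral>\<^sup>+t. W t \<partial>lborel) \<le> ennreal (\<Sum>\<^sub>\<infinity>l\<in>S. a l) \<and>
   (AE t in lborel. t \<in> {0..T} \<longrightarrow> (\<forall>F. finite F \<longrightarrow> F \<subseteq> S \<longrightarrow> (\<Sum>l\<in>F. wabs th \<nu> (f l) t) \<le> W t))"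
  if f: "\<And>l. l \<in> S \<Longrightarrow> l1bd th T \<nu> (f l) (a l)" and a: "a summable_on S" for f :: "'a \<Rightarrow> complex \<Rightarrow> complex" and a
 proof -
  have "\<forall>l\<in>S. \<exists>w. w \<in> borel_measurable borel \<and> (maj th T \<nu> (f l) w) \<and>
   (\<integral>\<^sup>+t. w t \<partial>lborel) \<le> ennreal (a l) \<and> a l \<ge> 0" using f unfolding l1bd_def by blast
  from bchoice[OF this] obtain w where w: "\<And>l. l \<in> S \<Longrightarrow> w l \<in> borel_measurable borel"
   "\<And>l. l \<in> S \<Longrightarrow> maj th T \<nu> (f l) (w l)"
   "\<And>l. l \<in> S \<Longrightarrow> (\<integral>\<^sup>+t. w l t \<partial>lborel) \<le> ennreal (a l)" "\<And>l. l \<in> S \<Longrightarrow> a l \<ge> 0" by blast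
  \<comment> \<open>The majorants are indexed by natural numbers, with 0 at the gaps, so that the
    integral can be exchanged with a series.\<close>
  define q where "q n = (if n \<in> to_nat ` S then w (from_nat n) else (\<lambda>_. 0))" for n
  have q: "q (to_nat l) = w l" if "l \<in> S" for l using that by (auto simp: q_def)
  have qm [measurable]: "q n \<in> borel_measurable borel" for n using w(1) by (auto simp: q_def)
  define W where "W t = (\<Sum>n. q n t)" for t
  have [measurable]: "W \<in> borel_measurable borel" unfolding W_def by measurable
  have "(\<integral>\<^sup>+t. W t \<partial>lborel) = (\<Sum>n. \<integral>\<^sup>+t. q n t \<partial>lborel)"
   unfolding W_def by (rule nn_integral_suminf) simp
  also have "\<dots> \<le> ennreal (\<Sum>\<^sub>\<infinity>l\<in>S. a l)"
  proof (rule suminf_le_const)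
   show "summable (\<lambda>n. \<integral>\<^sup>+t. q n t \<partial>lborel)" by simp
   fix n :: nat
   define F where "F = {l \<in> S. to_nat l < n}"
   have F: "finite F" "F \<subseteq> S" unfolding F_def by (rule finite_subset[OF _ finite_vimageI[of "{..<n}" to_nat]]) auto
   have "(\<Sum>k<n. \<integral>\<^sup>+t. q k t \<partial>lborel) = (\<Sum>k\<in>to_nat ` F. \<integral>\<^sup>+t. q k t \<partial>lborel)"
    by (intro sum.mono_neutral_right) (auto simp: F_def q_def)
   also have "\<dots> = (\<Sum>l\<in>F. \<integral>\<^sup>+t. w l t \<partial>lborel)"
    using F(2) q by (subst sum.reindex) (auto intro!: sum.cong)
   also have "\<dots> \<le> (\<Sum>l\<in>F. ennreal (a l))" using w(3) F by (intro sum_mono) auto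
   also have "\<dots> = ennreal (\<Sum>l\<in>F. a l)" using w(4) F by (intro sum_ennreal) auto
   also have "\<dots> \<le> ennreal (\<Sum>\<^sub>\<infinity>l\<in>S. a l)"
    using w(4) F a by (intro ennreal_leI finite_sum_le_infsum) auto
   finally show "(\<Sum>k<n. \<integral>\<^sup>+t. q k t \<partial>lborel) \<le> ennreal (\<Sum>\<^sub>\<infinity>l\<in>S. a l)" .
  qed
  finally have 1: "(\<integral>\<^sup>+t. W t \<partial>lborel) \<le> ennreal (\<Sum>\<^sub>\<infinity>l\<in>S. a l)" .
  have "AE t in lborel. \<forall>l. l \<in> S \<longrightarrow> t \<in> {0..T} \<longrightarrow> wabs th \<nu> (f l) t \<le> w l t"
   unfolding AE_all_countable
  proof
   fix l show "AE t in lborel. l \<in> S \<longrightarrow> t \<in> {0..T} \<longrightarrow> wabs th \<nu> (f l) t \<le> w l t"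
    using w(2)[of l] by (cases "l \<in> S") auto
  qed
  then have 2: "AE t in lborel. t \<in> {0..T} \<longrightarrow> (\<forall>F. finite F \<longrightarrow> F \<subseteq> S \<longrightarrow> (\<Sum>l\<in>F. wabs th \<nu> (f l) t) \<le> W t)"
  proof eventually_elim
   case (elim t)
   show ?case
   proof (intro impI allI)
    fix F assume t: "t \<in> {0..T}" and F: "finite F" "F \<subseteq> S"
    have "(\<Sum>l\<in>F. wabs th \<nu> (f l) t) \<le> (\<Sum>l\<in>F. q (to_nat l) t)" using elim t F q by (intro sum_mono) auto
    also have "\<dots> = (\<Sum>n\<in>to_nat ` F. q n t)" by (subst sum.reindex) auto
    also have "\<dots> \<le> W t" unfolding W_def using F by (intro sum_le_suminf) auto
    finally show "(\<Sum>l\<in>F. wabs th \<nu> (f l) t) \<le> W t" .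
   qed
  qed
  show ?thesis using 1 2 by (intro exI[of _ W]) auto
 qed
 obtain W1 where W1: "W1 \<in> borel_measurable borel" "(\<integral>\<^sup>+t. W1 t \<partial>lborel) \<le> ennreal (\<Sum>\<^sub>\<infinity>l\<in>S. A l)"
   "AE t in lborel. t \<in> {0..T} \<longrightarrow> (\<forall>F. finite F \<longrightarrow> F \<subseteq> S \<longrightarrow> (\<Sum>l\<in>F. wabs th \<nu> (h l) t) \<le> W1 t)"
  using key[OF h(1) A] by blast
 obtain W2 where W2: "W2 \<in> borel_measurable borel" "(\<integral>\<^sup>+t. W2 t \<partial>lborel) \<le> ennreal (\<Sum>\<^sub>\<infinity>l\<in>S. A l)"
   "AE t in lborel. t \<in> {0..T} \<longrightarrow> (\<forall>F. finite F \<longrightarrow> F \<subseteq> S \<longrightarrow> (\<Sum>l\<in>F. wabs th \<nu> (h' l) t) \<le> W2 t)"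
  using key[OF h(2) A] by blast
 obtain W where W: "W \<in> borel_measurable borel" "(\<integral>\<^sup>+t. W t \<partial>lborel) \<le> ennreal (\<Sum>\<^sub>\<infinity>l\<in>S. d l)"
   "AE t in lborel. t \<in> {0..T} \<longrightarrow> (\<forall>F. finite F \<longrightarrow> F \<subseteq> S \<longrightarrow> (\<Sum>l\<in>F. ennreal (exp (- \<nu> * t) * norm (h l (rp th t) - h' l (rp th t)))) \<le> W t)"
  using key[OF h(3) d] by blast
 have fin: "AE t in lborel. w t \<noteq> \<infinity>" if "w \<in> borel_measurable borel" "(\<integral>\<^sup>+t. w t \<partial>lborel) \<le> ennreal c" for w c
 proof (rule nn_integral_PInf_AE)
  show "(\<integral>\<^sup>+t. w t \<partial>lborel) \<noteq> \<infinity>" using that(2) by (auto simp: top_unique)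
 qed (use that(1) in simp)
 show ?thesis
 proof (rule l1bdI[OF _ W(1) _ W(2)])
  show "0 \<le> (\<Sum>\<^sub>\<infinity>l\<in>S. d l)" using h(3) by (intro infsum_nonneg) (auto simp: l1bd_def)
  show "AE t in lborel. t \<in> {0..T} \<longrightarrow> ennreal (exp (- \<nu> * t) *
   norm ((\<Sum>\<^sub>\<infinity>l\<in>S. h l (rp th t)) - (\<Sum>\<^sub>\<infinity>l\<in>S. h' l (rp th t)))) \<le> W t"
   using W1(3) fin[OF W1(1,2)] W2(3) fin[OF W2(1,2)] W(3) fin[OF W(1,2)]
  proof eventually_elim
   case (elim t)
   show ?case
   proof
    assume t: "t \<in> {0..T}"
    let ?p = "of_real t * cis th" and ?e = "exp (- \<nu> * t)"
    have "(\<lambda>l. h l ?p) summable_on S" "(\<lambda>l. h' l ?p) summable_on S"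
     using elim(1-4) t by (intro ennreal_norm_infsum(1)[where e = ?e]; simp)+
    note s = summable_on_diff_infsum[OF this]
    show "wabs th \<nu> (\<lambda>p. (\<Sum>\<^sub>\<infinity>l\<in>S. h l p) - (\<Sum>\<^sub>\<infinity>l\<in>S. h' l p)) t \<le> W t"
     unfolding s(2)[symmetric] using elim(5) t by (intro ennreal_norm_infsum(2)) simp_all
   qed
  qed
 qed
qed

lemma ray_rep_continuous: assumes "continuous_on (ray th) f"
 shows "ray_rep th f (\<lambda>t. indicat_real {0..} t *\<^sub>R f (rp th t))"
proof -
 have c: "continuous_on {0..} (\<lambda>t. f (rp th t))"
  by (rule continuous_on_compose2[OF assms]) (auto intro!: continuous_intros simp: ray_def)
 have "set_integrable lborel {0..T} (\<lambda>t. indicat_real {0..} t *\<^sub>R f (rp th t))" for T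
 proof -
  have "set_integrable lborel {0..T} (\<lambda>t. f (rp th t))"
   by (rule borel_integrable_atLeastAtMost'[OF continuous_on_subset[OF c]]) auto
  then show ?thesis
   unfolding set_integrable_def by (rule iffD1[OF Bochner_Integration.integrable_cong, rotated -1]) (auto simp: indicator_def)
 qed
 moreover have "(\<lambda>t. indicat_real {0..} t *\<^sub>R f (rp th t)) \<in> borel_measurable borel"
  by (rule borel_measurable_continuous_on_indicator[OF _ c]) simp
 ultimately show ?thesis by (auto simp: ray_rep_def)
qed

lemma wnorm_exp_le:
 assumes b: "\<And>t. t \<in> {0..T} \<Longrightarrow> norm (\<phi> t) \<le> M * exp (a * t)" and \<nu>: "\<nu> > a" and M: "M \<ge> 0" and T: "T \<ge> 0"
 shows "wnorm T \<nu> \<phi> \<le> ennreal (M / (\<nu> - a))"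
proof -
 define \<delta> where "\<delta> = \<nu> - a"
 have \<delta>: "\<delta> > 0" using \<nu> by (simp add: \<delta>_def)
 have "wnorm T \<nu> \<phi> \<le> (\<integral>\<^sup>+t. ennreal (M * exp (- \<delta> * t)) * indicator {0..T} t \<partial>lborel)"
  unfolding wnorm_def
 proof (intro nn_integral_mono)
  fix t
  have "exp (- \<nu> * t) * norm (\<phi> t) \<le> M * exp (- \<delta> * t)" if "t \<in> {0..T}"
  proof -
   have "exp (- \<nu> * t) * norm (\<phi> t) \<le> exp (- \<nu> * t) * (M * exp (a * t))" using b[OF that] by (intro mult_left_mono) auto
   also have "\<dots> = M * exp (- \<delta> * t)" by (simp add: \<delta>_def algebra_simps flip: exp_add)
   finally show ?thesis .
  qed
  then show "ennreal (indicat_real {0..T} t * exp (- \<nu> * t) * norm (\<phi> t)) \<le> ennreal (M * exp (- \<delta> * t)) * indicator {0..T} t"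
   by (auto simp: indicator_def intro!: ennreal_leI)
 qed
 also have "\<dots> = ennreal (- M / \<delta> * exp (- \<delta> * T) - (- M / \<delta> * exp (- \<delta> * 0)))"
  using \<delta> M T by (intro nn_integral_FTC_Icc) (auto intro!: derivative_eq_intros)
 also have "\<dots> \<le> ennreal (M / \<delta>)" using \<delta> M by (intro ennreal_leI) simp
 finally show ?thesis by (simp add: \<delta>_def)
qed

lemma wnorm_antimono: "\<nu> \<le> \<nu>' \<Longrightarrow> wnorm T \<nu>' \<phi> \<le> wnorm T \<nu> \<phi>" unfolding wnorm_def
 by (intro nn_integral_mono ennreal_leI mult_right_mono) (auto simp: indicator_def intro!: mult_right_mono)

text \<open>Dominated convergence: the weights tend to 0 at every \<open>t > 0\<close>, with the
  unweighted function as majorant.\<close>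

lemma wnorm_small: assumes "ray_rep th f \<phi>" "\<epsilon> > 0"
 obtains \<nu>0 where "\<And>\<nu>. \<nu> \<ge> \<nu>0 \<Longrightarrow> wnorm T \<nu> \<phi> \<le> ennreal \<epsilon>"
proof -
 note r = ray_repD[OF assms(1)]
 note [measurable] = r(1)
 define s where "s n t = indicat_real {0..T} t * exp (- real n * t) * norm (\<phi> t)" for n t
 have [measurable]: "s n \<in> borel_measurable borel" for n unfolding s_def by measurable
 have w: "integrable lborel (\<lambda>t. norm (indicat_real {0..T} t *\<^sub>R \<phi> t))"
  using r(4)[of T] unfolding set_integrable_def by (rule integrable_norm)
 have bnd: "norm (s n t) \<le> norm (indicat_real {0..T} t *\<^sub>R \<phi> t)" for n t
  by (auto simp: s_def indicator_def abs_mult intro!: mult_left_le_one_le)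
 have ae: "AE t in lborel. (\<lambda>n. s n t) \<longlonglongrightarrow> 0"
 proof -
  have "AE t in lborel. t \<noteq> (0::real)" by (rule AE_lborel_singleton)
  then show ?thesis
  proof eventually_elim
   case (elim t)
   show ?case
   proof (cases "t \<in> {0..T}")
    case True
    with elim have "t > 0" by auto
    then have "(\<lambda>n. exp (- real n * t)) \<longlonglongrightarrow> 0" by real_asymp
    from tendsto_mult_left_zero[OF this, of "norm (\<phi> t)"] show ?thesis using True by (simp add: s_def)
   qed (simp add: s_def)
  qed
 qed
 have lim: "(\<lambda>n. integral\<^sup>L lborel (s n)) \<longlonglongrightarrow> integral\<^sup>L lborel (\<lambda>t::real. 0)"
  using bnd by (intro integral_dominated_convergence[where w = "\<lambda>t. norm (indicat_real {0..T} t *\<^sub>R \<phi> t)"] w ae AE_I2) auto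
 have int: "integrable lborel (s n)" for n by (rule Bochner_Integration.integrable_bound[OF w]) (use bnd in auto)
 have eq: "wnorm T (real n) \<phi> = ennreal (integral\<^sup>L lborel (s n))" for n unfolding wnorm_def s_def[symmetric]
  by (rule nn_integral_eq_integral[OF int]) (auto simp: s_def)
 from lim have "eventually (\<lambda>n. integral\<^sup>L lborel (s n) < \<epsilon>) sequentially"
  using assms(2) by (intro order_tendstoD(2)) auto
 then obtain n where "integral\<^sup>L lborel (s n) < \<epsilon>" by (auto simp: eventually_sequentially)
 then have "wnorm T (real n) \<phi> \<le> ennreal \<epsilon>" unfolding eq by (intro ennreal_leI) auto
 then show thesis using wnorm_antimono[of "real n" _ T \<phi>] by (intro that[of "real n"]) (rule order_trans)
qed

lemma l1bd_conv_diff: assumes H: "ray_rep th f \<phi>" "ray_rep th g \<psi>" "ray_rep th f' \<phi>'" "ray_rep th g' \<psi>'"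
  and b: "l1bd th T \<nu> (\<lambda>p. f p - f' p) c1" "l1bd th T \<nu> g d" "l1bd th T \<nu> f' c" "l1bd th T \<nu> (\<lambda>p. g p - g' p) d1"
 shows "l1bd th T \<nu> (\<lambda>p. conv f g p - conv f' g' p) (c1 * d + c * d1)"
proof -
 note F = ray_repD[OF H(1)] and G = ray_repD[OF H(2)] and F' = ray_repD[OF H(3)] and G' = ray_repD[OF H(4)]
 have nn: "c1 \<ge> 0" "d \<ge> 0" "c \<ge> 0" "d1 \<ge> 0" using b by (auto simp: l1bd_def)
 have [measurable]: "\<phi> \<in> borel_measurable borel" "\<psi> \<in> borel_measurable borel" "\<phi>' \<in> borel_measurable borel" "\<psi>' \<in> borel_measurable borel"
  by (rule F G F' G')+
 define \<omega> where "\<omega> t = rconv (\<lambda>t. \<phi> t - \<phi>' t) \<psi> t + rconv \<phi>' (\<lambda>t. \<psi> t - \<psi>' t) t" for t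
 have rep: "ray_rep th (\<lambda>p. conv f g p - conv f' g' p) (\<lambda>t. cis th * rconv \<phi> \<psi> t - cis th * rconv \<phi>' \<psi>' t)"
  by (intro ray_rep_diff ray_rep_conv H)
 have "wnorm T \<nu> (\<lambda>t. cis th * rconv \<phi> \<psi> t - cis th * rconv \<phi>' \<psi>' t) = wnorm T \<nu> \<omega>"
  unfolding wnorm_def
 proof (intro nn_integral_cong_AE)
  show "AE t in lborel. ennreal (indicat_real {0..T} t * exp (- \<nu> * t) * norm (cis th * rconv \<phi> \<psi> t - cis th * rconv \<phi>' \<psi>' t))
   = ennreal (indicat_real {0..T} t * exp (- \<nu> * t) * norm (\<omega> t))" using rconv_diff_AE[OF H(1,3,2,4)]
   by eventually_elim (simp add: \<omega>_def norm_mult flip: right_diff_distrib)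
 qed
 also have "\<dots> \<le> wnorm T \<nu> (rconv (\<lambda>t. \<phi> t - \<phi>' t) \<psi>) + wnorm T \<nu> (rconv \<phi>' (\<lambda>t. \<psi> t - \<psi>' t))"
  unfolding \<omega>_def by (intro wnorm_add rconv_measurable) measurable
 also have "\<dots> \<le> wnorm T \<nu> (\<lambda>t. \<phi> t - \<phi>' t) * wnorm T \<nu> \<psi> + wnorm T \<nu> \<phi>' * wnorm T \<nu> (\<lambda>t. \<psi> t - \<psi>' t)"
  using F G F' G' by (intro add_mono wnorm_rconv) (auto intro: borel_measurable_diff)
 also have "\<dots> \<le> ennreal c1 * ennreal d + ennreal c * ennreal d1"
  by (intro add_mono mult_mono l1bd_rep[OF b(1) ray_rep_diff[OF H(1,3)]] l1bd_rep[OF b(2) H(2)]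
    l1bd_rep[OF b(3) H(3)] l1bd_rep[OF b(4) ray_rep_diff[OF H(2,4)]]) auto
 also have "\<dots> = ennreal (c1 * d + c * d1)" using nn by (simp add: ennreal_mult)
 finally show ?thesis using nn by (intro rep_l1bd[OF rep]) auto
qed

lemma ray_rep_zero: "ray_rep th (\<lambda>_. 0) (\<lambda>_. 0)" by (auto simp: ray_rep_def set_integrable_def)

lemma l1bd_conv: assumes "ray_rep th f \<phi>" "ray_rep th g \<psi>" "l1bd th T \<nu> f c" "l1bd th T \<nu> g d"
 shows "l1bd th T \<nu> (conv f g) (c * d)"
 using l1bd_conv_diff[OF assms(1,2) ray_rep_zero ray_rep_zero, of T \<nu> c d 0 d] assms l1bd_zero by simp

lemma l1bd_small: assumes "ray_rep th f \<phi>" "\<epsilon> > 0"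
 obtains \<nu>0 where "\<And>\<nu>. \<nu> \<ge> \<nu>0 \<Longrightarrow> l1bd th T \<nu> f \<epsilon>"
 using wnorm_small[OF assms, of T] rep_l1bd[OF assms(1)] assms(2) by (metis less_imp_le)

lemma l1bd_small_finite:
 assumes "\<And>i. i \<in> I \<Longrightarrow> \<exists>\<phi>. ray_rep th (f i) \<phi>" "\<epsilon> > 0" "finite I"
 shows "\<exists>\<nu>0. \<forall>i\<in>I. \<forall>\<nu>\<ge>\<nu>0. l1bd th T \<nu> (f i) \<epsilon>" using assms(3,1)
proof (induction I rule: finite_induct)
 case (insert i I)
 obtain \<nu>1 where 1: "\<forall>j\<in>I. \<forall>\<nu>\<ge>\<nu>1. l1bd th T \<nu> (f j) \<epsilon>" using insert by blast
 obtain \<phi> where "ray_rep th (f i) \<phi>" using insert.prems by blast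
 then obtain \<nu>2 where "\<And>\<nu>. \<nu> \<ge> \<nu>2 \<Longrightarrow> l1bd th T \<nu> (f i) \<epsilon>" using l1bd_small assms(2) by metis
 with 1 show ?case by (intro exI[of _ "max \<nu>1 \<nu>2"]) auto
qed simp

text \<open>A finite bound that can be halved indefinitely is 0; finiteness is local
  integrability.\<close>

lemma l1_contraction_zero: fixes D :: "'i::finite \<Rightarrow> complex \<Rightarrow> complex"
 assumes rep: "\<And>i. ray_rep th (D i) (\<phi> i)"
  and step: "\<And>\<epsilon>. \<epsilon> \<ge> 0 \<Longrightarrow> (\<And>i. l1bd th T \<nu> (D i) \<epsilon>) \<Longrightarrow> (\<forall>i. l1bd th T \<nu> (D i) (\<epsilon> / 2))"
 shows "AE t in lebesgue. t \<in> {0..T} \<longrightarrow> (\<forall>i. D i (rp th t) = 0)"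
proof -
 have "\<forall>i. \<exists>c. l1bd th T \<nu> (D i) c" using l1bd_finite[OF rep] by blast
 from choice[OF this] obtain c where c: "\<And>i. l1bd th T \<nu> (D i) (c i)" by blast
 have c0: "c i \<ge> 0" for i using c[of i] by (simp add: l1bd_def)
 define S where "S = (\<Sum>i\<in>UNIV. c i)"
 have S: "S \<ge> 0" unfolding S_def using c0 by (intro sum_nonneg) auto
 have it: "\<forall>i. l1bd th T \<nu> (D i) (S / 2 ^ n)" for n
 proof (induction n)
  case 0
  have "c i \<le> S" for i unfolding S_def using c0 by (intro member_le_sum) auto
  then show ?case using l1bd_mono[OF c] by simp
 next
  case (Suc n)
  then show ?case using step[of "S / 2 ^ n"] S by (simp add: mult.commute)
 qed
 have "wnorm T \<nu> (\<phi> i) = 0" for i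
 proof -
  have "wnorm T \<nu> (\<phi> i) \<le> ennreal (S / 2 ^ n)" for n using l1bd_rep[OF it[rule_format] rep] .
  moreover have "(\<lambda>n. ennreal (S / 2 ^ n)) \<longlonglongrightarrow> ennreal 0" by (intro tendsto_ennrealI) real_asymp
  ultimately have "wnorm T \<nu> (\<phi> i) \<le> ennreal 0" by (intro LIMSEQ_le_const) auto
  then show ?thesis by simp
 qed
 then have "AE t in lborel. ennreal (indicat_real {0..T} t * exp (- \<nu> * t) * norm (\<phi> i t)) = 0" for i
  unfolding wnorm_def using ray_repD(1)[OF rep] by (subst (asm) nn_integral_0_iff_AE) measurable
 then have "AE t in lebesgue. t \<in> {0..T} \<longrightarrow> D i (rp th t) = 0" for i
  using ray_repD(3)[OF rep[of i]] AE_completion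
 proof -
  have "AE t in lebesgue. ennreal (indicat_real {0..T} t * exp (- \<nu> * t) * norm (\<phi> i t)) = 0"
   by (rule AE_completion) fact
  then show ?thesis using ray_repD(3)[OF rep[of i]] by eventually_elim (auto simp: indicator_def ennreal_eq_0_iff mult_le_0_iff)
 qed
 then have "AE t in lebesgue. \<forall>i\<in>UNIV. t \<in> {0..T} \<longrightarrow> D i (rp th t) = 0"
  by (intro AE_finite_allI) auto
 then show ?thesis by eventually_elim auto
qed

lemma AE_ray_all_T: assumes "\<And>T. T \<ge> 0 \<Longrightarrow> AE t in lebesgue. t \<in> {0..T} \<longrightarrow> P (rp th t)"
 shows "AE_ray th P"
proof -
 have "AE t in lebesgue. \<forall>n::nat. t \<in> {0..real n} \<longrightarrow> P (rp th t)"
  unfolding AE_all_countable using assms by auto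
 then show ?thesis unfolding AE_ray_def by eventually_elim (meson atLeastAtMost_iff real_arch_simple)
qed

lemma l1bd_one: "T \<ge> 0 \<Longrightarrow> \<nu> > 0 \<Longrightarrow> l1bd th T \<nu> (\<lambda>_. 1) (1 / \<nu>)"
 using rep_l1bd[OF ray_rep_continuous[of th "\<lambda>_. 1"] wnorm_exp_le[of T _ 1 0 \<nu>]] by (simp add: indicator_def)

lemma (in coeff_bound) Gl_rep: "\<exists>\<phi>. ray_rep th (Gl gc l i) \<phi>"
proof -
 have "Gl gc l i holomorphic_on UNIV" using Gl_props(1)[OF \<rho>, of gc l i "K l" UNIV] gcK by (simp add: HD_def)
 then have "continuous_on (ray th) (Gl gc l i)" using continuous_on_subset holomorphic_on_imp_continuous_on by blast
 then show ?thesis by (blast intro: ray_rep_continuous)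
qed

text \<open>Young's inequality loses nothing, whence \<open>\<tau> = 1\<close>;
  \<open>K l * \<eta>\<close> bounds the weighted norm of the kernel \<open>Gl\<close>.\<close>

lemma (in coeff_bound) l1_conv_bound: assumes T: "T \<ge> 0" and \<nu>: "\<nu> > 1 / \<rho>"
 shows "conv_bound (\<lambda>f. \<exists>\<phi>. ray_rep th f \<phi>) (l1bd th T \<nu>) 1 (1 / (\<rho> * (\<nu> - 1 / \<rho>))) \<rho> K gc"
proof
 show "(0::real) \<le> 1" "0 \<le> 1 / (\<rho> * (\<nu> - 1 / \<rho>))" using \<rho> \<nu> by simp_all
 show "\<rho> > 0" "\<And>l. K l \<ge> 0" "(\<lambda>l. wt K \<rho> l) summable_on UNIV" by (fact \<rho> K0 Ksum)+
 show "norm (gc 0 l $ i) \<le> K l" for l i using gcK[of 0] by simp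
 show "\<exists>\<phi>. ray_rep th (conv f g) \<phi>" if "\<exists>\<phi>. ray_rep th f \<phi>" "\<exists>\<phi>. ray_rep th g \<phi>" for f g
  using that ray_rep_conv by blast
 show "\<exists>\<phi>. ray_rep th (Gl gc l i) \<phi>" for l i by (rule Gl_rep)
 show "\<exists>\<phi>. ray_rep th (\<lambda>_. 0) \<phi>" using ray_rep_zero by blast
 show "\<exists>\<phi>. ray_rep th (\<lambda>p. a * f p) \<phi>" if "\<exists>\<phi>. ray_rep th f \<phi>" for f a using that ray_rep_cmult by blast
 show "0 \<le> c" if "l1bd th T \<nu> f c" for f c using that by (simp add: l1bd_def)
 show "l1bd th T \<nu> (\<lambda>_. 0) 0" by (rule l1bd_zero)
 show "l1bd th T \<nu> f d" if "l1bd th T \<nu> f c" "c \<le> d" for f c d using that by (rule l1bd_mono)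
 show "l1bd th T \<nu> (\<lambda>p. f p + g p) (c + d)" if "l1bd th T \<nu> f c" "l1bd th T \<nu> g d" for f g c d using that by (rule l1bd_add)
 show "l1bd th T \<nu> (\<lambda>p. a * f p) (norm a * c)" if "l1bd th T \<nu> f c" for f a c using that by (rule l1bd_cmult)
 show "l1bd th T \<nu> (\<lambda>p. conv f g p - conv f' g' p) (1 * (c1 * d + c * d1))"
  if "\<exists>\<phi>. ray_rep th f \<phi>" "\<exists>\<phi>. ray_rep th g \<phi>" "\<exists>\<phi>. ray_rep th f' \<phi>" "\<exists>\<phi>. ray_rep th g' \<phi>"
   "l1bd th T \<nu> (\<lambda>p. f p - f' p) c1" "l1bd th T \<nu> g d" "l1bd th T \<nu> f' c" "l1bd th T \<nu> (\<lambda>p. g p - g' p) d1"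
  for f g f' g' c1 d c d1 using that l1bd_conv_diff by force
 show "l1bd th T \<nu> (\<lambda>p. conv (Gl gc l i) f p - conv (Gl gc l i) f' p) (K l * (1 / (\<rho> * (\<nu> - 1 / \<rho>))) * c)"
  if f: "\<exists>\<phi>. ray_rep th f \<phi>" "\<exists>\<phi>. ray_rep th f' \<phi>" and c: "l1bd th T \<nu> (\<lambda>p. f p - f' p) c" for f f' c l i
 proof -
  obtain \<phi> \<phi>' \<psi> where r: "ray_rep th f \<phi>" "ray_rep th f' \<phi>'" "ray_rep th (Gl gc l i) \<psi>" using f Gl_rep by blast
  have "norm (Gl gc l i (rp th t)) \<le> K l / \<rho> * exp (1 / \<rho> * t)" if "t \<ge> 0" for t
   using Gl_props(2)[OF \<rho> gcK, where l = l and i = i and p = "of_real t * cis th"] that by (simp add: norm_mult)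
  note bG = this
  obtain d where d: "l1bd th T \<nu> f d" using l1bd_finite[OF r(1)] .
  have G: "l1bd th T \<nu> (Gl gc l i) (K l / \<rho> / (\<nu> - 1 / \<rho>))"
  proof (rule rep_l1bd[OF ray_rep_continuous wnorm_exp_le])
   show "continuous_on (ray th) (Gl gc l i)"
    using Gl_props(1)[OF \<rho>, of gc l i "K l" UNIV] gcK continuous_on_subset holomorphic_on_imp_continuous_on
    by (simp add: HD_def) blast
  qed (use bG K0 \<rho> \<nu> T in \<open>auto simp: indicator_def\<close>)
  have "l1bd th T \<nu> (\<lambda>p. conv (Gl gc l i) f p - conv (Gl gc l i) f' p) (0 * d + K l / \<rho> / (\<nu> - 1 / \<rho>) * c)"
   using l1bd_conv_diff[OF r(3,1,3,2) _ d G c, of 0] l1bd_zero by simp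
  then show ?thesis by (simp add: mult_ac)
 qed
 show "l1bd th T \<nu> (\<lambda>p. (\<Sum>\<^sub>\<infinity>l\<in>S. h l p) - (\<Sum>\<^sub>\<infinity>l\<in>S. h' l p)) (\<Sum>\<^sub>\<infinity>l\<in>S. d l)"
  if "\<And>l. l \<in> S \<Longrightarrow> l1bd th T \<nu> (h l) (A l)" "\<And>l. l \<in> S \<Longrightarrow> l1bd th T \<nu> (h' l) (A l)"
   "\<And>l. l \<in> S \<Longrightarrow> l1bd th T \<nu> (\<lambda>p. h l p - h' l p) (d l)" "A summable_on S" "d summable_on S"
  for S :: "('n \<Rightarrow> nat) set" and h h' A d using l1bd_infsum[OF that] .
qed

section \<open>Almost everywhere statements on a ray\<close>

lemma AE_rayI: "(\<And>p. p \<in> ray th \<Longrightarrow> P p) \<Longrightarrow> AE_ray th P"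
 unfolding AE_ray_def by (intro AE_I2) (auto simp: ray_def)

lemma AE_ray_mp:
 assumes "AE_ray th P" "AE_ray th Q" "\<And>p. p \<in> ray th \<Longrightarrow> P p \<Longrightarrow> Q p \<Longrightarrow> R p"
 shows "AE_ray th R" using assms(1,2) unfolding AE_ray_def by eventually_elim (use assms(3) in \<open>auto simp: ray_def\<close>)

lemma AE_ray_mono: "AE_ray th P \<Longrightarrow> (\<And>p. p \<in> ray th \<Longrightarrow> P p \<Longrightarrow> R p) \<Longrightarrow> AE_ray th R"
 using AE_ray_mp[of th P P R] by blast

lemma AE_ray_all: "(\<And>x. AE_ray th (P x)) \<Longrightarrow> AE_ray th (\<lambda>p. \<forall>x::'a::countable. P x p)"
 unfolding AE_ray_def using AE_all_countable[of "\<lambda>x t. 0 \<le> t \<longrightarrow> P x (rp th t)" lebesgue] by auto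

lemma AE_ray_Ball: "finite S \<Longrightarrow> (\<And>x. x \<in> S \<Longrightarrow> AE_ray th (P x)) \<Longrightarrow> AE_ray th (\<lambda>p. \<forall>x\<in>S. P x p)"
 unfolding AE_ray_def using AE_finite_allI[of S "\<lambda>x t. 0 \<le> t \<longrightarrow> P x (rp th t)" lebesgue] by auto

lemma AE_ray_fin: "(\<And>i. AE_ray th (P i)) \<Longrightarrow> AE_ray th (\<lambda>p. \<forall>i::'i::finite. P i p)"
 using AE_ray_Ball[of UNIV th P] by simp

lemma AE_ray_neq_0: "AE_ray th (\<lambda>p. p \<noteq> 0)"
proof -
 have "AE t in lebesgue. t \<noteq> (0::real)" by (simp add: AE_completion_iff AE_lborel_singleton)
 then show ?thesis unfolding AE_ray_def by eventually_elim auto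
qed

lemma L1loc_rep: assumes "L1loc th Y" shows "\<exists>\<phi>. ray_rep th (\<lambda>p. Y p $ i) \<phi>"
proof -
 have "set_integrable lebesgue {0..T} (\<lambda>t. Y (rp th t) $ i)" for T
  using integrable_bounded_linear[OF bounded_linear_vec_nth[of i]] assms unfolding L1loc_def set_integrable_def by force
 then show ?thesis using ray_rep_exists[of "\<lambda>p. Y p $ i" th] by blast
qed

lemma rep_L1loc:
 assumes "\<And>i. \<exists>\<phi>. ray_rep th (\<lambda>p. Y p $ i) \<phi>" shows "L1loc th (Y :: complex \<Rightarrow> 'n::finite cvec)"
 unfolding L1loc_def
proof
 fix T
 have "set_integrable lebesgue {0..T} (\<lambda>t. axis i (Y (rp th t) $ i) :: 'n cvec)" for i
 proof -
  obtain \<phi> where "ray_rep th (\<lambda>p. Y p $ i) \<phi>" using assms by blast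
  from ray_rep_integrable[OF this, of T]
  have i: "integrable lebesgue (\<lambda>t. indicat_real {0..T} t *\<^sub>R Y (rp th t) $ i)" by (simp add: set_integrable_def)
  have lin: "bounded_linear (axis i :: complex \<Rightarrow> 'n cvec)"
   by (auto simp: axis_def vec_eq_iff intro!: linear_conv_bounded_linear[THEN iffD1] linearI)
  have ax: "axis i (c *\<^sub>R z) = c *\<^sub>R (axis i z :: 'n cvec)" for c z by (simp add: axis_def vec_eq_iff)
  show ?thesis using integrable_bounded_linear[OF lin i] by (simp add: set_integrable_def ax)
 qed
 then have "set_integrable lebesgue {0..T} (\<lambda>t. \<Sum>i\<in>UNIV. axis i (Y (rp th t) $ i) :: 'n cvec)"
  unfolding set_integrable_def scaleR_sum_right by (intro Bochner_Integration.integrable_sum) auto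
 moreover have "(\<Sum>i\<in>UNIV. axis i (y $ i)) = y" for y :: "'n cvec"
  by (simp add: vec_eq_iff axis_def if_distrib sum.delta cong: if_cong)
 ultimately show "set_integrable lebesgue {0..T} (\<lambda>t. Y (rp th t))" by simp
qed

section \<open>Uniqueness by contraction in weighted L1 norms\<close>

lemma ray_lower_bound: fixes \<mu> :: "'i::finite \<Rightarrow> complex"
 assumes "\<And>i. \<mu> i \<notin> (\<lambda>t. of_real t * cis th) ` {s..T}" "s \<le> T"
 obtains d where "d > 0" "\<And>i t. t \<in> {s..T} \<Longrightarrow> d \<le> norm (\<mu> i - of_real t * cis th)"
 by (rule compact_lower_bound[of "(\<lambda>t. of_real t * cis th) ` {s..T}" \<mu>])
  (use assms that in \<open>auto intro!: compact_continuous_image continuous_intros\<close>)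

text \<open>Large \<open>\<nu>\<close> makes both the integration and the kernels small in norm. An
  inequality is assumed in place of the equation so that intervals where \<open>D\<close> is already
  0 are covered even if the factor of the equation has a zero there.\<close>

lemma linear_zero: fixes D :: "'i::finite \<Rightarrow> complex \<Rightarrow> complex"
 assumes rep: "\<And>i. ray_rep th (D i) (\<phi> i)" and \<delta>: "\<And>i j. \<exists>\<psi>. ray_rep th (\<delta> i j) \<psi>" and M: "M \<ge> 0" and T: "T \<ge> 0"
  and ae: "AE t in lebesgue. t \<in> {0..T} \<longrightarrow> (\<forall>i. norm (D i (rp th t)) \<le>
   M * norm (b i * seg_int (D i) (rp th t) - (\<Sum>j\<in>UNIV. conv (D j) (\<delta> i j) (rp th t))))"
 shows "AE t in lebesgue. t \<in> {0..T} \<longrightarrow> (\<forall>i. D i (rp th t) = 0)"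
proof -
 define N where "N = real CARD('i)"
 define B where "B = (\<Sum>i\<in>UNIV. norm (b i))"
 have B: "norm (b i) \<le> B" for i unfolding B_def by (intro member_le_sum) auto
 have N: "N > 0" by (simp add: N_def)
 \<comment> \<open>The \<open>N\<close> kernels with the factor \<open>M\<close> stay below
   \<open>1 / 4\<close>; the choice of \<open>\<nu>\<close> leaves another \<open>1 / 4\<close> to
   the integral.\<close>
 define e where "e = 1 / (4 * N * (M + 1))"
 have e: "e > 0" using N M by (simp add: e_def)
 have "\<exists>\<nu>0. \<forall>x\<in>UNIV. \<forall>\<nu>\<ge>\<nu>0. l1bd th T \<nu> (case x of (i, j) \<Rightarrow> \<delta> i j) e"
  using \<delta> e by (intro l1bd_small_finite) auto
 then obtain \<nu>0 where \<nu>0: "\<And>i j \<nu>. \<nu> \<ge> \<nu>0 \<Longrightarrow> l1bd th T \<nu> (\<delta> i j) e" by fastforce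
 define \<nu> where "\<nu> = max \<nu>0 (4 * B * M + 1)"
 have B0: "B \<ge> 0" using B norm_ge_zero order_trans by blast
 have \<nu>: "\<nu> > 0" "\<nu> \<ge> \<nu>0" "M * (B * (1 / \<nu>)) \<le> 1 / 4"
 proof -
  have "4 * B * M + 1 \<le> \<nu>" by (simp add: \<nu>_def)
  moreover have "0 \<le> 4 * B * M" using B0 M by simp
  ultimately show "\<nu> > 0" by linarith
  then show "M * (B * (1 / \<nu>)) \<le> 1 / 4" using \<open>4 * B * M + 1 \<le> \<nu>\<close> by (simp add: field_simps)
 qed (simp add: \<nu>_def)
 have "M * (N * e) = M / (M + 1) / 4" using N by (simp add: e_def)
 also have "\<dots> \<le> 1 / 4" using M by (intro divide_right_mono) (auto simp: divide_le_eq)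
 finally have Me: "M * (N * e) \<le> 1 / 4" .
 have one: "ray_rep th (\<lambda>_. 1) (\<lambda>t. indicat_real {0..} t *\<^sub>R 1)" by (rule ray_rep_continuous) auto
 show ?thesis
 proof (rule l1_contraction_zero[where D = D, OF rep], rule allI)
  fix \<epsilon> :: real and i assume \<epsilon>: "\<epsilon> \<ge> 0" and D: "\<And>i. l1bd th T \<nu> (D i) \<epsilon>"
  have 1: "l1bd th T \<nu> (\<lambda>p. b i * seg_int (D i) p) (B * (\<epsilon> * (1 / \<nu>)))" unfolding seg_int_eq_conv
  proof (rule l1bd_mono[OF l1bd_cmult[OF l1bd_conv[OF rep one D l1bd_one[OF T \<nu>(1)]]]])
   show "norm (b i) * (\<epsilon> * (1 / \<nu>)) \<le> B * (\<epsilon> * (1 / \<nu>))" using B \<epsilon> \<nu> by (intro mult_right_mono) auto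
  qed
  have 2: "l1bd th T \<nu> (\<lambda>p. \<Sum>j\<in>UNIV. conv (D j) (\<delta> i j) p) (\<Sum>j\<in>(UNIV::'i set). \<epsilon> * e)"
  proof (rule l1bd_sum)
   fix j obtain \<psi> where "ray_rep th (\<delta> i j) \<psi>" using \<delta> by blast
   then show "l1bd th T \<nu> (conv (D j) (\<delta> i j)) (\<epsilon> * e)" using rep D \<nu>0[OF \<nu>(2)] by (intro l1bd_conv) auto
  qed
  have "l1bd th T \<nu> (\<lambda>p. of_real M * (b i * seg_int (D i) p + (- 1) * (\<Sum>j\<in>UNIV. conv (D j) (\<delta> i j) p)))
   (norm (of_real M :: complex) * (B * (\<epsilon> * (1 / \<nu>)) + norm (- 1 :: complex) * (\<Sum>j\<in>(UNIV::'i set). \<epsilon> * e)))"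
   by (intro l1bd_cmult l1bd_add 1 2)
  then have "l1bd th T \<nu> (D i) (norm (of_real M :: complex) * (B * (\<epsilon> * (1 / \<nu>)) + norm (- 1 :: complex) * (\<Sum>j\<in>(UNIV::'i set). \<epsilon> * e)))"
   by (rule l1bd_mono_AE) (use ae M in \<open>eventually_elim, auto simp: norm_mult\<close>)
  then show "l1bd th T \<nu> (D i) (\<epsilon> / 2)"
  proof (rule l1bd_mono)
   have "norm (of_real M :: complex) * (B * (\<epsilon> * (1 / \<nu>)) + norm (- 1 :: complex) * (\<Sum>j\<in>(UNIV::'i set). \<epsilon> * e))
    = \<epsilon> * (M * (B * (1 / \<nu>)) + M * (N * e))" using M by (simp add: N_def algebra_simps)
   also have "\<dots> \<le> \<epsilon> * (1 / 4 + 1 / 4)" by (intro mult_left_mono add_mono \<nu>(3) Me \<epsilon>)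
   finally show "norm (of_real M :: complex) * (B * (\<epsilon> * (1 / \<nu>)) + norm (- 1 :: complex) * (\<Sum>j\<in>(UNIV::'i set). \<epsilon> * e)) \<le> \<epsilon> / 2" by simp
  qed
 qed
qed

context conv_system begin

lemma conv_eq_unique: assumes ray: "\<And>i. lam $ i \<notin> ray th"
  and Y: "\<And>i. \<exists>\<phi>. ray_rep th (\<lambda>p. Y p $ i) \<phi>" and Z: "\<And>i. \<exists>\<phi>. ray_rep th (\<lambda>p. Z p $ i) \<phi>"
  and eqY: "solves_conv_eq lam b fc gc th Y" and eqZ: "solves_conv_eq lam b fc gc th Z" shows "AE_ray th (\<lambda>p. Z p = Y p)"
proof (rule AE_ray_all_T)
 fix T :: real assume T: "T \<ge> 0"
 obtain \<phi>Y where \<phi>Y: "\<And>i. ray_rep th (\<lambda>p. Y p $ i) (\<phi>Y i)" using Y by metis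
 obtain \<phi>Z where \<phi>Z: "\<And>i. ray_rep th (\<lambda>p. Z p $ i) (\<phi>Z i)" using Z by metis
 obtain d where d: "d > 0" "\<And>i t. t \<in> {0..T} \<Longrightarrow> d \<le> norm (lam $ i - of_real t * cis th)"
  using ray T by (rule_tac ray_lower_bound[of "\<lambda>i. lam $ i" th 0 T]) (auto simp: ray_def)
 define S where "S = (\<Sum>\<^sub>\<infinity>l. wt K \<rho> l)"
 define B where "B = (\<Sum>i\<in>UNIV. norm (b $ i))"
 have B: "norm (b $ i) \<le> B" for i unfolding B_def by (intro member_le_sum) auto
 have S: "S \<ge> 0" unfolding S_def using K0 \<rho> by (intro infsum_nonneg) auto
 \<comment> \<open>The quadratic part gets \<open>d / 4\<close>, and \<open>\<nu>\<close> is chosen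
   afterwards for the remaining \<open>d / 4\<close>. \<open>Y\<close> and \<open>Z\<close> are
   arbitrary solutions; raising \<open>\<nu>\<close> brings their norms below
   \<open>\<kappa>\<close>.\<close>
 define \<kappa> where "\<kappa> = min (\<rho> / 4) (d * \<rho>\<^sup>2 / (8 * (S + 1)))"
 have \<kappa>: "\<kappa> > 0" "\<kappa> \<le> \<rho> / 4" unfolding \<kappa>_def using d S \<rho> by simp (rule min.cobounded1)
 have "S * (2 * \<kappa> / \<rho>\<^sup>2) \<le> d / 4"
 proof -
  have "\<kappa> \<le> d * \<rho>\<^sup>2 / (8 * (S + 1))" by (simp add: \<kappa>_def)
  then have "\<kappa> * (8 * (S + 1)) \<le> d * \<rho>\<^sup>2" using S by (simp add: field_simps)
  moreover have "\<kappa> * (8 * S) \<le> \<kappa> * (8 * (S + 1))" using \<kappa> by (intro mult_left_mono) auto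
  ultimately show ?thesis using \<rho> by (simp add: field_simps)
 qed
 note S\<kappa> = this
 have "\<exists>\<nu>0. \<forall>i\<in>UNIV. \<forall>\<nu>\<ge>\<nu>0. l1bd th T \<nu> (\<lambda>p. Y p $ i) \<kappa>" "\<exists>\<nu>0. \<forall>i\<in>UNIV. \<forall>\<nu>\<ge>\<nu>0. l1bd th T \<nu> (\<lambda>p. Z p $ i) \<kappa>"
  using Y Z \<kappa> by (intro l1bd_small_finite; auto)+
 then obtain \<nu>1 \<nu>2 where \<nu>12: "\<And>i \<nu>. \<nu> \<ge> \<nu>1 \<Longrightarrow> l1bd th T \<nu> (\<lambda>p. Y p $ i) \<kappa>" "\<And>i \<nu>. \<nu> \<ge> \<nu>2 \<Longrightarrow> l1bd th T \<nu> (\<lambda>p. Z p $ i) \<kappa>"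
  by blast
 have "((\<lambda>\<nu>. B / \<nu> + S * (1 / (\<rho> * (\<nu> - 1 / \<rho>)) / \<rho>)) \<longlongrightarrow> 0) at_top" using \<rho> by real_asymp
 then have "eventually (\<lambda>\<nu>. B / \<nu> + S * (1 / (\<rho> * (\<nu> - 1 / \<rho>)) / \<rho>) < d / 4) at_top"
  using d by (intro order_tendstoD(2)) auto
 from eventually_conj[OF this eventually_ge_at_top[of "max \<nu>1 (max \<nu>2 (1 / \<rho> + 1))"]]
 obtain \<nu> where \<nu>: "B / \<nu> + S * (1 / (\<rho> * (\<nu> - 1 / \<rho>)) / \<rho>) < d / 4" "\<nu> \<ge> \<nu>1" "\<nu> \<ge> \<nu>2" "\<nu> > 1 / \<rho>"
  unfolding eventually_at_top_linorder by force
 have \<nu>0: "\<nu> > 0" using \<nu>(4) \<rho> by (meson less_trans zero_less_divide_1_iff)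
 interpret L: conv_bound "\<lambda>f. \<exists>\<phi>. ray_rep th f \<phi>" "l1bd th T \<nu>" 1 "1 / (\<rho> * (\<nu> - 1 / \<rho>))" \<rho> K gc
  by (rule l1_conv_bound[OF T \<nu>(4)])
 have one: "ray_rep th (\<lambda>_. 1) (\<lambda>t. indicat_real {0..} t *\<^sub>R 1)" by (rule ray_rep_continuous) auto
 have "AE t in lebesgue. t \<in> {0..T} \<longrightarrow> (\<forall>i. Y (rp th t) $ i - Z (rp th t) $ i = 0)"
 proof (rule l1_contraction_zero[where D = "\<lambda>i p. Y p $ i - Z p $ i", OF ray_rep_diff[OF \<phi>Y \<phi>Z]], rule allI)
  fix \<epsilon> :: real and i assume \<epsilon>: "\<epsilon> \<ge> 0" and D: "\<And>i. l1bd th T \<nu> (\<lambda>p. Y p $ i - Z p $ i) \<epsilon>"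
  have 1: "l1bd th T \<nu> (\<lambda>p. Nop gc Y p i - Nop gc Z p i) (S * (1 / (\<rho> * (\<nu> - 1 / \<rho>)) / \<rho> + 2 * (1 * \<kappa>) / \<rho>\<^sup>2) * \<epsilon>)"
   unfolding S_def using \<kappa> Y Z \<nu>12 \<nu>(2,3) D by (intro L.Nop_lipschitz) auto
  have "l1bd th T \<nu> (\<lambda>p. seg_int (\<lambda>s. Y s $ i) p - seg_int (\<lambda>s. Z s $ i) p) (\<epsilon> * (1 / \<nu>) + \<kappa> * 0)"
   unfolding seg_int_eq_conv using l1bd_zero \<nu>12 \<nu>(2,3)
   by (intro l1bd_conv_diff[OF \<phi>Y one \<phi>Z one] D l1bd_one T \<nu>0) auto
  then have 2: "l1bd th T \<nu> (\<lambda>p. (- b $ i) * (seg_int (\<lambda>s. Y s $ i) p - seg_int (\<lambda>s. Z s $ i) p)) (B * (\<epsilon> * (1 / \<nu>)))"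
   using B[of i] by (intro L.bd_scale_mono) auto
  have "l1bd th T \<nu> (\<lambda>p. of_real (1 / d) * ((- b $ i) * (seg_int (\<lambda>s. Y s $ i) p - seg_int (\<lambda>s. Z s $ i) p) + (Nop gc Y p i - Nop gc Z p i)))
   (norm (of_real (1 / d) :: complex) * (B * (\<epsilon> * (1 / \<nu>)) + S * (1 / (\<rho> * (\<nu> - 1 / \<rho>)) / \<rho> + 2 * (1 * \<kappa>) / \<rho>\<^sup>2) * \<epsilon>))"
   by (intro l1bd_cmult l1bd_add 1 2)
  then have "l1bd th T \<nu> (\<lambda>p. Y p $ i - Z p $ i)
   (norm (of_real (1 / d) :: complex) * (B * (\<epsilon> * (1 / \<nu>)) + S * (1 / (\<rho> * (\<nu> - 1 / \<rho>)) / \<rho> + 2 * (1 * \<kappa>) / \<rho>\<^sup>2) * \<epsilon>))"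
  proof (rule l1bd_mono_AE)
   show "AE t in lebesgue. t \<in> {0..T} \<longrightarrow> norm (Y (rp th t) $ i - Z (rp th t) $ i) \<le>
    norm (of_real (1 / d) * ((- b $ i) * (seg_int (\<lambda>s. Y s $ i) (rp th t) - seg_int (\<lambda>s. Z s $ i) (rp th t)) +
     (Nop gc Y (rp th t) i - Nop gc Z (rp th t) i)))"
    using eqY[unfolded solves_conv_eq_def AE_ray_def] eqZ[unfolded solves_conv_eq_def AE_ray_def]
   proof eventually_elim
    case (elim t)
    define p where "p = of_real t * cis th"
    show ?case unfolding p_def[symmetric]
    proof
     assume t: "t \<in> {0..T}"
     define R where "R = (- b $ i) * (seg_int (\<lambda>s. Y s $ i) p - seg_int (\<lambda>s. Z s $ i) p) + (Nop gc Y p i - Nop gc Z p i)"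
     have "- p * Y p $ i = F0 fc p i - lam $ i * Y p $ i - b $ i * seg_int (\<lambda>s. Y s $ i) p + Nop gc Y p i"
      "- p * Z p $ i = F0 fc p i - lam $ i * Z p $ i - b $ i * seg_int (\<lambda>s. Z s $ i) p + Nop gc Z p i"
      using elim t by (auto simp: p_def)
     then have "(lam $ i - p) * (Y p $ i - Z p $ i) = R" unfolding R_def by algebra
     then have "norm (lam $ i - p) * norm (Y p $ i - Z p $ i) = norm R" by (metis norm_mult)
     moreover have "d * norm (Y p $ i - Z p $ i) \<le> norm (lam $ i - p) * norm (Y p $ i - Z p $ i)"
      using d(2)[OF t, of i] by (intro mult_right_mono) (auto simp: p_def)
     ultimately show "norm (Y p $ i - Z p $ i) \<le> norm (of_real (1 / d) * R)"
      using d(1) by (simp add: norm_mult norm_divide field_simps)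
    qed
   qed
  qed
  then show "l1bd th T \<nu> (\<lambda>p. Y p $ i - Z p $ i) (\<epsilon> / 2)"
  proof (rule l1bd_mono)
   have "norm (of_real (1 / d) :: complex) * (B * (\<epsilon> * (1 / \<nu>)) + S * (1 / (\<rho> * (\<nu> - 1 / \<rho>)) / \<rho> + 2 * (1 * \<kappa>) / \<rho>\<^sup>2) * \<epsilon>)
    = 1 / d * ((B / \<nu> + S * (1 / (\<rho> * (\<nu> - 1 / \<rho>)) / \<rho>)) + S * (2 * \<kappa> / \<rho>\<^sup>2)) * \<epsilon>"
    using d(1) by (simp add: norm_divide algebra_simps)
   also have "\<dots> \<le> 1 / d * (d / 4 + d / 4) * \<epsilon>"
    using d(1) \<nu>(1) S\<kappa> \<epsilon> by (intro mult_right_mono mult_left_mono add_mono) auto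
   also have "\<dots> = \<epsilon> / 2" using d(1) by (simp add: field_simps)
   finally show "norm (of_real (1 / d) :: complex) * (B * (\<epsilon> * (1 / \<nu>)) + S * (1 / (\<rho> * (\<nu> - 1 / \<rho>)) / \<rho> + 2 * (1 * \<kappa>) / \<rho>\<^sup>2) * \<epsilon>) \<le> \<epsilon> / 2" .
  qed
 qed
 then show "AE t in lebesgue. t \<in> {0..T} \<longrightarrow> Z (rp th t) = Y (rp th t)"
  by eventually_elim (auto simp: vec_eq_iff)
qed

end

section \<open>Independence of representatives and homogeneity of the hierarchy\<close>

definition ae_mult :: "real \<Rightarrow> complex \<Rightarrow> dfun \<Rightarrow> dfun \<Rightarrow> bool"
 where "ae_mult th c F G \<longleftrightarrow> fst F = c * fst G \<and> AE_ray th (\<lambda>p. snd F p = c * snd G p)"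

text \<open>Used with factor 1 for independence of the representative, and with powers of
  \<open>C\<close> for homogeneity.\<close>

lemma ae_mult_dconv: assumes "ae_mult th c F G" "ae_mult th d F' G'" shows "ae_mult th (c * d) (dconv F F') (dconv G G')"
 unfolding ae_mult_def dconv_def fst_conv snd_conv
proof
 have cv: "conv (snd F) (snd F') p = c * (d * conv (snd G) (snd G') p)" if p: "p \<in> ray th" for p
  using conv_cong_ray[of th "snd F" "\<lambda>p. c * snd G p" "snd F'" "\<lambda>p. d * snd G' p", OF _ _ p] assms
  by (simp add: ae_mult_def conv_cmult)
 have 1: "AE_ray th (\<lambda>p. snd F p = c * snd G p)" "AE_ray th (\<lambda>p. snd F' p = d * snd G' p)"
  using assms by (simp_all add: ae_mult_def)
 show "AE_ray th (\<lambda>p. fst F * snd F' p + fst F' * snd F p + conv (snd F) (snd F') p =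
  c * d * (fst G * snd G' p + fst G' * snd G p + conv (snd G) (snd G') p))"
  by (rule AE_ray_mp[OF 1]) (use assms in \<open>simp add: cv ae_mult_def algebra_simps\<close>)
 show "fst F * fst F' = c * d * (fst G * fst G')" using assms by (simp add: ae_mult_def)
qed

lemma ae_mult_refl: "ae_mult th 1 F F" by (simp add: ae_mult_def AE_rayI)

lemma ae_mult_foldr:
 "(\<And>x. x \<in> set xs \<Longrightarrow> ae_mult th (c x) (F x) (G x)) \<Longrightarrow>
  ae_mult th (prod_list (map c xs)) (foldr dconv (map F xs) E) (foldr dconv (map G xs) E)"
 by (induction xs) (auto intro: ae_mult_refl ae_mult_dconv)

lemma ae_mult_conv_prod: assumes "\<And>i j. j \<in> {1..l i} \<Longrightarrow> AE_ray th (\<lambda>p. f i j p = c i j * g i j p)"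
 shows "ae_mult th (\<Prod>i\<in>UNIV. \<Prod>j\<in>{1..l i}. c i j) (conv_prod l f) (conv_prod l g)"
 unfolding conv_prod_idx prod_list_idx[symmetric]
 by (rule ae_mult_foldr) (use assms in \<open>auto simp: set_idx ae_mult_def\<close>)

lemma ae_mult_conv_pow: assumes "AE_ray th (\<lambda>p. Y p = Z p)" shows "ae_mult th 1 (conv_pow Y l) (conv_pow Z l)"
proof -
 have "AE_ray th (\<lambda>p. Y p $ i = 1 * Z p $ i)" for i by (rule AE_ray_mono[OF assms]) simp
 then show ?thesis unfolding conv_pow_def using ae_mult_conv_prod[where c = "\<lambda>_ _. 1" and l = l and f = "\<lambda>i j p. Y p $ i" and g = "\<lambda>i j p. Z p $ i"] by simp
qed

lemma ae_mult_dcoef: fixes Y Z :: "complex \<Rightarrow> 'n::{finite,linorder} cvec"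
 assumes "AE_ray th (\<lambda>p. Y p = Z p)" shows "ae_mult th 1 (dcoef gc Y m i) (dcoef gc Z m i)"
proof -
 define t where "t Y l = dconv (gc 0 l $ i, Gl gc l i) (conv_pow Y (\<lambda>j. l j - m j))" for Y :: "complex \<Rightarrow> 'n cvec" and l
 have d: "dcoef gc Y m i = (\<Sum>\<^sub>\<infinity>l\<in>{l. m \<le> l}. of_nat (mbinom l m) * fst (t Y l),
    \<lambda>p. \<Sum>\<^sub>\<infinity>l\<in>{l. m \<le> l}. of_nat (mbinom l m) * snd (t Y l) p)" for Y
  by (simp add: dcoef_def t_def Let_def)
 have t: "ae_mult th 1 (t Y l) (t Z l)" for l
  unfolding t_def using ae_mult_dconv[OF ae_mult_refl ae_mult_conv_pow[OF assms]] by simp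
 have "AE_ray th (\<lambda>p. \<forall>l. snd (t Y l) p = snd (t Z l) p)" using t by (intro AE_ray_all) (simp add: ae_mult_def)
 then have "AE_ray th (\<lambda>p. (\<Sum>\<^sub>\<infinity>l\<in>{l. m \<le> l}. of_nat (mbinom l m) * snd (t Y l) p) = (\<Sum>\<^sub>\<infinity>l\<in>{l. m \<le> l}. of_nat (mbinom l m) * snd (t Z l) p))"
  by (rule AE_ray_mono) simp
 moreover have "fst (t Y l) = fst (t Z l)" for l using t by (simp add: ae_mult_def)
 ultimately show ?thesis unfolding d ae_mult_def by simp
qed

lemma Nop_cong: fixes Y Z :: "complex \<Rightarrow> 'n::{finite,linorder} cvec"
 assumes "AE_ray th (\<lambda>p. Y p = Z p)" shows "AE_ray th (\<lambda>p. \<forall>i. Nop gc Y p i = Nop gc Z p i)"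
proof (rule AE_ray_fin)
 fix i
 have e: "AE_ray th (\<lambda>p. snd (conv_pow Y l) p = snd (conv_pow Z l) p)" for l
  using ae_mult_conv_pow[OF assms, of l] by (simp add: ae_mult_def)
 then have 1: "AE_ray th (\<lambda>p. \<forall>l. snd (conv_pow Y l) p = snd (conv_pow Z l) p)" by (rule AE_ray_all)
 have 2: "Gconv gc Y l i p = Gconv gc Z l i p" if "p \<in> ray th" for l p by (rule conv_cong_ray[OF AE_rayI e that]) simp
 show "AE_ray th (\<lambda>p. Nop gc Y p i = Nop gc Z p i)" by (rule AE_ray_mono[OF 1]) (simp add: Nop_def 2)
qed

lemma solves_conv_eq_cong: fixes Y Z :: "complex \<Rightarrow> 'n::{finite,linorder} cvec"
 assumes "AE_ray th (\<lambda>p. Y p = Z p)" "solves_conv_eq lam b fc gc th Z" shows "solves_conv_eq lam b fc gc th Y"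
proof -
 have s: "seg_int (\<lambda>s. Y s $ i) p = seg_int (\<lambda>s. Z s $ i) p" if "p \<in> ray th" for i p
  by (rule seg_int_cong_ray[OF AE_ray_mono[OF assms(1)] that]) simp
 have N: "AE_ray th (\<lambda>p. Y p = Z p \<and> (\<forall>i. Nop gc Y p i = Nop gc Z p i))"
  by (rule AE_ray_mp[OF assms(1) Nop_cong[OF assms(1)]]) simp
 show ?thesis unfolding solves_conv_eq_def by (rule AE_ray_mp[OF N assms(2)[unfolded solves_conv_eq_def]]) (simp add: s)
qed

definition hier_lhs where
 "hier_lhs lam b gc Y0 k D p i = (lam $ i - p - of_nat k) * D p $ i
    + b $ i * seg_int (\<lambda>s. D s $ i) p
    - (\<Sum>j\<in>UNIV. conv (\<lambda>s. D s $ j) (snd (dcoef gc Y0 (munit j) i)) p)"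

definition hier_rhs where
 "hier_rhs gc Y k p i = (\<Sum>\<^sub>\<infinity>l\<in>{l. msize l > 1}.
     snd (dconv (dcoef gc (Y 0) l i)
      (0, \<lambda>q. \<Sum>m\<in>compositions l k. snd (conv_prod l (\<lambda>i' j s. Y (m i' j) s $ i')) q)) p)"

lemma solves_hierarchy_eq:
 "solves_hierarchy lam b gc th Y k \<longleftrightarrow>
  AE_ray th (\<lambda>p. \<forall>i. hier_lhs lam b gc (Y 0) k (Y k) p i = hier_rhs gc Y k p i)"
 unfolding solves_hierarchy_def hier_lhs_def hier_rhs_def ..

lemma hier_lhs_cong: fixes Y Z D E :: "complex \<Rightarrow> 'n::{finite,linorder} cvec"
 assumes Y: "AE_ray th (\<lambda>p. Y p = Z p)" and D: "AE_ray th (\<lambda>p. D p = c *s E p)"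
 shows "AE_ray th (\<lambda>p. \<forall>i. hier_lhs lam b gc Y k D p i = c * hier_lhs lam b gc Z k E p i)"
proof (rule AE_ray_mono[OF D], intro allI)
 fix p i assume p: "p \<in> ray th" and Dp: "D p = c *s E p"
 have D1: "AE_ray th (\<lambda>p. D p $ j = c * E p $ j)" for j by (rule AE_ray_mono[OF D]) simp
 have s: "seg_int (\<lambda>s. D s $ i) p = c * seg_int (\<lambda>s. E s $ i) p"
  using seg_int_cong_ray[OF D1 p] by (simp add: seg_int_eq_conv conv_cmult)
 have "AE_ray th (\<lambda>p. snd (dcoef gc Y (munit j) i) p = snd (dcoef gc Z (munit j) i) p)" for j
  using ae_mult_dcoef[OF Y, of gc "munit j" i] by (simp add: ae_mult_def)
 then have c: "conv (\<lambda>s. D s $ j) (snd (dcoef gc Y (munit j) i)) p = c * conv (\<lambda>s. E s $ j) (snd (dcoef gc Z (munit j) i)) p" for j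
  using conv_cong_ray[OF D1 _ p] by (simp add: conv_cmult)
 show "hier_lhs lam b gc Y k D p i = c * hier_lhs lam b gc Z k E p i"
  unfolding hier_lhs_def s c Dp by (simp add: algebra_simps sum_distrib_left)
qed

text \<open>The parts of a composition add up to \<open>k\<close>, so each product scales by
  \<open>C^k\<close>. All parts are below \<open>k\<close>, which is why lower levels determine the
  right side.\<close>

lemma hier_rhs_cong: fixes Y Z :: "nat \<Rightarrow> complex \<Rightarrow> 'n::{finite,linorder} cvec"
 assumes k: "k \<ge> 1" and Z: "\<And>j. j < k \<Longrightarrow> AE_ray th (\<lambda>p. Z j p = C ^ j *s Y j p)"
 shows "AE_ray th (\<lambda>p. \<forall>i. hier_rhs gc Z k p i = C ^ k * hier_rhs gc Y k p i)"
proof (rule AE_ray_fin)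
 fix i
 have Z0: "AE_ray th (\<lambda>p. Z 0 p = Y 0 p)" by (rule AE_ray_mono[OF Z[of 0]]) (use k in auto)
 define W where "W Y l q = (\<Sum>m\<in>compositions l k. snd (conv_prod l (\<lambda>i' j s. Y (m i' j) s $ i')) q)"
  for Y :: "nat \<Rightarrow> complex \<Rightarrow> 'n cvec" and l q
 have "ae_mult th (C ^ k) (0, W Z l) (0, W Y l)" if l: "msize l > 1" for l
 proof -
  have "AE_ray th (\<lambda>q. \<forall>m\<in>compositions l k. snd (conv_prod l (\<lambda>i' j s. Z (m i' j) s $ i')) q
    = C ^ k * snd (conv_prod l (\<lambda>i' j s. Y (m i' j) s $ i')) q)"
  proof (rule AE_ray_Ball[OF finite_compositions])
   fix m assume m: "m \<in> compositions l k"
   have "ae_mult th (\<Prod>i\<in>UNIV. \<Prod>j\<in>{1..l i}. C ^ m i j) (conv_prod l (\<lambda>i' j s. Z (m i' j) s $ i')) (conv_prod l (\<lambda>i' j s. Y (m i' j) s $ i'))"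
   proof (rule ae_mult_conv_prod)
    fix i j assume j: "j \<in> {1..l i}"
    show "AE_ray th (\<lambda>p. Z (m i j) p $ i = C ^ m i j * Y (m i j) p $ i)"
     by (rule AE_ray_mono[OF Z[OF compositions_part(2)[OF m l j]]]) simp
   qed
   moreover have "(\<Prod>i\<in>UNIV. \<Prod>j\<in>{1..l i}. C ^ m i j) = C ^ k"
    using m by (simp add: compositions_def flip: power_sum)
   ultimately show "AE_ray th (\<lambda>q. snd (conv_prod l (\<lambda>i' j s. Z (m i' j) s $ i')) q
    = C ^ k * snd (conv_prod l (\<lambda>i' j s. Y (m i' j) s $ i')) q)" by (simp add: ae_mult_def)
  qed
  then have "AE_ray th (\<lambda>q. W Z l q = C ^ k * W Y l q)" by (rule AE_ray_mono) (simp add: W_def sum_distrib_left)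
  then show ?thesis by (simp add: ae_mult_def)
 qed
 from ae_mult_dconv[OF ae_mult_dcoef[OF Z0] this]
 have "AE_ray th (\<lambda>p. msize l > 1 \<longrightarrow> snd (dconv (dcoef gc (Z 0) l i) (0, W Z l)) p = C ^ k * snd (dconv (dcoef gc (Y 0) l i) (0, W Y l)) p)" for l
  by (cases "msize l > 1") (auto simp: ae_mult_def intro: AE_rayI)
 then have "AE_ray th (\<lambda>p. \<forall>l. msize l > 1 \<longrightarrow> snd (dconv (dcoef gc (Z 0) l i) (0, W Z l)) p = C ^ k * snd (dconv (dcoef gc (Y 0) l i) (0, W Y l)) p)"
  by (rule AE_ray_all)
 then show "AE_ray th (\<lambda>p. hier_rhs gc Z k p i = C ^ k * hier_rhs gc Y k p i)"
  unfolding hier_rhs_def W_def[symmetric] by (rule AE_ray_mono, subst infsum_cmult_right'[symmetric]) (auto intro!: infsum_cong)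
qed

lemma hier_rhs_1: "hier_rhs gc Y 1 p i = 0"
proof -
 have "compositions l 1 = {}" if "msize l > 1" for l :: "'a \<Rightarrow> nat"
 proof (rule ccontr)
  assume "compositions l 1 \<noteq> {}"
  then obtain m where m: "m \<in> compositions l 1" by blast
  have "l \<noteq> (\<lambda>_. 0)" using that by (auto simp: msize_def)
  then obtain i where "l i > 0" by auto
  then have "1 \<in> {1..l i}" by simp
  from compositions_part[OF m that this] show False by simp
 qed
 then show ?thesis unfolding hier_rhs_def by (intro infsum_0) (simp add: dconv_def)
qed

section \<open>The singular first level\<close>

text \<open>
 The first level of the hierarchy in real form: component \<open>i0\<close> satisfies
 \<open>t f = \<beta> \<integral> f - H\<close>, which is singular at 0 with homogeneous solution \<open>t^(\<beta> - 1)\<close>, and the other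
 components are regular. The limit of \<open>t^(-\<beta>) \<integral> f\<close> at 0 parametrizes the solutions.
\<close>

locale singular_system =
 fixes f :: "'i::finite \<Rightarrow> real \<Rightarrow> complex" and i0 :: 'i and \<beta> :: complex and H :: "real \<Rightarrow> complex" and C T :: real
 assumes T: "0 < T" "T \<le> 1" and C: "C \<ge> 0" "real CARD('i) * C * T \<le> 1 / 2" and \<beta>: "0 < Re \<beta>" "Re \<beta> \<le> 1"
  and int: "\<And>i. set_integrable lebesgue {0..T} (f i)" and contH: "continuous_on {0..T} H"
  and Hb: "\<And>t. t \<in> {0..T} \<Longrightarrow> norm (H t) \<le> C * t * integral {0..t} (\<lambda>s. \<Sum>i\<in>UNIV. norm (f i s))"
  and first: "AE t in lebesgue. t \<in> {0..T} \<longrightarrow> of_real t * f i0 t = \<beta> * integral {0..t} (f i0) - H t"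
  and rest: "AE t in lebesgue. t \<in> {0..T} \<longrightarrow> (\<forall>i. i \<noteq> i0 \<longrightarrow> norm (f i t) \<le> C * integral {0..t} (\<lambda>s. \<Sum>i\<in>UNIV. norm (f i s)))"
begin

definition "g s = (\<Sum>i\<in>UNIV. norm (f i s))"
definition "M t = integral {0..t} g"
definition "W t = integral {0..t} (f i0)"
definition "V t = exp (- \<beta> * of_real (ln t)) * W t"
text \<open>An exponent strictly between 0 and \<open>Re \<beta>\<close>: positive, so that
  \<open>t^(\<gamma> - 1)\<close> is integrable at 0, and with
  \<open>Re \<beta> - \<gamma> = \<gamma> < 1\<close>, so that \<open>t^(-\<gamma>)\<close> is
  integrable too.\<close>

definition "\<gamma> = Re \<beta> / 2"

lemma \<gamma>: "0 < \<gamma>" "\<gamma> \<le> 1 / 2" "Re \<beta> = 2 * \<gamma>" using \<beta> by (auto simp: \<gamma>_def)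

lemma gi: "set_integrable lebesgue {0..T} g"
 unfolding g_def[abs_def] by (intro absolutely_integrable_sum absolutely_integrable_norm[unfolded o_def] int) auto

lemma gi': "t \<le> T \<Longrightarrow> set_integrable lebesgue {0..t} g" by (rule set_integrable_subset[OF gi]) auto

lemma g0: "g s \<ge> 0" unfolding g_def by (intro sum_nonneg) auto

lemma M_mono: "s \<le> t \<Longrightarrow> t \<le> T \<Longrightarrow> M s \<le> M t"
 unfolding M_def using g0 set_lebesgue_integral_eq_integral(1)[OF gi'] by (intro integral_subset_le) auto

lemma M0: "t \<le> T \<Longrightarrow> M t \<ge> 0"
 unfolding M_def using g0 set_lebesgue_integral_eq_integral(1)[OF gi'] by (intro integral_nonneg) auto

lemma W_cont: "continuous_on {0..T} W" unfolding W_def[abs_def]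
 by (rule indefinite_integral_continuous_1[OF set_lebesgue_integral_eq_integral(1)[OF int]])

lemma Hb': "t \<in> {0..T} \<Longrightarrow> norm (H t) \<le> C * t * M t" using Hb unfolding M_def g_def[abs_def] .

text \<open>The first component is \<open>(\<beta> W - H) / s\<close>, of size
  \<open>s^(\<gamma> - 1)\<close> plus a multiple of \<open>M\<close>; the others are bounded by
  multiples of \<open>M\<close>. Integrated, these multiples give at most \<open>n C t M t\<close>,
  which is absorbed on the left because \<open>n C t \<le> 1 / 2\<close>.\<close>

lemma M_le:
 assumes t: "0 \<le> t" "t \<le> T" and A: "A \<ge> 0" and W: "\<And>s. s \<in> {0<..t} \<Longrightarrow> norm (W s) \<le> A * s powr \<gamma>"
 shows "M t \<le> 2 * norm \<beta> / \<gamma> * A * t powr \<gamma>"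
proof -
 define n where "n = real CARD('i)"
 have n: "n \<ge> 1" unfolding n_def by (simp add: Suc_leI)
 have p: "((\<lambda>s. s powr (\<gamma> - 1)) has_integral (t powr (\<gamma> - 1 + 1) / (\<gamma> - 1 + 1))) {0..t}"
  using t \<gamma> by (intro has_integral_powr_from_0) auto
 have pa: "set_integrable lebesgue {0..t} (\<lambda>s. s powr (\<gamma> - 1))"
  using p by (intro nonnegative_absolutely_integrable_1) auto
 have hi: "((\<lambda>s. norm \<beta> * A * s powr (\<gamma> - 1) + n * C * M t) has_integral
   (norm \<beta> * A * (t powr (\<gamma> - 1 + 1) / (\<gamma> - 1 + 1)) + (t - 0) *\<^sub>R (n * C * M t))) {0..t}"
  using t by (intro has_integral_add has_integral_mult_right p has_integral_const_real[THEN has_integral_eq_rhs]) auto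
 have ha: "set_integrable lebesgue {0..t} (\<lambda>s. norm \<beta> * A * s powr (\<gamma> - 1) + n * C * M t)"
  using hi C M0[OF t(2)] A n by (intro nonnegative_absolutely_integrable_1) (auto intro!: add_nonneg_nonneg mult_nonneg_nonneg)
 have "M t = (LINT s:{0..t}|lebesgue. g s)" unfolding M_def using set_lebesgue_integral_eq_integral(2)[OF gi'[OF t(2)]] by simp
 also have "\<dots> \<le> (LINT s:{0..t}|lebesgue. norm \<beta> * A * s powr (\<gamma> - 1) + n * C * M t)"
  unfolding set_lebesgue_integral_def
 proof (rule integral_mono_AE)
  show "integrable lebesgue (\<lambda>s. indicat_real {0..t} s *\<^sub>R g s)" using gi'[OF t(2)] by (simp add: set_integrable_def)
  show "integrable lebesgue (\<lambda>s. indicat_real {0..t} s *\<^sub>R (norm \<beta> * A * s powr (\<gamma> - 1) + n * C * M t))"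
   using ha by (simp add: set_integrable_def)
  have "AE s in lebesgue. s \<noteq> (0::real)" by (simp add: AE_completion_iff AE_lborel_singleton)
  then show "AE s in lebesgue. indicat_real {0..t} s *\<^sub>R g s \<le> indicat_real {0..t} s *\<^sub>R (norm \<beta> * A * s powr (\<gamma> - 1) + n * C * M t)"
   using first rest
  proof eventually_elim
   case (elim s)
   show ?case
   proof (cases "s \<in> {0..t}")
    case True
    then have s: "s > 0" "s \<le> t" "s \<in> {0..T}" using elim t by auto
    have CM: "C * M s \<le> C * M t" using M_mono[OF s(2) t(2)] C by (intro mult_left_mono) auto
    have "s * norm (f i0 s) = norm (\<beta> * W s - H s)"
     using elim(2) s unfolding W_def by (metis abs_of_pos norm_mult norm_of_real)
    also have "\<dots> \<le> norm \<beta> * (A * s powr \<gamma>) + C * s * M s"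
     using order_trans[OF norm_triangle_ineq4 add_mono[OF _ Hb'[OF s(3)]]] W[of s] s by (simp add: norm_mult mult_left_mono)
    finally have "norm (f i0 s) \<le> (norm \<beta> * (A * s powr \<gamma>) + C * s * M s) / s" using s by (simp add: field_simps)
    also have "\<dots> = norm \<beta> * A * s powr (\<gamma> - 1) + C * M s" using s by (simp add: powr_diff field_simps)
    finally have 1: "norm (f i0 s) \<le> norm \<beta> * A * s powr (\<gamma> - 1) + C * M t" using CM by linarith
    have "(\<Sum>i\<in>UNIV - {i0}. norm (f i s)) \<le> (\<Sum>i\<in>UNIV - {i0}. C * M t)"
    proof (intro sum_mono)
     fix i assume "i \<in> UNIV - {i0}"
     then have "norm (f i s) \<le> C * M s" using elim(3) s unfolding M_def g_def[abs_def] by auto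
     then show "norm (f i s) \<le> C * M t" using CM by linarith
    qed
    also have "\<dots> = (n - 1) * (C * M t)" by (simp add: n_def of_nat_diff)
    finally have "g s \<le> norm \<beta> * A * s powr (\<gamma> - 1) + C * M t + (n - 1) * (C * M t)"
     unfolding g_def using 1 by (subst sum.remove[of _ i0]) auto
    also have "\<dots> = norm \<beta> * A * s powr (\<gamma> - 1) + n * C * M t" by (simp add: algebra_simps)
    finally show ?thesis using True by simp
   qed simp
  qed
 qed
 also have "\<dots> = norm \<beta> * A * (t powr \<gamma> / \<gamma>) + (n * C * t) * M t"
  using set_lebesgue_integral_eq_integral(2)[OF ha] integral_unique[OF hi] by (simp add: mult_ac)
 finally have 1: "M t \<le> norm \<beta> * A * (t powr \<gamma> / \<gamma>) + (n * C * t) * M t" .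
 have "n * C * t \<le> n * C * T" using t n C by (intro mult_left_mono) auto
 then have "n * C * t \<le> 1 / 2" using C(2)[folded n_def] by linarith
 then have "(n * C * t) * M t \<le> 1 / 2 * M t" using M0[OF t(2)] by (rule mult_right_mono)
 then have "M t \<le> 2 * (norm \<beta> * A * (t powr \<gamma> / \<gamma>))" using 1 by simp
 then show ?thesis by (simp add: field_simps)
qed

definition "q t = (\<beta> * W t - H t) / of_real t"

text \<open>\<open>f i0\<close> agrees almost everywhere with the continuous function
  \<open>q\<close>, so its integral is differentiable in the classical sense away from 0.\<close>

lemma W_deriv: assumes t: "0 < t" "t < T" shows "(W has_vector_derivative q t) (at t)"
proof -
 define s where "s = t / 2"
 have s: "0 < s" "s < t" using t by (auto simp: s_def)
 have qc: "continuous_on {s..T} q"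
  unfolding q_def using s by (intro continuous_intros continuous_on_subset[OF W_cont] continuous_on_subset[OF contH]) auto
 have eq: "W x = W s + integral {s..x} q" if x: "x \<in> {s..T}" for x
 proof -
  have i: "f i0 integrable_on {0..x}"
   using set_lebesgue_integral_eq_integral(1)[OF set_integrable_subset[OF int, of "{0..x}"]] x by auto
  have "W x = W s + integral {s..x} (f i0)"
   unfolding W_def using Henstock_Kurzweil_Integration.integral_combine[OF _ _ i, of s] x s by simp
  also have "integral {s..x} (f i0) = (LINT y:{s..x}|lebesgue. f i0 y)"
   using set_lebesgue_integral_eq_integral(2)[OF set_integrable_subset[OF int, of "{s..x}"]] x s by auto
  also have "\<dots> = (LINT y:{s..x}|lebesgue. q y)" unfolding set_lebesgue_integral_def
  proof (rule LINT_cong_AE_lebesgue)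
   show "AE y in lebesgue. indicat_real {s..x} y *\<^sub>R f i0 y = indicat_real {s..x} y *\<^sub>R q y" using first
   proof eventually_elim
    case (elim y)
    then show ?case using s x by (auto simp: indicator_def q_def W_def field_simps)
   qed
  qed
  also have "\<dots> = integral {s..x} q"
   using x by (intro set_lebesgue_integral_eq_integral(2) absolutely_integrable_continuous_real continuous_on_subset[OF qc]) auto
  finally show ?thesis .
 qed
 have "((\<lambda>x. W s + integral {s..x} q) has_vector_derivative q t) (at t within {s..T})"
  using integral_has_vector_derivative[OF qc, of t] s t by (auto intro!: derivative_eq_intros)
 then have "((\<lambda>x. W s + integral {s..x} q) has_vector_derivative q t) (at t)"
  using at_within_interior[of t "{s..T}"] s t by (simp only: interior_atLeastAtMost_real greaterThanLessThan_iff)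
 then show ?thesis
 proof (rule has_vector_derivative_transform_within_open[where S = "{s<..<T}"])
  show "\<And>x. x \<in> {s<..<T} \<Longrightarrow> W s + integral {s..x} q = W x" by (rule eq[symmetric]) auto
 qed (use s t in auto)
qed

lemma norm_exp_ln: "t > 0 \<Longrightarrow> norm (exp (- \<beta> * of_real (ln t))) = t powr (- Re \<beta>)"
 by (simp add: norm_exp_eq_Re powr_def)

lemma V_deriv: assumes t: "0 < t" "t < T"
 shows "(V has_vector_derivative (- exp (- \<beta> * of_real (ln t)) * H t / of_real t)) (at t)"
  "norm (- exp (- \<beta> * of_real (ln t)) * H t / of_real t) \<le> C * t powr (- Re \<beta>) * M t"
proof -
 have e: "((\<lambda>t. exp (- \<beta> * of_real (ln t))) has_vector_derivative (- \<beta> / of_real t * exp (- \<beta> * of_real (ln t)))) (at t)"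
 proof -
  have "((\<lambda>t. - \<beta> * of_real (ln t)) has_vector_derivative (- \<beta> * of_real (1 / t))) (at t)"
   using t by (intro has_vector_derivative_mult_right has_vector_derivative_of_real DERIV_ln_divide)
  from field_vector_diff_chain_at[OF this DERIV_exp] show ?thesis by (simp add: o_def mult_ac divide_inverse)
 qed
 have "(V has_vector_derivative (exp (- \<beta> * of_real (ln t)) * q t + - \<beta> / of_real t * exp (- \<beta> * of_real (ln t)) * W t)) (at t)"
  unfolding V_def[abs_def] by (rule has_vector_derivative_mult[OF e W_deriv[OF t]])
 moreover have "exp (- \<beta> * of_real (ln t)) * q t + - \<beta> / of_real t * exp (- \<beta> * of_real (ln t)) * W t
   = - exp (- \<beta> * of_real (ln t)) * H t / of_real t" using t by (simp add: q_def field_simps)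
 ultimately show "(V has_vector_derivative (- exp (- \<beta> * of_real (ln t)) * H t / of_real t)) (at t)" by simp
 have "norm (- exp (- \<beta> * of_real (ln t)) * H t / of_real t) = t powr (- Re \<beta>) * norm (H t) / t"
  using t norm_exp_ln[OF t(1)] by (simp add: norm_mult norm_divide)
 also have "\<dots> \<le> t powr (- Re \<beta>) * (C * t * M t) / t"
  using Hb'[of t] t by (intro divide_right_mono mult_left_mono) auto
 finally show "norm (- exp (- \<beta> * of_real (ln t)) * H t / of_real t) \<le> C * t powr (- Re \<beta>) * M t" using t by (simp add: mult_ac)
qed

lemma V_diff:
 assumes st: "0 < s" "s < t" "t \<le> T" and \<phi>: "\<And>x. x \<in> {s..t} \<Longrightarrow> (\<phi> has_real_derivative \<phi>' x) (at x)"
  and le: "\<And>x. x \<in> {s<..<t} \<Longrightarrow> C * x powr (- Re \<beta>) * M x \<le> \<phi>' x"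
 shows "norm (V t - V s) \<le> \<phi> t - \<phi> s"
proof (rule differentiable_bound_general[OF st(2)])
 show "continuous_on {s..t} V" unfolding V_def[abs_def] using st by (intro continuous_intros continuous_on_subset[OF W_cont]) auto
 show "continuous_on {s..t} \<phi>" using \<phi> by (intro DERIV_continuous_on) (blast intro: DERIV_subset)
 fix x assume x: "s < x" "x < t"
 show "(V has_vector_derivative (- exp (- \<beta> * of_real (ln x)) * H x / of_real x)) (at x)" using x st by (intro V_deriv) auto
 show "(\<phi> has_vector_derivative \<phi>' x) (at x)" using \<phi>[of x] x by (simp add: has_real_derivative_iff_has_vector_derivative)
 show "norm (- exp (- \<beta> * of_real (ln x)) * H x / of_real x) \<le> \<phi>' x" using V_deriv(2)[of x] le[of x] x st by auto
qed

lemma norm_W: "t > 0 \<Longrightarrow> norm (W t) = t powr (2 * \<gamma>) * norm (V t)"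
 using norm_exp_ln[of t] \<gamma>(3) by (simp add: V_def norm_mult powr_minus field_simps)

lemma powr_deriv: "x > 0 \<Longrightarrow> ((\<lambda>x. c * x powr r) has_real_derivative c * (r * x powr (r - 1))) (at x)"
 by (intro DERIV_cmult has_real_derivative_powr)

text \<open>Bootstrap: with \<open>M\<close> merely bounded, integrating the derivative of
  \<open>V\<close> from \<open>T\<close> down to \<open>t\<close> gives growth at most
  \<open>t^(-\<gamma>)\<close>, hence \<open>W = O(t^\<gamma>)\<close>, and \<open>M_le\<close>
  turns this into decay of \<open>M\<close>.\<close>

lemma M_bound: obtains A where "A \<ge> 0" "\<And>t. t \<in> {0..T} \<Longrightarrow> M t \<le> A * t powr \<gamma>"
proof -
 define A1 where "A1 = norm (V T) + C * M T / \<gamma>"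
 have A1: "A1 \<ge> 0" using M0[of T] C \<gamma> by (simp add: A1_def)
 have W: "norm (W t) \<le> A1 * t powr \<gamma>" if t: "t \<in> {0<..T}" for t
 proof -
  have p1: "t powr (- \<gamma>) \<ge> 1" using t T \<gamma> powr_mono2'[of "- \<gamma>" t 1] by simp
  have cm: "C * M T / \<gamma> \<ge> 0" using M0[of T] C \<gamma> by simp
  have "norm (V T - V t) \<le> C * M T / \<gamma> * t powr (- \<gamma>)"
  proof (cases "t = T")
   case False
   have "norm (V T - V t) \<le> - (C * M T / \<gamma>) * T powr (- \<gamma>) - (- (C * M T / \<gamma>) * t powr (- \<gamma>))"
   proof (rule V_diff)
    fix x assume "x \<in> {t..T}"
    then show "((\<lambda>x. - (C * M T / \<gamma>) * x powr (- \<gamma>)) has_real_derivative (C * M T) * x powr (- \<gamma> - 1)) (at x)"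
     using t \<gamma> by (intro DERIV_cong[OF powr_deriv]) auto
   next
    fix x assume x: "x \<in> {t<..<T}"
    \<comment> \<open>The larger power \<open>- \<gamma> - 1\<close> always has a power as
      primitive, whereas \<open>- Re \<beta>\<close> would lead to a logarithm at
      \<open>Re \<beta> = 1\<close>.\<close>
    have "x powr (- Re \<beta>) \<le> x powr (- \<gamma> - 1)" using x t T \<gamma> by (intro powr_mono') auto
    moreover have "C * M x \<le> C * M T" using x C by (intro mult_left_mono M_mono) auto
    ultimately have "(C * M x) * x powr (- Re \<beta>) \<le> (C * M T) * x powr (- \<gamma> - 1)"
     using x t C M0[of T] by (intro mult_mono \<open>C * M x \<le> C * M T\<close>) auto
    then show "C * x powr (- Re \<beta>) * M x \<le> C * M T * x powr (- \<gamma> - 1)" by (simp add: mult_ac)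
   qed (use t False in auto)
   moreover have "- (C * M T / \<gamma>) * T powr (- \<gamma>) \<le> 0" using mult_nonneg_nonneg[OF cm powr_ge_zero[of T "- \<gamma>"]] by (simp only: minus_mult_left[symmetric] neg_le_0_iff_le)
   ultimately show ?thesis by linarith
  qed (use mult_nonneg_nonneg[OF cm powr_ge_zero[of T "- \<gamma>"]] in simp)
  moreover have "norm (V t) \<le> norm (V T) + norm (V T - V t)" by (metis norm_minus_commute norm_triangle_sub)
  moreover have "norm (V T) * 1 \<le> norm (V T) * t powr (- \<gamma>)" using p1 by (intro mult_left_mono) auto
  ultimately have "norm (V t) \<le> A1 * t powr (- \<gamma>)" unfolding A1_def distrib_right by linarith
  then have "t powr (2 * \<gamma>) * norm (V t) \<le> t powr (2 * \<gamma>) * (A1 * t powr (- \<gamma>))" by (intro mult_left_mono) auto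
  also have "\<dots> = A1 * (t powr (2 * \<gamma>) * t powr (- \<gamma>))" by simp
  also have "t powr (2 * \<gamma>) * t powr (- \<gamma>) = t powr \<gamma>" by (simp flip: powr_add)
  finally show ?thesis using norm_W t by simp
 qed
 show thesis
 proof (rule that)
  show "2 * norm \<beta> / \<gamma> * A1 \<ge> 0" using A1 \<gamma> by simp
  show "M t \<le> 2 * norm \<beta> / \<gamma> * A1 * t powr \<gamma>" if "t \<in> {0..T}" for t
   using that A1 W by (intro M_le) auto
 qed
qed

text \<open>With \<open>M = O(x^\<gamma>)\<close> the derivative of \<open>V\<close> is
  \<open>O(x^(-\<gamma>))\<close>, integrable at 0. The factor 2 bounds
  \<open>1 / (1 - \<gamma>)\<close>.\<close>

lemma V_Cauchy:
 assumes t': "t' \<le> T" and A: "A \<ge> 0" "\<And>t. t \<in> {0..t'} \<Longrightarrow> M t \<le> A * t powr \<gamma>" and st: "0 < s" "s \<le> t" "t \<le> t'"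
 shows "norm (V t - V s) \<le> 2 * C * A * t powr (1 - \<gamma>)"
proof (cases "s = t")
 case False
 have "norm (V t - V s) \<le> C * A / (1 - \<gamma>) * t powr (1 - \<gamma>) - C * A / (1 - \<gamma>) * s powr (1 - \<gamma>)"
 proof (rule V_diff)
  fix x assume "x \<in> {s..t}"
  then show "((\<lambda>x. C * A / (1 - \<gamma>) * x powr (1 - \<gamma>)) has_real_derivative (C * A) * x powr (- \<gamma>)) (at x)"
   using st \<gamma> by (intro DERIV_cong[OF powr_deriv]) auto
 next
  fix x assume x: "x \<in> {s<..<t}"
  have "C * x powr (- Re \<beta>) * M x \<le> C * x powr (- Re \<beta>) * (A * x powr \<gamma>)"
   using A(2)[of x] x st C by (intro mult_left_mono) auto
  also have "\<dots> = C * A * (x powr (- Re \<beta>) * x powr \<gamma>)" by simp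
  also have "x powr (- Re \<beta>) * x powr \<gamma> = x powr (- \<gamma>)" using \<gamma>(3) by (simp flip: powr_add)
  finally show "C * x powr (- Re \<beta>) * M x \<le> C * A * x powr (- \<gamma>)" .
 qed (use st t' False in auto)
 also have "\<dots> \<le> C * A / (1 - \<gamma>) * t powr (1 - \<gamma>)" using C A \<gamma> by simp
 also have "\<dots> \<le> 2 * C * A * t powr (1 - \<gamma>)"
 proof (rule mult_right_mono)
  have "C * A \<le> C * A * (2 * (1 - \<gamma>))" using \<gamma> C A mult_left_mono[of 1 "2 * (1 - \<gamma>)" "C * A"] by simp
  then show "C * A / (1 - \<gamma>) \<le> 2 * C * A" using \<gamma> by (simp add: field_simps)
 qed simp
 finally show ?thesis .
qed (use A C in simp)

lemma V_limit: obtains v where "(V \<longlongrightarrow> v) (at_right 0)"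
proof -
 obtain A where A: "A \<ge> 0" "\<And>t. t \<in> {0..T} \<Longrightarrow> M t \<le> A * t powr \<gamma>" using M_bound by blast
 define x where "x n = T / (real n + 1)" for n :: nat
 have x: "0 < x n" "x n \<le> T" for n using T by (auto simp: x_def divide_le_eq)
 have xm: "x m \<le> x n" if "n \<le> m" for m n using T that by (auto simp: x_def intro!: divide_left_mono mult_pos_pos)
 have lim: "(\<lambda>n. 2 * C * A * x n powr (1 - \<gamma>)) \<longlonglongrightarrow> 0" unfolding x_def using T \<gamma> by real_asymp
 have bd: "norm (V (x m) - V (x n)) \<le> 2 * C * A * x N powr (1 - \<gamma>)" if "m \<ge> N" "n \<ge> N" for m n N
 proof -
  have *: "norm (V (x m) - V (x n)) \<le> 2 * C * A * x N powr (1 - \<gamma>)" if "n \<ge> m" "m \<ge> N" for m n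
  proof -
   have "norm (V (x m) - V (x n)) \<le> 2 * C * A * x m powr (1 - \<gamma>)" by (rule V_Cauchy[OF order_refl A]) (use x xm that in auto)
   also have "\<dots> \<le> 2 * C * A * x N powr (1 - \<gamma>)"
    using A C \<gamma> x[of m] xm[OF that(2)] by (intro mult_left_mono powr_mono2) (auto simp: less_imp_le)
   finally show ?thesis .
  qed
  show ?thesis using *[of m n] *[of n m] that by (cases "n \<ge> m") (auto simp: norm_minus_commute)
 qed
 have "Cauchy (\<lambda>n. V (x n))"
 proof (rule metric_CauchyI)
  fix e :: real assume "e > 0"
  with lim have "eventually (\<lambda>n. 2 * C * A * x n powr (1 - \<gamma>) < e) sequentially" by (intro order_tendstoD(2)) auto
  then obtain N where "2 * C * A * x N powr (1 - \<gamma>) < e" by (auto simp: eventually_sequentially)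
  then show "\<exists>N. \<forall>m\<ge>N. \<forall>n\<ge>N. dist (V (x m)) (V (x n)) < e"
   using bd by (intro exI[of _ N]) (auto simp: dist_norm intro: le_less_trans)
 qed
 then obtain v where v: "(\<lambda>n. V (x n)) \<longlonglongrightarrow> v" by (auto simp: Cauchy_convergent_iff convergent_def)
 have b: "norm (V t - v) \<le> 2 * C * A * t powr (1 - \<gamma>)" if t: "0 < t" "t \<le> T" for t
 proof (rule tendsto_upperbound)
  show "(\<lambda>n. norm (V t - V (x n))) \<longlonglongrightarrow> norm (V t - v)" by (intro tendsto_intros v)
  have "x \<longlonglongrightarrow> 0" unfolding x_def[abs_def] by real_asymp
  then have "eventually (\<lambda>n. x n < t) sequentially" using t by (intro order_tendstoD(2)) auto
  then show "\<forall>\<^sub>F n in sequentially. norm (V t - V (x n)) \<le> 2 * C * A * t powr (1 - \<gamma>)"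
   by eventually_elim (use V_Cauchy[OF order_refl A] x t in auto)
 qed simp
 have "((\<lambda>t. 2 * C * A * t powr (1 - \<gamma>)) \<longlongrightarrow> 0) (at_right 0)" using \<gamma> by real_asymp
 then have "((\<lambda>t. V t - v) \<longlongrightarrow> 0) (at_right 0)"
 proof (rule Lim_null_comparison[rotated])
  show "\<forall>\<^sub>F t in at_right 0. norm (V t - v) \<le> 2 * C * A * t powr (1 - \<gamma>)"
   using T b unfolding eventually_at_right_field by (intro exI[of _ T]) auto
 qed
 then show thesis using that Lim_null by blast
qed

text \<open>Limit 0 gives \<open>|V s| \<le> 2 C A s^(1 - \<gamma>)\<close>, so \<open>W s\<close>
  is of size \<open>A s^\<gamma>\<close> times an extra factor \<open>s \<le> t0\<close>. On a short
  interval \<open>M_le\<close> then halves \<open>A\<close>, and iteration leaves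
  \<open>M = 0\<close>.\<close>

lemma zero_limit: assumes v: "(V \<longlongrightarrow> 0) (at_right 0)"
 obtains t0 where "0 < t0" "t0 \<le> T" "AE t in lebesgue. t \<in> {0..t0} \<longrightarrow> (\<forall>i. f i t = 0)"
proof -
 obtain A0 where A0: "A0 \<ge> 0" "\<And>t. t \<in> {0..T} \<Longrightarrow> M t \<le> A0 * t powr \<gamma>" using M_bound by blast
 \<comment> \<open>\<open>M_le\<close> multiplies \<open>2 C t0 A\<close> by
   \<open>2 |\<beta>| / \<gamma>\<close>; \<open>t0 \<le> 1 / c\<close> brings the product below
   \<open>A / 2\<close>.\<close>
 define c where "c = 8 * norm \<beta> * C / \<gamma> + 1"
 have c: "c > 0" using C \<gamma> by (simp add: c_def add_nonneg_pos)
 define t0 where "t0 = min T (1 / c)"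
 have t0: "0 < t0" "t0 \<le> T" using T c by (auto simp: t0_def)
 have "t0 * c \<le> 1" using c by (simp add: t0_def min_def field_simps)
 then have t0c: "2 * norm \<beta> / \<gamma> * (2 * C * t0) \<le> 1 / 2" using t0 by (simp add: c_def algebra_simps)
 have step: "\<forall>t\<in>{0..t0}. M t \<le> A / 2 * t powr \<gamma>" if A: "A \<ge> 0" "\<forall>t\<in>{0..t0}. M t \<le> A * t powr \<gamma>" for A
 proof
  have W: "norm (W s) \<le> 2 * C * t0 * A * s powr \<gamma>" if s: "s \<in> {0<..t0}" for s
  proof -
   have "norm (V s - 0) \<le> 2 * C * A * s powr (1 - \<gamma>)"
   proof (rule tendsto_upperbound)
    show "((\<lambda>r. norm (V s - V r)) \<longlongrightarrow> norm (V s - 0)) (at_right 0)" by (intro tendsto_intros v)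
    show "\<forall>\<^sub>F r in at_right 0. norm (V s - V r) \<le> 2 * C * A * s powr (1 - \<gamma>)"
     unfolding eventually_at_right_field using s V_Cauchy[OF t0(2) A(1)] A(2) by (intro exI[of _ s]) auto
   qed simp
   then have "norm (W s) \<le> s powr (2 * \<gamma>) * (2 * C * A * s powr (1 - \<gamma>))"
    using norm_W s by (simp add: mult_left_mono)
   also have "\<dots> = 2 * C * A * (s powr (2 * \<gamma>) * s powr (1 - \<gamma>))" by simp
   also have "s powr (2 * \<gamma>) * s powr (1 - \<gamma>) = s * s powr \<gamma>" using s by (simp add: powr_mult_base add.commute flip: powr_add)
   also have "2 * C * A * (s * s powr \<gamma>) \<le> 2 * C * A * (t0 * s powr \<gamma>)"
    using s C A by (intro mult_left_mono mult_right_mono) auto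
   finally show ?thesis by (simp add: mult_ac)
  qed
  fix t assume t: "t \<in> {0..t0}"
  have "M t \<le> 2 * norm \<beta> / \<gamma> * (2 * C * t0 * A) * t powr \<gamma>" using t t0 A C W by (intro M_le) auto
  also have "\<dots> = (2 * norm \<beta> / \<gamma> * (2 * C * t0)) * A * t powr \<gamma>" by simp
  also have "\<dots> \<le> 1 / 2 * A * t powr \<gamma>" using A by (intro mult_right_mono t0c) auto
  finally show "M t \<le> A / 2 * t powr \<gamma>" by simp
 qed
 have it: "\<forall>t\<in>{0..t0}. M t \<le> A0 / 2 ^ n * t powr \<gamma>" for n
 proof (induction n)
  case (Suc n)
  then show ?case using step[of "A0 / 2 ^ n"] A0 by (simp add: mult.commute)
 qed (use A0 t0 in auto)
 have "M t0 \<le> 0"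
 proof (rule LIMSEQ_le_const)
  show "(\<lambda>n. A0 / 2 ^ n * t0 powr \<gamma>) \<longlonglongrightarrow> 0" by real_asymp
 qed (use it t0 in auto)
 then have "(LINT s:{0..t0}|lebesgue. g s) = 0"
  using M0[OF t0(2)] set_lebesgue_integral_eq_integral(2)[OF gi'[OF t0(2)]] by (simp add: M_def)
 then have "AE s in lebesgue. indicat_real {0..t0} s *\<^sub>R g s = 0"
  using gi'[OF t0(2)] g0 unfolding set_lebesgue_integral_def set_integrable_def by (subst (asm) integral_nonneg_eq_0_iff_AE) auto
 then have "AE t in lebesgue. t \<in> {0..t0} \<longrightarrow> (\<forall>i. f i t = 0)"
  by eventually_elim (auto simp: g_def sum_nonneg_eq_0_iff)
 then show thesis using that t0 by blast
qed

end

section \<open>The first level on a ray\<close>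

lemma seg_int_ray_integral: assumes f: "ray_rep th f \<phi>" and t: "t \<ge> 0"
 shows "seg_int f (rp th t) = cis th * integral {0..t} \<phi>"
proof (cases "t = 0")
 case False
 have s: "set_integrable lebesgue {0..t} (\<lambda>s. f (rp th s))" by (rule ray_rep_integrable[OF f])
 have "(LINT s|lebesgue. indicat_real {0..t} s *\<^sub>R (f (rp th s) * 1)) = (LINT s:{0..t}|lebesgue. \<phi> s)"
  unfolding set_lebesgue_integral_def
  by (rule LINT_cong_AE_lebesgue, use ray_repD(3)[OF f] in eventually_elim) (auto simp: indicator_def)
 moreover have "set_integrable lebesgue {0..t} \<phi>"
  using ray_repD(1,4)[OF f] unfolding set_integrable_def by (subst integrable_completion) auto
 ultimately show ?thesis
  using conv_on_ray[of t f "\<lambda>_. 1" th] t False set_lebesgue_integral_eq_integral(2)[of "{0..t}" \<phi>]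
  by (simp add: seg_int_eq_conv)
qed (simp add: seg_int_def)

lemma ray_rep_abs_integrable: "ray_rep th f \<phi> \<Longrightarrow> set_integrable lebesgue {0..t} \<phi>"
 using ray_repD(1,4) unfolding set_integrable_def by (subst integrable_completion) auto

text \<open>A kernel vanishing at 0 extends by 0 to a continuous function on the whole line;
  dominated convergence then makes the convolution continuous although \<open>\<phi>\<close> is
  merely locally integrable.\<close>

lemma rconv_continuous_kernel: assumes f: "ray_rep th f \<phi>" and \<delta>: "continuous_on (ray th) \<delta>" "\<delta> 0 = 0"
 defines "\<psi> \<equiv> \<lambda>t. indicat_real {0..} t *\<^sub>R \<delta> (rp th t)"
 shows "continuous_on {0..T} (rconv \<phi> \<psi>)"
  "t \<ge> 0 \<Longrightarrow> (\<And>s. s \<in> {0..t} \<Longrightarrow> norm (\<delta> (rp th s)) \<le> c) \<Longrightarrow>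
   norm (rconv \<phi> \<psi> t) \<le> c * integral {0..t} (\<lambda>s. norm (\<phi> s))"
proof -
 note F = ray_repD[OF f]
 have \<psi>_eq: "\<psi> = (\<lambda>t. \<delta> (rp th (max t 0)))"
  using \<delta>(2) by (auto simp: \<psi>_def fun_eq_iff max_def indicator_def)
 have \<psi>c: "continuous_on UNIV \<psi>"
  unfolding \<psi>_eq by (rule continuous_on_compose2[OF \<delta>(1)]) (auto intro!: continuous_intros simp: ray_def)
 have \<psi>0: "\<psi> t = 0" if "t < 0" for t using that by (simp add: \<psi>_def)
 note [measurable] = F(1) borel_measurable_continuous_onI[OF \<psi>c]
 have bnd: "norm (\<phi> s * \<psi> (t - s)) \<le> c * norm (indicat_real {0..t} s *\<^sub>R \<phi> s)"
  if c: "\<And>s. s \<in> {0..t} \<Longrightarrow> norm (\<psi> s) \<le> c" for c s t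
 proof -
  consider "s < 0" | "s > t" | "s \<in> {0..t}" by fastforce
  then show ?thesis
  proof cases
   case 3
   have "norm (\<phi> s) * norm (\<psi> (t - s)) \<le> norm (\<phi> s) * c" using c[of "t - s"] 3 by (intro mult_left_mono) auto
   then show ?thesis using 3 by (simp add: norm_mult mult.commute)
  qed (auto simp: F(2) \<psi>0)
 qed
 have ig: "integrable lborel (\<lambda>s. norm (indicat_real {0..t} s *\<^sub>R \<phi> s))" for t
  using F(4)[of t] unfolding set_integrable_def by (rule integrable_norm)
 show "continuous_on {0..T} (rconv \<phi> \<psi>)" unfolding continuous_on_sequentially
 proof (intro allI ballI impI)
  fix x t assume t: "t \<in> {0..T}" and x: "(\<forall>n. x n \<in> {0..T}) \<and> x \<longlonglongrightarrow> t"
  obtain B where B: "\<And>s. s \<in> {0..T} \<Longrightarrow> norm (\<psi> s) \<le> B"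
  proof -
   have "bounded (\<psi> ` {0..T})" by (intro compact_imp_bounded compact_continuous_image continuous_on_subset[OF \<psi>c]) auto
   then obtain a where "\<forall>s\<in>{0..T}. norm (\<psi> s) \<le> a" by (auto simp: bounded_iff)
   then show thesis by (intro that[of a]) auto
  qed
  have B0: "B \<ge> 0" using B[OF t] norm_ge_zero order_trans by blast
  show "(rconv \<phi> \<psi> \<circ> x) \<longlonglongrightarrow> rconv \<phi> \<psi> t" unfolding o_def rconv_def
  proof (rule integral_dominated_convergence[where w = "\<lambda>s. B * norm (indicat_real {0..T} s *\<^sub>R \<phi> s)"])
   show "integrable lborel (\<lambda>s. B * norm (indicat_real {0..T} s *\<^sub>R \<phi> s))" by (intro integrable_mult_right ig)
   show "AE s in lborel. (\<lambda>n. \<phi> s * \<psi> (x n - s)) \<longlonglongrightarrow> \<phi> s * \<psi> (t - s)"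
   proof (intro AE_I2 tendsto_mult tendsto_const)
    fix s
    have "isCont \<psi> (t - s)" using \<psi>c by (simp add: continuous_on_eq_continuous_at)
    then show "(\<lambda>n. \<psi> (x n - s)) \<longlonglongrightarrow> \<psi> (t - s)"
     by (rule isCont_tendsto_compose) (intro tendsto_intros conjunct2[OF x])
   qed
   fix n
   show "AE s in lborel. norm (\<phi> s * \<psi> (x n - s)) \<le> B * norm (indicat_real {0..T} s *\<^sub>R \<phi> s)"
   proof (rule AE_I2)
    fix s
    have xn: "0 \<le> x n" "x n \<le> T" using x by auto
    have "norm (\<phi> s * \<psi> (x n - s)) \<le> B * norm (indicat_real {0..x n} s *\<^sub>R \<phi> s)" by (rule bnd) (use B xn in auto)
    also have "\<dots> \<le> B * norm (indicat_real {0..T} s *\<^sub>R \<phi> s)"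
     using xn B0 by (intro mult_left_mono) (auto simp: indicator_def)
    finally show "norm (\<phi> s * \<psi> (x n - s)) \<le> B * norm (indicat_real {0..T} s *\<^sub>R \<phi> s)" .
   qed
  qed measurable
 qed
 show "norm (rconv \<phi> \<psi> t) \<le> c * integral {0..t} (\<lambda>s. norm (\<phi> s))"
  if t: "t \<ge> 0" and c: "\<And>s. s \<in> {0..t} \<Longrightarrow> norm (\<delta> (rp th s)) \<le> c"
 proof -
  have c': "norm (\<psi> s) \<le> c" if "s \<in> {0..t}" for s using c[OF that] that by (simp add: \<psi>_def)
  have i: "integrable lborel (\<lambda>s. \<phi> s * \<psi> (t - s))"
   by (rule Bochner_Integration.integrable_bound[OF integrable_mult_right[OF ig[of t], of c]])
    (measurable, use bnd[OF c'] in \<open>auto intro: order_trans[OF _ abs_ge_self]\<close>)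
  have "norm (rconv \<phi> \<psi> t) \<le> (LINT s|lborel. norm (\<phi> s * \<psi> (t - s)))" unfolding rconv_def by (rule integral_norm_bound)
  also have "\<dots> \<le> (LINT s|lborel. c * norm (indicat_real {0..t} s *\<^sub>R \<phi> s))"
   by (intro integral_mono integrable_norm i integrable_mult_right ig bnd c')
  also have "\<dots> = c * (LINT s:{0..t}|lborel. norm (\<phi> s))" by (simp add: set_lebesgue_integral_def)
  also have "(LINT s:{0..t}|lborel. norm (\<phi> s)) = integral {0..t} (\<lambda>s. norm (\<phi> s))"
   using ig[of t] by (intro set_borel_integral_eq_integral(2)) (simp add: set_integrable_def)
  finally show ?thesis .
 qed
qed

lemma conv_diff_ray: assumes "ray_rep th f \<phi>" "ray_rep th g \<psi>" "ray_rep th h \<omega>"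
 shows "AE_ray th (\<lambda>p. conv (\<lambda>s. f s - c * g s) h p = conv f h p - c * conv g h p)"
proof -
 have "AE t in lebesgue. t \<noteq> (0::real)" by (simp add: AE_completion_iff AE_lborel_singleton)
 then show ?thesis unfolding AE_ray_def
  using AE_completion[OF rconv_AE_integrable[OF assms(1,3)]] AE_completion[OF rconv_AE_integrable[OF assms(2,3)]]
 proof eventually_elim
  case (elim t)
  show ?case
  proof
   assume "0 \<le> t"
   then have t: "t > 0" using elim by simp
   have e: "rconv (\<lambda>t. \<phi> t - c * \<psi> t) \<omega> t = rconv \<phi> \<omega> t - c * rconv \<psi> \<omega> t"
    using elim by (simp add: rconv_def left_diff_distrib mult.assoc)
   then show "conv (\<lambda>s. f s - c * g s) h (rp th t) = conv f h (rp th t) - c * conv g h (rp th t)"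
    unfolding conv_eq_rconv[OF ray_rep_diff[OF assms(1) ray_rep_cmult[OF assms(2)]] assms(3) t]
     conv_eq_rconv[OF assms(1,3) t] conv_eq_rconv[OF assms(2,3) t] e by (simp add: algebra_simps)
  qed
 qed
qed

lemma hier_lhs_diff:
 assumes "\<And>i. ray_rep th (\<lambda>p. D p $ i) (\<phi> i)" "\<And>i. ray_rep th (\<lambda>p. E p $ i) (\<psi> i)"
  "\<And>i j. \<exists>\<omega>. ray_rep th (snd (dcoef gc Y (munit j) i)) \<omega>"
 shows "AE_ray th (\<lambda>p. \<forall>i. hier_lhs lam b gc Y k (\<lambda>p. D p - c *s E p) p i = hier_lhs lam b gc Y k D p i - c * hier_lhs lam b gc Y k E p i)"
proof (rule AE_ray_fin)
 fix i
 have one: "ray_rep th (\<lambda>_. 1) (\<lambda>t. indicat_real {0..} t *\<^sub>R 1)" by (rule ray_rep_continuous) auto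
 have 1: "AE_ray th (\<lambda>p. conv (\<lambda>s. D s $ i - c * E s $ i) (\<lambda>_. 1) p = conv (\<lambda>s. D s $ i) (\<lambda>_. 1) p - c * conv (\<lambda>s. E s $ i) (\<lambda>_. 1) p)"
  by (rule conv_diff_ray[OF assms(1,2) one])
 have 2: "AE_ray th (\<lambda>p. \<forall>j. conv (\<lambda>s. D s $ j - c * E s $ j) (snd (dcoef gc Y (munit j) i)) p =
  conv (\<lambda>s. D s $ j) (snd (dcoef gc Y (munit j) i)) p - c * conv (\<lambda>s. E s $ j) (snd (dcoef gc Y (munit j) i)) p)"
 proof (rule AE_ray_fin)
  fix j
  obtain \<omega> where "ray_rep th (snd (dcoef gc Y (munit j) i)) \<omega>" using assms(3) by blast
  from conv_diff_ray[OF assms(1,2) this]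
  show "AE_ray th (\<lambda>p. conv (\<lambda>s. D s $ j - c * E s $ j) (snd (dcoef gc Y (munit j) i)) p =
   conv (\<lambda>s. D s $ j) (snd (dcoef gc Y (munit j) i)) p - c * conv (\<lambda>s. E s $ j) (snd (dcoef gc Y (munit j) i)) p)" .
 qed
 show "AE_ray th (\<lambda>p. hier_lhs lam b gc Y k (\<lambda>p. D p - c *s E p) p i = hier_lhs lam b gc Y k D p i - c * hier_lhs lam b gc Y k E p i)"
  by (rule AE_ray_mp[OF 1 2]) (simp add: hier_lhs_def seg_int_eq_conv sum_subtractf, simp add: sum_distrib_left algebra_simps)
qed

lemma hier_lhs_bound: assumes "hier_lhs lam b gc Y k D p i = 0" "d \<le> norm (lam $ i - of_nat k - p)" "d > 0"
 shows "norm (D p $ i) \<le> 1 / d * norm (b $ i * seg_int (\<lambda>p. D p $ i) p - (\<Sum>j\<in>UNIV. conv (\<lambda>p. D p $ j) (snd (dcoef gc Y (munit j) i)) p))"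
proof -
 define R where "R = b $ i * seg_int (\<lambda>p. D p $ i) p - (\<Sum>j\<in>UNIV. conv (\<lambda>p. D p $ j) (snd (dcoef gc Y (munit j) i)) p)"
 have "(lam $ i - of_nat k - p) * D p $ i = - R" using assms(1) unfolding hier_lhs_def R_def by (simp add: algebra_simps)
 then have "norm (lam $ i - of_nat k - p) * norm (D p $ i) = norm R" by (metis norm_minus_cancel norm_mult)
 moreover have "d * norm (D p $ i) \<le> norm (lam $ i - of_nat k - p) * norm (D p $ i)"
  using assms(2) by (rule mult_right_mono) simp
 ultimately show ?thesis unfolding R_def[symmetric] using assms(3) by (simp add: field_simps)
qed

text \<open>The inequality required by \<open>linear_zero\<close> is trivial where \<open>D\<close>
  vanishes already, so a zero of \<open>lam - k - p\<close> before \<open>t0\<close> does no harm.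
  Level 1 uses this with \<open>t0 > 0\<close>, the higher levels with
  \<open>t0 = 0\<close>.\<close>

lemma hier_zero_from:
 assumes D: "\<And>i. ray_rep th (\<lambda>p. D p $ i) (\<phi> i)" and \<delta>: "\<And>i j. \<exists>\<psi>. ray_rep th (snd (dcoef gc Y (munit j) i)) \<psi>"
  and eq: "AE_ray th (\<lambda>p. \<forall>i. hier_lhs lam b gc Y k D p i = 0)" and t0: "t0 \<ge> 0"
  and ini: "AE t in lebesgue. t \<in> {0..<t0} \<longrightarrow> D (rp th t) = 0"
  and nz: "\<And>i t. t \<ge> t0 \<Longrightarrow> lam $ i - of_nat k \<noteq> of_real t * cis th"
 shows "AE_ray th (\<lambda>p. D p = 0)"
proof (rule AE_ray_all_T)
 fix T :: real assume T: "T \<ge> 0"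
 define T' where "T' = max T t0"
 obtain d where d: "d > 0" "\<And>i t. t \<in> {t0..T'} \<Longrightarrow> d \<le> norm (lam $ i - of_nat k - of_real t * cis th)"
  by (rule ray_lower_bound[of "\<lambda>i. lam $ i - of_nat k" th t0 T']) (use nz in \<open>auto simp: T'_def\<close>)
 have "AE t in lebesgue. t \<in> {0..T'} \<longrightarrow> (\<forall>i. D (rp th t) $ i = 0)"
 proof (rule linear_zero[where D = "\<lambda>i p. D p $ i" and M = "1 / d" and b = "\<lambda>i. b $ i" and \<delta> = "\<lambda>i j. snd (dcoef gc Y (munit j) i)", OF D \<delta>])
  show "AE t in lebesgue. t \<in> {0..T'} \<longrightarrow> (\<forall>i. norm (D (rp th t) $ i) \<le>
   1 / d * norm (b $ i * seg_int (\<lambda>p. D p $ i) (rp th t) - (\<Sum>j\<in>UNIV. conv (\<lambda>p. D p $ j) (snd (dcoef gc Y (munit j) i)) (rp th t))))"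
   using eq[unfolded AE_ray_def] ini
  proof eventually_elim
   case (elim t)
   show ?case
   proof (intro impI allI)
    fix i assume t: "t \<in> {0..T'}"
    show "norm (D (rp th t) $ i) \<le>
     1 / d * norm (b $ i * seg_int (\<lambda>p. D p $ i) (rp th t) - (\<Sum>j\<in>UNIV. conv (\<lambda>p. D p $ j) (snd (dcoef gc Y (munit j) i)) (rp th t)))"
    proof (cases "t < t0")
     case True
     then show ?thesis using elim(2) t d(1) by auto
    next
     case False
     then show ?thesis using elim(1) t by (intro hier_lhs_bound[OF _ d(2) d(1)]) auto
    qed
   qed
  qed
 qed (use d T in \<open>auto simp: T'_def\<close>)
 then show "AE t in lebesgue. t \<in> {0..T} \<longrightarrow> D (rp th t) = 0" by eventually_elim (auto simp: T'_def vec_eq_iff)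
qed

lemma star_open_linear_bound:
 assumes U: "star_open U" and \<delta>: "\<And>x. x \<in> I \<Longrightarrow> \<delta> x holomorphic_on U" "\<And>x. x \<in> I \<Longrightarrow> \<delta> x 0 = 0"
  and I: "finite I" and K: "compact K" "K \<subseteq> U"
 shows "\<exists>c\<ge>0. \<forall>x\<in>I. \<forall>p\<in>K. norm (\<delta> x p) \<le> c * norm p" using I \<delta>
proof (induction I rule: finite_induct)
 case (insert x I)
 then obtain c where c: "c \<ge> 0" "\<forall>x\<in>I. \<forall>p\<in>K. norm (\<delta> x p) \<le> c * norm p" by auto
 obtain g where g: "g holomorphic_on U" "\<And>p. \<delta> x p = p * g p"
  using holomorphic_divide_p[of "\<delta> x" U] insert.prems star_openD(1,2)[OF U] by auto
 obtain d where d: "d \<ge> 0" "\<And>p. p \<in> K \<Longrightarrow> norm (g p) \<le> d" using holomorphic_bdd_on_compact[OF g(1) K] by blast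
 have "norm (\<delta> x p) \<le> d * norm p" if "p \<in> K" for p
  using mult_right_mono[OF d(2)[OF that], of "norm p"] by (simp add: g(2) norm_mult mult.commute)
 moreover have m: "c * norm p \<le> max c d * norm p" "d * norm p \<le> max c d * norm p" for p :: complex
  by (auto intro!: mult_right_mono)
 ultimately have "\<forall>y\<in>insert x I. \<forall>p\<in>K. norm (\<delta> y p) \<le> max c d * norm p"
  using c(2) order_trans[OF _ m(1)] order_trans[OF _ m(2)] by blast
 then show ?case using c by (intro exI[of _ "max c d"]) auto
qed auto

text \<open>Reduction to \<open>singular_system\<close> on a short initial interval. Kernels that
  vanish at 0 are \<open>O(t)\<close> there, which is the smallness demanded of \<open>H\<close>.
  Once \<open>D\<close> is 0 near the origin, the rest of the ray is regular.\<close>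

lemma hier_first: fixes lam :: "'n::{finite,linorder} cvec"
 assumes D: "\<And>i. ray_rep th (\<lambda>p. D p $ i) (\<phi> i)" and U: "star_open U" "ray th \<subseteq> U"
  and \<delta>: "\<And>i j. snd (dcoef gc Y (munit j) i) holomorphic_on U" "\<And>i j. snd (dcoef gc Y (munit j) i) 0 = 0"
  and eq: "AE_ray th (\<lambda>p. \<forall>i. hier_lhs lam b gc Y 1 D p i = 0)"
  and lam: "lam $ ix1 = 1" "\<And>i. i \<noteq> ix1 \<Longrightarrow> lam $ i - 1 \<notin> ray th" and \<beta>: "0 < Re (b $ ix1)" "Re (b $ ix1) \<le> 1"
 obtains v where "((\<lambda>t. exp (- (b $ ix1) * of_real (ln t)) * integral {0..t} (\<phi> ix1)) \<longlongrightarrow> v) (at_right 0)"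
  "v = 0 \<Longrightarrow> AE_ray th (\<lambda>p. D p = 0)"
proof -
 define \<Delta> where "\<Delta> i j = snd (dcoef gc Y (munit j) i)" for i j
 have \<Delta>c: "continuous_on (ray th) (\<Delta> i j)" for i j
  unfolding \<Delta>_def using continuous_on_subset[OF holomorphic_on_imp_continuous_on[OF \<delta>(1)] U(2)] .
 have \<Delta>0: "\<Delta> i j 0 = 0" for i j unfolding \<Delta>_def by (rule \<delta>(2))
 define K where "K = (\<lambda>t. of_real t * cis th) ` {0..1::real}"
 have K: "compact K" "K \<subseteq> U" unfolding K_def using U(2)
  by (auto intro!: compact_continuous_image continuous_intros simp: ray_def)
 have "\<exists>c\<ge>0. \<forall>x\<in>UNIV. \<forall>p\<in>K. norm (case x of (i, j) \<Rightarrow> \<Delta> i j p) \<le> c * norm p"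
  by (rule star_open_linear_bound[OF U(1) _ _ _ K]) (auto simp: \<Delta>_def \<delta>)
 then obtain c where c: "c \<ge> 0" "\<And>i j t. t \<in> {0..1} \<Longrightarrow> norm (\<Delta> i j (rp th t)) \<le> c * t"
  by (force simp: K_def norm_mult)
 \<comment> \<open>The first component is singular and needs no lower bound. It receives
   \<open>- cis th\<close>, opposite to the ray, as a placeholder, so that one \<open>d\<close>
   serves all indices.\<close>
 obtain d where d: "d > 0" "\<And>i t. t \<in> {0..1} \<Longrightarrow> d \<le> norm ((if i = ix1 then - cis th else lam $ i - 1) - of_real t * cis th)"
 proof (rule ray_lower_bound[of "\<lambda>i. if i = ix1 then - cis th else lam $ i - 1" th 0 1])
  fix i
  have "- cis th \<noteq> of_real t * cis th" if "t \<ge> 0" for t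
  proof
   assume "- cis th = of_real t * cis th"
   moreover have "(of_real (t + 1) :: complex) * cis th = of_real t * cis th + cis th" by (simp add: algebra_simps)
   ultimately have "(of_real (t + 1) :: complex) * cis th = 0" by (metis add.left_inverse)
   then show False using that by (simp del: of_real_add)
  qed
  then have "- cis th \<notin> (\<lambda>t. of_real t * cis th) ` {0..1}" unfolding image_iff by fastforce
  moreover have "lam $ i - 1 \<notin> (\<lambda>t. of_real t * cis th) ` {0..1}" if "i \<noteq> ix1"
   using lam(2)[OF that] by (auto simp: ray_def)
  ultimately show "(if i = ix1 then - cis th else lam $ i - 1) \<notin> (\<lambda>t. of_real t * cis th) ` {0..1}"
   by (cases "i = ix1") simp_all
 qed simp_all
 define B where "B = (\<Sum>i\<in>UNIV. norm (b $ i))"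
 have B: "norm (b $ i) \<le> B" for i unfolding B_def by (intro member_le_sum) auto
 have B0: "B \<ge> 0" unfolding B_def by (intro sum_nonneg) auto
 \<comment> \<open>\<open>c\<close> serves the bound on \<open>H\<close> in the first component,
   \<open>(B + c) / d\<close> the other components after division by their factor.\<close>
 define C where "C = max c ((B + c) / d)"
 define n where "n = real CARD('n)"
 have C: "C \<ge> 0" "c \<le> C" "(B + c) / d \<le> C" using c by (auto simp: C_def)
 have n: "n > 0" by (simp add: n_def)
 define T where "T = min 1 (1 / (2 * n * (C + 1)))"
 have T: "0 < T" "T \<le> 1" using n C by (auto simp: T_def)
 have nCT: "n * C * T \<le> 1 / 2"
 proof -
  have "T \<le> 1 / (2 * n * (C + 1))" by (simp add: T_def)
  then have "T * (2 * n * (C + 1)) \<le> 1" using n C by (simp add: pos_le_divide_eq)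
  moreover have "0 \<le> T * (2 * n)" using T n by simp
  ultimately show ?thesis by (simp add: algebra_simps)
 qed
 define M where "M t = integral {0..t} (\<lambda>s. \<Sum>i\<in>UNIV. norm (\<phi> i s))" for t
 have ni: "(\<lambda>s. norm (\<phi> i s)) integrable_on {0..t}" for i t
  using ray_rep_abs_integrable[OF D, of t] by (simp add: absolutely_integrable_on_def)
 have M: "M t = (\<Sum>i\<in>UNIV. integral {0..t} (\<lambda>s. norm (\<phi> i s)))" for t
  unfolding M_def using ni by (intro integral_sum) auto
 have In: "integral {0..t} (\<lambda>s. norm (\<phi> i s)) \<ge> 0" for i t using ni by (intro integral_nonneg) auto
 have IM: "integral {0..t} (\<lambda>s. norm (\<phi> i s)) \<le> M t" for i t unfolding M using In by (intro member_le_sum) auto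
 have M0: "M t \<ge> 0" for t unfolding M using In by (intro sum_nonneg) auto
 define \<psi> where "\<psi> i j t = indicat_real {0..} t *\<^sub>R \<Delta> i j (rp th t)" for i j t
 have \<psi>r: "ray_rep th (\<Delta> i j) (\<psi> i j)" for i j unfolding \<psi>_def[abs_def] by (rule ray_rep_continuous[OF \<Delta>c])
 define H where "H i t = (\<Sum>j\<in>UNIV. rconv (\<phi> j) (\<psi> i j) t)" for i t
 have Hb: "norm (H i t) \<le> c * t * M t" if t: "t \<in> {0..1}" for i t
 proof -
  have "norm (H i t) \<le> (\<Sum>j\<in>UNIV. norm (rconv (\<phi> j) (\<psi> i j) t))" unfolding H_def by (rule norm_sum)
  also have "\<dots> \<le> (\<Sum>j\<in>UNIV. (c * t) * integral {0..t} (\<lambda>s. norm (\<phi> j s)))"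
  proof (intro sum_mono)
   fix j
   show "norm (rconv (\<phi> j) (\<psi> i j) t) \<le> (c * t) * integral {0..t} (\<lambda>s. norm (\<phi> j s))"
    unfolding \<psi>_def[abs_def]
   proof (rule rconv_continuous_kernel(2)[OF D \<Delta>c \<Delta>0])
    fix s assume s: "s \<in> {0..t}"
    then have "norm (\<Delta> i j (rp th s)) \<le> c * s" using t by (intro c) auto
    also have "\<dots> \<le> c * t" using s c by (intro mult_left_mono) auto
    finally show "norm (\<Delta> i j (rp th s)) \<le> c * t" .
   qed (use t in auto)
  qed
  finally show ?thesis by (simp add: M sum_distrib_left)
 qed
 have Hc: "(\<Sum>j\<in>UNIV. conv (\<lambda>p. D p $ j) (\<Delta> i j) (rp th t)) = cis th * H i t" if "t > 0" for i t
  unfolding H_def sum_distrib_left using conv_eq_rconv[OF D \<psi>r that] by simp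
 have W: "norm (seg_int (\<lambda>p. D p $ i) (rp th t)) \<le> M t" if t: "t \<ge> 0" for i t
 proof -
  have "norm (integral {0..t} (\<phi> i)) \<le> integral {0..t} (\<lambda>s. norm (\<phi> i s))"
   using ray_rep_abs_integrable[OF D, of t] ni by (intro integral_norm_bound_integral) (auto simp: absolutely_integrable_on_def)
  then show ?thesis using IM[of t i] by (simp add: seg_int_ray_integral[OF D t] norm_mult)
 qed
 have ae0: "AE t in lebesgue. t \<noteq> (0::real)" by (simp add: AE_completion_iff AE_lborel_singleton)
 have aeD: "AE t in lebesgue. \<forall>i\<in>UNIV. t \<ge> 0 \<longrightarrow> D (rp th t) $ i = \<phi> i t"
  by (rule AE_finite_allI) (auto intro: ray_repD(3)[OF D])
 interpret S: singular_system \<phi> ix1 "b $ ix1" "H ix1" C T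
 proof
  show "real CARD('n) * C * T \<le> 1 / 2" using nCT by (simp add: n_def)
  show "set_integrable lebesgue {0..T} (\<phi> i)" for i by (rule ray_rep_abs_integrable[OF D])
  show "continuous_on {0..T} (H ix1)"
   unfolding H_def \<psi>_def[abs_def] by (intro continuous_on_sum rconv_continuous_kernel(1)[OF D \<Delta>c \<Delta>0])
  show "norm (H ix1 t) \<le> C * t * integral {0..t} (\<lambda>s. \<Sum>i\<in>UNIV. norm (\<phi> i s))" if t: "t \<in> {0..T}" for t
  proof -
   have "c * t * M t \<le> C * t * M t" using C t M0 by (intro mult_right_mono) auto
   then show ?thesis using Hb[of t ix1] t T unfolding M_def by auto
  qed
  show "AE t in lebesgue. t \<in> {0..T} \<longrightarrow> of_real t * \<phi> ix1 t = b $ ix1 * integral {0..t} (\<phi> ix1) - H ix1 t"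
   using eq[unfolded AE_ray_def] aeD ae0
  proof eventually_elim
   case (elim t)
   show ?case
   proof
    assume t: "t \<in> {0..T}"
    then have t0: "t > 0" using elim(3) by auto
    have e: "hier_lhs lam b gc Y 1 D (rp th t) ix1 = 0" using elim(1) t by auto
    \<comment> \<open>\<open>lam $ ix1 = 1\<close> reduces the factor to \<open>- p\<close>; then
      \<open>p\<close>, the integral and the convolutions carry one factor \<open>cis th\<close>
      each, which cancels.\<close>
    have "cis th * (- of_real t * \<phi> ix1 t + b $ ix1 * integral {0..t} (\<phi> ix1) - H ix1 t) = 0"
     using e elim(2) t0 lam(1) unfolding hier_lhs_def \<Delta>_def[symmetric] Hc[OF t0] seg_int_ray_integral[OF D less_imp_le[OF t0]]
     by (simp add: algebra_simps)
    then have "- of_real t * \<phi> ix1 t + b $ ix1 * integral {0..t} (\<phi> ix1) - H ix1 t = 0"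
     using cis_neq_zero[of th] unfolding mult_eq_0_iff by blast
    then show "of_real t * \<phi> ix1 t = b $ ix1 * integral {0..t} (\<phi> ix1) - H ix1 t" by (simp add: algebra_simps)
   qed
  qed
  show "AE t in lebesgue. t \<in> {0..T} \<longrightarrow> (\<forall>i. i \<noteq> ix1 \<longrightarrow> norm (\<phi> i t) \<le> C * integral {0..t} (\<lambda>s. \<Sum>i\<in>UNIV. norm (\<phi> i s)))"
   using eq[unfolded AE_ray_def] aeD ae0
  proof eventually_elim
   case (elim t)
   show ?case
   proof (intro impI allI)
    fix i :: 'n assume t: "t \<in> {0..T}" and i: "i \<noteq> ix1"
    then have t0: "t > 0" "t \<in> {0..1}" using elim(3) T by auto
    have "norm (D (rp th t) $ i) \<le> 1 / d * norm (b $ i * seg_int (\<lambda>p. D p $ i) (rp th t) -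
     (\<Sum>j\<in>UNIV. conv (\<lambda>p. D p $ j) (\<Delta> i j) (rp th t)))"
     unfolding \<Delta>_def using elim(1) t d(2)[OF t0(2), of i] i by (intro hier_lhs_bound[where k = 1, OF _ _ d(1)]) auto
    also have "\<dots> \<le> 1 / d * (B * M t + c * 1 * M t)"
    proof (intro mult_left_mono)
     have "norm (b $ i * seg_int (\<lambda>p. D p $ i) (rp th t)) \<le> B * M t"
      unfolding norm_mult using B B0 W[of t i] t0 by (intro mult_mono) auto
     moreover have "norm (H i t) \<le> c * 1 * M t"
     proof (rule order_trans[OF Hb[OF t0(2)]])
      show "c * t * M t \<le> c * 1 * M t" using t0 c M0 by (intro mult_right_mono mult_left_mono) auto
     qed
     ultimately show "norm (b $ i * seg_int (\<lambda>p. D p $ i) (rp th t) -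
      (\<Sum>j\<in>UNIV. conv (\<lambda>p. D p $ j) (\<Delta> i j) (rp th t))) \<le> B * M t + c * 1 * M t"
      unfolding Hc[OF t0(1)] by (intro order_trans[OF norm_triangle_ineq4] add_mono) (auto simp: norm_mult)
    qed (use d in simp)
    also have "\<dots> = (B + c) / d * M t" by (simp add: field_simps)
    also have "\<dots> \<le> C * M t" by (intro mult_right_mono C M0)
    finally show "norm (\<phi> i t) \<le> C * integral {0..t} (\<lambda>s. \<Sum>i\<in>UNIV. norm (\<phi> i s))"
     using elim(2) t0 unfolding M_def by simp
   qed
  qed
 qed (use T C \<beta> in auto)
 obtain v where v: "(S.V \<longlongrightarrow> v) (at_right 0)" using S.V_limit by blast
 show thesis
 proof (rule that)
  show "((\<lambda>t. exp (- (b $ ix1) * of_real (ln t)) * integral {0..t} (\<phi> ix1)) \<longlongrightarrow> v) (at_right 0)"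
   using v unfolding S.V_def[abs_def] S.W_def .
  assume "v = 0"
  then obtain t0 where t0: "0 < t0" "t0 \<le> T" "AE t in lebesgue. t \<in> {0..t0} \<longrightarrow> (\<forall>i. \<phi> i t = 0)"
   using S.zero_limit v by blast
  show "AE_ray th (\<lambda>p. D p = 0)"
  proof (rule hier_zero_from[OF D _ eq, of t0])
   show "\<exists>\<psi>. ray_rep th (snd (dcoef gc Y (munit j) i)) \<psi>" for i j using \<psi>r unfolding \<Delta>_def by blast
   show "AE t in lebesgue. t \<in> {0..<t0} \<longrightarrow> D (rp th t) = 0"
    using t0(3) aeD by eventually_elim (auto simp: vec_eq_iff)
   fix i t assume t: "t0 \<le> t"
   then have "of_real t * cis th \<in> ray th" "of_real t * cis th \<noteq> 0" using t0 by (auto simp: ray_def)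
   then show "lam $ i - of_nat 1 \<noteq> of_real t * cis th" using lam(1) lam(2)[of i] by (cases "i = ix1") auto
  qed (use t0 in auto)
 qed
qed

section \<open>Existence and uniqueness on rays\<close>

definition half_line :: "complex \<Rightarrow> complex set"
 where "half_line c = {of_real \<alpha> * c | \<alpha>. \<alpha> \<ge> 1}"

lemma star_open_compl_half_line: assumes "c \<noteq> 0" shows "star_open (- half_line c)"
proof -
 have eq: "half_line c = {p. Im (p / c) = 0 \<and> 1 \<le> Re (p / c)}"
 proof (intro set_eqI iffI)
  fix p assume "p \<in> {p. Im (p / c) = 0 \<and> 1 \<le> Re (p / c)}"
  then have "p / c = of_real (Re (p / c))" "1 \<le> Re (p / c)" by (auto simp: complex_eq_iff)
  then show "p \<in> half_line c" using assms unfolding half_line_def by (auto simp: field_simps intro!: exI[of _ "Re (p / c)"])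
 qed (use assms in \<open>auto simp: half_line_def\<close>)
 have "closed (half_line c)"
  unfolding eq using assms by (intro closed_Collect_conj closed_Collect_eq closed_Collect_le continuous_intros) auto
 moreover have "of_real u * p \<notin> half_line c" if "p \<notin> half_line c" "u \<in> {0..1}" for p u
 proof
  assume "of_real u * p \<in> half_line c"
  then obtain \<alpha> where \<alpha>: "of_real u * p = of_real \<alpha> * c" "\<alpha> \<ge> 1" by (auto simp: half_line_def)
  then have u: "u > 0" using assms that(2) by (cases "u = 0") auto
  then have "p = of_real (\<alpha> / u) * c" using \<alpha>(1) by (simp add: field_simps)
  moreover have "\<alpha> / u \<ge> 1" using \<alpha>(2) u that(2) by (auto simp: field_simps)
  ultimately show False using that(1) by (auto simp: half_line_def)
 qed
 moreover have "0 \<notin> half_line c" using assms by (auto simp: half_line_def)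
 ultimately show ?thesis by (auto simp: star_open_def)
qed

lemma star_open_INT: "finite I \<Longrightarrow> (\<And>x. x \<in> I \<Longrightarrow> star_open (A x)) \<Longrightarrow> star_open (\<Inter>x\<in>I. A x)"
proof (induction I rule: finite_induct)
 case empty
 show ?case by (simp add: star_open_def)
qed (auto intro: star_open_Int)

text \<open>Cutting along half-lines that point away from 0 keeps the domain star-shaped, and
  cutting for all \<open>k' \<le> k\<close> makes the domains decrease. Pairs with
  \<open>lam $ j = k'\<close> are left out, since their half-line would be the origin
  itself.\<close>

definition level_dom :: "'n::finite cvec \<Rightarrow> nat \<Rightarrow> complex set"
 where "level_dom lam k = (\<Inter>(j, k')\<in>{(j, k'). k' \<le> k \<and> lam $ j \<noteq> of_nat k'}. - half_line (lam $ j - of_nat k'))"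

lemma star_open_level_dom: "star_open (level_dom lam k)" unfolding level_dom_def
proof (rule star_open_INT)
 show "finite {(j, k'). k' \<le> k \<and> lam $ j \<noteq> of_nat k'}" by (rule finite_subset[of _ "UNIV \<times> {..k}"]) auto
qed (auto intro!: star_open_compl_half_line)

section \<open>Borel transforms on a ray: integrability, nonvanishing, relation to the
  series\<close>

lemma RB_ray_rep: assumes F: "RB th U s w F" and U: "ray th \<subseteq> U" and s: "Re s > 0"
 shows "\<exists>\<phi>. ray_rep th F \<phi>"
proof -
 obtain A where A: "A holomorphic_on U" "\<And>p. p \<in> ray th - {0} \<Longrightarrow> F p = ray_power th (s - 1) p * A p"
  using F unfolding RB_def by blast
 have "set_integrable lebesgue {0..T} (\<lambda>t. F (rp th t))" for T
 proof (cases "T \<ge> 0")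
  case True
  define K where "K = (\<lambda>t. of_real t * cis th) ` {0..T}"
  have K: "compact K" "K \<subseteq> U" unfolding K_def using U
   by (auto intro!: compact_continuous_image continuous_intros simp: ray_def)
  obtain c where c: "c \<ge> 0" "\<And>p. p \<in> K \<Longrightarrow> norm (A p) \<le> c" using holomorphic_bdd_on_compact[OF A(1) K] by blast
  have Ft: "F (rp th t) = exp ((s - 1) * Complex (ln t) th) * A (rp th t)" if "t \<in> {0<..T}" for t
   using A(2)[of "of_real t * cis th"] that by (auto simp: ray_def ray_power_def norm_mult)
  have Ac: "continuous_on {0<..T} (\<lambda>t. A (rp th t))"
   by (rule continuous_on_compose2[OF holomorphic_on_imp_continuous_on[OF A(1)]])
    (use U in \<open>auto intro!: continuous_intros simp: ray_def\<close>)
  have "(\<lambda>t. F (rp th t)) absolutely_integrable_on {0<..T}"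
  proof (rule measurable_bounded_by_integrable_imp_absolutely_integrable)
   have "continuous_on {0<..T} (\<lambda>t. exp ((s - 1) * (of_real (ln t) + \<i> * of_real th)) * A (rp th t))"
    by (intro continuous_intros Ac) auto
   then have "continuous_on {0<..T} (\<lambda>t. F (rp th t))" by (rule continuous_on_eq) (simp add: Ft Complex_eq)
   then show "(\<lambda>t. F (rp th t)) \<in> borel_measurable (lebesgue_on {0<..T})"
    by (rule continuous_imp_measurable_on_sets_lebesgue) auto
   have "(\<lambda>t. t powr (Re s - 1)) integrable_on {0..T}"
    using has_integral_powr_from_0[of "Re s - 1" T] s True by (auto intro: has_integral_integrable)
   then have "(\<lambda>t. (exp (- Im s * th) * c) * t powr (Re s - 1)) integrable_on {0..T}" by (intro integrable_on_mult_right)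
   then show "(\<lambda>t. (exp (- Im s * th) * c) * t powr (Re s - 1)) integrable_on {0<..T}"
    by (rule integrable_spike_set) (auto intro: negligible_subset[of "{0}"])
   fix t assume t: "t \<in> {0<..T}"
   have "norm (exp ((s - 1) * Complex (ln t) th)) = exp (- Im s * th) * t powr (Re s - 1)"
    using t by (simp add: norm_exp_eq_Re powr_def flip: exp_add)
   then show "norm (F (rp th t)) \<le> (exp (- Im s * th) * c) * t powr (Re s - 1)" using c(2)[of "of_real t * cis th"] t
     mult_left_mono[of "norm (A (rp th t))" c "exp (- Im s * th) * t powr (Re s - 1)"]
    unfolding Ft[OF t] norm_mult by (auto simp: K_def mult_ac)
  qed simp
  then show ?thesis by (rule absolutely_integrable_spike_set_eq[THEN iffD1, rotated -1]) (auto intro: negligible_subset[of "{0}"])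
 qed (simp add: set_integrable_def)
 then show ?thesis using ray_rep_exists[of F th] by blast
qed

lemma AE_ray_near_0: assumes "AE_ray th P" "r > 0" obtains t where "0 < t" "t < r" "P (rp th t)"
proof (rule ccontr)
 assume "\<not> thesis"
 then have "AE t in lebesgue. t \<notin> {0<..<r}" using assms(1) that unfolding AE_ray_def by (auto elim!: eventually_mono)
 then have "AE t in lborel. t \<notin> {0<..<r}" by (simp add: AE_completion_iff)
 then have "{0<..<r} \<in> null_sets lborel" by (subst (asm) AE_iff_null_sets[symmetric]) auto
 then show False using assms(2) by (simp add: null_sets_def)
qed

text \<open>The analytic factor takes the value \<open>rGamma s\<close> at 0, which is nonzero for
  \<open>Re s > 0\<close>. For the first component of \<open>Y 1\<close> this shows that the limit
  parametrizing level 1 does not vanish.\<close>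

lemma RB_not_AE_zero: assumes F: "RB th U s w F" and U: "open U" "ray th \<subseteq> U" and s: "Re s > 0" and w: "fps_nth w 0 = 1"
 shows "\<not> AE_ray th (\<lambda>p. F p = 0)"
proof
 assume ae: "AE_ray th (\<lambda>p. F p = 0)"
 obtain A where A: "A holomorphic_on U" "A has_fps_expansion bor s w" "\<And>p. p \<in> ray th - {0} \<Longrightarrow> F p = ray_power th (s - 1) p * A p"
  using F unfolding RB_def by blast
 have "A 0 = rGamma s" using has_fps_expansion_imp_0_eq_fps_nth_0[OF A(2)] w by simp
 then have A0: "A 0 \<noteq> 0" using s by (auto simp: rGamma_eq_zero_iff elim!: nonpos_Ints_cases)
 have "0 \<in> U" using U(2) by (force simp: ray_def)
 then have "isCont A 0" using A(1) U(1) holomorphic_on_imp_continuous_on continuous_on_eq_continuous_at by blast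
 from continuous_at_avoid[OF this A0] obtain r where r: "r > 0" "\<And>p. dist 0 p < r \<Longrightarrow> A p \<noteq> 0" by blast
 obtain t where t: "0 < t" "t < r" "F (rp th t) = 0" using AE_ray_near_0[OF ae r(1)] by blast
 then have "A (rp th t) = 0" using A(3)[of "of_real t * cis th"] by (auto simp: ray_def ray_power_def)
 then show False using r(2)[of "of_real t * cis th"] t by (simp add: dist_norm norm_mult)
qed

lemma RB_borel_along: assumes RB: "\<And>i. RB th U s (w i) (\<lambda>p. Y p $ i)" and U: "open U" "ray th \<subseteq> U"
 shows "borel_along th s (\<lambda>m. \<chi> i. fps_nth (w i) m) (Y :: complex \<Rightarrow> 'n::finite cvec)"
proof -
 have "\<forall>i. \<exists>A. A holomorphic_on U \<and> A has_fps_expansion bor s (w i) \<and>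
  (\<forall>p\<in>ray th - {0}. Y p $ i = ray_power th (s - 1) p * A p)" using RB unfolding RB_def by blast
 from choice[OF this] obtain A where A: "\<And>i. A i holomorphic_on U" "\<And>i. A i has_fps_expansion bor s (w i)"
  "\<And>i p. p \<in> ray th - {0} \<Longrightarrow> Y p $ i = ray_power th (s - 1) p * A i p" by blast
 have "\<forall>i. \<exists>r>0. \<forall>p. norm p < r \<longrightarrow> (\<lambda>m. fps_nth (bor s (w i)) m * p ^ m) sums A i p"
  using has_fps_expansion_sums_near_0[OF A(2)] by metis
 from choice[OF this] obtain r where r: "\<And>i. r i > 0" "\<And>i p. norm p < r i \<Longrightarrow> (\<lambda>m. fps_nth (bor s (w i)) m * p ^ m) sums A i p"
  by blast
 have "Min (range r) > 0" using r(1) by (subst Min_gr_iff) auto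
 moreover have "(\<lambda>m. fps_nth (w i) m * p ^ m * rGamma (s + of_nat m)) sums A i p" if "norm p < Min (range r)" for p i
 proof -
  have "norm p < r i" using that by (subst (asm) Min_gr_iff) auto
  from r(2)[OF this] show ?thesis by (simp add: mult_ac)
 qed
 ultimately have e: "\<exists>\<epsilon>>0. \<forall>p i. cmod p < \<epsilon> \<longrightarrow> (\<lambda>m. (\<chi> i. fps_nth (w i) m) $ i * p ^ m * rGamma (s + of_nat m)) sums ((\<chi> i. A i p) $ i)"
  unfolding vec_lambda_beta by blast
 have h: "\<forall>i. (\<lambda>p. (\<chi> i. A i p) $ i) holomorphic_on U" using A(1) by simp
 have Y: "\<forall>p\<in>ray th - {0}. Y p = ray_power th (s - 1) p *s (\<chi> i. A i p)" using A(3) by (simp add: vec_eq_iff)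
 show ?thesis unfolding borel_along_def by (rule exI[of _ U], rule exI[of _ "\<lambda>p. \<chi> i. A i p"]) (intro conjI U h e Y)
qed

lemma HD_RB_0: "HD U (0, F) w \<Longrightarrow> RB th U 0 w F"
proof -
 assume F: "HD U (0, F) w"
 then have "fps_nth w 0 = 0" by (simp add: HD_def)
 then have "fps_X * fps_shift 1 w = w" using fps_const_X_shift[of w] by simp
 then show ?thesis using RB_shift[of th U 0 "fps_shift 1 w" F] RB_HD[OF F, of th] by simp
qed

section \<open>Position of the rays relative to the singular points\<close>

context conv_system begin

lemma Arg2pi_mono: "i \<le> j \<Longrightarrow> Arg2pi (lam $ i) \<le> Arg2pi (lam $ j)"
 using lam_arg[of i j] le_neq_trans[of i j] by (cases "i = j") auto

text \<open>Arguments increase strictly with the index, so only the first entry can have argument 0,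
  and it is 1.\<close>

lemma lam_eq_of_nat: assumes "lam $ i = of_nat k" shows "i = ix1" "k = 1"
proof -
 show i: "i = ix1"
 proof (rule ccontr)
  assume "i \<noteq> ix1"
  then have "ix1 < i" unfolding ix1_def by (simp add: order.strict_iff_order)
  from lam_arg[OF this] have "Arg2pi (lam $ i) \<noteq> 0" using Arg2pi_ge_0[of "lam $ ix1"] by linarith
  then show False using assms by (simp add: Arg2pi_eq_0)
 qed
 show "k = 1" using assms lam_1 i by simp
qed

lemma star_levels_level_dom: "star_levels (level_dom lam)" unfolding star_levels_def
proof (intro conjI allI ballI impI)
 have out: "p \<noteq> lam $ i - of_nat k" if "p \<in> level_dom lam k" "lam $ i \<noteq> of_nat k" for p i k
 proof -
  have "p \<notin> half_line (lam $ i - of_nat k)" using that by (auto simp: level_dom_def)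
  moreover have "lam $ i - of_nat k \<in> half_line (lam $ i - of_nat k)" by (auto simp: half_line_def intro!: exI[of _ 1])
  ultimately show ?thesis by blast
 qed
 show "p \<noteq> lam $ i" if "p \<in> level_dom lam 0" for p i using out[OF that, of i] lam_nz by simp
 show "(\<forall>p\<in>level_dom lam k. p \<noteq> lam $ i - of_nat k) \<or> i = ix1 \<and> k = 1" for k i
  using out[of _ k i] lam_eq_of_nat[of i k] by blast
 show "star_open (level_dom lam k)" for k by (rule star_open_level_dom)
qed (auto simp: level_dom_def)

lemma domD_level_dom: "domD lam = level_dom lam 0" using lam_nz by (force simp: domD_def level_dom_def half_line_def)

text \<open>A half-line points away from 0, so the ray can meet it only if the starting point
  \<open>lam $ j - k'\<close> lies on the ray. \<open>domD\<close> excludes this for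
  \<open>k' = 0\<close>, nonresonance for \<open>k' \<ge> 1\<close>.\<close>

lemma ray_level_dom:
 assumes ray: "ray th \<subseteq> domD lam" and nr: "nonresonant_ray lam th" shows "ray th \<subseteq> level_dom lam k"
proof
 fix p assume p: "p \<in> ray th"
 have "p \<notin> half_line (lam $ j - of_nat k')" if ne: "lam $ j \<noteq> of_nat k'" for j k'
 proof (cases "k' = 0")
  case True
  then show ?thesis using p ray lam_nz by (auto simp: domD_level_dom level_dom_def)
 next
  case False
  show ?thesis
  proof
   assume "p \<in> half_line (lam $ j - of_nat k')"
   then obtain \<alpha> where \<alpha>: "p = of_real \<alpha> * (lam $ j - of_nat k')" "\<alpha> \<ge> 1" by (auto simp: half_line_def)
   obtain t where t: "p = of_real t * cis th" "t \<ge> 0" using p by (auto simp: ray_def)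
   have "lam $ j - of_nat k' = of_real (t / \<alpha>) * cis th" using \<alpha> t by (simp add: field_simps)
   then have "lam $ j - of_nat k' \<in> ray th - {0}" using \<alpha>(2) t(2) ne by (auto simp: ray_def intro!: exI[of _ "t / \<alpha>"])
   then show False using nr False by (auto simp: nonresonant_ray_def)
  qed
 qed
 then show "p \<in> level_dom lam k" by (auto simp: level_dom_def)
qed

text \<open>A point \<open>lam $ j\<close> on the ray is not 1, so its argument lies in
  \<open>[phi_plus, 2 \<pi> - phi_minus]\<close>, and no shift by a multiple of
  \<open>2 \<pi>\<close> brings it strictly between \<open>- phi_minus\<close> and
  \<open>phi_plus\<close>.\<close>

lemma domW1_domD: assumes W: "ray th - {0} \<subseteq> domW1 lam" shows "ray th \<subseteq> domD lam"
proof
 fix p assume p: "p \<in> ray th"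
 show "p \<in> domD lam"
 proof (rule ccontr)
  assume "p \<notin> domD lam"
  then obtain \<alpha> j where \<alpha>: "p = of_real \<alpha> * lam $ j" "\<alpha> \<ge> 1" by (auto simp: domD_def)
  obtain t where t: "p = of_real t * cis th" "t \<ge> 0" using p by (auto simp: ray_def)
  have "lam $ j = of_real (t / \<alpha>) * cis th" using \<alpha> t by (simp add: field_simps)
  then have "lam $ j \<in> ray th - {0}" using \<alpha>(2) t(2) lam_nz by (auto simp: ray_def intro!: exI[of _ "t / \<alpha>"])
  then have w: "lam $ j \<in> domW1 lam" using W by blast
  then have "lam $ j \<notin> \<nat>" by (simp add: domW1_def)
  then have j: "j \<noteq> ix1" using lam_1 by auto
  then have "CARD('n) \<noteq> 1" by (metis UNIV_I card_1_singletonE singletonD)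
  then obtain a where a: "- phi_minus lam < a" "a < phi_plus lam" "lam $ j = of_real (cmod (lam $ j)) * cis a"
   using w by (auto simp: domW1_def)
  define A where "A = Arg2pi (lam $ j)"
  have "lam $ j = of_real (cmod (lam $ j)) * cis A" using Arg2pi_eq[of "lam $ j"] by (simp add: A_def cis_conv_exp)
  then have "cis a = cis A" using a(3) lam_nz[of j] by (metis mult_left_cancel norm_eq_zero of_real_eq_0_iff)
  then have "sin a = sin A \<and> cos a = cos A" by (metis cis.sel)
  then obtain m :: int where m: "a = A + 2 * pi * m" by (auto simp: sin_cos_eq_iff)
  have "phi_plus lam \<le> A" unfolding phi_plus_def A_def using j by (intro Arg2pi_mono Min_le) auto
  then have "2 * pi * m < 0" using a(2) m by linarith
  then have "m < 0" by (simp add: mult_less_0_iff)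
  then have "real_of_int m \<le> - 1" by simp
  then have "2 * pi * m \<le> 2 * pi * (- 1)" by (intro mult_left_mono) auto
  moreover have "A \<le> 2 * pi - phi_minus lam" unfolding phi_minus_def A_def by (simp add: Arg2pi_mono)
  ultimately show False using a(1) m by linarith
 qed
qed

lemma unique_solution: assumes y: "transseries lam b fc gc y" and ray: "ray th \<subseteq> domD lam"
 obtains Y0 where "borel_along th 0 (ts_coeff y 0) Y0" "L1loc th Y0" "solves_conv_eq lam b fc gc th Y0"
  "\<And>Z. L1loc th Z \<Longrightarrow> solves_conv_eq lam b fc gc th Z \<Longrightarrow> AE_ray th (\<lambda>p. Z p = Y0 p)"
proof -
 have U: "star_open (domD lam)" unfolding domD_level_dom by (rule star_open_level_dom)
 have nl: "p \<noteq> lam $ i" if "p \<in> domD lam" for p i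
  using star_levels_level_dom that by (auto simp: star_levels_def domD_level_dom)
 obtain Y where Y: "\<And>i. HD (domD lam) (0, \<lambda>p. Y p $ i) (fps_nth (y i) 0)"
  "\<And>p i. p \<in> domD lam \<Longrightarrow> conv_eq_at Y p i"
  by (rule conv_eq_solution[OF U nl y], assumption) (rule that; assumption)
 have rep: "\<exists>\<phi>. ray_rep th (\<lambda>p. Y p $ i) \<phi>" for i
 proof -
  have "(\<lambda>p. Y p $ i) holomorphic_on domD lam" using Y(1)[of i] by (simp add: HD_def)
  then show ?thesis using ray_rep_continuous continuous_on_subset[OF holomorphic_on_imp_continuous_on ray] by blast
 qed
 have eq: "solves_conv_eq lam b fc gc th Y" unfolding solves_conv_eq_def
 proof (intro AE_rayI allI)
  fix p i assume "p \<in> ray th"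
  then show "- p * Y p $ i = F0 fc p i - lam $ i * Y p $ i - b $ i * seg_int (\<lambda>s. Y s $ i) p + Nop gc Y p i"
   using Y(2)[of p i] ray by (auto simp: algebra_simps)
 qed
 show thesis
 proof (rule that[OF _ rep_L1loc[OF rep] eq])
  show "borel_along th 0 (ts_coeff y 0) Y"
   unfolding ts_coeff_def[abs_def] using U by (intro RB_borel_along[OF HD_RB_0[OF Y(1)] _ ray]) (rule star_openD)
  show "AE_ray th (\<lambda>p. Z p = Y p)" if "L1loc th Z" "solves_conv_eq lam b fc gc th Z" for Z
   using that ray nl by (intro conv_eq_unique rep L1loc_rep eq) auto
 qed
qed

end

context conv_system begin

abbreviation is_solution :: "real \<Rightarrow> (nat \<Rightarrow> complex \<Rightarrow> 'n cvec) \<Rightarrow> bool"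
 where "is_solution th Z \<equiv> (\<forall>k. L1loc th (Z k)) \<and> solves_conv_eq lam b fc gc th (Z 0) \<and> (\<forall>k\<ge>1. solves_hierarchy lam b gc th Z k)"

lemma general_solution:
 assumes y: "transseries lam b fc gc y" and ray: "ray th \<subseteq> domD lam" and nr: "nonresonant_ray lam th"
 obtains Y where "\<And>k. borel_along th (of_nat k * b $ ix1) (ts_coeff y k) (Y k)"
  "\<And>Z. is_solution th Z \<longleftrightarrow> (\<exists>C. \<forall>k. AE_ray th (\<lambda>p. Z k p = C ^ k *s Y k p))"
proof -
 let ?U = "level_dom lam"
 let ?\<beta> = "b $ ix1"
 have lev: "star_levels ?U" by (rule star_levels_level_dom)
 have sU: "star_open (?U k)" for k by (rule star_open_level_dom)
 have oU: "open (?U k)" for k using star_openD(1)[OF sU] .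
 have rU: "ray th \<subseteq> ?U k" for k by (rule ray_level_dom[OF ray nr])
 obtain Y where Y0: "\<And>i. HD (?U 0) (0, \<lambda>p. Y 0 p $ i) (fps_nth (y i) 0)" and small: "small_on (?U 0) (Y 0)"
  and eq0: "\<And>p i. p \<in> ?U 0 \<Longrightarrow> conv_eq_at (Y 0) p i"
  and YR: "\<And>k i. k \<ge> 1 \<Longrightarrow> RB th (?U k) (of_nat k * ?\<beta>) (fps_nth (y i) k) (\<lambda>p. Y k p $ i)"
  and eqk: "\<And>k i p. k \<ge> 1 \<Longrightarrow> p \<in> ray th - {0} \<Longrightarrow> hier_eq Y k p i"
  by (rule hierarchy_solution[OF lev y rU]) (rule that; assumption)
 have Yrep: "\<exists>\<phi>. ray_rep th (\<lambda>p. Y k p $ i) \<phi>" for k i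
 proof (cases "k = 0")
  case True
  have "(\<lambda>p. Y 0 p $ i) holomorphic_on ?U 0" using Y0[of i] by (simp add: HD_def)
  then show ?thesis using True ray_rep_continuous continuous_on_subset[OF holomorphic_on_imp_continuous_on rU] by blast
 next
  case False
  then have "Re (of_nat k * ?\<beta>) > 0" using beta by simp
  with False show ?thesis using RB_ray_rep[OF YR rU] by simp
 qed
 have S0: "solves_conv_eq lam b fc gc th (Y 0)" unfolding solves_conv_eq_def
 proof (intro AE_rayI allI)
  fix p i assume "p \<in> ray th"
  then show "- p * Y 0 p $ i = F0 fc p i - lam $ i * Y 0 p $ i - b $ i * seg_int (\<lambda>s. Y 0 s $ i) p + Nop gc (Y 0) p i"
   using eq0[of p i] rU by (auto simp: algebra_simps)
 qed
 have Sk: "AE_ray th (\<lambda>p. \<forall>i. hier_lhs lam b gc (Y 0) k (Y k) p i = hier_rhs gc Y k p i)" if "k \<ge> 1" for k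
  unfolding hier_lhs_def hier_rhs_def by (rule AE_ray_mono[OF AE_ray_neq_0]) (use eqk[OF that] in auto)
 have low: "fps_nth (fps_nth (y j) 0) 0 = 0" "fps_nth (fps_nth (y j) 0) 1 = 0" for j using y by (auto simp: transseries_def)
 have \<delta>HD: "HD (?U 0) (dcoef gc (Y 0) (munit j) i) (dfps gc (\<lambda>j. fps_nth (y j) 0) (munit j) i)" for i j
  by (rule dcoef_HD[OF sU Y0 small])
 have \<delta>: "snd (dcoef gc (Y 0) (munit j) i) holomorphic_on ?U 0" "snd (dcoef gc (Y 0) (munit j) i) 0 = 0" for i j
 proof -
  show "snd (dcoef gc (Y 0) (munit j) i) holomorphic_on ?U 0" using \<delta>HD[of j i] by (simp add: HD_def)
  have "snd (dcoef gc (Y 0) (munit j) i) has_fps_expansion bor 1 (fps_shift 1 (dfps gc (\<lambda>j. fps_nth (y j) 0) (munit j) i))"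
   using \<delta>HD[of j i] by (simp add: HD_def)
  from has_fps_expansion_imp_0_eq_fps_nth_0[OF this] show "snd (dcoef gc (Y 0) (munit j) i) 0 = 0"
   using dfps_munit_low[where w = "\<lambda>j. fps_nth (y j) 0" and N = 1 and j = j and i = i, OF low] by simp
 qed
 have \<delta>r: "\<exists>\<psi>. ray_rep th (snd (dcoef gc (Y 0) (munit j) i)) \<psi>" for i j
  using ray_rep_continuous continuous_on_subset[OF holomorphic_on_imp_continuous_on[OF \<delta>(1)] rU] by blast
 have nz: "lam $ i - of_nat k \<notin> ray th \<or> i = ix1 \<and> k = 1" if "k \<ge> 1" for i k
  using lev that rU[of k] unfolding star_levels_def by blast
 obtain \<phi>1 where \<phi>1: "\<And>i. ray_rep th (\<lambda>p. Y 1 p $ i) (\<phi>1 i)" using Yrep by metis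
 have first: "\<exists>v. ((\<lambda>t. exp (- ?\<beta> * of_real (ln t)) * integral {0..t} (\<phi> ix1)) \<longlongrightarrow> v) (at_right 0) \<and> (v = 0 \<longrightarrow> AE_ray th (\<lambda>p. D p = 0))"
  if "\<And>i. ray_rep th (\<lambda>p. D p $ i) (\<phi> i)" "AE_ray th (\<lambda>p. \<forall>i. hier_lhs lam b gc (Y 0) 1 D p i = 0)" for D \<phi>
 proof (rule hier_first[OF that(1) sU[of 0] rU \<delta> that(2) lam_1 _ beta])
  show "i \<noteq> ix1 \<Longrightarrow> lam $ i - 1 \<notin> ray th" for i using nz[of 1 i] by simp
 qed blast
 have "AE_ray th (\<lambda>p. \<forall>i. hier_lhs lam b gc (Y 0) 1 (Y 1) p i = 0)" using Sk[of 1] by (simp add: hier_rhs_1[unfolded One_nat_def])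
 from first[OF \<phi>1 this] obtain v1 where v1: "((\<lambda>t. exp (- ?\<beta> * of_real (ln t)) * integral {0..t} (\<phi>1 ix1)) \<longlongrightarrow> v1) (at_right 0)"
  "v1 = 0 \<longrightarrow> AE_ray th (\<lambda>p. Y 1 p = 0)" by blast
 \<comment> \<open>Otherwise \<open>Y 1\<close> would vanish almost everywhere, contrary to the
   leading coefficient 1 of its first component.\<close>
 have v1nz: "v1 \<noteq> 0"
 proof
  assume "v1 = 0"
  then have "AE_ray th (\<lambda>p. Y 1 p $ ix1 = 0)" using AE_ray_mono[of th "\<lambda>p. Y 1 p = 0"] v1(2) by auto
  moreover have "fps_nth (fps_nth (y ix1) 1) 0 = 1" using y by (simp add: transseries_def)
  ultimately show False using RB_not_AE_zero[OF YR[of 1 ix1] oU rU] beta by simp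
 qed
 have hom: "AE_ray th (\<lambda>p. \<forall>i. hier_lhs lam b gc (Y 0) k (\<lambda>p. Z p - c *s Y k p) p i = 0)"
  if k: "k \<ge> 1" and Z: "\<And>i. ray_rep th (\<lambda>p. Z p $ i) (\<zeta> i)"
   and eq: "AE_ray th (\<lambda>p. \<forall>i. hier_lhs lam b gc (Y 0) k Z p i = c * hier_rhs gc Y k p i)" for k Z c \<zeta>
 proof -
  obtain \<phi> where \<phi>: "\<And>i. ray_rep th (\<lambda>p. Y k p $ i) (\<phi> i)" using Yrep by metis
  have 1: "AE_ray th (\<lambda>p. (\<forall>i. hier_lhs lam b gc (Y 0) k Z p i = c * hier_rhs gc Y k p i) \<and>
   (\<forall>i. hier_lhs lam b gc (Y 0) k (Y k) p i = hier_rhs gc Y k p i))" by (rule AE_ray_mp[OF eq Sk[OF k]]) blast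
  show ?thesis by (rule AE_ray_mp[OF 1 hier_lhs_diff[OF Z \<phi> \<delta>r, where lam = lam and b = b and k = k and c = c]]) simp
 qed
 have uniq: "\<exists>C. \<forall>k. AE_ray th (\<lambda>p. Z k p = C ^ k *s Y k p)"
  if L: "\<forall>k. L1loc th (Z k)" and Z0: "solves_conv_eq lam b fc gc th (Z 0)" and Zk: "\<forall>k\<ge>1. solves_hierarchy lam b gc th Z k" for Z
 proof -
  have Zrep: "\<exists>\<phi>. ray_rep th (\<lambda>p. Z k p $ i) \<phi>" for k i using L L1loc_rep by blast
  have "lam $ i \<notin> ray th" for i using lev rU[of 0] unfolding star_levels_def by blast
  then have Z0Y: "AE_ray th (\<lambda>p. Z 0 p = Y 0 p)" by (intro conv_eq_unique Yrep Zrep S0 Z0)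
  have step: "AE_ray th (\<lambda>p. \<forall>i. hier_lhs lam b gc (Y 0) k (Z k) p i = C ^ k * hier_rhs gc Y k p i)"
   if k: "k \<ge> 1" and lt: "\<And>j. j < k \<Longrightarrow> AE_ray th (\<lambda>p. Z j p = C ^ j *s Y j p)" for k C
  proof -
   have 1: "AE_ray th (\<lambda>p. \<forall>i. hier_lhs lam b gc (Z 0) k (Z k) p i = hier_rhs gc Z k p i)"
    using Zk k by (simp add: solves_hierarchy_eq)
   have 2: "AE_ray th (\<lambda>p. \<forall>i. hier_lhs lam b gc (Z 0) k (Z k) p i = 1 * hier_lhs lam b gc (Y 0) k (Z k) p i)"
    by (rule hier_lhs_cong[OF Z0Y]) (simp add: AE_rayI)
   have 3: "AE_ray th (\<lambda>p. \<forall>i. hier_lhs lam b gc (Y 0) k (Z k) p i = hier_rhs gc Z k p i)"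
    by (rule AE_ray_mp[OF 1 2]) simp
   show ?thesis by (rule AE_ray_mp[OF 3 hier_rhs_cong[OF k lt]]) simp_all
  qed
  obtain \<zeta> where \<zeta>: "\<And>i. ray_rep th (\<lambda>p. Z 1 p $ i) (\<zeta> i)" using Zrep by metis
  \<comment> \<open>The right side at level 1 is 0, so any multiple of it may be written; below the
    multiple is \<open>C\<close>.\<close>
  have Z1: "AE_ray th (\<lambda>p. \<forall>i. hier_lhs lam b gc (Y 0) 1 (Z 1) p i = c * hier_rhs gc Y 1 p i)" for c
   using step[of 1 c] Z0Y unfolding hier_rhs_1 by simp
  have "AE_ray th (\<lambda>p. \<forall>i. hier_lhs lam b gc (Y 0) 1 (Z 1) p i = 0)" using Z1[of 0] by simp
  from first[OF \<zeta> this] obtain v where v: "((\<lambda>t. exp (- ?\<beta> * of_real (ln t)) * integral {0..t} (\<zeta> ix1)) \<longlongrightarrow> v) (at_right 0)" by blast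
  \<comment> \<open>The limit is linear in the solution, so \<open>Z 1 - C Y 1\<close> has limit 0
    and vanishes by \<open>first\<close>.\<close>
  define C where "C = v / v1"
  have D: "ray_rep th (\<lambda>p. (Z 1 p - C *s Y 1 p) $ i) (\<lambda>t. \<zeta> i t - C * \<phi>1 i t)" for i
   using ray_rep_diff[OF \<zeta> ray_rep_cmult[OF \<phi>1]] by simp
  from first[OF D hom[OF _ \<zeta> Z1]] obtain v2 where
   v2: "((\<lambda>t. exp (- ?\<beta> * of_real (ln t)) * integral {0..t} (\<lambda>t. \<zeta> ix1 t - C * \<phi>1 ix1 t)) \<longlongrightarrow> v2) (at_right 0)"
   "v2 = 0 \<longrightarrow> AE_ray th (\<lambda>p. Z 1 p - C *s Y 1 p = 0)" by auto
  have e: "exp (- ?\<beta> * of_real (ln t)) * integral {0..t} (\<lambda>t. \<zeta> ix1 t - C * \<phi>1 ix1 t) =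
    exp (- ?\<beta> * of_real (ln t)) * integral {0..t} (\<zeta> ix1) - C * (exp (- ?\<beta> * of_real (ln t)) * integral {0..t} (\<phi>1 ix1))" for t
  proof -
   have "\<zeta> ix1 integrable_on {0..t}" "\<phi>1 ix1 integrable_on {0..t}"
    using set_lebesgue_integral_eq_integral(1)[OF ray_rep_abs_integrable] \<zeta> \<phi>1 by blast+
   then have i: "integral {0..t} (\<lambda>t. \<zeta> ix1 t - C * \<phi>1 ix1 t) = integral {0..t} (\<zeta> ix1) - C * integral {0..t} (\<phi>1 ix1)"
    by (subst Henstock_Kurzweil_Integration.integral_diff) (auto intro: integrable_on_mult_right)
   show ?thesis unfolding i by (simp add: algebra_simps)
  qed
  have "v2 = v - C * v1"
   by (rule tendsto_unique[OF _ v2(1)]) (auto simp only: e intro!: trivial_limit_at_right_real tendsto_intros v v1(1))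
  then have "v2 = 0" using v1nz by (simp add: C_def)
  then have C1: "AE_ray th (\<lambda>p. Z 1 p = C *s Y 1 p)" using v2(2) by simp
  have "AE_ray th (\<lambda>p. Z k p = C ^ k *s Y k p)" for k
  proof (induction k rule: less_induct)
   case (less k)
   consider "k = 0" | "k = 1" | "k \<ge> 2" by linarith
   then show ?case
   proof cases
    \<comment> \<open>For \<open>k \<ge> 2\<close> the factor \<open>lam - p - k\<close> has no zero
      on the ray, not even at \<open>p = 0\<close>, so \<open>hier_zero_from\<close> applies from
      the origin on.\<close>
    case 3
    then have k: "k \<ge> 1" by simp
    obtain \<zeta> where \<zeta>: "\<And>i. ray_rep th (\<lambda>p. Z k p $ i) (\<zeta> i)" using Zrep by metis
    obtain \<phi> where \<phi>: "\<And>i. ray_rep th (\<lambda>p. Y k p $ i) (\<phi> i)" using Yrep by metis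
    have D: "ray_rep th (\<lambda>p. (Z k p - C ^ k *s Y k p) $ i) (\<lambda>t. \<zeta> i t - C ^ k * \<phi> i t)" for i
     using ray_rep_diff[OF \<zeta> ray_rep_cmult[OF \<phi>]] by simp
    have "AE_ray th (\<lambda>p. Z k p - C ^ k *s Y k p = 0)"
    proof (rule hier_zero_from[OF D \<delta>r hom[OF k \<zeta> step[OF k less]], of 0])
     show "lam $ i - of_nat k \<noteq> of_real t * cis th" if "0 \<le> t" for i t
      using nz[OF k, of i] 3 that by (auto simp: ray_def)
    qed simp_all
    then show ?thesis by simp
   qed (use Z0Y C1 in simp_all)
  qed
  then show ?thesis by blast
 qed
 show thesis
 proof (rule that)
  fix k
  show "borel_along th (of_nat k * ?\<beta>) (ts_coeff y k) (Y k)"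
  proof (cases "k = 0")
   case True
   have "borel_along th 0 (\<lambda>m. \<chi> i. fps_nth (fps_nth (y i) 0) m) (Y 0)"
    by (rule RB_borel_along[OF HD_RB_0[OF Y0] oU rU])
   then show ?thesis using True by (simp add: ts_coeff_def[abs_def])
  next
   case False
   then show ?thesis unfolding ts_coeff_def[abs_def] by (intro RB_borel_along[OF YR oU rU]) simp
  qed
 next
  fix Z :: "nat \<Rightarrow> complex \<Rightarrow> 'n cvec"
  show "is_solution th Z \<longleftrightarrow> (\<exists>C. \<forall>k. AE_ray th (\<lambda>p. Z k p = C ^ k *s Y k p))"
  proof
   assume "\<exists>C. \<forall>k. AE_ray th (\<lambda>p. Z k p = C ^ k *s Y k p)"
   then obtain C where C: "\<And>k. AE_ray th (\<lambda>p. Z k p = C ^ k *s Y k p)" by blast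
   have Z0Y: "AE_ray th (\<lambda>p. Z 0 p = Y 0 p)" using C[of 0] by simp
   have "\<exists>\<phi>. ray_rep th (\<lambda>p. Z k p $ i) \<phi>" for k i
   proof -
    obtain \<phi> where "ray_rep th (\<lambda>p. Y k p $ i) \<phi>" using Yrep by blast
    from ray_rep_cong[OF ray_rep_cmult[OF this], of "C ^ k" "\<lambda>p. Z k p $ i"] show ?thesis
     using AE_ray_mono[OF C[of k], of "\<lambda>p. C ^ k * Y k p $ i = Z k p $ i"] by auto
   qed
   then have "L1loc th (Z k)" for k by (rule rep_L1loc)
   moreover have "solves_conv_eq lam b fc gc th (Z 0)" by (rule solves_conv_eq_cong[OF Z0Y S0])
   moreover have "solves_hierarchy lam b gc th Z k" if k: "k \<ge> 1" for k
   proof -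
    have 1: "AE_ray th (\<lambda>p. (\<forall>i. hier_lhs lam b gc (Z 0) k (Z k) p i = C ^ k * hier_lhs lam b gc (Y 0) k (Y k) p i) \<and>
     (\<forall>i. hier_rhs gc Z k p i = C ^ k * hier_rhs gc Y k p i))"
     by (rule AE_ray_mp[OF hier_lhs_cong[OF Z0Y C[of k]] hier_rhs_cong[OF k C]]) blast
    show ?thesis unfolding solves_hierarchy_eq by (rule AE_ray_mp[OF 1 Sk[OF k]]) simp
   qed
   ultimately show "is_solution th Z" by blast
  qed (use uniq in blast)
 qed
qed

end

theorem proposition3:
  fixes lam b :: "'n::{finite,linorder} cvec"
    and f0 :: "complex \<Rightarrow> 'n cvec" and fc :: "nat \<Rightarrow> 'n cvec"
    and g :: "complex \<Rightarrow> 'n cvec \<Rightarrow> 'n cvec" and gc :: "nat \<Rightarrow> ('n \<Rightarrow> nat) \<Rightarrow> 'n cvec"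
    and y :: "'n \<Rightarrow> complex fps fps"
  assumes "normal_form lam b f0 fc g gc"
    and "transseries lam b fc gc y"
  shows
    "(\<forall>\<theta>. ray \<theta> \<subseteq> domD lam \<longrightarrow>
        (\<exists>Y0. borel_along \<theta> 0 (ts_coeff y 0) Y0 \<and>
           L1loc \<theta> Y0 \<and> solves_conv_eq lam b fc gc \<theta> Y0 \<and>
           (\<forall>Z. L1loc \<theta> Z \<and> solves_conv_eq lam b fc gc \<theta> Z \<longrightarrow> AE_ray \<theta> (\<lambda>p. Z p = Y0 p))))
     \<and>
     (\<forall>\<theta>. ray \<theta> - {0} \<subseteq> domW1 lam \<and> nonresonant_ray lam \<theta> \<longrightarrow>
        (\<exists>Y. (\<forall>k. borel_along \<theta> (of_nat k * b $ ix1) (ts_coeff y k) (Y k)) \<and>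
           (\<forall>Z. ((\<forall>k. L1loc \<theta> (Z k)) \<and> solves_conv_eq lam b fc gc \<theta> (Z 0) \<and>
                  (\<forall>k\<ge>1. solves_hierarchy lam b gc \<theta> Z k)) \<longleftrightarrow>
                (\<exists>C. \<forall>k. AE_ray \<theta> (\<lambda>p. Z k p = C^k *s Y k p)))))"
proof -
  obtain \<rho> K where K: "\<rho> > 0" "\<And>l. K l \<ge> (0::real)" "(\<lambda>l. wt K \<rho> l) summable_on UNIV"
    "\<And>m l i. norm (gc m l $ i) \<le> K l / \<rho> ^ m" by (rule coeff_bounds[OF assms(1)]) (rule that; assumption)
  obtain C R where R: "R > 0" "C \<ge> 0" "\<And>m i. norm (fc m $ i) \<le> C * R ^ m" by (rule inhom_bounds[OF assms(1)]) (rule that; assumption)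
  interpret conv_system \<rho> K gc lam b fc R C
  proof
    show "\<rho> > 0" "\<And>l. K l \<ge> 0" "(\<lambda>l. wt K \<rho> l) summable_on UNIV"
      "\<And>m l i. norm (gc m l $ i) \<le> K l / \<rho> ^ m" "R > 0" "C \<ge> 0" "\<And>m i. norm (fc m $ i) \<le> C * R ^ m" by (fact K R)+
  qed (use assms(1) in \<open>simp_all add: normal_form_def\<close>)
  show ?thesis
  proof (intro conjI allI impI)
    fix \<theta> assume "ray \<theta> \<subseteq> domD lam"
    note * = unique_solution[OF assms(2) this]
    show "\<exists>Y0. borel_along \<theta> 0 (ts_coeff y 0) Y0 \<and>
           L1loc \<theta> Y0 \<and> solves_conv_eq lam b fc gc \<theta> Y0 \<and>
           (\<forall>Z. L1loc \<theta> Z \<and> solves_conv_eq lam b fc gc \<theta> Z \<longrightarrow> AE_ray \<theta> (\<lambda>p. Z p = Y0 p))"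
    proof (rule *)
      fix Y0 assume "borel_along \<theta> 0 (ts_coeff y 0) Y0" "L1loc \<theta> Y0" "solves_conv_eq lam b fc gc \<theta> Y0"
        "\<And>Z. L1loc \<theta> Z \<Longrightarrow> solves_conv_eq lam b fc gc \<theta> Z \<Longrightarrow> AE_ray \<theta> (\<lambda>p. Z p = Y0 p)"
      then show ?thesis by (intro exI[of _ Y0]) simp
    qed
  next
    fix \<theta> assume a: "ray \<theta> - {0} \<subseteq> domW1 lam \<and> nonresonant_ray lam \<theta>"
    note * = general_solution[OF assms(2) domW1_domD[OF conjunct1[OF a]] conjunct2[OF a]]
    show "\<exists>Y. (\<forall>k. borel_along \<theta> (of_nat k * b $ ix1) (ts_coeff y k) (Y k)) \<and>
           (\<forall>Z. ((\<forall>k. L1loc \<theta> (Z k)) \<and> solves_conv_eq lam b fc gc \<theta> (Z 0) \<and>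
                  (\<forall>k\<ge>1. solves_hierarchy lam b gc \<theta> Z k)) \<longleftrightarrow>
                (\<exists>C. \<forall>k. AE_ray \<theta> (\<lambda>p. Z k p = C^k *s Y k p)))"
    proof (rule *, intro exI conjI allI)
      fix Y Z k assume "\<And>k. borel_along \<theta> (of_nat k * b $ ix1) (ts_coeff y k) (Y k)"
      then show "borel_along \<theta> (of_nat k * b $ ix1) (ts_coeff y k) (Y k)" .
    qed assumption
  qed
qed

end
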